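(* Let $k$ be a commutative ring and $S$ a finite painted set with $|S|\ge 3$ containing at least two white elements. (a) The action of $H^*_S$ on $H_{*S}$ (described in the context) makes $H_{*S}$ a free module of rank one over $H^*_S$. (b) The standard relations $$\sum_{\alpha:\,IJ\alpha KL}[m(\tau(\alpha))]-\sum_{\alpha:\,KJ\alpha IL}[m(\tau(\alpha))]=0$$ ($\tau$ any painted stable $S$-tree, $v$ any vertex of $\tau$, $I,J,K,L$ any allowed quadruple of flags in $F_\tau(v)$, and $\alpha$ running over painted stable 2-partitions of $F_\tau(v)$) span all linear relations between the classes $[m(\tau)]$ of good monomials in $H^*_S$.
   Context: **Trees.** A graph $\tau$ consists of finite sets $V_\tau$ (vertices) and $F_\tau$ (flags, or half-edges), a map $F_\tau\to V_\tau$ assigning to each flag its vertex, and an involution of $F_\tau$. Two-element orbits of the involution are edges (the two flags are the halves of the edge); fixed flags are tails. $F_\tau(v)$ is the set of flags at $v$, $E_\tau$ the set of edges. A tree is a graph whose geometric realization is connected without loops. A painted set is a finite set $S$ partitioned into white and black elements. An $S$-tree is a tree with a bijection between $S$ and its set of tails (tails inherit colors); $S$-isomorphisms and $S$-morphisms are identical on $S$. An $S$-tree is painted stable if every vertex is incident to at least 3 flags and every vertex incident to at most one edge carries at least one white tail. **2-partitions.** All 2-partitions are unordered, into two non-empty parts. A 2-partition of a painted set is painted stable if each part has at least 2 elements and contains a white element. For a 2-partition $\sigma$ and subsets $S_1,S_2$, the notation $S_1\sigma S_2$ means that $S_1$ lies in one part of $\sigma$ and $S_2$ in the other (e.g. $ij\sigma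 kl$). For an edge $e$ of an $S$-tree $\tau$, $\sigma_e$ is the 2-partition of $S$ obtained by deleting the interior of $e$. Let $\sigma$ be painted stable and $\tau$ a painted stable $S$-tree. We say $\sigma$ breaks $\tau$ at the edge $e$ if $\sigma=\sigma_e$; $\sigma$ breaks $\tau$ at the vertex $v$ if there is a painted stable $S$-tree $\tau'$ and an $S$-morphism $\tau'\to\tau$ contracting one edge $e$ of $\tau'$ to the vertex $v$, with $\sigma=\sigma_e$; then $\tau'$ (unique up to $S$-isomorphism) is denoted $\sigma*\tau$. If neither happens, $\sigma$ does not break $\tau$. **Allowed quadruples.** An ordered quadruple of pairwise distinct $i,j,k,l\in S$ is allowed if both 2-partitions $\{i,j\}|\{k,l\}$ and $\{k,j\}|\{i,l\}$ of $\{i,j,k,l\}$ are painted stable. For a flag $f\in F_\tau(v)$, its branch is the connected component of (the geometric realization of) $\tau$ minus $v$ that starts with $f$; let $S_f\subset S$ be the set of labels of tails on this branch. A quadruple of flags $I,J,K,L$ is allowed if there are labels $i,j,k,l$ on the branches starting with $I,J,K,L$ respectively forming an allowed quadruple. A 2-partition $\alpha$ of $F_\tau(v)$ induces a 2-partition $\sigma$ of $S$ (replace each flag $f$ by $S_f$); $\alpha$ is painted stable if both its parts contain at least two flags and the induced $\sigma$ is painted stable. Then $\sigma$ breaks $\tau$ at $v$ and we put $\tau(\alpha):=\sigma*\tau$. **Cohomology ring.** $\mathcal{R}_S=k[l_\sigma]$ is the polynomial ring on independent commuting variables indexed by painted stable 2-partitions $\sigma$ of $S$. $I_S\subset\mathcal{R}_S$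 is the ideal generated by (a) for each allowed quadruple $i,j,k,l$, the element $R_{ijkl}=\sum_{\sigma:\,ij\sigma kl}l_\sigma-\sum_{\sigma:\,kj\sigma il}l_\sigma$; (b) the products $l_\sigma l_{\sigma'}$ for all $\sigma,\sigma'$ such that there is an allowed quadruple $i,j,k,l$ with $ij\sigma kl$ and $kj\sigma' il$. Put $H^*_S:=\mathcal{R}_S/I_S$. For a painted stable $S$-tree $\tau$, the good monomial is $m(\tau):=\prod_{e\in E_\tau}l_{\sigma_e}\in\mathcal{R}_S$ ($m(\tau)=1$ for the one-vertex tree), and $[m(\tau)]$ is its class in $H^*_S$. **Homology.** $\mathcal{M}_S=\bigoplus_\tau k\,\mu(\tau)$ is the free $k$-module on $S$-isomorphism classes of painted stable $S$-trees. $J_S\subset\mathcal{M}_S$ is the submodule spanned by the elements $\sum_{\alpha:\,IJ\alpha KL}\mu(\tau(\alpha))-\sum_{\alpha:\,KJ\alpha IL}\mu(\tau(\alpha))$ for all $\tau$, $v$, and allowed quadruples $I,J,K,L\in F_\tau(v)$, with $\alpha$ running over painted stable 2-partitions of $F_\tau(v)$. Put $H_{*S}:=\mathcal{M}_S/J_S$, and let $[\mu(\tau)]$ be the class of $\mu(\tau)$. **Action.** $H^*_S$ acts on $H_{*S}$ as follows. If $\sigma$ does not break $\tau$, $l_\sigma[\mu(\tau)]=0$. If $\sigma$ breaks $\tau$ at a vertex, $l_\sigma[\mu(\tau)]=[\mu(\sigma*\tau)]$. If $\sigma$ breaks $\tau$ at an edge $e$ with vertices $v_1,v_2$ and halves $e_1\in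 F_\tau(v_1)$, $e_2\in F_\tau(v_2)$, then $$l_\sigma[\mu(\tau)]=-\sum_{\alpha:\ IJ\alpha e_1}[\mu(\tau(\alpha))]-\sum_{\beta:\ e_2\beta KL}[\mu(\tau(\beta))]$$ for any allowed quadruple with $I\ne J$ in $F_\tau(v_1)\setminus\{e_1\}$, $K\ne L$ in $F_\tau(v_2)\setminus\{e_2\}$ (branches taken at the respective vertices), where $\alpha$, $\beta$ run over painted stable 2-partitions of $F_\tau(v_1)$, $F_\tau(v_2)$. This is a well defined action, independent of the choice of $I,J,K,L$. *)

theory Defs
  imports
    "HOL-Algebra.QuotRing"
    "HOL-Algebra.Module"
    "HOL-Library.Poly_Mapping"
    "HOL-Library.Disjoint_Sets"
begin

text \<open>A painted set is a pair of a finite set \<open>S\<close> and the subset \<open>W\<close> of its white elements.\<close>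

definition two_partition :: "'a set \<Rightarrow> 'a set set \<Rightarrow> bool" where
  "two_partition S \<sigma> \<longleftrightarrow> partition_on S \<sigma> \<and> card \<sigma> = 2"

definition stable_two_partition :: "'a set \<Rightarrow> 'a set \<Rightarrow> 'a set set \<Rightarrow> bool" where
  "stable_two_partition S W \<sigma> \<longleftrightarrow>
     two_partition S \<sigma> \<and> (\<forall>A\<in>\<sigma>. card A \<ge> 2 \<and> A \<inter> W \<noteq> {})"

definition separates :: "'a set \<Rightarrow> 'a set set \<Rightarrow> 'a set \<Rightarrow> bool" where
  "separates A \<sigma> B \<longleftrightarrow> (\<exists>P\<in>\<sigma>. \<exists>Q\<in>\<sigma>. P \<noteq> Q \<and> A \<subseteq> P \<and> B \<subseteq> Q)"

definition allowed :: "'a set \<Rightarrow> 'a set \<Rightarrow> 'a \<Rightarrow> 'a \<Rightarrow> 'a \<Rightarrow> 'a \<Rightarrow> bool" where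
  "allowed S W i j k l \<longleftrightarrow>
     {i, j, k, l} \<subseteq> S \<and> distinct [i, j, k, l] \<and>
     stable_two_partition {i, j, k, l} W {{i, j}, {k, l}} \<and>
     stable_two_partition {i, j, k, l} W {{k, j}, {i, l}}"

text \<open>
  Vertices and flags are natural numbers; this loses no generality, since every finite graph is
  isomorphic to such a graph and trees only enter through their isomorphism classes.
  The values of \<open>bnd\<close> and \<open>invol\<close> outside \<open>flags\<close>, and of \<open>tail\<close> outside the label set, are
  irrelevant and are not seen by isomorphisms.
\<close>

record graph =
  verts :: "nat set"
  flags :: "nat set"
  bnd :: "nat \<Rightarrow> nat"
  invol :: "nat \<Rightarrow> nat"

record 'a lgraph = graph +
  tail :: "'a \<Rightarrow> nat"

definition graph :: "('b) graph_scheme \<Rightarrow> bool" where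
  "graph G \<longleftrightarrow> finite (verts G) \<and> finite (flags G) \<and>
     (\<forall>f\<in>flags G. bnd G f \<in> verts G \<and> invol G f \<in> flags G \<and> invol G (invol G f) = f)"

definition flags_at :: "'b graph_scheme \<Rightarrow> nat \<Rightarrow> nat set" where
  "flags_at G v = {f \<in> flags G. bnd G f = v}"

definition edges :: "'b graph_scheme \<Rightarrow> nat set set" where
  "edges G = {{f, invol G f} | f. f \<in> flags G \<and> invol G f \<noteq> f}"

definition tails :: "'b graph_scheme \<Rightarrow> nat set" where
  "tails G = {f \<in> flags G. invol G f = f}"

definition graph_connected :: "'b graph_scheme \<Rightarrow> bool" where
  "graph_connected G \<longleftrightarrow> verts G \<noteq> {} \<and>
     (\<forall>u\<in>verts G. \<forall>v\<in>verts G. (u, v) \<in> {(bnd G f, bnd G (invol G f)) | f. f \<in> flags G}\<^sup>*)"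

text \<open>
  A list of flags \<open>f\<^sub>1, \<dots>, f\<^sub>n\<close> is read as the closed path running along the edges of the \<open>f\<^sub>i\<close>, each
  from \<open>bnd f\<^sub>i\<close> to \<open>bnd (invol f\<^sub>i)\<close>. The conditions say that the path traces out an embedded circle
  of the geometric realization (self-loops and double edges included).
\<close>

definition circuit :: "'b graph_scheme \<Rightarrow> nat list \<Rightarrow> bool" where
  "circuit G fs \<longleftrightarrow> fs \<noteq> [] \<and> set fs \<subseteq> flags G - tails G \<and>
     (\<forall>i<length fs. bnd G (invol G (fs ! i)) = bnd G (fs ! (Suc i mod length fs))) \<and>
     distinct (map (bnd G) fs) \<and> (\<forall>f\<in>set fs. invol G f \<notin> set fs)"

definition tree :: "'b graph_scheme \<Rightarrow> bool" where
  "tree G \<longleftrightarrow> graph G \<and> graph_connected G \<and> (\<nexists>fs. circuit G fs)"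

definition labelled_tree :: "'a set \<Rightarrow> 'a lgraph \<Rightarrow> bool" where
  "labelled_tree S T \<longleftrightarrow> tree T \<and> bij_betw (tail T) S (tails T)"

definition stable_tree :: "'a set \<Rightarrow> 'a set \<Rightarrow> 'a lgraph \<Rightarrow> bool" where
  "stable_tree S W T \<longleftrightarrow> labelled_tree S T \<and>
     (\<forall>v\<in>verts T. card (flags_at T v) \<ge> 3 \<and>
        (card {e \<in> edges T. e \<inter> flags_at T v \<noteq> {}} \<le> 1 \<longrightarrow> (\<exists>s\<in>W. bnd T (tail T s) = v)))"

text \<open>
  Two flags are linked if they lie in (or are attached to) the same connected component of the
  geometric realization from which the vertices in \<open>X\<close> and the interiors of the edges with halves
  in \<open>Y\<close> have been deleted.
\<close>

definition linked :: "'b graph_scheme \<Rightarrow> nat set \<Rightarrow> nat set \<Rightarrow> (nat \<times> nat) set" where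
  "linked G X Y = {(f, g). f \<in> flags G \<and> g \<in> flags G \<and>
     (bnd G f = bnd G g \<and> bnd G f \<notin> X \<or> g = invol G f \<and> f \<notin> Y)}\<^sup>*"

definition branch_labels :: "'a set \<Rightarrow> 'a lgraph \<Rightarrow> nat \<Rightarrow> nat \<Rightarrow> 'a set" where
  "branch_labels S T v f = {s \<in> S. (f, tail T s) \<in> linked T {v} {}}"

definition edge_partition :: "'a set \<Rightarrow> 'a lgraph \<Rightarrow> nat set \<Rightarrow> 'a set set" where
  "edge_partition S T e = (\<lambda>f. {s \<in> S. (f, tail T s) \<in> linked T {} e}) ` e"

definition tree_iso :: "'a set \<Rightarrow> 'a lgraph \<Rightarrow> 'a lgraph \<Rightarrow> bool" where
  "tree_iso S T T' \<longleftrightarrow> (\<exists>hV hF.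
     bij_betw hV (verts T) (verts T') \<and> bij_betw hF (flags T) (flags T') \<and>
     (\<forall>f\<in>flags T. bnd T' (hF f) = hV (bnd T f) \<and> invol T' (hF f) = hF (invol T f)) \<and>
     (\<forall>s\<in>S. hF (tail T s) = tail T' s))"

text \<open>
  A morphism \<open>T' \<rightarrow> T\<close>, identical on \<open>S\<close>, contracting the edge \<open>e\<close> of \<open>T'\<close> to the vertex \<open>v\<close> of \<open>T\<close>;
  it is covariant on vertices and contravariant on flags.
\<close>

definition contracts :: "'a set \<Rightarrow> 'a lgraph \<Rightarrow> 'a lgraph \<Rightarrow> nat set \<Rightarrow> nat \<Rightarrow> bool" where
  "contracts S T' T e v \<longleftrightarrow> e \<in> edges T' \<and> (\<exists>hV hF.
     hV ` verts T' = verts T \<and> hV ` bnd T' ` e = {v} \<and>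
     (\<forall>u\<in>verts T'. \<forall>w\<in>verts T'. hV u = hV w \<longleftrightarrow> u = w \<or> {u, w} \<subseteq> bnd T' ` e) \<and>
     bij_betw hF (flags T) (flags T' - e) \<and>
     (\<forall>f\<in>flags T. hV (bnd T' (hF f)) = bnd T f \<and> invol T' (hF f) = hF (invol T f)) \<and>
     (\<forall>s\<in>S. hF (tail T s) = tail T' s))"

definition breaks_at_edge :: "'a set \<Rightarrow> 'a set set \<Rightarrow> 'a lgraph \<Rightarrow> nat set \<Rightarrow> bool" where
  "breaks_at_edge S \<sigma> T e \<longleftrightarrow> e \<in> edges T \<and> \<sigma> = edge_partition S T e"

definition splits_vertex ::
    "'a set \<Rightarrow> 'a set \<Rightarrow> 'a set set \<Rightarrow> 'a lgraph \<Rightarrow> nat \<Rightarrow> 'a lgraph \<Rightarrow> bool" where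
  "splits_vertex S W \<sigma> T v T' \<longleftrightarrow>
     stable_tree S W T' \<and> (\<exists>e. contracts S T' T e v \<and> \<sigma> = edge_partition S T' e)"

definition breaks_at_vertex ::
    "'a set \<Rightarrow> 'a set \<Rightarrow> 'a set set \<Rightarrow> 'a lgraph \<Rightarrow> nat \<Rightarrow> bool" where
  "breaks_at_vertex S W \<sigma> T v \<longleftrightarrow> v \<in> verts T \<and> (\<exists>T'. splits_vertex S W \<sigma> T v T')"

text \<open>The tree \<open>\<sigma> * T\<close>, of which only the isomorphism class is determined by \<open>\<sigma>\<close> and \<open>T\<close>.\<close>

definition star :: "'a set \<Rightarrow> 'a set \<Rightarrow> 'a set set \<Rightarrow> 'a lgraph \<Rightarrow> 'a lgraph" where
  "star S W \<sigma> T = (SOME T'. \<exists>v\<in>verts T. splits_vertex S W \<sigma> T v T')"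

definition induced_partition :: "'a set \<Rightarrow> 'a lgraph \<Rightarrow> nat \<Rightarrow> nat set set \<Rightarrow> 'a set set" where
  "induced_partition S T v \<alpha> = (\<lambda>A. \<Union>f\<in>A. branch_labels S T v f) ` \<alpha>"

definition stable_flag_partition ::
    "'a set \<Rightarrow> 'a set \<Rightarrow> 'a lgraph \<Rightarrow> nat \<Rightarrow> nat set set \<Rightarrow> bool" where
  "stable_flag_partition S W T v \<alpha> \<longleftrightarrow>
     two_partition (flags_at T v) \<alpha> \<and> (\<forall>A\<in>\<alpha>. card A \<ge> 2) \<and>
     stable_two_partition S W (induced_partition S T v \<alpha>)"

definition split_tree ::
    "'a set \<Rightarrow> 'a set \<Rightarrow> 'a lgraph \<Rightarrow> nat \<Rightarrow> nat set set \<Rightarrow> 'a lgraph" where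
  "split_tree S W T v \<alpha> = star S W (induced_partition S T v \<alpha>) T"

definition allowed_branches ::
    "'a set \<Rightarrow> 'a set \<Rightarrow> 'a set \<Rightarrow> 'a set \<Rightarrow> 'a set \<Rightarrow> 'a set \<Rightarrow> bool" where
  "allowed_branches S W A B C D \<longleftrightarrow> (\<exists>i\<in>A. \<exists>j\<in>B. \<exists>k\<in>C. \<exists>l\<in>D. allowed S W i j k l)"

definition allowed_flags ::
    "'a set \<Rightarrow> 'a set \<Rightarrow> 'a lgraph \<Rightarrow> nat \<Rightarrow> nat \<Rightarrow> nat \<Rightarrow> nat \<Rightarrow> nat \<Rightarrow> bool" where
  "allowed_flags S W T v I J K L \<longleftrightarrow>
     {I, J, K, L} \<subseteq> flags_at T v \<and> distinct [I, J, K, L] \<and>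
     allowed_branches S W (branch_labels S T v I) (branch_labels S T v J)
       (branch_labels S T v K) (branch_labels S T v L)"

text \<open>
  The sum of \<open>g (T(\<alpha>))\<close> over the stable \<open>\<alpha>\<close> with \<open>A \<alpha> B\<close>, and the standard relation at a vertex
  \<open>v\<close>; \<open>g\<close> will be either the basis element or the good monomial of a tree.
\<close>

definition split_sum :: "'a set \<Rightarrow> 'a set \<Rightarrow> ('a lgraph \<Rightarrow> 'm::comm_monoid_add) \<Rightarrow>
    'a lgraph \<Rightarrow> nat \<Rightarrow> nat set \<Rightarrow> nat set \<Rightarrow> 'm" where
  "split_sum S W g T v A B =
     (\<Sum>\<alpha> | stable_flag_partition S W T v \<alpha> \<and> separates A \<alpha> B. g (split_tree S W T v \<alpha>))"

definition standard_relation :: "'a set \<Rightarrow> 'a set \<Rightarrow> ('a lgraph \<Rightarrow> 'm::ab_group_add) \<Rightarrow>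
    'a lgraph \<Rightarrow> nat \<Rightarrow> nat \<Rightarrow> nat \<Rightarrow> nat \<Rightarrow> nat \<Rightarrow> 'm" where
  "standard_relation S W g T v I J K L =
     split_sum S W g T v {I, J} {K, L} - split_sum S W g T v {K, J} {I, L}"

text \<open>
  The coefficient ring is a type \<open>'k\<close> of sort \<open>{comm_ring, monoid_mult}\<close>, that is, a commutative ring
  with 1. (The class \<open>comm_ring_1\<close> would in addition exclude the zero ring.)
  Polynomials are finitely supported functions from monomials to coefficients.
\<close>

type_synonym ('a, 'k) lpoly = "('a set set \<Rightarrow>\<^sub>0 nat) \<Rightarrow>\<^sub>0 'k"

definition coeff_ring :: "'k::{comm_ring,monoid_mult} ring" where
  "coeff_ring = \<lparr>carrier = UNIV, mult = (*), one = 1, zero = 0, add = (+)\<rparr>"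

definition poly_const :: "'k::{comm_ring,monoid_mult} \<Rightarrow> ('a, 'k) lpoly" where
  "poly_const a = Poly_Mapping.single 0 a"

definition poly_var :: "'a set set \<Rightarrow> ('a, 'k::{comm_ring,monoid_mult}) lpoly" where
  "poly_var \<sigma> = Poly_Mapping.single (Poly_Mapping.single \<sigma> 1) 1"

definition partition_poly_ring ::
    "'a set \<Rightarrow> 'a set \<Rightarrow> ('a, 'k::{comm_ring,monoid_mult}) lpoly ring" where
  "partition_poly_ring S W =
     \<lparr>carrier = {p. \<forall>m\<in>Poly_Mapping.keys p. \<forall>\<sigma>\<in>Poly_Mapping.keys m. stable_two_partition S W \<sigma>},
      mult = (*), one = poly_const 1, zero = 0, add = (+)\<rparr>"

definition linear_relator ::
    "'a set \<Rightarrow> 'a set \<Rightarrow> 'a \<Rightarrow> 'a \<Rightarrow> 'a \<Rightarrow> 'a \<Rightarrow> ('a, 'k::{comm_ring,monoid_mult}) lpoly" where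
  "linear_relator S W i j k l =
     (\<Sum>\<sigma> | stable_two_partition S W \<sigma> \<and> separates {i, j} \<sigma> {k, l}. poly_var \<sigma>) -
     (\<Sum>\<sigma> | stable_two_partition S W \<sigma> \<and> separates {k, j} \<sigma> {i, l}. poly_var \<sigma>)"

definition cohomology_ideal ::
    "'a set \<Rightarrow> 'a set \<Rightarrow> ('a, 'k::{comm_ring,monoid_mult}) lpoly set" where
  "cohomology_ideal S W = genideal (partition_poly_ring S W)
     ({linear_relator S W i j k l | i j k l. allowed S W i j k l} \<union>
      {poly_var \<sigma> * poly_var \<sigma>' | \<sigma> \<sigma>'.
         stable_two_partition S W \<sigma> \<and> stable_two_partition S W \<sigma>' \<and>
         (\<exists>i j k l. allowed S W i j k l \<and> separates {i, j} \<sigma> {k, l} \<and> separates {k, j} \<sigma>' {i, l})})"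

definition cohomology ::
    "'a set \<Rightarrow> 'a set \<Rightarrow> ('a, 'k::{comm_ring,monoid_mult}) lpoly set ring" where
  "cohomology S W = partition_poly_ring S W Quot cohomology_ideal S W"

definition coh_class ::
    "'a set \<Rightarrow> 'a set \<Rightarrow> ('a, 'k::{comm_ring,monoid_mult}) lpoly \<Rightarrow> ('a, 'k) lpoly set" where
  "coh_class S W p = cohomology_ideal S W +>\<^bsub>partition_poly_ring S W\<^esub> p"

definition good_monomial ::
    "'a set \<Rightarrow> 'a set \<Rightarrow> 'a lgraph \<Rightarrow> ('a, 'k::{comm_ring,monoid_mult}) lpoly" where
  "good_monomial S W T =
     (\<Otimes>\<^bsub>partition_poly_ring S W\<^esub>e\<in>edges T. poly_var (edge_partition S T e))"

type_synonym ('a, 'k) tree_chain = "'a lgraph set \<Rightarrow>\<^sub>0 'k"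

definition tree_class :: "'a set \<Rightarrow> 'a set \<Rightarrow> 'a lgraph \<Rightarrow> 'a lgraph set" where
  "tree_class S W T = {T'. stable_tree S W T' \<and> tree_iso S T T'}"

definition tree_classes :: "'a set \<Rightarrow> 'a set \<Rightarrow> 'a lgraph set set" where
  "tree_classes S W = tree_class S W ` {T. stable_tree S W T}"

definition basis_elt ::
    "'a set \<Rightarrow> 'a set \<Rightarrow> 'a lgraph \<Rightarrow> ('a, 'k::{comm_ring,monoid_mult}) tree_chain" where
  "basis_elt S W T = Poly_Mapping.single (tree_class S W T) 1"

text \<open>The record type of modules has ring multiplication fields, which play no role here.\<close>

definition tree_module ::
    "'a set \<Rightarrow> 'a set \<Rightarrow> ('k::{comm_ring,monoid_mult}, ('a, 'k) tree_chain) module" where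
  "tree_module S W =
     \<lparr>carrier = {c. Poly_Mapping.keys c \<subseteq> tree_classes S W},
      mult = undefined, one = undefined, zero = 0, add = (+),
      smult = (\<lambda>a. Poly_Mapping.map ((*) a))\<rparr>"

definition gen_submodule :: "('r, 'x) ring_scheme \<Rightarrow> ('r, 'm, 'y) module_scheme \<Rightarrow> 'm set \<Rightarrow> 'm set" where
  "gen_submodule R M X = \<Inter>{N. submodule N R M \<and> X \<subseteq> N}"

definition tree_relations ::
    "'a set \<Rightarrow> 'a set \<Rightarrow> ('a, 'k::{comm_ring,monoid_mult}) tree_chain set" where
  "tree_relations S W = gen_submodule coeff_ring (tree_module S W)
     {standard_relation S W (basis_elt S W) T v I J K L | T v I J K L.
        stable_tree S W T \<and> v \<in> verts T \<and> allowed_flags S W T v I J K L}"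

definition hom_class ::
    "'a set \<Rightarrow> 'a set \<Rightarrow> ('a, 'k::{comm_ring,monoid_mult}) tree_chain \<Rightarrow> ('a, 'k) tree_chain set" where
  "hom_class S W c = tree_relations S W +>\<^bsub>tree_module S W\<^esub> c"

definition homology :: "'a set \<Rightarrow> 'a set \<Rightarrow>
    (('a, 'k::{comm_ring,monoid_mult}) lpoly set \<Rightarrow> ('a, 'k) tree_chain set \<Rightarrow> ('a, 'k) tree_chain set) \<Rightarrow>
    (('a, 'k) lpoly set, ('a, 'k) tree_chain set) module" where
  "homology S W act =
     \<lparr>carrier = a_rcosets\<^bsub>tree_module S W\<^esub> tree_relations S W,
      mult = undefined, one = undefined,
      zero = tree_relations S W, add = set_add (tree_module S W), smult = act\<rparr>"

text \<open>
  A \<open>k\<close>-linear module structure on homology over the cohomology ring in which the generators act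
  by the three prescribed formulas. An edge \<open>e\<close> at which \<open>\<sigma>\<close> breaks \<open>T\<close> is given by one of its halves
  \<open>e\<^sub>1\<close>, the other one being \<open>e\<^sub>2 = invol T e\<^sub>1\<close>. The generators and the constants generate the
  cohomology ring, so that these conditions determine the action.
\<close>

definition is_homology_action :: "'a set \<Rightarrow> 'a set \<Rightarrow>
    (('a, 'k::{comm_ring,monoid_mult}) lpoly set \<Rightarrow> ('a, 'k) tree_chain set \<Rightarrow> ('a, 'k) tree_chain set) \<Rightarrow>
    bool" where
  "is_homology_action S W act \<longleftrightarrow>
     module (cohomology S W) (homology S W act) \<and>
     (\<forall>a. \<forall>c\<in>carrier (tree_module S W).
        act (coh_class S W (poly_const a)) (hom_class S W c) =
          hom_class S W (a \<odot>\<^bsub>tree_module S W\<^esub> c)) \<and>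
     (\<forall>\<sigma> T. stable_two_partition S W \<sigma> \<and> stable_tree S W T \<longrightarrow>
        ((\<nexists>e. breaks_at_edge S \<sigma> T e) \<and> (\<nexists>v. breaks_at_vertex S W \<sigma> T v) \<longrightarrow>
           act (coh_class S W (poly_var \<sigma>)) (hom_class S W (basis_elt S W T)) = hom_class S W 0) \<and>
        (\<forall>v. breaks_at_vertex S W \<sigma> T v \<longrightarrow>
           act (coh_class S W (poly_var \<sigma>)) (hom_class S W (basis_elt S W T)) =
             hom_class S W (basis_elt S W (star S W \<sigma> T))) \<and>
        (\<forall>e\<^sub>1\<in>flags T. \<forall>e\<^sub>2 v\<^sub>1 v\<^sub>2 I J K L.
           e\<^sub>2 = invol T e\<^sub>1 \<and> breaks_at_edge S \<sigma> T {e\<^sub>1, e\<^sub>2} \<and> v\<^sub>1 = bnd T e\<^sub>1 \<and> v\<^sub>2 = bnd T e\<^sub>2 \<and>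
           {I, J} \<subseteq> flags_at T v\<^sub>1 - {e\<^sub>1} \<and> I \<noteq> J \<and> {K, L} \<subseteq> flags_at T v\<^sub>2 - {e\<^sub>2} \<and> K \<noteq> L \<and>
           allowed_branches S W (branch_labels S T v\<^sub>1 I) (branch_labels S T v\<^sub>1 J)
             (branch_labels S T v\<^sub>2 K) (branch_labels S T v\<^sub>2 L) \<longrightarrow>
           act (coh_class S W (poly_var \<sigma>)) (hom_class S W (basis_elt S W T)) =
             hom_class S W (- split_sum S W (basis_elt S W) T v\<^sub>1 {I, J} {e\<^sub>1}
                            - split_sum S W (basis_elt S W) T v\<^sub>2 {e\<^sub>2} {K, L})))"

definition free_of_rank_one :: "('r, 'x) ring_scheme \<Rightarrow> ('r, 'm, 'y) module_scheme \<Rightarrow> bool" where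
  "free_of_rank_one R M \<longleftrightarrow> module R M \<and>
     (\<exists>x\<in>carrier M. bij_betw (\<lambda>r. r \<odot>\<^bsub>M\<^esub> x) (carrier R) (carrier M))"

text \<open>
  The element \<open>c\<close> of the free module on isomorphism classes of trees stands for the linear
  combination of good monomials with coefficients \<open>c\<close>. The good monomial of a class is that of any
  of its members.
\<close>

definition monomial_combination ::
    "'a set \<Rightarrow> 'a set \<Rightarrow> ('a, 'k::{comm_ring,monoid_mult}) tree_chain \<Rightarrow> ('a, 'k) lpoly" where
  "monomial_combination S W c =
     (\<Sum>C\<in>Poly_Mapping.keys c.
        poly_const (Poly_Mapping.lookup c C) * good_monomial S W (SOME T. T \<in> C))"

definition monomial_relations ::
    "'a set \<Rightarrow> 'a set \<Rightarrow> ('a, 'k::{comm_ring,monoid_mult}) tree_chain set" where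
  "monomial_relations S W = {c \<in> carrier (tree_module S W).
     coh_class S W (monomial_combination S W c) = \<zero>\<^bsub>cohomology S W\<^esub>}"

end

theory Submission
  imports Defs
begin

text \<open>
  Cutting the edges of a painted stable tree identifies isomorphism classes of such trees with sets
  of pairwise compatible painted stable 2-partitions, the faces of a flag complex. Two 2-partitions
  are incompatible exactly if an allowed quadruple separates them, so the cohomology ring is the
  Stanley-Reisner ring of this complex modulo the linear forms \<open>R\<^sub>i\<^sub>j\<^sub>k\<^sub>l\<close>. On the homology side, the
  standard relations are the sums \<open>\<rho> F \<theta>\<close> of \<open>\<theta> \<tau> (F \<union> {\<tau>})\<close> over the link of a face \<open>F\<close>, for such
  linear forms \<open>\<theta>\<close> vanishing on \<open>F\<close>.

  The combinatorial input is that every element \<open>\<sigma>\<close> of a face \<open>F\<close> has a dual form in the span of the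
  \<open>R\<^sub>i\<^sub>j\<^sub>k\<^sub>l\<close>, which is 1 at \<open>\<sigma>\<close> and 0 on the rest of \<open>F\<close>. Fixing a white label \<open>w\<close> and replacing each
  2-partition by its part without \<open>w\<close> turns \<open>F\<close> into a laminar family of clusters, and the forms into
  differences of indicators \<open>[x, y \<in> A]\<close> for pairs \<open>x, y\<close> with a white member; the dual form of a
  cluster compares two such pairs, one generating the cluster, the other the next larger one.

  The operators \<open>X \<sigma>\<close> which send \<open>F\<close> to \<open>F \<union> {\<sigma>}\<close>, to 0, or, for \<open>\<sigma> \<in> F\<close>, to \<open>- \<rho> F \<theta>\<close> with \<open>\<theta>\<close> dual
  to \<open>\<sigma>\<close>, are well defined modulo the standard relations and commute, because the second order
  expression \<open>D F \<theta> \<psi>\<close> is symmetric. Hence \<open>p \<mapsto> p(X) {}\<close> is a well defined inverse of the map taking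
  a tree to its good monomial, which gives (b), and (a) with the one-vertex tree as a basis.
\<close>

section \<open>Linear maps and submodules of finitely supported functions\<close>

text \<open>The obstacle is that \<open>X\<close> has to respect \<open>J\<close>. For \<sigma> in F
  the value \<open>- rho F \<theta>\<close> depends on the chosen dual form. Two choices differ by a
  member of \<open>L\<close> vanishing on F, and such a member is a combination of forms R_ijkl
  which need not vanish on F one by one, while the generators of \<open>J\<close> come from forms
  that do. Hence \<open>dual_forms\<close> contains, besides the dual forms, a statement about the
  part of each generating form that vanishes on F; laminarity of the clusters delivers both. As k is
  an arbitrary commutative ring, nothing may be divided, and the dual forms must take the exact
  values 0 and 1 on F. The case \<sigma> in F is a self-intersection: the linear relation \<theta> =
  0 moves \<sigma> off the stratum of F.

  The action is not built from \<open>X\<close>: multiplication in the ring is transported to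
  homology and the prescribed formulas are checked for it. For an arbitrary action obeying them,
  freeness rests on the fact that every tree arises from the one-vertex tree by successive vertex
  splittings, so that good monomials send the one-vertex class to the classes of their
  trees.\<close>

definition scale :: "'k::{comm_ring,monoid_mult} \<Rightarrow> ('b \<Rightarrow>\<^sub>0 'k) \<Rightarrow> ('b \<Rightarrow>\<^sub>0 'k)" where
  "scale a p = Poly_Mapping.map ((*) a) p"

lemma lookup_scale [simp]: "Poly_Mapping.lookup (scale a p) x = a * Poly_Mapping.lookup p x"
  by (simp add: scale_def Poly_Mapping.map.rep_eq when_def)

lemma scale_add_right: "scale a (p + q) = scale a p + scale a q"
  by (rule poly_mapping_eqI) (simp add: lookup_add distrib_left)

lemma scale_add_left: "scale (a + b) p = scale a p + scale b p"
  by (rule poly_mapping_eqI) (simp add: lookup_add distrib_right)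

lemma scale_diff_right: "scale a (p - q) = scale a p - scale a q"
  by (rule poly_mapping_eqI) (simp add: lookup_minus right_diff_distrib)

lemma scale_diff_left: "scale (a - b) p = scale a p - scale b p"
  by (rule poly_mapping_eqI) (simp add: lookup_minus left_diff_distrib)

lemma scale_uminus_right: "scale a (- p) = - scale a p"
  by (rule poly_mapping_eqI) simp

lemma scale_scale [simp]: "scale a (scale b p) = scale (a * b) p"
  by (rule poly_mapping_eqI) (simp add: mult.assoc)

lemma scale_one [simp]: "scale 1 p = p"
  by (rule poly_mapping_eqI) simp

lemma scale_zero [simp]: "scale 0 p = 0" "scale a 0 = 0"
  by (rule poly_mapping_eqI, simp)+

lemma scale_minus_one: "scale (- 1) p = - p"
proof (rule poly_mapping_eqI)
  fix x
  have "- 1 * Poly_Mapping.lookup p x = - (1 * Poly_Mapping.lookup p x)"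
    by (rule minus_mult_left [symmetric])
  then show "Poly_Mapping.lookup (scale (- 1) p) x = Poly_Mapping.lookup (- p) x"
    by simp
qed

lemma scale_sum: "scale a (\<Sum>x\<in>A. f x) = (\<Sum>x\<in>A. scale a (f x))"
  by (induction A rule: infinite_finite_induct) (simp_all add: scale_add_right)

lemma scale_single [simp]: "scale a (Poly_Mapping.single x b) = Poly_Mapping.single x (a * b)"
  by (rule poly_mapping_eqI) (simp add: lookup_single when_def)

lemma scale_mult_left: "scale a p * q = scale a (p * q)"
  unfolding scale_def mult_map_scale_conv_mult by (simp add: mult.assoc)

lemma scale_mult_right: "p * scale a q = scale a (p * q)"
  for p q :: "'c::comm_monoid_add \<Rightarrow>\<^sub>0 'k::{comm_ring,monoid_mult}"
  using scale_mult_left[of a q p] by (simp add: mult.commute)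

lemma keys_scale: "Poly_Mapping.keys (scale a p) \<subseteq> Poly_Mapping.keys p"
  by (auto simp: in_keys_iff)

lemma single_zero_mult: "Poly_Mapping.single 0 a * p = scale a p"
  by (simp add: scale_def mult_map_scale_conv_mult)

lemma poly_const_mult: "poly_const a * p = scale a p"
  by (simp add: poly_const_def scale_def mult_map_scale_conv_mult)

lemma single_eq_scale: "Poly_Mapping.single x a = scale a (Poly_Mapping.single x 1)"
  by simp

definition lin :: "('b \<Rightarrow> ('c \<Rightarrow>\<^sub>0 'k::{comm_ring,monoid_mult})) \<Rightarrow> ('b \<Rightarrow>\<^sub>0 'k) \<Rightarrow> ('c \<Rightarrow>\<^sub>0 'k)" where
  "lin g p = (\<Sum>x\<in>Poly_Mapping.keys p. scale (Poly_Mapping.lookup p x) (g x))"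

definition klinear :: "(('b \<Rightarrow>\<^sub>0 'k::{comm_ring,monoid_mult}) \<Rightarrow> ('c \<Rightarrow>\<^sub>0 'k)) \<Rightarrow> bool" where
  "klinear \<phi> \<longleftrightarrow> (\<forall>p q. \<phi> (p + q) = \<phi> p + \<phi> q) \<and> (\<forall>a p. \<phi> (scale a p) = scale a (\<phi> p))"

lemma lin_superset:
  assumes "finite A" "Poly_Mapping.keys p \<subseteq> A"
  shows "lin g p = (\<Sum>x\<in>A. scale (Poly_Mapping.lookup p x) (g x))"
  unfolding lin_def using assms
  by (intro sum.mono_neutral_left) (auto simp: in_keys_iff)

lemma klinear_lin: "klinear (lin g)"
  unfolding klinear_def
proof (intro conjI allI)
  fix p q :: "'a \<Rightarrow>\<^sub>0 'b" and a
  let ?A = "Poly_Mapping.keys p \<union> Poly_Mapping.keys q"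
  have "lin g (p + q) = (\<Sum>x\<in>?A. scale (Poly_Mapping.lookup (p + q) x) (g x))"
    using keys_add[of p q] by (intro lin_superset) auto
  also have "\<dots> = lin g p + lin g q"
    by (simp add: lookup_add scale_add_left sum.distrib lin_superset[of ?A])
  finally show "lin g (p + q) = lin g p + lin g q" .
  have "lin g (scale a p) = (\<Sum>x\<in>Poly_Mapping.keys p. scale (Poly_Mapping.lookup (scale a p) x) (g x))"
    by (intro lin_superset finite_keys keys_scale)
  then show "lin g (scale a p) = scale a (lin g p)"
    by (simp add: lin_def scale_sum)
qed

lemma lin_single [simp]: "lin g (Poly_Mapping.single x a) = scale a (g x)"
  by (subst lin_superset[of "{x}"]) (auto simp: lookup_single split: if_splits)

lemma klinear_add: "klinear \<phi> \<Longrightarrow> \<phi> (p + q) = \<phi> p + \<phi> q"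
  and klinear_scale: "klinear \<phi> \<Longrightarrow> \<phi> (scale a p) = scale a (\<phi> p)"
  by (simp_all add: klinear_def)

lemma klinear_zero: "klinear \<phi> \<Longrightarrow> \<phi> 0 = 0"
  by (metis add_cancel_right_right klinear_add)

lemma klinear_uminus: "klinear \<phi> \<Longrightarrow> \<phi> (- p) = - \<phi> p"
  by (metis klinear_scale scale_minus_one)

lemma klinear_diff: "klinear \<phi> \<Longrightarrow> \<phi> (p - q) = \<phi> p - \<phi> q"
  using klinear_add[of \<phi> p "- q"] klinear_uminus[of \<phi> q] by simp

lemma klinear_sum: "klinear \<phi> \<Longrightarrow> \<phi> (\<Sum>x\<in>A. f x) = (\<Sum>x\<in>A. \<phi> (f x))"
  by (induction A rule: infinite_finite_induct) (simp_all add: klinear_zero klinear_add)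

lemma klinear_single: "klinear \<phi> \<Longrightarrow> \<phi> (Poly_Mapping.single x a) = scale a (\<phi> (Poly_Mapping.single x 1))"
  by (metis klinear_scale single_eq_scale)

lemma klinear_comp: "klinear \<phi> \<Longrightarrow> klinear \<psi> \<Longrightarrow> klinear (\<lambda>p. \<phi> (\<psi> p))"
  by (simp add: klinear_def)

lemma klinear_id: "klinear (\<lambda>p. p)"
  by (simp add: klinear_def)

lemma klinear_minus: "klinear \<phi> \<Longrightarrow> klinear \<psi> \<Longrightarrow> klinear (\<lambda>p. \<phi> p - \<psi> p)"
  by (simp add: klinear_def scale_diff_right)

lemma klinear_scale_comp: "klinear \<phi> \<Longrightarrow> klinear (\<lambda>p. scale a (\<phi> p))"
  by (simp add: klinear_def scale_add_right mult.commute)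

lemma klinear_sum_comp: "(\<And>x. x \<in> A \<Longrightarrow> klinear (\<phi> x)) \<Longrightarrow> klinear (\<lambda>p. \<Sum>x\<in>A. \<phi> x p)"
  by (simp add: klinear_def sum.distrib scale_sum cong: sum.cong)

lemma klinear_mult: "klinear (\<lambda>p. q * p)" for q :: "'c::comm_monoid_add \<Rightarrow>\<^sub>0 'k::{comm_ring,monoid_mult}"
  by (simp add: klinear_def distrib_left scale_mult_right)

lemma sum_single_lookup: "(\<Sum>x\<in>Poly_Mapping.keys p. Poly_Mapping.single x (Poly_Mapping.lookup p x)) = p"
  by (rule poly_mapping_eqI) (simp add: lookup_sum lookup_single when_def in_keys_iff)

section \<open>Submodules and congruences modulo a submodule\<close>

definition ksub :: "('c \<Rightarrow>\<^sub>0 'k::{comm_ring,monoid_mult}) set \<Rightarrow> bool" where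
  "ksub N \<longleftrightarrow> 0 \<in> N \<and> (\<forall>p\<in>N. \<forall>q\<in>N. p + q \<in> N) \<and> (\<forall>a. \<forall>p\<in>N. scale a p \<in> N)"

lemma ksub_zero: "ksub N \<Longrightarrow> 0 \<in> N"
  and ksub_add: "ksub N \<Longrightarrow> p \<in> N \<Longrightarrow> q \<in> N \<Longrightarrow> p + q \<in> N"
  and ksub_scale: "ksub N \<Longrightarrow> p \<in> N \<Longrightarrow> scale a p \<in> N"
  by (simp_all add: ksub_def)

lemma ksub_uminus: "ksub N \<Longrightarrow> p \<in> N \<Longrightarrow> - p \<in> N"
  by (metis ksub_scale scale_minus_one)

lemma ksub_diff: "ksub N \<Longrightarrow> p \<in> N \<Longrightarrow> q \<in> N \<Longrightarrow> p - q \<in> N"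
  using ksub_add[of N p "- q"] ksub_uminus[of N q] by simp

lemma ksub_sum: "ksub N \<Longrightarrow> (\<And>x. x \<in> A \<Longrightarrow> f x \<in> N) \<Longrightarrow> (\<Sum>x\<in>A. f x) \<in> N"
  by (induction A rule: infinite_finite_induct) (auto simp: ksub_zero ksub_add)

text \<open>A congruence modulo \<open>N\<close> is always written as membership of a difference;
  this lemma and the two after it replace calculations in the quotient.\<close>

lemma ksub_trans: "ksub N \<Longrightarrow> p - q \<in> N \<Longrightarrow> q - r \<in> N \<Longrightarrow> p - r \<in> N"
  using ksub_add[of N "p - q" "q - r"] by simp

lemma ksub_sym: "ksub N \<Longrightarrow> p - q \<in> N \<Longrightarrow> q - p \<in> N"
  by (metis minus_diff_eq ksub_uminus)

lemma ksub_diff_cong: "ksub N \<Longrightarrow> p - q \<in> N \<Longrightarrow> q \<in> N \<Longrightarrow> p \<in> N"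
  using ksub_add[of N "p - q" q] by simp

lemma klinear_mem:
  assumes "ksub N" "klinear \<phi>" "\<And>x. x \<in> Poly_Mapping.keys p \<Longrightarrow> \<phi> (Poly_Mapping.single x 1) \<in> N"
  shows "\<phi> p \<in> N"
proof -
  have "\<phi> p = (\<Sum>x\<in>Poly_Mapping.keys p. \<phi> (Poly_Mapping.single x (Poly_Mapping.lookup p x)))"
    using klinear_sum[OF assms(2)] sum_single_lookup[of p] by metis
  also have "\<dots> \<in> N"
    by (intro ksub_sum assms(1)) (metis assms klinear_single ksub_scale)
  finally show ?thesis .
qed

text \<open>Reduces a congruence of linear maps to basis elements. Only those in the support of
  \<open>p\<close> are tested, so that facts such as all keys being faces can be used.\<close>

lemma klinear_cong:
  assumes "ksub N" "klinear \<phi>" "klinear \<psi>"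
    "\<And>x. x \<in> Poly_Mapping.keys p \<Longrightarrow> \<phi> (Poly_Mapping.single x 1) - \<psi> (Poly_Mapping.single x 1) \<in> N"
  shows "\<phi> p - \<psi> p \<in> N"
  using klinear_mem[OF assms(1) klinear_minus[OF assms(2,3)]] assms(4) by blast

inductive_set kspan :: "('c \<Rightarrow>\<^sub>0 'k::{comm_ring,monoid_mult}) set \<Rightarrow> ('c \<Rightarrow>\<^sub>0 'k) set"
  for X :: "('c \<Rightarrow>\<^sub>0 'k::{comm_ring,monoid_mult}) set" where
  kspan_zero: "0 \<in> kspan X"
| kspan_base: "x \<in> X \<Longrightarrow> x \<in> kspan X"
| kspan_add: "p \<in> kspan X \<Longrightarrow> q \<in> kspan X \<Longrightarrow> p + q \<in> kspan X"
| kspan_scale: "p \<in> kspan X \<Longrightarrow> scale a p \<in> kspan X"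

lemma ksub_kspan: "ksub (kspan X)"
  by (simp add: ksub_def kspan.intros)

lemma klinear_kspan:
  assumes "ksub N" "klinear \<phi>" "p \<in> kspan X" "\<And>x. x \<in> X \<Longrightarrow> \<phi> x \<in> N"
  shows "\<phi> p \<in> N"
  using assms(3)
  by induction (auto simp: assms klinear_zero klinear_add klinear_scale ksub_zero ksub_add ksub_scale)

section \<open>Flag complexes with linear forms\<close>

text \<open>A clique complex on \<open>V\<close> with a set \<open>G\<close> of linear forms given
  by their coefficients at the vertices. In the application the vertices are the painted stable
  2-partitions and \<open>G\<close> consists of the coefficient functions of the R_ijkl.\<close>

locale flag_complex =
  fixes V :: "'v set" and compat :: "'v \<Rightarrow> 'v \<Rightarrow> bool"
    and G :: "('v \<Rightarrow> 'k::{comm_ring,monoid_mult}) set"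
  assumes finite_V: "finite V" and compat_sym: "compat \<sigma> \<tau> \<Longrightarrow> compat \<tau> \<sigma>"
begin

definition face :: "'v set \<Rightarrow> bool" where
  "face F \<longleftrightarrow> F \<subseteq> V \<and> (\<forall>\<sigma>\<in>F. \<forall>\<tau>\<in>F. \<sigma> \<noteq> \<tau> \<longrightarrow> compat \<sigma> \<tau>)"

definition link :: "'v set \<Rightarrow> 'v set" where
  "link F = {\<tau> \<in> V - F. face (insert \<tau> F)}"

text \<open>In the Stanley-Reisner ring this is what remains of the product of \<theta> with the
  monomial of \<open>F\<close> when the terms at the vertices of \<open>F\<close> are dropped;
  products with vertices outside the link are zero there.\<close>

definition rho :: "'v set \<Rightarrow> ('v \<Rightarrow> 'k) \<Rightarrow> ('v set \<Rightarrow>\<^sub>0 'k)" where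
  "rho F \<theta> = (\<Sum>\<tau>\<in>link F. Poly_Mapping.single (insert \<tau> F) (\<theta> \<tau>))"

definition J :: "('v set \<Rightarrow>\<^sub>0 'k) set" where
  "J = kspan {rho F g | F g. face F \<and> g \<in> G \<and> (\<forall>\<sigma>\<in>F. g \<sigma> = 0)}"

text \<open>The span of \<open>G\<close>. Forms are functions on a whole type but only their values
  on \<open>V\<close> count, hence the rule \<open>L_cong\<close>.\<close>

inductive_set L :: "('v \<Rightarrow> 'k) set" where
  L_zero: "(\<lambda>_. 0) \<in> L"
| L_base: "g \<in> G \<Longrightarrow> g \<in> L"
| L_add: "\<theta> \<in> L \<Longrightarrow> \<theta>' \<in> L \<Longrightarrow> (\<lambda>\<sigma>. \<theta> \<sigma> + \<theta>' \<sigma>) \<in> L"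
| L_scale: "\<theta> \<in> L \<Longrightarrow> (\<lambda>\<sigma>. a * \<theta> \<sigma>) \<in> L"
| L_cong: "\<theta> \<in> L \<Longrightarrow> (\<And>\<sigma>. \<sigma> \<in> V \<Longrightarrow> \<theta> \<sigma> = \<theta>' \<sigma>) \<Longrightarrow> \<theta>' \<in> L"

lemma L_uminus: "\<theta> \<in> L \<Longrightarrow> (\<lambda>\<sigma>. - \<theta> \<sigma>) \<in> L"
  using L_scale[of \<theta> "- 1"] by (simp flip: minus_mult_left)

lemma L_diff: "\<theta> \<in> L \<Longrightarrow> \<theta>' \<in> L \<Longrightarrow> (\<lambda>\<sigma>. \<theta> \<sigma> - \<theta>' \<sigma>) \<in> L"
  using L_add[of \<theta> "\<lambda>\<sigma>. - \<theta>' \<sigma>"] L_uminus by simp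

lemma L_diff_scale: "\<theta> \<in> L \<Longrightarrow> \<theta>' \<in> L \<Longrightarrow> (\<lambda>\<sigma>. \<theta> \<sigma> - a * \<theta>' \<sigma>) \<in> L"
  by (intro L_diff L_scale)

lemma L_sum: "(\<And>x. x \<in> A \<Longrightarrow> f x \<in> L) \<Longrightarrow> (\<lambda>\<sigma>. \<Sum>x\<in>A. f x \<sigma>) \<in> L"
  by (induction A rule: infinite_finite_induct) (auto intro: L_zero L_add)

lemma face_subset: "face F \<Longrightarrow> F' \<subseteq> F \<Longrightarrow> face F'"
  unfolding face_def by blast

lemma face_empty: "face {}"
  by (simp add: face_def)

lemma finite_face: "face F \<Longrightarrow> finite F"
  unfolding face_def using finite_V finite_subset by blast

lemma finite_link [simp]: "finite (link F)"
  unfolding link_def using finite_V by simp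

lemma ksub_J: "ksub J"
  by (simp add: J_def ksub_kspan)

lemma rho_in_J: "face F \<Longrightarrow> g \<in> G \<Longrightarrow> (\<And>\<sigma>. \<sigma> \<in> F \<Longrightarrow> g \<sigma> = 0) \<Longrightarrow> rho F g \<in> J"
  unfolding J_def by (rule kspan_base) blast

lemma rho_add: "rho F (\<lambda>\<tau>. \<theta> \<tau> + \<theta>' \<tau>) = rho F \<theta> + rho F \<theta>'"
  by (simp add: rho_def single_add sum.distrib)

lemma rho_diff: "rho F (\<lambda>\<tau>. \<theta> \<tau> - \<theta>' \<tau>) = rho F \<theta> - rho F \<theta>'"
  by (simp add: rho_def single_diff sum_subtractf)

lemma rho_scale: "rho F (\<lambda>\<tau>. a * \<theta> \<tau>) = scale a (rho F \<theta>)"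
  by (simp add: rho_def scale_sum)

lemma rho_zero: "rho F (\<lambda>\<tau>. 0) = 0"
  by (simp add: rho_def)

lemma rho_sum: "rho F (\<lambda>\<tau>. \<Sum>x\<in>A. f x \<tau>) = (\<Sum>x\<in>A. rho F (f x))"
  by (induction A rule: infinite_finite_induct) (simp_all add: rho_zero rho_add)

lemma rho_cong: "(\<And>\<tau>. \<tau> \<in> link F \<Longrightarrow> \<theta> \<tau> = \<theta>' \<tau>) \<Longrightarrow> rho F \<theta> = rho F \<theta>'"
  by (simp add: rho_def)

lemma rho_cong_V: "(\<And>\<tau>. \<tau> \<in> V \<Longrightarrow> \<theta> \<tau> = \<theta>' \<tau>) \<Longrightarrow> rho F \<theta> = rho F \<theta>'"
  by (rule rho_cong) (simp add: link_def)

text \<open>Describes the second vertex added to \<open>F\<close> by a condition symmetric in the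
  two added vertices, so that double sums over links can be interchanged.\<close>

lemma link_insert:
  assumes "\<tau> \<in> link F"
  shows "link (insert \<tau> F) = {\<upsilon> \<in> link F. \<tau> \<noteq> \<upsilon> \<and> face (insert \<tau> (insert \<upsilon> F))}"
proof -
  have "insert \<upsilon> (insert \<tau> F) = insert \<tau> (insert \<upsilon> F)" for \<upsilon>
    by blast
  then show ?thesis
    using assms unfolding link_def by (auto intro: face_subset)
qed

end

text \<open>The form under \<open>rho\<close> in the second clause is \<open>g\<close> minus its
  interpolation on \<open>F\<close>. It vanishes on \<open>F\<close>, but the generators from which
  it is combined need not, so that its membership in \<open>J\<close> is a separate
  requirement.\<close>

locale unimodular_complex = flag_complex +
  assumes dual_forms: "face F \<Longrightarrow>
    \<exists>\<Theta>. (\<forall>\<sigma>\<in>F. \<Theta> \<sigma> \<in> L \<and> (\<forall>\<tau>\<in>F. \<Theta> \<sigma> \<tau> = (if \<tau> = \<sigma> then 1 else 0))) \<and>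
      (\<forall>g\<in>G. rho F (\<lambda>\<tau>. g \<tau> - (\<Sum>\<sigma>\<in>F. g \<sigma> * \<Theta> \<sigma> \<tau>)) \<in> J)"
begin

text \<open>The map \<open>r\<close> removes from a form its interpolation on \<open>F\<close>. It
  is linear and sends \<open>G\<close> to forms whose \<open>rho\<close> lies in \<open>J\<close>,
  hence does so on all of \<open>L\<close>; a form vanishing on \<open>F\<close> is fixed by
  it.\<close>

lemma rho_form_in_J:
  assumes F: "face F" and \<theta>: "\<theta> \<in> L" and zero: "\<And>\<sigma>. \<sigma> \<in> F \<Longrightarrow> \<theta> \<sigma> = 0"
  shows "rho F \<theta> \<in> J"
proof -
  from dual_forms[OF F] obtain \<Theta>
    where \<Theta>: "\<And>g. g \<in> G \<Longrightarrow> rho F (\<lambda>\<tau>. g \<tau> - (\<Sum>\<sigma>\<in>F. g \<sigma> * \<Theta> \<sigma> \<tau>)) \<in> J"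
    by blast
  define r where "r \<theta> = (\<lambda>\<tau>. \<theta> \<tau> - (\<Sum>\<sigma>\<in>F. \<theta> \<sigma> * \<Theta> \<sigma> \<tau>))" for \<theta> :: "'a \<Rightarrow> 'b"
  have FV: "F \<subseteq> V"
    using F by (simp add: face_def)
  from \<theta> have "rho F (r \<theta>) \<in> J"
  proof induction
    case L_zero
    then show ?case by (simp add: r_def rho_zero ksub_zero ksub_J)
  next
    case (L_base g)
    then show ?case using \<Theta> by (simp add: r_def)
  next
    case (L_add \<theta> \<theta>')
    have "r (\<lambda>\<sigma>. \<theta> \<sigma> + \<theta>' \<sigma>) = (\<lambda>\<tau>. r \<theta> \<tau> + r \<theta>' \<tau>)"
      by (simp add: r_def fun_eq_iff distrib_right sum.distrib)
    then show ?case using L_add by (simp add: rho_add ksub_add ksub_J)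
  next
    case (L_scale \<theta> a)
    have "r (\<lambda>\<sigma>. a * \<theta> \<sigma>) = (\<lambda>\<tau>. a * r \<theta> \<tau>)"
      by (simp add: r_def fun_eq_iff right_diff_distrib sum_distrib_left mult.assoc)
    then show ?case using L_scale by (simp add: rho_scale ksub_scale ksub_J)
  next
    case (L_cong \<theta> \<theta>')
    have "r \<theta> \<tau> = r \<theta>' \<tau>" if "\<tau> \<in> V" for \<tau>
    proof -
      have "(\<Sum>\<sigma>\<in>F. \<theta> \<sigma> * \<Theta> \<sigma> \<tau>) = (\<Sum>\<sigma>\<in>F. \<theta>' \<sigma> * \<Theta> \<sigma> \<tau>)"
        using L_cong.hyps FV by (intro sum.cong) (auto simp: subset_iff)
      then show ?thesis
        using that L_cong.hyps by (simp add: r_def)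
    qed
    then have "rho F (r \<theta>) = rho F (r \<theta>')"
      by (rule rho_cong_V)
    then show ?case using L_cong by simp
  qed
  moreover have "r \<theta> = \<theta>"
    using zero by (simp add: r_def)
  ultimately show ?thesis by simp
qed

section \<open>The multiplication operators \<open>X\<close> on chains and their commutation\<close>

definition dual :: "'a set \<Rightarrow> 'a \<Rightarrow> 'a \<Rightarrow> 'b" where
  "dual F \<sigma> = (SOME \<theta>. \<theta> \<in> L \<and> (\<forall>\<tau>\<in>F. \<theta> \<tau> = (if \<tau> = \<sigma> then 1 else 0)))"

lemma dual:
  assumes "face F" "\<sigma> \<in> F"
  shows dual_in_L: "dual F \<sigma> \<in> L" and dual_apply: "\<tau> \<in> F \<Longrightarrow> dual F \<sigma> \<tau> = (if \<tau> = \<sigma> then 1 else 0)"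
proof -
  have "\<exists>\<theta>. \<theta> \<in> L \<and> (\<forall>\<tau>\<in>F. \<theta> \<tau> = (if \<tau> = \<sigma> then 1 else 0))"
    using dual_forms[OF assms(1)] assms(2) by blast
  from someI_ex[OF this]
  show "dual F \<sigma> \<in> L" "\<tau> \<in> F \<Longrightarrow> dual F \<sigma> \<tau> = (if \<tau> = \<sigma> then 1 else 0)"
    unfolding dual_def by blast+
qed

text \<open>In the ring a dual form \<theta> of \<sigma> is zero, and its product with the monomial
  of \<open>F\<close> is the product with \<sigma> plus \<open>rho F \<theta>\<close>; this explains
  the minus sign. Non-faces are sent to 0 to make the operator total.\<close>

definition xop :: "'a \<Rightarrow> 'a set \<Rightarrow> ('a set \<Rightarrow>\<^sub>0 'b)" where
  "xop \<sigma> F = (if \<not> face F then 0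
     else if \<sigma> \<in> F then - rho F (dual F \<sigma>)
     else if face (insert \<sigma> F) then Poly_Mapping.single (insert \<sigma> F) 1 else 0)"

definition X :: "'a \<Rightarrow> ('a set \<Rightarrow>\<^sub>0 'b) \<Rightarrow> ('a set \<Rightarrow>\<^sub>0 'b)" where
  "X \<sigma> = lin (xop \<sigma>)"

lemma klinear_X: "klinear (X \<sigma>)"
  by (simp add: X_def klinear_lin)

lemma X_single [simp]: "X \<sigma> (Poly_Mapping.single F a) = scale a (xop \<sigma> F)"
  by (simp add: X_def)

lemma X_rho: "X \<sigma> (rho F \<theta>) = (\<Sum>\<tau>\<in>link F. scale (\<theta> \<tau>) (xop \<sigma> (insert \<tau> F)))"
  by (simp add: rho_def klinear_sum[OF klinear_X])

text \<open>Two dual forms of the same vertex differ by a form vanishing on \<open>F\<close>; modulo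
  \<open>J\<close> the value of \<open>X\<close> on a face containing \<sigma> is therefore
  independent of the choice made by \<open>dual\<close>.\<close>

lemma rho_dual_unique:
  assumes "face F" "\<theta> \<in> L" "\<theta>' \<in> L" "\<And>\<tau>. \<tau> \<in> F \<Longrightarrow> \<theta> \<tau> = \<theta>' \<tau>"
  shows "rho F \<theta> - rho F \<theta>' \<in> J"
proof -
  have "rho F (\<lambda>\<tau>. \<theta> \<tau> - \<theta>' \<tau>) \<in> J"
    using assms by (intro rho_form_in_J L_diff) auto
  then show ?thesis by (simp add: rho_diff)
qed

lemma xop_in:
  assumes "face F" "\<sigma> \<in> F" "\<theta> \<in> L" "\<And>\<tau>. \<tau> \<in> F \<Longrightarrow> \<theta> \<tau> = (if \<tau> = \<sigma> then 1 else 0)"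
  shows "xop \<sigma> F + rho F \<theta> \<in> J"
  using rho_dual_unique[of F \<theta> "dual F \<sigma>"] assms
  by (simp add: xop_def dual_in_L dual_apply)

text \<open>The summand at \<sigma> itself is the self-intersection term. Among the others, adding
  \<sigma> leaves a face exactly for \<tau> in the link of \<open>insert \<sigma> F\<close>, and
  those give the first summand.\<close>

lemma X_rho_out:
  assumes "\<sigma> \<notin> F" "face (insert \<sigma> F)"
  shows "X \<sigma> (rho F \<theta>) = rho (insert \<sigma> F) \<theta> + scale (\<theta> \<sigma>) (xop \<sigma> (insert \<sigma> F))"
proof -
  have \<sigma>: "\<sigma> \<in> link F"
    using assms by (auto simp: link_def face_def)
  have "(\<Sum>\<tau>\<in>link F - {\<sigma>}. scale (\<theta> \<tau>) (xop \<sigma> (insert \<tau> F))) =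
        (\<Sum>\<tau>\<in>link (insert \<sigma> F). scale (\<theta> \<tau>) (xop \<sigma> (insert \<tau> F)))"
  proof (rule sum.mono_neutral_right)
    show "link (insert \<sigma> F) \<subseteq> link F - {\<sigma>}"
      using link_insert[OF \<sigma>] by auto
    show "\<forall>\<tau>\<in>link F - {\<sigma>} - link (insert \<sigma> F). scale (\<theta> \<tau>) (xop \<sigma> (insert \<tau> F)) = 0"
      using link_insert[OF \<sigma>] assms(1) by (auto simp: xop_def)
  qed simp
  also have "\<dots> = rho (insert \<sigma> F) \<theta>"
    unfolding rho_def
  proof (rule sum.cong)
    fix \<tau> assume "\<tau> \<in> link (insert \<sigma> F)"
    then have \<tau>: "\<tau> \<noteq> \<sigma>" "face (insert \<sigma> (insert \<tau> F))"
      by (auto simp: link_insert[OF \<sigma>])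
    moreover have "face (insert \<tau> F)"
      using \<tau>(2) by (rule face_subset) blast
    ultimately show "scale (\<theta> \<tau>) (xop \<sigma> (insert \<tau> F)) = Poly_Mapping.single (insert \<tau> (insert \<sigma> F)) (\<theta> \<tau>)"
      using assms(1) by (simp add: xop_def insert_commute)
  qed simp
  finally show ?thesis
    unfolding X_rho using sum.remove[OF finite_link \<sigma>, of "\<lambda>\<tau>. scale (\<theta> \<tau>) (xop \<sigma> (insert \<tau> F))"]
    by (simp add: add.commute)
qed

lemma X_rho_incompatible:
  assumes "\<sigma> \<notin> F" "\<not> face (insert \<sigma> F)"
  shows "X \<sigma> (rho F \<theta>) = 0"
  unfolding X_rho
proof (rule sum.neutral, rule ballI)
  fix \<tau> assume \<tau>: "\<tau> \<in> link F"
  then have "\<tau> \<noteq> \<sigma>"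
    using assms by (auto simp: link_def)
  moreover have "\<not> face (insert \<sigma> (insert \<tau> F))"
    using assms face_subset by blast
  ultimately show "scale (\<theta> \<tau>) (xop \<sigma> (insert \<tau> F)) = 0"
    using assms(1) by (simp add: xop_def)
qed

text \<open>\<open>D F \<theta> \<psi>\<close> is the second order expression obtained by first applying \<open>\<theta>\<close> and then \<open>\<psi>\<close>,
  the latter corrected so as to vanish on the new element of the face.\<close>

definition corrected :: "'a set \<Rightarrow> 'a \<Rightarrow> ('a \<Rightarrow> 'b) \<Rightarrow> 'a \<Rightarrow> 'b" where
  "corrected F \<tau> \<psi> = (\<lambda>\<upsilon>. \<psi> \<upsilon> - \<psi> \<tau> * dual (insert \<tau> F) \<tau> \<upsilon>)"

definition D :: "'a set \<Rightarrow> ('a \<Rightarrow> 'b) \<Rightarrow> ('a \<Rightarrow> 'b) \<Rightarrow> ('a set \<Rightarrow>\<^sub>0 'b)" where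
  "D F \<theta> \<psi> = (\<Sum>\<tau>\<in>link F. scale (\<theta> \<tau>) (rho (insert \<tau> F) (corrected F \<tau> \<psi>)))"

text \<open>The leading part is a sum over ordered pairs of vertices that together extend
  \<open>F\<close> to a larger face, a symmetric condition. The correction depends on the two forms
  only through the product of their values at \<tau>.\<close>

lemma D_sym: "D F \<theta> \<psi> = D F \<psi> \<theta>"
proof -
  let ?R = "\<lambda>\<tau> \<upsilon>. \<tau> \<noteq> \<upsilon> \<and> face (insert \<tau> (insert \<upsilon> F))"
  define A where "A \<theta> \<psi> = (\<Sum>\<tau>\<in>link F. scale (\<theta> \<tau>) (rho (insert \<tau> F) \<psi>))" for \<theta> \<psi> :: "'a \<Rightarrow> 'b"
  have A: "A \<theta> \<psi> = (\<Sum>\<tau>\<in>link F. \<Sum>\<upsilon> | \<upsilon> \<in> link F \<and> ?R \<tau> \<upsilon>.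
      Poly_Mapping.single (insert \<tau> (insert \<upsilon> F)) (\<theta> \<tau> * \<psi> \<upsilon>))" for \<theta> \<psi>
    unfolding A_def rho_def
    by (intro sum.cong) (simp_all add: scale_sum link_insert insert_commute)
  have R_sym: "?R \<tau> \<upsilon> \<longleftrightarrow> ?R \<upsilon> \<tau>" for \<tau> \<upsilon>
    by (auto simp: insert_commute)
  have "A \<theta> \<psi> = (\<Sum>\<upsilon>\<in>link F. \<Sum>\<tau> | \<tau> \<in> link F \<and> ?R \<tau> \<upsilon>.
      Poly_Mapping.single (insert \<tau> (insert \<upsilon> F)) (\<theta> \<tau> * \<psi> \<upsilon>))"
    unfolding A by (rule sum.swap_restrict) auto
  also have "\<dots> = (\<Sum>\<upsilon>\<in>link F. \<Sum>\<tau> | \<tau> \<in> link F \<and> ?R \<upsilon> \<tau>.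
      Poly_Mapping.single (insert \<upsilon> (insert \<tau> F)) (\<psi> \<upsilon> * \<theta> \<tau>))"
    by (intro sum.cong refl) (auto simp: insert_commute mult.commute)
  also have "\<dots> = A \<psi> \<theta>"
    unfolding A ..
  finally have A_sym: "A \<theta> \<psi> = A \<psi> \<theta>" .
  have "D F \<theta> \<psi> = A \<theta> \<psi> -
      (\<Sum>\<tau>\<in>link F. scale (\<theta> \<tau> * \<psi> \<tau>) (rho (insert \<tau> F) (dual (insert \<tau> F) \<tau>)))" for \<theta> \<psi>
    unfolding D_def A_def corrected_def rho_diff rho_scale
    by (simp add: scale_diff_right sum_subtractf)
  then show ?thesis
    by (simp add: A_sym mult.commute)
qed

lemma corrected:
  assumes "\<tau> \<in> link F" "\<psi> \<in> L"
  shows corrected_in_L: "corrected F \<tau> \<psi> \<in> L"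
    and corrected_apply: "\<upsilon> \<in> insert \<tau> F \<Longrightarrow> corrected F \<tau> \<psi> \<upsilon> = (if \<upsilon> = \<tau> then 0 else \<psi> \<upsilon>)"
  using assms dual_in_L[of "insert \<tau> F" \<tau>] dual_apply[of "insert \<tau> F" \<tau>]
  by (auto simp: link_def corrected_def intro: L_diff_scale)

text \<open>As \<sigma> lies in \<open>F\<close>, correcting its dual form at \<tau> yields a form
  dual to \<sigma> on \<open>insert \<tau> F\<close>, which computes each term of the sum modulo
  \<open>J\<close>.\<close>

lemma X_rho_in:
  assumes "\<sigma> \<in> F" "\<psi> \<in> L" "\<And>\<tau>. \<tau> \<in> F \<Longrightarrow> \<psi> \<tau> = (if \<tau> = \<sigma> then 1 else 0)"
  shows "X \<sigma> (rho F \<theta>) + D F \<theta> \<psi> \<in> J"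
proof -
  have "scale (\<theta> \<tau>) (xop \<sigma> (insert \<tau> F) + rho (insert \<tau> F) (corrected F \<tau> \<psi>)) \<in> J"
    if \<tau>: "\<tau> \<in> link F" for \<tau>
  proof (rule ksub_scale[OF ksub_J], rule xop_in)
    show "corrected F \<tau> \<psi> \<upsilon> = (if \<upsilon> = \<sigma> then 1 else 0)" if "\<upsilon> \<in> insert \<tau> F" for \<upsilon>
      using that corrected_apply[OF \<tau> assms(2) that] assms(1,3) \<tau> by (auto simp: link_def)
  qed (use \<tau> assms corrected_in_L[OF \<tau> assms(2)] in \<open>auto simp: link_def\<close>)
  then have "(\<Sum>\<tau>\<in>link F. scale (\<theta> \<tau>) (xop \<sigma> (insert \<tau> F) + rho (insert \<tau> F) (corrected F \<tau> \<psi>))) \<in> J"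
    by (intro ksub_sum ksub_J)
  then show ?thesis
    by (simp add: X_rho D_def scale_add_right sum.distrib)
qed

text \<open>All corrected forms vanish on the enlarged faces. By \<open>D_sym\<close> the same
  conclusion holds when it is the first form that vanishes on \<open>F\<close>.\<close>

lemma D_in_J:
  assumes "\<theta> \<in> L" "\<And>\<tau>. \<tau> \<in> F \<Longrightarrow> \<theta> \<tau> = 0"
  shows "D F \<psi> \<theta> \<in> J"
  unfolding D_def
proof (intro ksub_sum ksub_scale ksub_J)
  fix \<tau> assume \<tau>: "\<tau> \<in> link F"
  show "rho (insert \<tau> F) (corrected F \<tau> \<theta>) \<in> J"
  proof (rule rho_form_in_J)
    show "corrected F \<tau> \<theta> \<upsilon> = 0" if "\<upsilon> \<in> insert \<tau> F" for \<upsilon>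
      using that corrected_apply[OF \<tau> assms(1) that] assms(2) by auto
  qed (use \<tau> corrected_in_L[OF \<tau> assms(1)] in \<open>auto simp: link_def\<close>)
qed

text \<open>This is what makes \<open>X\<close> act on the quotient. If \<sigma> lies in
  \<open>F\<close>, \<open>D_sym\<close> exchanges the roles of \<theta> and the dual form; if
  \<sigma> extends \<open>F\<close>, the self-intersection term supplies exactly the correction that
  makes \<theta> vanish at \<sigma>.\<close>

lemma X_rho_form:
  assumes F: "face F" and \<theta>: "\<theta> \<in> L" and zero: "\<And>\<tau>. \<tau> \<in> F \<Longrightarrow> \<theta> \<tau> = 0"
  shows "X \<sigma> (rho F \<theta>) \<in> J"
proof (cases "\<sigma> \<in> F")
  case True
  have "X \<sigma> (rho F \<theta>) + D F \<theta> (dual F \<sigma>) \<in> J"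
    by (rule X_rho_in[OF True]) (use dual_in_L dual_apply F True in auto)
  moreover have "D F \<theta> (dual F \<sigma>) \<in> J"
    by (subst D_sym) (rule D_in_J[OF \<theta> zero])
  ultimately show ?thesis
    using ksub_diff[OF ksub_J] by fastforce
next
  case out: False
  show ?thesis
  proof (cases "face (insert \<sigma> F)")
    case True
    let ?\<phi> = "dual (insert \<sigma> F) \<sigma>"
    have \<phi>: "?\<phi> \<in> L" "\<And>\<tau>. \<tau> \<in> insert \<sigma> F \<Longrightarrow> ?\<phi> \<tau> = (if \<tau> = \<sigma> then 1 else 0)"
      using dual_in_L[OF True] dual_apply[OF True] by auto
    have "rho (insert \<sigma> F) (\<lambda>\<tau>. \<theta> \<tau> - \<theta> \<sigma> * ?\<phi> \<tau>) \<in> J"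
      by (rule rho_form_in_J) (use True \<phi> \<theta> zero L_diff_scale in auto)
    then show ?thesis
      using True out by (simp add: X_rho_out rho_diff rho_scale xop_def scale_uminus_right)
  next
    case False
    then show ?thesis
      using out by (simp add: X_rho_incompatible ksub_zero ksub_J)
  qed
qed

lemma X_J: "c \<in> J \<Longrightarrow> X \<sigma> c \<in> J"
  unfolding J_def
  by (erule klinear_kspan[OF ksub_kspan klinear_X], fold J_def)
    (auto intro: X_rho_form L_base)

lemma X_cong: "c - d \<in> J \<Longrightarrow> X \<sigma> c - X \<sigma> d \<in> J"
  using X_J[of "c - d"] by (simp add: klinear_diff[OF klinear_X])

text \<open>The essential case has two distinct vertices of the face: either order of composition is
  congruent to the same symmetric expression
  \<open>D F (dual F \<sigma>) (dual F \<tau>)\<close>.\<close>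

lemma X_commute_single:
  "X \<sigma> (xop \<tau> F) - X \<tau> (xop \<sigma> F) \<in> J"
proof -
  note J0 = ksub_zero[OF ksub_J]
  consider "\<not> face F" | "face F" "\<sigma> \<notin> F" "\<tau> \<notin> F" | "face F" "\<sigma> = \<tau>"
    | "face F" "\<sigma> \<in> F" "\<tau> \<in> F" "\<sigma> \<noteq> \<tau>" | "face F" "\<sigma> \<in> F" "\<tau> \<notin> F" | "face F" "\<sigma> \<notin> F" "\<tau> \<in> F"
    by blast
  then show ?thesis
  proof cases
    case 1
    then show ?thesis by (simp add: xop_def klinear_zero[OF klinear_X] J0)
  next
    case 2
    have "X \<upsilon> (xop \<omega> F) = (if face (insert \<upsilon> (insert \<omega> F)) then Poly_Mapping.single (insert \<upsilon> (insert \<omega> F)) 1 else 0)"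
      if "\<upsilon> \<notin> F" "\<omega> \<notin> F" "\<upsilon> \<noteq> \<omega>" for \<upsilon> \<omega>
      using that 2(1) face_subset[of "insert \<upsilon> (insert \<omega> F)" "insert \<omega> F"]
      by (auto simp: xop_def klinear_zero[OF klinear_X])
    then show ?thesis
      using 2 J0 by (cases "\<sigma> = \<tau>") (auto simp: insert_commute)
  next
    case 3
    then show ?thesis by (simp add: J0)
  next
    case 4
    have D: "X \<upsilon> (xop \<omega> F) - D F (dual F \<sigma>) (dual F \<tau>) \<in> J"
      if "\<upsilon> = \<sigma> \<and> \<omega> = \<tau> \<or> \<upsilon> = \<tau> \<and> \<omega> = \<sigma>" for \<upsilon> \<omega>
    proof -
      have "\<upsilon> \<in> F" "\<omega> \<in> F" using that 4 by auto
      then have "X \<upsilon> (rho F (dual F \<omega>)) + D F (dual F \<omega>) (dual F \<upsilon>) \<in> J"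
        using 4(1) dual_in_L dual_apply by (intro X_rho_in) auto
      then have "- (X \<upsilon> (rho F (dual F \<omega>)) + D F (dual F \<omega>) (dual F \<upsilon>)) \<in> J"
        by (rule ksub_uminus[OF ksub_J])
      moreover have "D F (dual F \<omega>) (dual F \<upsilon>) = D F (dual F \<sigma>) (dual F \<tau>)"
        using that D_sym by blast
      ultimately show ?thesis
        using 4(1) \<open>\<omega> \<in> F\<close> by (simp add: xop_def klinear_uminus[OF klinear_X])
    qed
    show ?thesis
      using ksub_trans[OF ksub_J D ksub_sym[OF ksub_J D]] by blast
  next
    case 5
    have *: "X \<sigma>' (xop \<tau>' F) - X \<tau>' (xop \<sigma>' F) \<in> J" if "\<sigma>' \<in> F" "\<tau>' \<notin> F" for \<sigma>' \<tau>'
    proof (cases "face (insert \<tau>' F)")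
      case True
      \<comment> \<open>A form dual to \<sigma>' on the larger face is also dual on \<open>F\<close>
        and vanishes at \<tau>', so that \<open>X_rho_out\<close> leaves no self-intersection
        term.\<close>
      let ?\<theta> = "dual (insert \<tau>' F) \<sigma>'"
      have \<theta>: "?\<theta> \<in> L" "\<And>\<upsilon>. \<upsilon> \<in> insert \<tau>' F \<Longrightarrow> ?\<theta> \<upsilon> = (if \<upsilon> = \<sigma>' then 1 else 0)"
        using dual_in_L[OF True] dual_apply[OF True] that by auto
      have "xop \<sigma>' F + rho F ?\<theta> \<in> J"
        by (rule xop_in) (use \<theta> 5 that in auto)
      from X_J[OF this, of \<tau>'] have "X \<tau>' (xop \<sigma>' F) + X \<tau>' (rho F ?\<theta>) \<in> J"
        by (simp add: klinear_add[OF klinear_X])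
      moreover have "?\<theta> \<tau>' = 0"
        using \<theta>(2)[of \<tau>'] that by auto
      then have "X \<tau>' (rho F ?\<theta>) = rho (insert \<tau>' F) ?\<theta>"
        using True that by (simp add: X_rho_out)
      moreover have "X \<sigma>' (xop \<tau>' F) = - rho (insert \<tau>' F) ?\<theta>"
        using True that 5(1) by (simp add: xop_def)
      ultimately have "X \<tau>' (xop \<sigma>' F) - X \<sigma>' (xop \<tau>' F) \<in> J"
        by simp
      then show ?thesis
        by (rule ksub_sym[OF ksub_J])
    next
      case False
      then show ?thesis
        using that 5(1) J0
        by (simp add: xop_def klinear_zero[OF klinear_X] klinear_uminus[OF klinear_X] X_rho_incompatible)
    qed
    show ?thesis
      using * 5 by blast
  next
    case 6
    have "X \<tau> (xop \<sigma> F) - X \<sigma> (xop \<tau> F) \<in> J"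
    proof (cases "face (insert \<sigma> F)")
      case True
      let ?\<theta> = "dual (insert \<sigma> F) \<tau>"
      have \<theta>: "?\<theta> \<in> L" "\<And>\<upsilon>. \<upsilon> \<in> insert \<sigma> F \<Longrightarrow> ?\<theta> \<upsilon> = (if \<upsilon> = \<tau> then 1 else 0)"
        using dual_in_L[OF True] dual_apply[OF True] 6 by auto
      have "xop \<tau> F + rho F ?\<theta> \<in> J"
        by (rule xop_in) (use \<theta> 6 in auto)
      from X_J[OF this, of \<sigma>] have "X \<sigma> (xop \<tau> F) + X \<sigma> (rho F ?\<theta>) \<in> J"
        by (simp add: klinear_add[OF klinear_X])
      moreover have "?\<theta> \<sigma> = 0"
        using \<theta>(2)[of \<sigma>] 6 by auto
      then have "X \<sigma> (rho F ?\<theta>) = rho (insert \<sigma> F) ?\<theta>"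
        using True 6 by (simp add: X_rho_out)
      moreover have "X \<tau> (xop \<sigma> F) = - rho (insert \<sigma> F) ?\<theta>"
        using True 6 by (simp add: xop_def)
      ultimately have "X \<sigma> (xop \<tau> F) - X \<tau> (xop \<sigma> F) \<in> J"
        by simp
      then show ?thesis
        by (rule ksub_sym[OF ksub_J])
    next
      case False
      then show ?thesis
        using 6 J0
        by (simp add: xop_def klinear_zero[OF klinear_X] klinear_uminus[OF klinear_X] X_rho_incompatible)
    qed
    then show ?thesis
      by (rule ksub_sym[OF ksub_J])
  qed
qed

lemma X_commute: "X \<sigma> (X \<tau> c) - X \<tau> (X \<sigma> c) \<in> J"
  by (rule klinear_cong[OF ksub_J klinear_comp klinear_comp])
    (auto simp: klinear_X X_commute_single)

text \<open>Unless \<tau> lies in the face and \<sigma> does not, the composition is zero outright;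
  in the remaining case the opposite composition is zero and \<open>X_commute_single\<close>
  applies.\<close>

lemma X_incompatible:
  assumes "\<sigma> \<in> V" "\<tau> \<in> V" "\<sigma> \<noteq> \<tau>" "\<not> compat \<sigma> \<tau>"
  shows "X \<sigma> (X \<tau> c) \<in> J"
proof (rule klinear_mem[OF ksub_J klinear_comp[OF klinear_X klinear_X]])
  fix F
  note J0 = ksub_zero[OF ksub_J]
  have nf: "\<not> face F" if "{\<sigma>, \<tau>} \<subseteq> F" for F
    using that assms unfolding face_def by blast
  have out: "X \<upsilon> (xop \<omega> F) = 0" if "\<upsilon> = \<sigma> \<and> \<omega> = \<tau> \<or> \<upsilon> = \<tau> \<and> \<omega> = \<sigma>" "\<omega> \<notin> F" for \<upsilon> \<omega>
  proof -
    have "\<not> face (insert \<upsilon> (insert \<omega> F))"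
      using nf[of "insert \<upsilon> (insert \<omega> F)"] that(1) by blast
    moreover have "\<upsilon> \<noteq> \<omega>"
      using that(1) assms(3) by blast
    moreover have "\<upsilon> \<notin> F \<or> \<not> face (insert \<omega> F)"
      using nf[of "insert \<omega> F"] that(1) by blast
    ultimately show ?thesis
      using that(2) by (auto simp: xop_def klinear_zero[OF klinear_X])
  qed
  show "X \<sigma> (X \<tau> (Poly_Mapping.single F 1)) \<in> J"
  proof (cases "\<tau> \<in> F")
    case False
    then show ?thesis
      using out[of \<sigma> \<tau>] J0 by simp
  next
    case True
    show ?thesis
    proof (cases "\<sigma> \<in> F")
      case True
      then show ?thesis
        using nf \<open>\<tau> \<in> F\<close> by (simp add: xop_def klinear_zero[OF klinear_X] J0)
    next
      case False
      then have "X \<tau> (xop \<sigma> F) = 0"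
        using out[of \<tau> \<sigma>] by (simp add: insert_commute)
      then show ?thesis
        using X_commute_single[of \<sigma> \<tau> F] by simp
    qed
  qed
qed

text \<open>On a face \<open>F\<close> the vertices of \<open>F\<close> contribute minus
  \<open>rho F\<close> of the interpolation of \<theta>, the link contributes
  \<open>rho F \<theta>\<close>, and all other vertices nothing. Together this is
  \<open>rho F\<close> of a form vanishing on \<open>F\<close>.\<close>

lemma X_form:
  assumes \<theta>: "\<theta> \<in> L"
  shows "(\<Sum>\<sigma>\<in>V. scale (\<theta> \<sigma>) (X \<sigma> c)) \<in> J"
proof (rule klinear_mem[OF ksub_J, where \<phi> = "\<lambda>c. \<Sum>\<sigma>\<in>V. scale (\<theta> \<sigma>) (X \<sigma> c)"])
  show "klinear (\<lambda>c. \<Sum>\<sigma>\<in>V. scale (\<theta> \<sigma>) (X \<sigma> c))"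
    by (intro klinear_sum_comp klinear_scale_comp klinear_X)
  fix F
  show "(\<Sum>\<sigma>\<in>V. scale (\<theta> \<sigma>) (X \<sigma> (Poly_Mapping.single F 1))) \<in> J"
  proof (cases "face F")
    case False
    then show ?thesis by (simp add: xop_def ksub_zero[OF ksub_J])
  next
    case True
    then have FV: "F \<subseteq> V" "finite F"
      by (auto simp: face_def finite_face)
    have "(\<Sum>\<sigma>\<in>V. scale (\<theta> \<sigma>) (X \<sigma> (Poly_Mapping.single F 1))) = (\<Sum>\<sigma>\<in>V. scale (\<theta> \<sigma>) (xop \<sigma> F))"
      by simp
    also have "\<dots> = (\<Sum>\<sigma>\<in>F \<union> link F. scale (\<theta> \<sigma>) (xop \<sigma> F))"
      using FV finite_V by (intro sum.mono_neutral_right) (auto simp: link_def xop_def)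
    also have "\<dots> = (\<Sum>\<sigma>\<in>F. scale (\<theta> \<sigma>) (xop \<sigma> F)) + (\<Sum>\<sigma>\<in>link F. scale (\<theta> \<sigma>) (xop \<sigma> F))"
      using FV by (intro sum.union_disjoint finite_link) (auto simp: link_def)
    also have "(\<Sum>\<sigma>\<in>F. scale (\<theta> \<sigma>) (xop \<sigma> F)) = - rho F (\<lambda>\<tau>. \<Sum>\<sigma>\<in>F. \<theta> \<sigma> * dual F \<sigma> \<tau>)"
      using True by (simp add: rho_sum rho_scale xop_def scale_uminus_right sum_negf)
    also have "(\<Sum>\<sigma>\<in>link F. scale (\<theta> \<sigma>) (xop \<sigma> F)) = rho F \<theta>"
      unfolding rho_def using True by (intro sum.cong) (auto simp: xop_def link_def)
    also have "- rho F (\<lambda>\<tau>. \<Sum>\<sigma>\<in>F. \<theta> \<sigma> * dual F \<sigma> \<tau>) + rho F \<theta> =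
        rho F (\<lambda>\<tau>. \<theta> \<tau> - (\<Sum>\<sigma>\<in>F. \<theta> \<sigma> * dual F \<sigma> \<tau>))"
      by (simp add: rho_diff)
    also have "\<dots> \<in> J"
    proof (rule rho_form_in_J[OF True])
      show "(\<lambda>\<tau>. \<theta> \<tau> - (\<Sum>\<sigma>\<in>F. \<theta> \<sigma> * dual F \<sigma> \<tau>)) \<in> L"
        by (intro L_diff \<theta> L_sum L_scale dual_in_L True)
      show "\<theta> \<tau> - (\<Sum>\<sigma>\<in>F. \<theta> \<sigma> * dual F \<sigma> \<tau>) = 0" if "\<tau> \<in> F" for \<tau>
      proof -
        have "(\<Sum>\<sigma>\<in>F. \<theta> \<sigma> * dual F \<sigma> \<tau>) = (\<Sum>\<sigma>\<in>F. if \<tau> = \<sigma> then \<theta> \<sigma> else 0)"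
          using True that by (intro sum.cong) (auto simp: dual_apply)
        then show ?thesis
          using that FV by simp
      qed
    qed
    finally show ?thesis .
  qed
qed

end

section \<open>The quotient ring of a flag complex\<close>

definition (in flag_complex) var :: "'v \<Rightarrow> (('v \<Rightarrow>\<^sub>0 nat) \<Rightarrow>\<^sub>0 'k)" where
  "var \<sigma> = Poly_Mapping.single (Poly_Mapping.single \<sigma> 1) 1"

definition (in flag_complex) mono :: "'v set \<Rightarrow> (('v \<Rightarrow>\<^sub>0 nat) \<Rightarrow>\<^sub>0 'k)" where
  "mono F = Poly_Mapping.single (\<Sum>\<sigma>\<in>F. Poly_Mapping.single \<sigma> 1) 1"

definition (in flag_complex) form :: "('v \<Rightarrow> 'k) \<Rightarrow> (('v \<Rightarrow>\<^sub>0 nat) \<Rightarrow>\<^sub>0 'k)" where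
  "form \<theta> = (\<Sum>\<sigma>\<in>V. scale (\<theta> \<sigma>) (var \<sigma>))"

text \<open>On trees this becomes the map to good monomials, by \<open>good_monomial_eq\<close> and
  \<open>monomial_combination_eq\<close>.\<close>

definition (in flag_complex) Phi :: "('v set \<Rightarrow>\<^sub>0 'k) \<Rightarrow> (('v \<Rightarrow>\<^sub>0 nat) \<Rightarrow>\<^sub>0 'k)" where
  "Phi = lin (\<lambda>F. if face F then mono F else 0)"

definition (in flag_complex) polys :: "(('v \<Rightarrow>\<^sub>0 nat) \<Rightarrow>\<^sub>0 'k) set" where
  "polys = {p. \<forall>m\<in>Poly_Mapping.keys p. Poly_Mapping.keys m \<subseteq> V}"

definition (in flag_complex) is_ideal :: "(('v \<Rightarrow>\<^sub>0 nat) \<Rightarrow>\<^sub>0 'k) set \<Rightarrow> bool" where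
  "is_ideal N \<longleftrightarrow> N \<subseteq> polys \<and> ksub N \<and> (\<forall>p\<in>N. \<forall>q\<in>polys. q * p \<in> N)"

definition (in flag_complex) relators :: "(('v \<Rightarrow>\<^sub>0 nat) \<Rightarrow>\<^sub>0 'k) set" where
  "relators = form ` G \<union> {var \<sigma> * var \<tau> | \<sigma> \<tau>. \<sigma> \<in> V \<and> \<tau> \<in> V \<and> \<sigma> \<noteq> \<tau> \<and> \<not> compat \<sigma> \<tau>}"

context flag_complex
begin

lemma var_mult_mono: "finite F \<Longrightarrow> \<sigma> \<notin> F \<Longrightarrow> var \<sigma> * mono F = mono (insert \<sigma> F)"
  by (simp add: var_def mono_def mult_single)

lemma var_mult_single: "var \<sigma> * Poly_Mapping.single m a = Poly_Mapping.single (Poly_Mapping.single \<sigma> 1 + m) a"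
  by (simp add: var_def mult_single)

lemma mono_empty_mult: "mono {} * p = p"
  by (simp add: mono_def single_zero_mult)

lemma single_in_polys: "Poly_Mapping.keys m \<subseteq> V \<Longrightarrow> Poly_Mapping.single m a \<in> polys"
  by (simp add: polys_def)

lemma var_in_polys: "\<sigma> \<in> V \<Longrightarrow> var \<sigma> \<in> polys"
  by (simp add: var_def polys_def)

lemma mono_in_polys:
  assumes "F \<subseteq> V"
  shows "mono F \<in> polys"
proof -
  have "Poly_Mapping.keys (\<Sum>\<sigma>\<in>F. Poly_Mapping.single \<sigma> (1::nat)) \<subseteq> F"
    using keys_sum[of "\<lambda>\<sigma>. Poly_Mapping.single \<sigma> (1::nat)" F] by auto
  then show ?thesis
    unfolding mono_def using assms by (intro single_in_polys) blast
qed

lemma ksub_polys: "ksub polys"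
  unfolding ksub_def polys_def
proof (intro conjI ballI allI; clarsimp)
  fix p q :: "('v \<Rightarrow>\<^sub>0 nat) \<Rightarrow>\<^sub>0 'k" and m \<sigma>
  assume "\<forall>m\<in>Poly_Mapping.keys p. Poly_Mapping.keys m \<subseteq> V" "\<forall>m\<in>Poly_Mapping.keys q. Poly_Mapping.keys m \<subseteq> V"
    "m \<in> Poly_Mapping.keys (p + q)" "\<sigma> \<in> Poly_Mapping.keys m"
  then show "\<sigma> \<in> V" using keys_add[of p q] by blast
next
  fix a and p :: "('v \<Rightarrow>\<^sub>0 nat) \<Rightarrow>\<^sub>0 'k" and m \<sigma>
  assume "\<forall>m\<in>Poly_Mapping.keys p. Poly_Mapping.keys m \<subseteq> V"
    "m \<in> Poly_Mapping.keys (scale a p)" "\<sigma> \<in> Poly_Mapping.keys m"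
  then show "\<sigma> \<in> V" using keys_scale[of a p] by blast
qed

lemma mult_in_polys:
  assumes "p \<in> polys" "q \<in> polys"
  shows "p * q \<in> polys"
  unfolding polys_def
proof (clarsimp)
  fix m \<sigma> assume m: "m \<in> Poly_Mapping.keys (p * q)" and \<sigma>: "\<sigma> \<in> Poly_Mapping.keys m"
  from m obtain a b where "a \<in> Poly_Mapping.keys p" "b \<in> Poly_Mapping.keys q" "m = a + b"
    using keys_mult[of p q] by blast
  then show "\<sigma> \<in> V"
    using assms \<sigma> keys_add[of a b] unfolding polys_def by blast
qed

lemma form_in_polys: "form \<theta> \<in> polys"
  unfolding form_def by (intro ksub_sum ksub_scale ksub_polys var_in_polys)

lemma Phi_single [simp]: "face F \<Longrightarrow> Phi (Poly_Mapping.single F a) = scale a (mono F)"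
  by (simp add: Phi_def)

lemma klinear_Phi: "klinear Phi"
  by (simp add: Phi_def klinear_lin)

lemma Phi_in_polys: "Phi c \<in> polys"
  by (rule klinear_mem[OF ksub_polys klinear_Phi])
    (auto simp: Phi_def ksub_zero[OF ksub_polys] face_def intro: mono_in_polys)

lemma form_mult: "form \<theta> * p = (\<Sum>\<sigma>\<in>V. scale (\<theta> \<sigma>) (var \<sigma> * p))"
  by (simp add: form_def sum_distrib_right scale_mult_left)

end

definition (in flag_complex) chains :: "('v set \<Rightarrow>\<^sub>0 'k) set" where
  "chains = {c. Poly_Mapping.keys c \<subseteq> Collect face}"

lemma (in flag_complex) ksub_chains: "ksub chains"
  unfolding ksub_def chains_def mem_Collect_eq
  by (auto dest!: subsetD[OF keys_add] subsetD[OF keys_scale])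

lemma (in flag_complex) single_in_chains: "face F \<Longrightarrow> Poly_Mapping.single F a \<in> chains"
  by (simp add: chains_def)

lemma (in flag_complex) rho_in_chains: "rho F \<theta> \<in> chains"
  unfolding rho_def by (intro ksub_sum ksub_chains single_in_chains) (simp add: link_def)

text \<open>\<open>I\<close> is given as the least ideal containing the relators, the form in which
  \<open>genideal\<close> provides it; minimality enters through \<open>Psi_I\<close>.\<close>

locale complex_ideal = unimodular_complex +
  fixes I
  assumes ideal_I: "is_ideal I" and relators_in_I: "relators \<subseteq> I"
    and I_minimal: "is_ideal N \<Longrightarrow> relators \<subseteq> N \<Longrightarrow> I \<subseteq> N"
begin

lemma ksub_I: "ksub I"
  using ideal_I by (simp add: is_ideal_def)

lemma I_mult: "p \<in> I \<Longrightarrow> q \<in> polys \<Longrightarrow> q * p \<in> I"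
  using ideal_I by (simp add: is_ideal_def)

lemma var_mult_cong: "\<sigma> \<in> V \<Longrightarrow> p - q \<in> I \<Longrightarrow> var \<sigma> * p - var \<sigma> * q \<in> I"
  using I_mult[of "p - q" "var \<sigma>"] by (simp add: var_in_polys right_diff_distrib)

lemma form_in_I:
  assumes "\<theta> \<in> L"
  shows "form \<theta> \<in> I"
  using assms
proof induction
  case L_zero
  then show ?case by (simp add: form_def ksub_zero[OF ksub_I])
next
  case (L_base g)
  then show ?case using relators_in_I by (auto simp: relators_def)
next
  case (L_add \<theta> \<theta>')
  then show ?case by (simp add: form_def scale_add_left sum.distrib ksub_add[OF ksub_I])
next
  case (L_scale \<theta> a)
  then have "scale a (form \<theta>) \<in> I" by (simp add: ksub_scale[OF ksub_I])
  then show ?case by (simp add: form_def scale_sum)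
next
  case (L_cong \<theta> \<theta>')
  then have "form \<theta> = form \<theta>'" by (simp add: form_def)
  then show ?case using L_cong by simp
qed

text \<open>A vertex of \<open>F\<close> incompatible with \<sigma> splits off as a factor of the
  monomial, and its product with \<open>var \<sigma>\<close> is a relator.\<close>

lemma var_mult_mono_incompatible:
  assumes "\<sigma> \<in> V" "face F" "\<not> face (insert \<sigma> F)"
  shows "var \<sigma> * mono F \<in> I"
proof -
  from assms obtain \<tau> where \<tau>: "\<tau> \<in> F" "\<tau> \<noteq> \<sigma>" "\<not> compat \<sigma> \<tau>"
    unfolding face_def using compat_sym by blast
  then have "\<tau> \<in> V"
    using assms(2) by (auto simp: face_def)
  then have "var \<sigma> * var \<tau> \<in> I"
    using \<tau> assms(1) relators_in_I unfolding relators_def by blast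
  then have "mono (F - {\<tau>}) * (var \<sigma> * var \<tau>) \<in> I"
    using assms(2) by (intro I_mult[of "var \<sigma> * var \<tau>"] mono_in_polys) (auto simp: face_def)
  moreover have "mono F = var \<tau> * mono (F - {\<tau>})"
    using \<tau> finite_face[OF assms(2)] by (simp add: var_mult_mono insert_absorb)
  ultimately show ?thesis
    by (simp add: ac_simps)
qed

text \<open>The vertices are sorted into those of \<open>F\<close>, those of its link, whose terms
  make up \<open>rho\<close>, and the rest, whose products with the monomial lie in
  \<open>I\<close>.\<close>

lemma form_mult_mono:
  assumes F: "face F"
  shows "form \<theta> * mono F - (\<Sum>\<tau>\<in>F. scale (\<theta> \<tau>) (var \<tau> * mono F)) - Phi (rho F \<theta>) \<in> I"
proof -
  let ?t = "\<lambda>\<tau>. scale (\<theta> \<tau>) (var \<tau> * mono F)"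
  have FV: "F \<subseteq> V" "finite F"
    using F finite_face by (auto simp: face_def)
  have VF: "V = F \<union> (link F \<union> (V - F - link F))"
    using FV by (auto simp: link_def)
  have "form \<theta> * mono F = sum ?t (F \<union> (link F \<union> (V - F - link F)))"
    unfolding form_mult by (rule arg_cong[OF VF])
  also have "\<dots> = sum ?t F + sum ?t (link F \<union> (V - F - link F))"
    using FV finite_V by (intro sum.union_disjoint) (auto simp: link_def)
  also have "sum ?t (link F \<union> (V - F - link F)) = sum ?t (link F) + sum ?t (V - F - link F)"
    using finite_V by (intro sum.union_disjoint) auto
  also have "sum ?t (link F) = Phi (rho F \<theta>)"
    unfolding rho_def klinear_sum[OF klinear_Phi]
    by (intro sum.cong) (use FV in \<open>auto simp: link_def var_mult_mono\<close>)
  finally have eq: "form \<theta> * mono F - sum ?t F - Phi (rho F \<theta>) = sum ?t (V - F - link F)"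
    by simp
  have "sum ?t (V - F - link F) \<in> I"
    by (intro ksub_sum ksub_scale ksub_I var_mult_mono_incompatible F) (auto simp: link_def)
  with eq show ?thesis by simp
qed

text \<open>Multiplying the form, which is zero in the quotient, by the monomial of \<open>F\<close>
  expresses a product with a repeated factor through squarefree ones. The definition of
  \<open>xop\<close> is modelled on this identity.\<close>

lemma var_mult_mono_in:
  assumes "face F" "\<sigma> \<in> F" "\<theta> \<in> L" "\<And>\<tau>. \<tau> \<in> F \<Longrightarrow> \<theta> \<tau> = (if \<tau> = \<sigma> then 1 else 0)"
  shows "var \<sigma> * mono F + Phi (rho F \<theta>) \<in> I"
proof -
  have "(\<Sum>\<tau>\<in>F. scale (\<theta> \<tau>) (var \<tau> * mono F)) = (\<Sum>\<tau>\<in>F. if \<tau> = \<sigma> then var \<tau> * mono F else 0)"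
    using assms by (intro sum.cong) auto
  also have "\<dots> = var \<sigma> * mono F"
    using assms finite_face by simp
  finally have "form \<theta> * mono F - var \<sigma> * mono F - Phi (rho F \<theta>) \<in> I"
    using form_mult_mono[OF assms(1), of \<theta>] by simp
  moreover have "form \<theta> * mono F \<in> I"
    using I_mult[OF form_in_I[OF assms(3)] mono_in_polys] assms(1)
    by (simp add: face_def mult.commute)
  ultimately show ?thesis
    using ksub_diff[OF ksub_I, of "form \<theta> * mono F" "form \<theta> * mono F - var \<sigma> * mono F - Phi (rho F \<theta>)"]
    by (simp add: add.commute)
qed

lemma Phi_J: "c \<in> J \<Longrightarrow> Phi c \<in> I"
  unfolding J_def
proof (erule klinear_kspan[OF ksub_I klinear_Phi], clarify)
  fix F g assume Fg: "face F" "g \<in> G" "\<forall>\<sigma>\<in>F. g \<sigma> = 0"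
  then have "form g * mono F - Phi (rho F g) \<in> I"
    using form_mult_mono[OF Fg(1), of g] by simp
  moreover have "form g * mono F \<in> I"
    using I_mult[OF form_in_I[OF L_base[OF Fg(2)]] mono_in_polys] Fg(1)
    by (simp add: face_def mult.commute)
  ultimately show "Phi (rho F g) \<in> I"
    using ksub_diff[OF ksub_I] by fastforce
qed

text \<open>Under \<open>Phi\<close> the operator \<open>X \<sigma>\<close> becomes multiplication
  by the variable; \<open>Psi_var_mult\<close> is the counterpart for the map in the other
  direction.\<close>

lemma var_mult_Phi:
  assumes \<sigma>: "\<sigma> \<in> V"
  shows "var \<sigma> * Phi c - Phi (X \<sigma> c) \<in> I"
proof (rule klinear_cong[OF ksub_I klinear_comp[OF klinear_mult klinear_Phi] klinear_comp[OF klinear_Phi klinear_X]])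
  fix F
  note I0 = ksub_zero[OF ksub_I]
  show "var \<sigma> * Phi (Poly_Mapping.single F 1) - Phi (X \<sigma> (Poly_Mapping.single F 1)) \<in> I"
  proof (cases "face F")
    case False
    then show ?thesis
      by (simp add: Phi_def xop_def klinear_zero[OF klinear_lin] I0)
  next
    case F: True
    show ?thesis
    proof (cases "\<sigma> \<in> F")
      case True
      then show ?thesis
        using F var_mult_mono_in[OF F True dual_in_L[OF F True] dual_apply[OF F True]]
        by (simp add: xop_def klinear_uminus[OF klinear_Phi])
    next
      case False
      then show ?thesis
        using F var_mult_mono_incompatible[OF \<sigma> F] I0 finite_face[OF F]
        by (auto simp: xop_def var_mult_mono klinear_zero[OF klinear_Phi])
    qed
  qed
qed

section \<open>The inverse map from polynomials to chains\<close>

definition vlist :: "'a list" where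
  "vlist = (SOME xs. set xs = V \<and> distinct xs)"

lemma vlist: "set vlist = V" "distinct vlist"
  using someI_ex[OF finite_distinct_list[OF finite_V]] unfolding vlist_def by blast+

text \<open>The monomial \<open>m\<close> evaluated at the operators \<open>X\<close> and applied to
  the empty face. A fixed list of the variables makes the product definite; by
  \<open>X_commute\<close> its order matters only up to \<open>J\<close>.\<close>

definition psi :: "('a \<Rightarrow>\<^sub>0 nat) \<Rightarrow> ('a set \<Rightarrow>\<^sub>0 'b)" where
  "psi m = foldr (\<lambda>\<sigma>. X \<sigma> ^^ Poly_Mapping.lookup m \<sigma>) vlist (Poly_Mapping.single {} 1)"

definition Psi :: "(('a \<Rightarrow>\<^sub>0 nat) \<Rightarrow>\<^sub>0 'b) \<Rightarrow> ('a set \<Rightarrow>\<^sub>0 'b)" where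
  "Psi = lin psi"

lemma klinear_Psi: "klinear Psi"
  by (simp add: Psi_def klinear_lin)

lemma X_pow_cong: "c - d \<in> J \<Longrightarrow> (X \<tau> ^^ n) c - (X \<tau> ^^ n) d \<in> J"
  by (induction n) (auto simp: X_cong)

lemma X_pow_commute: "X \<sigma> ((X \<tau> ^^ n) c) - (X \<tau> ^^ n) (X \<sigma> c) \<in> J"
proof (induction n)
  case 0
  then show ?case by (simp add: ksub_zero[OF ksub_J])
next
  case (Suc n)
  show ?case
    using ksub_trans[OF ksub_J X_commute X_cong[OF Suc]] by simp
qed

text \<open>The additional \<open>X \<sigma>\<close> arises at the place of \<sigma> in the list and
  is moved to the front past the powers before it, at the cost of members of
  \<open>J\<close>.\<close>

lemma foldr_X:
  fixes m :: "'a \<Rightarrow>\<^sub>0 nat" and c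
  defines "f \<equiv> \<lambda>m xs. foldr (\<lambda>\<sigma>. X \<sigma> ^^ Poly_Mapping.lookup m \<sigma>) xs c"
  assumes "distinct xs"
  shows "f (Poly_Mapping.single \<sigma> 1 + m) xs - (if \<sigma> \<in> set xs then X \<sigma> (f m xs) else f m xs) \<in> J"
  using assms(2)
proof (induction xs)
  case Nil
  then show ?case by (simp add: f_def ksub_zero[OF ksub_J])
next
  case (Cons \<tau> xs)
  let ?m = "Poly_Mapping.single \<sigma> 1 + m"
  let ?n = "Poly_Mapping.lookup m \<tau>"
  show ?case
  proof (cases "\<sigma> = \<tau>")
    case True
    then have "f ?m xs - f m xs \<in> J"
      using Cons by simp
    then have "X \<tau> ((X \<tau> ^^ ?n) (f ?m xs)) - X \<tau> ((X \<tau> ^^ ?n) (f m xs)) \<in> J"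
      by (intro X_cong X_pow_cong)
    then show ?thesis
      using True by (simp add: f_def lookup_add)
  next
    case False
    then have eq: "f ?m (\<tau> # xs) = (X \<tau> ^^ ?n) (f ?m xs)"
      by (simp add: f_def lookup_add lookup_single)
    show ?thesis
    proof (cases "\<sigma> \<in> set xs")
      case True
      then have "(X \<tau> ^^ ?n) (f ?m xs) - (X \<tau> ^^ ?n) (X \<sigma> (f m xs)) \<in> J"
        using Cons by (intro X_pow_cong) simp
      from ksub_trans[OF ksub_J this ksub_sym[OF ksub_J X_pow_commute]]
      show ?thesis
        using eq True by (simp add: f_def)
    next
      case out: False
      then have "(X \<tau> ^^ ?n) (f ?m xs) - (X \<tau> ^^ ?n) (f m xs) \<in> J"
        using Cons by (intro X_pow_cong) simp
      then show ?thesis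
        using eq out False by (simp add: f_def)
    qed
  qed
qed

lemma psi_add: "\<sigma> \<in> V \<Longrightarrow> psi (Poly_Mapping.single \<sigma> 1 + m) - X \<sigma> (psi m) \<in> J"
  using foldr_X[OF vlist(2), where \<sigma> = \<sigma> and m = m and c = "Poly_Mapping.single {} 1"]
  by (simp add: psi_def vlist(1))

lemma Psi_var_mult: "\<sigma> \<in> V \<Longrightarrow> Psi (var \<sigma> * p) - X \<sigma> (Psi p) \<in> J"
  by (rule klinear_cong[OF ksub_J klinear_comp[OF klinear_Psi klinear_mult] klinear_comp[OF klinear_X klinear_Psi]])
    (use psi_add in \<open>simp add: var_mult_single Psi_def\<close>)

lemma Psi_form_mult:
  assumes "\<theta> \<in> L"
  shows "Psi (form \<theta> * p) \<in> J"
proof -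
  have "Psi (form \<theta> * p) - (\<Sum>\<sigma>\<in>V. scale (\<theta> \<sigma>) (X \<sigma> (Psi p))) =
      (\<Sum>\<sigma>\<in>V. scale (\<theta> \<sigma>) (Psi (var \<sigma> * p) - X \<sigma> (Psi p)))"
    by (simp add: form_mult klinear_sum[OF klinear_Psi] klinear_scale[OF klinear_Psi]
        scale_diff_right sum_subtractf)
  also have "\<dots> \<in> J"
    by (intro ksub_sum ksub_scale ksub_J Psi_var_mult)
  finally show ?thesis
    using ksub_diff_cong[OF ksub_J _ X_form[OF assms]] by blast
qed

lemma Psi_relator_mult:
  assumes "\<sigma> \<in> V" "\<tau> \<in> V" "\<sigma> \<noteq> \<tau>" "\<not> compat \<sigma> \<tau>"
  shows "Psi (var \<sigma> * var \<tau> * p) \<in> J"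
proof -
  have "Psi (var \<sigma> * (var \<tau> * p)) - X \<sigma> (X \<tau> (Psi p)) \<in> J"
    by (rule ksub_trans[OF ksub_J Psi_var_mult X_cong[OF Psi_var_mult]]) (use assms in auto)
  then show ?thesis
    using ksub_diff_cong[OF ksub_J _ X_incompatible[OF assms]] by (simp add: mult.assoc)
qed

text \<open>The polynomials p with \<open>Psi (q * p)\<close> in \<open>J\<close> for all q form an
  ideal containing the relators. Having the multiples in the condition makes closure under
  multiplication immediate.\<close>

lemma Psi_I:
  assumes "p \<in> I"
  shows "Psi p \<in> J"
proof -
  let ?N = "{p \<in> polys. \<forall>q\<in>polys. Psi (q * p) \<in> J}"
  have "is_ideal ?N"
    unfolding is_ideal_def
  proof (intro conjI ballI)
    show "ksub ?N"
      unfolding ksub_def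
      by (auto simp: ksub_zero[OF ksub_polys] ksub_zero[OF ksub_J] klinear_zero[OF klinear_Psi]
          ksub_add[OF ksub_polys] distrib_left klinear_add[OF klinear_Psi] ksub_add[OF ksub_J]
          ksub_scale[OF ksub_polys] scale_mult_right klinear_scale[OF klinear_Psi] ksub_scale[OF ksub_J])
    show "q * p \<in> ?N" if "p \<in> ?N" "q \<in> polys" for p q
      using that by (auto simp: mult_in_polys simp flip: mult.assoc)
  qed auto
  moreover have "relators \<subseteq> ?N"
    unfolding relators_def
    using Psi_form_mult Psi_relator_mult L_base
    by (auto simp: form_in_polys var_in_polys mult_in_polys mult.commute)
  ultimately have "p \<in> ?N"
    using I_minimal assms by blast
  then have "Psi (mono {} * p) \<in> J"
    using mono_in_polys[of "{}"] by blast
  then show ?thesis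
    by (simp add: mono_empty_mult)
qed

lemma psi_zero: "psi 0 = Poly_Mapping.single {} 1"
proof -
  have "foldr (\<lambda>\<sigma>. X \<sigma> ^^ Poly_Mapping.lookup 0 \<sigma>) xs c = c" for xs c
    by (induction xs) auto
  then show ?thesis by (simp add: psi_def)
qed

text \<open>Building up a face one vertex at a time only meets the case of \<open>xop\<close> that
  enlarges the face.\<close>

lemma Psi_mono:
  assumes "face F"
  shows "Psi (mono F) - Poly_Mapping.single F 1 \<in> J"
  using finite_face[OF assms] assms
proof (induction F rule: finite_induct)
  case empty
  then show ?case
    by (simp add: mono_def Psi_def psi_zero ksub_zero[OF ksub_J])
next
  case (insert \<sigma> F)
  then have F: "face F" "\<sigma> \<in> V"
    using face_subset[of "insert \<sigma> F" F] by (blast, simp add: face_def)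
  have "Psi (mono (insert \<sigma> F)) = Psi (var \<sigma> * mono F)"
    using insert by (simp add: var_mult_mono)
  moreover have "Psi (var \<sigma> * mono F) - X \<sigma> (Poly_Mapping.single F 1) \<in> J"
    by (rule ksub_trans[OF ksub_J Psi_var_mult X_cong]) (use F insert in auto)
  ultimately show ?case
    using F insert by (simp add: xop_def)
qed

lemma Psi_Phi:
  assumes "\<And>F. F \<in> Poly_Mapping.keys c \<Longrightarrow> face F"
  shows "Psi (Phi c) - c \<in> J"
  by (rule klinear_cong[OF ksub_J klinear_comp[OF klinear_Psi klinear_Phi] klinear_id])
    (use assms Psi_mono in auto)

text \<open>Induction on the degree: one variable is split off, and \<open>var_mult_Phi\<close> and
  \<open>psi_add\<close> exchange it for \<open>X\<close>.\<close>

lemma Phi_Psi_monomial: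
  assumes "Poly_Mapping.keys m \<subseteq> V"
  shows "Poly_Mapping.single m 1 - Phi (psi m) \<in> I"
  using assms
proof (induction "\<Sum>\<sigma>\<in>V. Poly_Mapping.lookup m \<sigma>" arbitrary: m)
  case 0
  then have "m = 0"
    using finite_V by (intro poly_mapping_eqI) (auto simp: in_keys_iff subset_iff)
  then show ?case
    by (simp add: psi_zero face_empty mono_def ksub_zero[OF ksub_I])
next
  case (Suc n)
  then obtain \<sigma> where \<sigma>: "\<sigma> \<in> V" "Poly_Mapping.lookup m \<sigma> \<noteq> 0"
    by (metis Zero_neq_Suc sum.neutral)
  define m' where "m' = m - Poly_Mapping.single \<sigma> 1"
  have m: "m = Poly_Mapping.single \<sigma> 1 + m'"
    using \<sigma>(2) by (intro poly_mapping_eqI) (auto simp: m'_def lookup_add lookup_minus lookup_single when_def)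
  have "(\<Sum>\<tau>\<in>V. Poly_Mapping.lookup m \<tau>) = Suc (\<Sum>\<tau>\<in>V. Poly_Mapping.lookup m' \<tau>)"
    unfolding m using \<sigma>(1) finite_V
    by (simp add: lookup_add lookup_single when_def sum.distrib)
  moreover have "Poly_Mapping.keys m' \<subseteq> V"
    using Suc.prems unfolding m by (auto simp: in_keys_iff lookup_add subset_iff)
  ultimately have "Poly_Mapping.single m' 1 - Phi (psi m') \<in> I"
    using Suc by simp
  from var_mult_cong[OF \<sigma>(1) this]
  have 1: "Poly_Mapping.single m 1 - var \<sigma> * Phi (psi m') \<in> I"
    by (simp add: var_mult_single m)
  have "Phi (psi m - X \<sigma> (psi m')) \<in> I"
    unfolding m by (intro Phi_J psi_add \<sigma>)
  then have "Phi (X \<sigma> (psi m')) - Phi (psi m) \<in> I"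
    using ksub_sym[OF ksub_I] by (simp add: klinear_diff[OF klinear_Phi])
  from ksub_trans[OF ksub_I ksub_trans[OF ksub_I 1 var_mult_Phi[OF \<sigma>(1)]] this]
  show ?case .
qed

lemma Phi_Psi:
  assumes "p \<in> polys"
  shows "p - Phi (Psi p) \<in> I"
  by (rule klinear_cong[OF ksub_I klinear_id klinear_comp[OF klinear_Phi klinear_Psi]])
    (use assms Phi_Psi_monomial in \<open>auto simp: polys_def Psi_def\<close>)

text \<open>This is part (b) for an abstract complex: the relations between the monomials of faces
  are exactly those in \<open>J\<close>.\<close>

lemma Phi_in_I_iff:
  assumes "\<And>F. F \<in> Poly_Mapping.keys c \<Longrightarrow> face F"
  shows "Phi c \<in> I \<longleftrightarrow> c \<in> J"
proof
  assume "Phi c \<in> I"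
  then have "Psi (Phi c) \<in> J" by (rule Psi_I)
  then show "c \<in> J"
    using ksub_diff_cong[OF ksub_J ksub_sym[OF ksub_J Psi_Phi]] assms by blast
qed (rule Phi_J)

lemma keys_X_faces:
  assumes "Poly_Mapping.keys c \<subseteq> Collect face"
  shows "Poly_Mapping.keys (X \<sigma> c) \<subseteq> Collect face"
proof -
  have *: "ksub (chains :: ('a set \<Rightarrow>\<^sub>0 'b) set)"
    by (rule ksub_chains)
  have "X \<sigma> c \<in> chains"
  proof (rule klinear_mem[OF * klinear_X])
    fix F assume "F \<in> Poly_Mapping.keys c"
    then have "face F" using assms by blast
    then show "X \<sigma> (Poly_Mapping.single F 1) \<in> chains"
      by (auto simp: xop_def single_in_chains ksub_zero[OF *] intro!: ksub_uminus[OF *] rho_in_chains)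
  qed
  then show ?thesis by (simp add: chains_def)
qed

lemma keys_Psi:
  assumes "F \<in> Poly_Mapping.keys (Psi p)"
  shows "face F"
proof -
  have pow: "Poly_Mapping.keys ((X \<sigma> ^^ n) c) \<subseteq> Collect face" if "Poly_Mapping.keys c \<subseteq> Collect face" for \<sigma> n c
    by (induction n) (simp_all add: that keys_X_faces)
  have "Poly_Mapping.keys (foldr (\<lambda>\<sigma>. X \<sigma> ^^ Poly_Mapping.lookup m \<sigma>) xs (Poly_Mapping.single {} 1)) \<subseteq> Collect face" for m xs
    by (induction xs) (auto simp: face_empty pow)
  then have "psi m \<in> chains" for m
    by (simp add: psi_def chains_def)
  then have "Psi p \<in> chains"
    using klinear_mem[OF ksub_chains klinear_Psi, of p] by (simp add: Psi_def)
  with assms show ?thesis by (auto simp: chains_def)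
qed

end

section \<open>Painted stable 2-partitions\<close>

definition splits :: "'a set \<Rightarrow> 'a set \<Rightarrow> 'a set set set" where
  "splits S W = {\<sigma>. stable_two_partition S W \<sigma>}"

text \<open>The classical compatibility of splits from the theory of phylogenetic trees; pairwise
  compatible families are those cut out by the edges of a tree.\<close>

definition compatible :: "'a set set \<Rightarrow> 'a set set \<Rightarrow> bool" where
  "compatible \<sigma> \<tau> \<longleftrightarrow> (\<exists>P\<in>\<sigma>. \<exists>Q\<in>\<tau>. P \<inter> Q = {})"

text \<open>The coefficient function of \<open>linear_relator\<close>, see
  \<open>form_quad_form\<close>.\<close>

definition quad_form :: "'a \<Rightarrow> 'a \<Rightarrow> 'a \<Rightarrow> 'a \<Rightarrow> 'a set set \<Rightarrow> 'k::{comm_ring,monoid_mult}" where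
  "quad_form i j k l \<sigma> =
     (if separates {i, j} \<sigma> {k, l} then 1 else 0) - (if separates {k, j} \<sigma> {i, l} then 1 else 0)"

definition quad_forms :: "'a set \<Rightarrow> 'a set \<Rightarrow> ('a set set \<Rightarrow> 'k::{comm_ring,monoid_mult}) set" where
  "quad_forms S W = {quad_form i j k l | i j k l. allowed S W i j k l}"

lemma two_partition_iff: "two_partition S \<sigma> \<longleftrightarrow> (\<exists>A. \<sigma> = {A, S - A} \<and> A \<subseteq> S \<and> A \<noteq> {} \<and> S - A \<noteq> {})"
proof
  assume "two_partition S \<sigma>"
  then have "partition_on S \<sigma>" "card \<sigma> = 2"
    by (auto simp: two_partition_def)
  then obtain A B where AB: "\<sigma> = {A, B}" "A \<noteq> B"
    by (auto simp: card_2_iff)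
  have "A \<inter> B = {}" "A \<union> B = S" "A \<noteq> {}" "B \<noteq> {}"
    using \<open>partition_on S \<sigma>\<close> AB by (auto simp: partition_on_def disjoint_def)
  then have "B = S - A" by blast
  then show "\<exists>A. \<sigma> = {A, S - A} \<and> A \<subseteq> S \<and> A \<noteq> {} \<and> S - A \<noteq> {}"
    using AB \<open>A \<union> B = S\<close> \<open>A \<noteq> {}\<close> \<open>B \<noteq> {}\<close> by blast
next
  assume "\<exists>A. \<sigma> = {A, S - A} \<and> A \<subseteq> S \<and> A \<noteq> {} \<and> S - A \<noteq> {}"
  then obtain A where A: "\<sigma> = {A, S - A}" "A \<subseteq> S" "A \<noteq> {}" "S - A \<noteq> {}"
    by blast
  then have "A \<noteq> S - A" by blast
  then show "two_partition S \<sigma>"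
    using A by (auto simp: two_partition_def partition_on_def disjoint_def)
qed

lemma stable_two_partition_iff:
  "stable_two_partition S W \<sigma> \<longleftrightarrow> (\<exists>A. \<sigma> = {A, S - A} \<and> A \<subseteq> S \<and>
     2 \<le> card A \<and> 2 \<le> card (S - A) \<and> A \<inter> W \<noteq> {} \<and> (S - A) \<inter> W \<noteq> {})"
proof
  assume "stable_two_partition S W \<sigma>"
  then obtain A where "\<sigma> = {A, S - A}" "A \<subseteq> S" "\<forall>B\<in>{A, S - A}. 2 \<le> card B \<and> B \<inter> W \<noteq> {}"
    unfolding stable_two_partition_def two_partition_iff by metis
  then show "\<exists>A. \<sigma> = {A, S - A} \<and> A \<subseteq> S \<and>
     2 \<le> card A \<and> 2 \<le> card (S - A) \<and> A \<inter> W \<noteq> {} \<and> (S - A) \<inter> W \<noteq> {}"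
    by (intro exI[of _ A]) simp
next
  assume "\<exists>A. \<sigma> = {A, S - A} \<and> A \<subseteq> S \<and>
     2 \<le> card A \<and> 2 \<le> card (S - A) \<and> A \<inter> W \<noteq> {} \<and> (S - A) \<inter> W \<noteq> {}"
  then obtain A where A: "\<sigma> = {A, S - A}" "A \<subseteq> S"
    "2 \<le> card A" "2 \<le> card (S - A)" "A \<inter> W \<noteq> {}" "(S - A) \<inter> W \<noteq> {}"
    by blast
  then have "A \<noteq> {}" "S - A \<noteq> {}"
    by (metis inf_bot_left)+
  then show "stable_two_partition S W \<sigma>"
    unfolding stable_two_partition_def two_partition_iff using A by (intro conjI exI[of _ A]) auto
qed

lemma finite_splits: "finite S \<Longrightarrow> finite (splits S W)"
  by (rule finite_subset[of _ "Pow (Pow S)"])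
    (auto simp: splits_def stable_two_partition_def two_partition_def partition_on_def)

lemma compatible_sym: "compatible \<sigma> \<tau> \<Longrightarrow> compatible \<tau> \<sigma>"
  unfolding compatible_def by blast

lemma separates_pair:
  assumes "A \<subseteq> S" "A \<noteq> {}" "X \<noteq> {}" "Y \<noteq> {}"
  shows "separates X {A, S - A} Y \<longleftrightarrow> X \<subseteq> A \<and> Y \<subseteq> S - A \<or> X \<subseteq> S - A \<and> Y \<subseteq> A"
proof -
  have "A \<noteq> S - A" using assms(1,2) by blast
  then show ?thesis by (auto simp: separates_def)
qed

text \<open>With i, j, k, l as the corners of a square in this order, the parts of the two
  2-partitions are its four sides, and a set of corners meeting all sides contains a
  diagonal.\<close>

lemma allowed_iff:
  "allowed S W i j k l \<longleftrightarrow> {i, j, k, l} \<subseteq> S \<and> distinct [i, j, k, l] \<and>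
     (i \<in> W \<and> k \<in> W \<or> j \<in> W \<and> l \<in> W)"
proof -
  have "stable_two_partition {a, b, c, d} W {{a, b}, {c, d}} \<longleftrightarrow> (a \<in> W \<or> b \<in> W) \<and> (c \<in> W \<or> d \<in> W)"
    if "distinct [a, b, c, d]" for a b c d
  proof -
    have "two_partition {a, b, c, d} {{a, b}, {c, d}}"
      unfolding two_partition_iff using that by (intro exI[of _ "{a, b}"]) auto
    then show ?thesis
      using that by (simp add: stable_two_partition_def)
  qed
  moreover have "{k, j, i, l} = {i, j, k, l}"
    by blast
  moreover have "distinct [k, j, i, l] \<longleftrightarrow> distinct [i, j, k, l]"
    by auto
  ultimately have "distinct [i, j, k, l] \<Longrightarrow> stable_two_partition {i, j, k, l} W {{i, j}, {k, l}} \<and>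
      stable_two_partition {i, j, k, l} W {{k, j}, {i, l}} \<longleftrightarrow> i \<in> W \<and> k \<in> W \<or> j \<in> W \<and> l \<in> W"
    by metis
  then show ?thesis
    unfolding allowed_def by blast
qed

lemma splitsE:
  assumes "\<sigma> \<in> splits S W"
  obtains A where "\<sigma> = {A, S - A}" "A \<subseteq> S" "A \<noteq> {}" "A \<inter> W \<noteq> {}" "(S - A) \<inter> W \<noteq> {}"
    "2 \<le> card A" "2 \<le> card (S - A)"
proof -
  from assms obtain A where A: "\<sigma> = {A, S - A}" "A \<subseteq> S"
     "2 \<le> card A" "2 \<le> card (S - A)" "A \<inter> W \<noteq> {}" "(S - A) \<inter> W \<noteq> {}"
    unfolding splits_def mem_Collect_eq stable_two_partition_iff by blast
  moreover have "A \<noteq> {}" using A(5) by blast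
  ultimately show thesis using that by blast
qed

text \<open>Parts of incompatible 2-partitions meet in four nonempty cells, one for each label of
  the quadruple. Stability provides enough white elements to choose white labels in two opposite
  cells.\<close>

lemma incompatible_iff_allowed:
  assumes "\<sigma> \<in> splits S W" "\<tau> \<in> splits S W"
  shows "\<not> compatible \<sigma> \<tau> \<longleftrightarrow>
    (\<exists>i j k l. allowed S W i j k l \<and> separates {i, j} \<sigma> {k, l} \<and> separates {k, j} \<tau> {i, l})"
proof -
  obtain A where A: "\<sigma> = {A, S - A}" "A \<subseteq> S" "A \<noteq> {}" "A \<inter> W \<noteq> {}" "(S - A) \<inter> W \<noteq> {}"
    using splitsE[OF assms(1)] by metis
  obtain B where B: "\<tau> = {B, S - B}" "B \<subseteq> S" "B \<noteq> {}" "B \<inter> W \<noteq> {}" "(S - B) \<inter> W \<noteq> {}"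
    using splitsE[OF assms(2)] by metis
  have compat: "compatible \<sigma> \<tau> \<longleftrightarrow>
      A \<inter> B = {} \<or> A \<inter> (S - B) = {} \<or> (S - A) \<inter> B = {} \<or> (S - A) \<inter> (S - B) = {}"
    unfolding compatible_def A(1) B(1) by simp
  have sepA: "separates {i, j} \<sigma> {k, l} \<longleftrightarrow> {i, j} \<subseteq> A \<and> {k, l} \<subseteq> S - A \<or> {i, j} \<subseteq> S - A \<and> {k, l} \<subseteq> A" for i j k l
    unfolding A(1) by (rule separates_pair) (use A in auto)
  have sepB: "separates {i, j} \<tau> {k, l} \<longleftrightarrow> {i, j} \<subseteq> B \<and> {k, l} \<subseteq> S - B \<or> {i, j} \<subseteq> S - B \<and> {k, l} \<subseteq> B" for i j k l
    unfolding B(1) by (rule separates_pair) (use B in auto)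
  show ?thesis
  proof
    assume "\<not> compatible \<sigma> \<tau>"
    then have "A \<inter> (S - B) \<noteq> {}" "A \<inter> B \<noteq> {}" "(S - A) \<inter> B \<noteq> {}" "(S - A) \<inter> (S - B) \<noteq> {}"
      unfolding compat by blast+
    then obtain a b c d where ne: "a \<in> A \<inter> (S - B)" "b \<in> A \<inter> B" "c \<in> (S - A) \<inter> B" "d \<in> (S - A) \<inter> (S - B)"
      unfolding ex_in_conv[symmetric] by (elim exE)
    from A(4) obtain x where x: "x \<in> A" "x \<in> W" by blast
    from A(5) obtain y where y: "y \<in> S - A" "y \<in> W" by blast
    from B(4) obtain x' where x': "x' \<in> B" "x' \<in> W" by blast
    from B(5) obtain y' where y': "y' \<in> S - B" "y' \<in> W" by blast
    note xy = x y x' y'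
    have xS: "x \<in> S" "x' \<in> S"
      using xy A(2) B(2) by auto
    \<comment> \<open>The cells form a square with rows \<open>A\<close>, \<open>S - A\<close> and
      columns \<open>B\<close>, \<open>S - B\<close>. Every part has a white element, so the cells
      with white elements meet both rows and both columns, and two of them are opposite.\<close>
    have "\<exists>i j k l. i \<in> A \<inter> (S - B) \<and> j \<in> A \<inter> B \<and> k \<in> (S - A) \<inter> B \<and> l \<in> (S - A) \<inter> (S - B) \<and>
      (i \<in> W \<and> k \<in> W \<or> j \<in> W \<and> l \<in> W)"
    proof (cases "x \<in> B")
      case True
      show ?thesis
      proof (cases "y \<in> B")
        case False
        then show ?thesis
          using ne xy True by (intro exI[of _ a] exI[of _ x] exI[of _ c] exI[of _ y]) auto
      next
        case y: True
        show ?thesis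
        proof (cases "y' \<in> A")
          case True
          then show ?thesis
            using ne xy y by (intro exI[of _ y'] exI[of _ b] exI[of _ y] exI[of _ d]) auto
        next
          case False
          then show ?thesis
            using ne xy \<open>x \<in> B\<close> by (intro exI[of _ a] exI[of _ x] exI[of _ c] exI[of _ y']) auto
        qed
      qed
    next
      case False
      show ?thesis
      proof (cases "y \<in> B")
        case True
        then show ?thesis
          using ne xy xS False by (intro exI[of _ x] exI[of _ b] exI[of _ y] exI[of _ d]) auto
      next
        case y: False
        show ?thesis
        proof (cases "x' \<in> A")
          case True
          then show ?thesis
            using ne xy y by (intro exI[of _ a] exI[of _ x'] exI[of _ c] exI[of _ y]) auto
        next
          case x': False
          then show ?thesis
            using ne xy xS False by (intro exI[of _ x] exI[of _ b] exI[of _ x'] exI[of _ d]) auto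
        qed
      qed
    qed
    then obtain i j k l where ijkl: "i \<in> A \<inter> (S - B)" "j \<in> A \<inter> B" "k \<in> (S - A) \<inter> B" "l \<in> (S - A) \<inter> (S - B)"
      "i \<in> W \<and> k \<in> W \<or> j \<in> W \<and> l \<in> W"
      by blast
    moreover have "distinct [i, j, k, l]" "{i, j, k, l} \<subseteq> S"
      using ijkl A(2) by auto
    ultimately have "allowed S W i j k l \<and> separates {i, j} \<sigma> {k, l} \<and> separates {k, j} \<tau> {i, l}"
      unfolding allowed_iff sepA sepB by simp
    then show "\<exists>i j k l. allowed S W i j k l \<and> separates {i, j} \<sigma> {k, l} \<and> separates {k, j} \<tau> {i, l}"
      by blast
  next
    assume "\<exists>i j k l. allowed S W i j k l \<and> separates {i, j} \<sigma> {k, l} \<and> separates {k, j} \<tau> {i, l}"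
    then obtain i j k l where "separates {i, j} \<sigma> {k, l}" "separates {k, j} \<tau> {i, l}"
      by blast
    then show "\<not> compatible \<sigma> \<tau>"
      unfolding compat sepA sepB by (elim disjE) auto
  qed
qed

lemma compatible_refl:
  assumes "\<sigma> \<in> splits S W"
  shows "compatible \<sigma> \<sigma>"
proof -
  from assms obtain A where "\<sigma> = {A, S - A}" by (rule splitsE)
  then show ?thesis by (simp add: compatible_def)
qed

section \<open>Clusters with respect to a white root label\<close>

locale painted_set =
  fixes S W :: "'a set" and w :: 'a and K :: "'k::{comm_ring,monoid_mult} itself"
  assumes finite_S: "finite S" and W_subset: "W \<subseteq> S" and card_S: "card S \<ge> 3" and card_W: "card W \<ge> 2"
    and w: "w \<in> W"
begin

sublocale flag_complex "splits S W" compatible "quad_forms S W :: ('a set set \<Rightarrow> 'k) set"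
  by unfold_locales (simp_all add: finite_splits finite_S compatible_sym)

definition S0 :: "'a set" where
  "S0 = S - {w}"

text \<open>The part without \<open>w\<close>; as there is only one, the union is a way to name
  it.\<close>

definition cl :: "'a set set \<Rightarrow> 'a set" where
  "cl \<sigma> = \<Union>{P \<in> \<sigma>. w \<notin> P}"

lemma w_in_S: "w \<in> S"
  using w W_subset by blast

lemma splits_iff: "\<sigma> \<in> splits S W \<longleftrightarrow>
  (\<exists>A. \<sigma> = {A, S - A} \<and> A \<subseteq> S0 \<and> 2 \<le> card A \<and> 2 \<le> card (S - A) \<and> A \<inter> W \<noteq> {})"
proof
  assume "\<sigma> \<in> splits S W"
  then obtain A where A: "\<sigma> = {A, S - A}" "A \<subseteq> S" "2 \<le> card A" "2 \<le> card (S - A)"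
    "A \<inter> W \<noteq> {}" "(S - A) \<inter> W \<noteq> {}"
    by (elim splitsE) blast
  show "\<exists>A. \<sigma> = {A, S - A} \<and> A \<subseteq> S0 \<and> 2 \<le> card A \<and> 2 \<le> card (S - A) \<and> A \<inter> W \<noteq> {}"
  proof (cases "w \<in> A")
    case True
    then show ?thesis
      using A by (intro exI[of _ "S - A"]) (auto simp: S0_def double_diff)
  next
    case False
    then show ?thesis
      using A by (intro exI[of _ A]) (auto simp: S0_def)
  qed
next
  assume "\<exists>A. \<sigma> = {A, S - A} \<and> A \<subseteq> S0 \<and> 2 \<le> card A \<and> 2 \<le> card (S - A) \<and> A \<inter> W \<noteq> {}"
  then obtain A where A: "\<sigma> = {A, S - A}" "A \<subseteq> S0" "2 \<le> card A" "2 \<le> card (S - A)" "A \<inter> W \<noteq> {}"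
    by blast
  moreover have "w \<in> (S - A) \<inter> W" "A \<subseteq> S"
    using A w w_in_S by (auto simp: S0_def)
  ultimately show "\<sigma> \<in> splits S W"
    unfolding splits_def mem_Collect_eq stable_two_partition_iff by blast
qed

lemma cl_pair: "A \<subseteq> S0 \<Longrightarrow> cl {A, S - A} = A"
  using w_in_S by (auto simp: cl_def S0_def)

lemma split_eq:
  assumes "\<sigma> \<in> splits S W"
  shows "\<sigma> = {cl \<sigma>, S - cl \<sigma>}"
  using assms unfolding splits_iff by (auto simp: cl_pair)

lemma cl_props:
  assumes "\<sigma> \<in> splits S W"
  shows "cl \<sigma> \<subseteq> S0" "2 \<le> card (cl \<sigma>)" "2 \<le> card (S - cl \<sigma>)" "cl \<sigma> \<inter> W \<noteq> {}" "w \<notin> cl \<sigma>" "cl \<sigma> \<noteq> S0"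
    "cl \<sigma> \<subset> S0"
proof -
  from assms show *: "cl \<sigma> \<subseteq> S0" "2 \<le> card (cl \<sigma>)" "2 \<le> card (S - cl \<sigma>)" "cl \<sigma> \<inter> W \<noteq> {}"
    unfolding splits_iff by (auto simp: cl_pair)
  then show "w \<notin> cl \<sigma>" by (auto simp: S0_def)
  show "cl \<sigma> \<noteq> S0"
  proof
    assume "cl \<sigma> = S0"
    then have "S - cl \<sigma> = {w}" using w_in_S by (auto simp: S0_def)
    then show False using *(3) by simp
  qed
  then show "cl \<sigma> \<subset> S0" using * by blast
qed

lemma cl_inj: "\<sigma> \<in> splits S W \<Longrightarrow> \<tau> \<in> splits S W \<Longrightarrow> cl \<sigma> = cl \<tau> \<Longrightarrow> \<sigma> = \<tau>"
  using split_eq by metis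

text \<open>The complements of both clusters contain \<open>w\<close>, so that only three of the
  four intersections can be empty; these cases are nesting in either direction and
  disjointness.\<close>

lemma compatible_cl:
  assumes "\<sigma> \<in> splits S W" "\<tau> \<in> splits S W"
  shows "compatible \<sigma> \<tau> \<longleftrightarrow> cl \<sigma> \<subseteq> cl \<tau> \<or> cl \<tau> \<subseteq> cl \<sigma> \<or> cl \<sigma> \<inter> cl \<tau> = {}"
proof -
  have "compatible \<sigma> \<tau> \<longleftrightarrow> compatible {cl \<sigma>, S - cl \<sigma>} {cl \<tau>, S - cl \<tau>}"
    by (simp only: split_eq[OF assms(1), symmetric] split_eq[OF assms(2), symmetric])
  then have "compatible \<sigma> \<tau> \<longleftrightarrow> cl \<sigma> \<inter> cl \<tau> = {} \<or> cl \<sigma> \<inter> (S - cl \<tau>) = {} \<or>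
      (S - cl \<sigma>) \<inter> cl \<tau> = {} \<or> (S - cl \<sigma>) \<inter> (S - cl \<tau>) = {}"
    by (simp add: compatible_def)
  then show ?thesis
    using cl_props(1,5)[OF assms(1)] cl_props(1,5)[OF assms(2)] w_in_S unfolding S0_def by blast
qed

definition fp :: "'a \<Rightarrow> 'a \<Rightarrow> 'a set set \<Rightarrow> 'k" where
  "fp x y \<sigma> = (if x \<in> cl \<sigma> \<and> y \<in> cl \<sigma> then 1 else 0)"

lemma fp_sym: "fp x y = fp y x"
  by (auto simp: fp_def)

lemma fp_w: "\<sigma> \<in> splits S W \<Longrightarrow> fp w y \<sigma> = 0" "\<sigma> \<in> splits S W \<Longrightarrow> fp x w \<sigma> = 0"
  using cl_props by (auto simp: fp_def)

lemma separates_cl: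
  assumes "\<sigma> \<in> splits S W" "{i, j, k, l} \<subseteq> S"
  shows "separates {i, j} \<sigma> {k, l} \<longleftrightarrow>
    i \<in> cl \<sigma> \<and> j \<in> cl \<sigma> \<and> k \<notin> cl \<sigma> \<and> l \<notin> cl \<sigma> \<or> i \<notin> cl \<sigma> \<and> j \<notin> cl \<sigma> \<and> k \<in> cl \<sigma> \<and> l \<in> cl \<sigma>"
proof -
  have "separates {i, j} {cl \<sigma>, S - cl \<sigma>} {k, l} \<longleftrightarrow>
    {i, j} \<subseteq> cl \<sigma> \<and> {k, l} \<subseteq> S - cl \<sigma> \<or> {i, j} \<subseteq> S - cl \<sigma> \<and> {k, l} \<subseteq> cl \<sigma>"
    using cl_props[OF assms(1)] by (intro separates_pair) (auto simp: S0_def)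
  then show ?thesis
    using split_eq[OF assms(1)] assms(2) by auto
qed

text \<open>Only which labels lie in the cluster matters. The right side cancels unless these are
  exactly one of the four listed pairs.\<close>

lemma quad_form_fp:
  assumes "\<sigma> \<in> splits S W" "{i, j, k, l} \<subseteq> S"
  shows "(quad_form i j k l \<sigma> :: 'k) = fp i j \<sigma> + fp k l \<sigma> - fp k j \<sigma> - fp i l \<sigma>"
proof -
  have "separates {i, j} \<sigma> {k, l} \<longleftrightarrow>
    i \<in> cl \<sigma> \<and> j \<in> cl \<sigma> \<and> k \<notin> cl \<sigma> \<and> l \<notin> cl \<sigma> \<or> i \<notin> cl \<sigma> \<and> j \<notin> cl \<sigma> \<and> k \<in> cl \<sigma> \<and> l \<in> cl \<sigma>"
    by (rule separates_cl[OF assms])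
  moreover have "separates {k, j} \<sigma> {i, l} \<longleftrightarrow>
    k \<in> cl \<sigma> \<and> j \<in> cl \<sigma> \<and> i \<notin> cl \<sigma> \<and> l \<notin> cl \<sigma> \<or> k \<notin> cl \<sigma> \<and> j \<notin> cl \<sigma> \<and> i \<in> cl \<sigma> \<and> l \<in> cl \<sigma>"
    using assms by (intro separates_cl) auto
  ultimately show ?thesis
    unfolding quad_form_def fp_def
    by (cases "i \<in> cl \<sigma>"; cases "j \<in> cl \<sigma>"; cases "k \<in> cl \<sigma>"; cases "l \<in> cl \<sigma>") simp_all
qed

lemma quad_form_in_G: "allowed S W i j k l \<Longrightarrow> quad_form i j k l \<in> quad_forms S W"
  by (auto simp: quad_forms_def)

text \<open>As \<open>w\<close> lies in no cluster, placing it third leaves two terms; the opposite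
  labels \<open>x\<close> and \<open>w\<close> are white. This moves one end of a pair while its
  white end stays.\<close>

lemma quad_form_star:
  assumes "x \<in> W" "{x, y, z} \<subseteq> S0" "distinct [x, y, z]"
  shows "allowed S W x y w z" "\<sigma> \<in> splits S W \<Longrightarrow> (quad_form x y w z \<sigma> :: 'k) = fp x y \<sigma> - fp x z \<sigma>"
proof -
  show "allowed S W x y w z"
    using assms w w_in_S by (auto simp: allowed_iff S0_def)
  show "(quad_form x y w z \<sigma> :: 'k) = fp x y \<sigma> - fp x z \<sigma>" if "\<sigma> \<in> splits S W"
    using assms w_in_S by (subst quad_form_fp[OF that]) (auto simp: fp_w that S0_def)
qed

text \<open>Here \<open>w\<close> comes last and the opposite white labels are \<open>x\<close> and
  \<open>z\<close>: the white end of the pair moves.\<close>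

lemma quad_form_slide:
  assumes "x \<in> W" "z \<in> W" "{x, y, z} \<subseteq> S0" "distinct [x, y, z]"
  shows "allowed S W x y z w" "\<sigma> \<in> splits S W \<Longrightarrow> (quad_form x y z w \<sigma> :: 'k) = fp x y \<sigma> - fp z y \<sigma>"
proof -
  show "allowed S W x y z w"
    using assms w w_in_S by (auto simp: allowed_iff S0_def)
  show "(quad_form x y z w \<sigma> :: 'k) = fp x y \<sigma> - fp z y \<sigma>" if "\<sigma> \<in> splits S W"
    using assms w_in_S by (subst quad_form_fp[OF that]) (auto simp: fp_w that S0_def)
qed

definition white_pair :: "'a \<Rightarrow> 'a \<Rightarrow> bool" where
  "white_pair x y \<longleftrightarrow> {x, y} \<subseteq> S0 \<and> x \<noteq> y \<and> (x \<in> W \<or> y \<in> W)"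

lemma fp_diff_star_in_L:
  assumes "x \<in> W" "{x, y, z} \<subseteq> S0" "x \<noteq> y" "x \<noteq> z"
  shows "(\<lambda>\<sigma>. fp x y \<sigma> - fp x z \<sigma>) \<in> L"
proof (cases "y = z")
  case True
  then show ?thesis by (simp add: L_zero)
next
  case False
  then have *: "x \<in> W" "{x, y, z} \<subseteq> S0" "distinct [x, y, z]"
    using assms by auto
  show ?thesis
    by (rule L_cong[OF L_base[OF quad_form_in_G[OF quad_form_star(1)[OF *]]]])
      (rule quad_form_star(2)[OF *])
qed

text \<open>If the white ends differ, two star moves pass through the pair formed by both white
  ends.\<close>

lemma fp_diff_in_L:
  assumes "white_pair x y" "white_pair x' y'"
  shows "(\<lambda>\<sigma>. fp x y \<sigma> - fp x' y' \<sigma>) \<in> L"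
proof -
  have *: "(\<lambda>\<sigma>. fp x y \<sigma> - fp x' y' \<sigma>) \<in> L"
    if "x \<in> W" "x' \<in> W" "{x, y} \<subseteq> S0" "{x', y'} \<subseteq> S0" "x \<noteq> y" "x' \<noteq> y'" for x y x' y'
  proof (cases "x = x'")
    case True
    then show ?thesis
      using fp_diff_star_in_L that by auto
  next
    case False
    have "(\<lambda>\<sigma>. fp x y \<sigma> - fp x x' \<sigma>) \<in> L" "(\<lambda>\<sigma>. fp x' x \<sigma> - fp x' y' \<sigma>) \<in> L"
      using fp_diff_star_in_L[of x y x'] fp_diff_star_in_L[of x' x y'] that False by auto
    from L_add[OF this] show ?thesis
      by (simp add: fp_sym[of x' x])
  qed
  show ?thesis
    using assms *[of x x' y y'] *[of x y' y x'] *[of y x' x y'] *[of y y' x x']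
    unfolding white_pair_def fp_sym[of y x] fp_sym[of y' x'] by auto
qed

section \<open>The laminar family of a face and its dual forms\<close>

context
  fixes F assumes F: "face F"
begin

text \<open>\<open>S0\<close>, the cluster of the future root vertex, comes from no 2-partition;
  adding it gives every other cluster a next larger one.\<close>

definition clusters :: "'a set set" where
  "clusters = insert S0 (cl ` F)"

lemma F_splits: "\<sigma> \<in> F \<Longrightarrow> \<sigma> \<in> splits S W"
  using F by (auto simp: face_def)

lemma clusters_subset: "A \<in> clusters \<Longrightarrow> A \<subseteq> S0"
  using cl_props(1) F_splits by (auto simp: clusters_def)

lemma S0_cluster: "S0 \<in> clusters"
  by (simp add: clusters_def)

lemma finite_clusters: "finite clusters"
  using finite_face[OF F] by (simp add: clusters_def)

lemma laminar: "A \<in> clusters \<Longrightarrow> B \<in> clusters \<Longrightarrow> A \<subseteq> B \<or> B \<subseteq> A \<or> A \<inter> B = {}"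
proof -
  assume AB: "A \<in> clusters" "B \<in> clusters"
  show ?thesis
  proof (cases "A = S0 \<or> B = S0")
    case True
    then show ?thesis using clusters_subset AB by blast
  next
    case False
    then obtain \<sigma> \<tau> where \<sigma>\<tau>: "\<sigma> \<in> F" "\<tau> \<in> F" "A = cl \<sigma>" "B = cl \<tau>"
      using AB by (auto simp: clusters_def)
    then have "compatible \<sigma> \<tau>"
      using F compatible_refl[OF F_splits[OF \<sigma>\<tau>(1)]] by (cases "\<sigma> = \<tau>") (auto simp: face_def)
    then show ?thesis
      using \<sigma>\<tau> compatible_cl F_splits by simp
  qed
qed

lemma card_S0: "card S0 \<ge> 2" "S0 \<inter> W \<noteq> {}"
proof -
  show "card S0 \<ge> 2"
    using card_S finite_S w_in_S by (simp add: S0_def)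
  have "card (W - {w}) \<ge> 1"
    using card_W finite_subset[OF W_subset finite_S] w by simp
  then have "W - {w} \<noteq> {}"
    by (metis card.empty not_one_le_zero)
  then show "S0 \<inter> W \<noteq> {}"
    using W_subset by (auto simp: S0_def)
qed

lemma cluster_props: "A \<in> clusters \<Longrightarrow> card A \<ge> 2 \<and> A \<inter> W \<noteq> {}"
  using card_S0 cl_props F_splits by (auto simp: clusters_def)

text \<open>Clusters sharing the label \<open>x\<close> form a chain, so a minimal one with property
  \<open>Q\<close> is least.\<close>

lemma least_cluster:
  assumes "Q S0" "\<And>B. B \<in> clusters \<Longrightarrow> Q B \<Longrightarrow> x \<in> B"
  shows "\<exists>A\<in>clusters. Q A \<and> (\<forall>B\<in>clusters. Q B \<longrightarrow> A \<subseteq> B)"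
proof -
  let ?D = "{A \<in> clusters. Q A}"
  have "finite ?D" "?D \<noteq> {}"
    using finite_clusters S0_cluster assms(1) by auto
  then obtain A where A: "A \<in> ?D" "\<And>B. B \<in> ?D \<Longrightarrow> \<not> B \<subset> A"
    using finite_has_minimal[of ?D] by blast
  have "A \<subseteq> B" if "B \<in> clusters" "Q B" for B
    using laminar[of A B] A that assms(2)[of A] assms(2)[of B] by blast
  then show ?thesis using A(1) by blast
qed

text \<open>The clusters properly inside \<open>A\<close> that contain a fixed white element of
  \<open>A\<close> form a chain. The second element is taken outside the largest of them, or
  arbitrarily if there are none.\<close>

lemma generating_pair:
  assumes "A \<in> clusters"
  shows "\<exists>x y. x \<in> W \<and> x \<in> A \<and> y \<in> A \<and> x \<noteq> y \<and> (\<forall>B\<in>clusters. x \<in> B \<and> y \<in> B \<longrightarrow> A \<subseteq> B)"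
proof -
  obtain x where x: "x \<in> A" "x \<in> W"
    using cluster_props[OF assms] by blast
  let ?D = "{B \<in> clusters. x \<in> B \<and> B \<subset> A}"
  have "\<exists>y\<in>A. y \<noteq> x \<and> (\<forall>B\<in>?D. y \<notin> B)"
  proof (cases "?D = {}")
    case True
    have "A \<noteq> {x}" using cluster_props[OF assms] by auto
    then obtain y where "y \<in> A" "y \<noteq> x" using x(1) by blast
    then show ?thesis unfolding True by blast
  next
    case False
    have "finite ?D" using finite_clusters by simp
    from finite_has_maximal[OF this False] obtain D
      where D: "D \<in> ?D" "\<forall>B\<in>?D. D \<subseteq> B \<longrightarrow> D = B"
      by (rule bexE)
    from D(1) obtain y where y: "y \<in> A" "y \<notin> D" by auto
    have "y \<notin> B" if B: "B \<in> ?D" for B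
    proof -
      have "B \<subseteq> D \<or> D \<subseteq> B"
        using laminar[of B D] D(1) B by auto
      then show ?thesis
        using bspec[OF D(2) B] y(2) by auto
    qed
    moreover have "x \<in> D" using D(1) by simp
    ultimately show ?thesis using y by metis
  qed
  then obtain y where y: "y \<in> A" "y \<noteq> x" "\<forall>B\<in>?D. y \<notin> B"
    by (elim bexE conjE)
  have "A \<subseteq> B" if B: "B \<in> clusters" "x \<in> B" "y \<in> B" for B
  proof -
    have "A \<subseteq> B \<or> B \<subset> A"
      using laminar[OF B(1) assms] B(2) x(1) by auto
    moreover have "\<not> B \<subset> A"
      using y(3) B by auto
    ultimately show ?thesis by blast
  qed
  then show ?thesis using x y(1,2) by metis
qed

lemma rho_fp_star:
  assumes "x \<in> W" "{x, y, z} \<subseteq> S0" "x \<noteq> y" "x \<noteq> z"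
    "\<And>\<sigma>. \<sigma> \<in> F \<Longrightarrow> x \<in> cl \<sigma> \<and> y \<in> cl \<sigma> \<longleftrightarrow> x \<in> cl \<sigma> \<and> z \<in> cl \<sigma>"
  shows "rho F (fp x y) - rho F (fp x z) \<in> J"
proof (cases "y = z")
  case True
  then show ?thesis by (simp add: ksub_zero[OF ksub_J])
next
  case False
  then have *: "x \<in> W" "{x, y, z} \<subseteq> S0" "distinct [x, y, z]"
    using assms by auto
  have "rho F (quad_form x y w z) \<in> J"
  proof (rule rho_in_J[OF F quad_form_in_G[OF quad_form_star(1)[OF *]]])
    fix \<sigma> assume "\<sigma> \<in> F"
    then show "quad_form x y w z \<sigma> = (0 :: 'k)"
      using quad_form_star(2)[OF * F_splits] assms(5) by (simp add: fp_def)
  qed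
  also have "rho F (quad_form x y w z) = rho F (\<lambda>\<sigma>. fp x y \<sigma> - fp x z \<sigma>)"
    by (rule rho_cong_V) (rule quad_form_star(2)[OF *])
  finally show ?thesis by (simp add: rho_diff)
qed

lemma rho_fp_slide:
  assumes "x \<in> W" "z \<in> W" "{x, y, z} \<subseteq> S0" "distinct [x, y, z]"
    "\<And>\<sigma>. \<sigma> \<in> F \<Longrightarrow> x \<in> cl \<sigma> \<and> y \<in> cl \<sigma> \<longleftrightarrow> z \<in> cl \<sigma> \<and> y \<in> cl \<sigma>"
  shows "rho F (fp x y) - rho F (fp z y) \<in> J"
proof -
  note * = assms(1-4)
  have "rho F (quad_form x y z w) \<in> J"
  proof (rule rho_in_J[OF F quad_form_in_G[OF quad_form_slide(1)[OF *]]])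
    fix \<sigma> assume "\<sigma> \<in> F"
    then show "quad_form x y z w \<sigma> = (0 :: 'k)"
      using quad_form_slide(2)[OF * F_splits] assms(5) by (simp add: fp_def)
  qed
  also have "rho F (quad_form x y z w) = rho F (\<lambda>\<sigma>. fp x y \<sigma> - fp z y \<sigma>)"
    by (rule rho_cong_V) (rule quad_form_slide(2)[OF *])
  finally show ?thesis by (simp add: rho_diff)
qed

text \<open>Two white pairs with the same smallest cluster are joined by at most two relations, passing
  through a pair formed from both of them.\<close>

lemma rho_fp_eq:
  assumes "white_pair x y" "white_pair x' y'"
    "\<And>\<sigma>. \<sigma> \<in> F \<Longrightarrow> x \<in> cl \<sigma> \<and> y \<in> cl \<sigma> \<longleftrightarrow> x' \<in> cl \<sigma> \<and> y' \<in> cl \<sigma>"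
  shows "rho F (fp x y) - rho F (fp x' y') \<in> J"
proof -
  have *: "rho F (fp x y) - rho F (fp x' y') \<in> J"
    if xy: "x \<in> W" "x' \<in> W" "{x, y} \<subseteq> S0" "{x', y'} \<subseteq> S0" "x \<noteq> y" "x' \<noteq> y'"
      and eq: "\<And>\<sigma>. \<sigma> \<in> F \<Longrightarrow> x \<in> cl \<sigma> \<and> y \<in> cl \<sigma> \<longleftrightarrow> x' \<in> cl \<sigma> \<and> y' \<in> cl \<sigma>" for x y x' y'
  proof (cases "x = x'")
    case True
    then show ?thesis
      using rho_fp_star[of x y y'] that by auto
  next
    case neq: False
    show ?thesis
    \<comment> \<open>If every cluster containing both white ends also contains \<open>y\<close>,
      the white ends form a pair with the same clusters as the two given pairs, and it serves as the
      intermediate one.\<close>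
    proof (cases "\<forall>\<sigma>\<in>F. x \<in> cl \<sigma> \<and> x' \<in> cl \<sigma> \<longrightarrow> y \<in> cl \<sigma>")
      case True
      then have eq': "x \<in> cl \<sigma> \<and> x' \<in> cl \<sigma> \<longleftrightarrow> x \<in> cl \<sigma> \<and> y \<in> cl \<sigma>" if "\<sigma> \<in> F" for \<sigma>
        using eq that by blast
      have "rho F (fp x y) - rho F (fp x x') \<in> J"
        by (rule rho_fp_star) (use xy neq eq' in auto)
      moreover have "rho F (fp x' x) - rho F (fp x' y') \<in> J"
        by (rule rho_fp_star) (use xy neq eq eq' in auto)
      ultimately show ?thesis
        using ksub_trans[OF ksub_J] fp_sym[of x x'] by metis
    next
      case False
      then obtain \<sigma> where \<sigma>: "\<sigma> \<in> F" "x \<in> cl \<sigma>" "x' \<in> cl \<sigma>" "y \<notin> cl \<sigma>" by blast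
      then have y': "y' \<notin> cl \<sigma>" using eq by blast
      \<comment> \<open>A cluster containing \<open>y'\<close> and one of \<open>x\<close>,
        \<open>x'\<close> meets \<open>cl \<sigma>\<close> without lying inside it. By laminarity it
        contains \<open>cl \<sigma>\<close> and with it both white ends, so \<open>x\<close>,
        \<open>y'\<close> can be the intermediate pair.\<close>
      have eq': "x \<in> cl \<tau> \<and> y' \<in> cl \<tau> \<longleftrightarrow> x' \<in> cl \<tau> \<and> y' \<in> cl \<tau>" if "\<tau> \<in> F" for \<tau>
        using laminar[of "cl \<sigma>" "cl \<tau>"] \<sigma> y' that by (auto simp: clusters_def)
      have ne: "x \<noteq> y'" using \<sigma> y' by blast
      have "rho F (fp x y) - rho F (fp x y') \<in> J"
        by (rule rho_fp_star) (use xy ne eq eq' in auto)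
      moreover have "rho F (fp x y') - rho F (fp x' y') \<in> J"
        by (rule rho_fp_slide) (use xy neq ne eq' in auto)
      ultimately show ?thesis
        using ksub_trans[OF ksub_J] by blast
    qed
  qed
  show ?thesis
    using assms *[of x x' y y'] *[of x y' y x'] *[of y x' x y'] *[of y y' x x']
    unfolding white_pair_def fp_sym[of y x] fp_sym[of y' x'] by auto
qed

text \<open>The form \<open>h A\<close> of a generating pair has value 1 at \<tau> in
  \<open>F\<close> exactly if \<open>A\<close> lies in \<open>cl \<tau>\<close>. Subtracting the
  form of the next larger cluster leaves only the \<tau> with cluster \<open>A\<close>. For the
  second clause, the form of a white pair minus its interpolation has \<open>rho\<close> congruent
  to \<open>rho F (h S0)\<close>, whatever the pair, so that the terms of a quadruple form
  cancel.\<close>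

lemma dual_forms_exist:
  "\<exists>\<Theta>. (\<forall>\<sigma>\<in>F. \<Theta> \<sigma> \<in> L \<and> (\<forall>\<tau>\<in>F. \<Theta> \<sigma> \<tau> = (if \<tau> = \<sigma> then 1 else 0))) \<and>
      (\<forall>g\<in>quad_forms S W. rho F (\<lambda>\<tau>. g \<tau> - (\<Sum>\<sigma>\<in>F. g \<sigma> * \<Theta> \<sigma> \<tau>)) \<in> (J :: ('a set set set \<Rightarrow>\<^sub>0 'k) set))"
proof -
  have "\<forall>A. \<exists>x y. A \<in> clusters \<longrightarrow> x \<in> W \<and> x \<in> A \<and> y \<in> A \<and> x \<noteq> y \<and> (\<forall>B\<in>clusters. x \<in> B \<and> y \<in> B \<longrightarrow> A \<subseteq> B)"
    using generating_pair by blast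
  then obtain px py where p: "\<And>A. A \<in> clusters \<Longrightarrow> px A \<in> W \<and> px A \<in> A \<and> py A \<in> A \<and> px A \<noteq> py A \<and>
      (\<forall>B\<in>clusters. px A \<in> B \<and> py A \<in> B \<longrightarrow> A \<subseteq> B)"
    by metis
  have "\<exists>B\<in>clusters. cl \<sigma> \<subset> B \<and> (\<forall>C\<in>clusters. cl \<sigma> \<subset> C \<longrightarrow> B \<subseteq> C)" if \<sigma>: "\<sigma> \<in> F" for \<sigma>
  proof -
    obtain x where "x \<in> cl \<sigma>"
      using cl_props(4)[OF F_splits[OF \<sigma>]] by blast
    then show ?thesis
      using cl_props(7)[OF F_splits[OF \<sigma>]] by (intro least_cluster) auto
  qed
  then obtain par where par: "\<And>\<sigma>. \<sigma> \<in> F \<Longrightarrow> par \<sigma> \<in> clusters \<and> cl \<sigma> \<subset> par \<sigma> \<and>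
      (\<forall>C\<in>clusters. cl \<sigma> \<subset> C \<longrightarrow> par \<sigma> \<subseteq> C)"
    by metis
  define h where "h A = fp (px A) (py A)" for A
  define \<Theta> where "\<Theta> \<sigma> = (\<lambda>\<tau>. h (cl \<sigma>) \<tau> - h (par \<sigma>) \<tau>)" for \<sigma>
  have cl_in: "cl \<sigma> \<in> clusters" if "\<sigma> \<in> F" for \<sigma>
    using that by (simp add: clusters_def)
  have p_iff: "px A \<in> B \<and> py A \<in> B \<longleftrightarrow> A \<subseteq> B" if "A \<in> clusters" "B \<in> clusters" for A B
    using p[OF that(1)] that(2) by blast
  have wp: "white_pair (px A) (py A)" if "A \<in> clusters" for A
    using p[OF that] clusters_subset[OF that] by (auto simp: white_pair_def)
  have h_F: "h A \<tau> = (if A \<subseteq> cl \<tau> then 1 else 0)" if "A \<in> clusters" "\<tau> \<in> F" for A \<tau>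
    using p_iff[OF that(1) cl_in[OF that(2)]] by (simp add: h_def fp_def)
  have \<Theta>1: "\<Theta> \<sigma> \<in> L \<and> (\<forall>\<tau>\<in>F. \<Theta> \<sigma> \<tau> = (if \<tau> = \<sigma> then 1 else 0))" if \<sigma>: "\<sigma> \<in> F" for \<sigma>
  proof (intro conjI ballI)
    show "\<Theta> \<sigma> \<in> L"
      unfolding \<Theta>_def h_def using wp cl_in[OF \<sigma>] par[OF \<sigma>] by (intro fp_diff_in_L) auto
    fix \<tau> assume \<tau>: "\<tau> \<in> F"
    have "par \<sigma> \<subseteq> cl \<tau> \<longleftrightarrow> cl \<sigma> \<subset> cl \<tau>"
      using par[OF \<sigma>] cl_in[OF \<tau>] by blast
    moreover have "cl \<sigma> = cl \<tau> \<longleftrightarrow> \<tau> = \<sigma>"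
      using cl_inj F_splits \<sigma> \<tau> by metis
    ultimately show "\<Theta> \<sigma> \<tau> = (if \<tau> = \<sigma> then 1 else 0)"
      using h_F \<tau> cl_in[OF \<sigma>] par[OF \<sigma>] by (auto simp: \<Theta>_def)
  qed
  \<comment> \<open>The clusters containing \<open>A\<close> form a chain in which
    \<open>par\<close> is the step to the next member, so the differences collapse.\<close>
  have telescope: "(\<Sum>\<sigma>\<in>{\<sigma>\<in>F. A \<subseteq> cl \<sigma>}. \<Theta> \<sigma> \<tau>) = h A \<tau> - h S0 \<tau>" if "A \<in> clusters" for A \<tau>
    using that
  proof (induction "card (S0 - A)" arbitrary: A rule: less_induct)
    case less
    show ?case
    proof (cases "A = S0")
      case True
      then have "{\<sigma>\<in>F. A \<subseteq> cl \<sigma>} = {}"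
        using cl_props(7) F_splits by blast
      then show ?thesis using True by (simp only: sum.empty) simp
    next
      case False
      then obtain \<sigma> where \<sigma>: "\<sigma> \<in> F" "A = cl \<sigma>"
        using less.prems by (auto simp: clusters_def)
      have "{\<sigma>\<in>F. A \<subseteq> cl \<sigma>} = insert \<sigma> {\<tau>\<in>F. par \<sigma> \<subseteq> cl \<tau>}"
      proof (intro equalityI subsetI)
        fix \<tau> assume "\<tau> \<in> {\<sigma>\<in>F. A \<subseteq> cl \<sigma>}"
        then show "\<tau> \<in> insert \<sigma> {\<tau>\<in>F. par \<sigma> \<subseteq> cl \<tau>}"
          using par[OF \<sigma>(1)] \<sigma> cl_in cl_inj F_splits by (metis (mono_tags, lifting) insertCI mem_Collect_eq psubsetI)
      next
        fix \<tau> assume "\<tau> \<in> insert \<sigma> {\<tau>\<in>F. par \<sigma> \<subseteq> cl \<tau>}"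
        then show "\<tau> \<in> {\<sigma>\<in>F. A \<subseteq> cl \<sigma>}"
          using par[OF \<sigma>(1)] \<sigma> by auto
      qed
      moreover have "\<sigma> \<notin> {\<tau>\<in>F. par \<sigma> \<subseteq> cl \<tau>}"
        using par[OF \<sigma>(1)] by auto
      ultimately have "(\<Sum>\<sigma>\<in>{\<sigma>\<in>F. A \<subseteq> cl \<sigma>}. \<Theta> \<sigma> \<tau>) = \<Theta> \<sigma> \<tau> + (\<Sum>\<sigma>\<in>{\<tau>\<in>F. par \<sigma> \<subseteq> cl \<tau>}. \<Theta> \<sigma> \<tau>)"
        using finite_face[OF F] by simp
      also have "(\<Sum>\<sigma>\<in>{\<tau>\<in>F. par \<sigma> \<subseteq> cl \<tau>}. \<Theta> \<sigma> \<tau>) = h (par \<sigma>) \<tau> - h S0 \<tau>"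
      proof (rule less.hyps)
        have "S0 - par \<sigma> \<subset> S0 - A"
          using par[OF \<sigma>(1)] \<sigma> clusters_subset by blast
        then show "card (S0 - par \<sigma>) < card (S0 - A)"
          using finite_S by (intro psubset_card_mono) (auto simp: S0_def)
      qed (use par \<sigma> in auto)
      finally show ?thesis
        using \<sigma> by (simp add: \<Theta>_def)
    qed
  qed
  define u where "u x y = rho F (\<lambda>\<tau>. fp x y \<tau> - (\<Sum>\<sigma>\<in>F. fp x y \<sigma> * \<Theta> \<sigma> \<tau>))" for x y
  \<comment> \<open>The least cluster containing the pair takes its place: \<open>rho_fp_eq\<close>
    compares the pair with the generating pair of that cluster, and telescoping leaves
    \<open>h S0\<close>.\<close>
  have u_white: "u x y - rho F (h S0) \<in> J" if xy: "white_pair x y" for x y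
  proof -
    have "\<exists>A\<in>clusters. {x, y} \<subseteq> A \<and> (\<forall>B\<in>clusters. {x, y} \<subseteq> B \<longrightarrow> A \<subseteq> B)"
      using xy by (intro least_cluster[of "\<lambda>A. {x, y} \<subseteq> A" x]) (auto simp: white_pair_def)
    then obtain A where A: "A \<in> clusters" "{x, y} \<subseteq> A" "\<forall>B\<in>clusters. {x, y} \<subseteq> B \<longrightarrow> A \<subseteq> B"
      by (elim bexE conjE)
    have iff: "x \<in> cl \<sigma> \<and> y \<in> cl \<sigma> \<longleftrightarrow> A \<subseteq> cl \<sigma>" if "\<sigma> \<in> F" for \<sigma>
      using A cl_in[OF that] by blast
    have "(\<Sum>\<sigma>\<in>F. fp x y \<sigma> * \<Theta> \<sigma> \<tau>) = h A \<tau> - h S0 \<tau>" for \<tau>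
    proof -
      have "(\<Sum>\<sigma>\<in>F. fp x y \<sigma> * \<Theta> \<sigma> \<tau>) = (\<Sum>\<sigma>\<in>F. if A \<subseteq> cl \<sigma> then \<Theta> \<sigma> \<tau> else 0)"
        using iff by (intro sum.cong) (auto simp: fp_def)
      also have "\<dots> = (\<Sum>\<sigma>\<in>{\<sigma>\<in>F. A \<subseteq> cl \<sigma>}. \<Theta> \<sigma> \<tau>)"
        using finite_face[OF F] by (simp add: sum.inter_filter)
      finally show ?thesis using telescope[OF A(1)] by simp
    qed
    then have "u x y = rho F (fp x y) - (rho F (h A) - rho F (h S0))"
      by (simp add: u_def rho_diff)
    then have "u x y - rho F (h S0) = rho F (fp x y) - rho F (h A)"
      by (simp only: diff_diff_eq2 add_diff_eq) simp
    moreover have "rho F (fp x y) - rho F (h A) \<in> J"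
      unfolding h_def using iff p_iff[OF A(1)] cl_in by (intro rho_fp_eq xy wp A(1)) simp
    ultimately show ?thesis by simp
  qed
  have u_w: "u w y = 0" "u x w = 0" for x y
  proof -
    have "(\<Sum>\<sigma>\<in>F. fp w y \<sigma> * \<Theta> \<sigma> \<tau>) = 0" "(\<Sum>\<sigma>\<in>F. fp x w \<sigma> * \<Theta> \<sigma> \<tau>) = 0" for \<tau>
      using fp_w F_splits by simp_all
    then have "u w y = rho F (fp w y)" "u x w = rho F (fp x w)"
      by (simp_all add: u_def)
    moreover have "rho F (fp w y) = rho F (\<lambda>_. 0)" "rho F (fp x w) = rho F (\<lambda>_. 0)"
      by (rule rho_cong_V, simp add: fp_w)+
    ultimately show "u w y = 0" "u x w = 0"
      by (simp_all add: rho_zero)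
  qed
  have "rho F (\<lambda>\<tau>. g \<tau> - (\<Sum>\<sigma>\<in>F. g \<sigma> * \<Theta> \<sigma> \<tau>)) \<in> J" if gG: "g \<in> quad_forms S W" for g
  proof -
    obtain i j k l where g: "g = quad_form i j k l" and al: "allowed S W i j k l"
      using gG by (auto simp: quad_forms_def)
    then have ijkl: "{i, j, k, l} \<subseteq> S" "distinct [i, j, k, l]" "i \<in> W \<and> k \<in> W \<or> j \<in> W \<and> l \<in> W"
      by (auto simp: allowed_iff)
    have gV: "g \<sigma> = fp i j \<sigma> + fp k l \<sigma> - fp k j \<sigma> - fp i l \<sigma>" if "\<sigma> \<in> splits S W" for \<sigma>
      unfolding g by (rule quad_form_fp[OF that ijkl(1)])
    have "(\<Sum>\<sigma>\<in>F. g \<sigma> * \<Theta> \<sigma> \<tau>) = (\<Sum>\<sigma>\<in>F. fp i j \<sigma> * \<Theta> \<sigma> \<tau>) + (\<Sum>\<sigma>\<in>F. fp k l \<sigma> * \<Theta> \<sigma> \<tau>)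
        - (\<Sum>\<sigma>\<in>F. fp k j \<sigma> * \<Theta> \<sigma> \<tau>) - (\<Sum>\<sigma>\<in>F. fp i l \<sigma> * \<Theta> \<sigma> \<tau>)" for \<tau>
      unfolding sum.distrib[symmetric] sum_subtractf[symmetric]
      by (intro sum.cong) (simp_all add: gV F_splits algebra_simps)
    then have "rho F (\<lambda>\<tau>. g \<tau> - (\<Sum>\<sigma>\<in>F. g \<sigma> * \<Theta> \<sigma> \<tau>)) =
        rho F (\<lambda>\<tau>. (fp i j \<tau> - (\<Sum>\<sigma>\<in>F. fp i j \<sigma> * \<Theta> \<sigma> \<tau>)) + (fp k l \<tau> - (\<Sum>\<sigma>\<in>F. fp k l \<sigma> * \<Theta> \<sigma> \<tau>))
          - (fp k j \<tau> - (\<Sum>\<sigma>\<in>F. fp k j \<sigma> * \<Theta> \<sigma> \<tau>)) - (fp i l \<tau> - (\<Sum>\<sigma>\<in>F. fp i l \<sigma> * \<Theta> \<sigma> \<tau>)))"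
      by (intro rho_cong_V) (simp add: gV algebra_simps)
    also have "\<dots> = u i j + u k l - u k j - u i l"
      unfolding u_def rho_diff rho_add by simp
    also have "\<dots> = (u i j - u k j) - (u i l - u k l)" by simp
    also have "\<dots> \<in> J"
    proof -
      have d: "u x y - u x' y' \<in> J" if "white_pair x y" "white_pair x' y'" for x y x' y'
        using ksub_trans[OF ksub_J u_white[OF that(1)] ksub_sym[OF ksub_J u_white[OF that(2)]]] .
      \<comment> \<open>Such a pair takes one label from each diagonal of the quadruple, and one of
        the diagonals is white.\<close>
      have wp: "white_pair x y" if "x \<in> {i, k}" "y \<in> {j, l}" "x \<noteq> w" "y \<noteq> w" for x y
        using that ijkl by (auto simp: white_pair_def S0_def)
      \<comment> \<open>At most one label is \<open>w\<close>; the two terms containing it vanish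
        and the other two have opposite signs.\<close>
      consider "w \<notin> {i, j, k, l}" | "w = i" | "w = j" | "w = k" | "w = l" by blast
      then show ?thesis
      proof cases
        case 1
        then show ?thesis by (intro ksub_diff[OF ksub_J] d wp) auto
      next
        case 2
        then have "u k l - u k j \<in> J" using ijkl by (intro d wp) auto
        then show ?thesis unfolding 2[symmetric] by (simp add: u_w uminus_add_conv_diff)
      next
        case 3
        then have "u k l - u i l \<in> J" using ijkl by (intro d wp) auto
        then show ?thesis unfolding 3[symmetric] by (simp add: u_w)
      next
        case 4
        then have "u i j - u i l \<in> J" using ijkl by (intro d wp) auto
        then show ?thesis unfolding 4[symmetric] by (simp add: u_w)
      next
        case 5
        then have "u i j - u k j \<in> J" using ijkl by (intro d wp) auto
        then show ?thesis unfolding 5[symmetric] by (simp add: u_w)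
      qed
    qed
    finally show ?thesis .
  qed
  with \<Theta>1 show ?thesis by blast
qed

end

sublocale unimodular_complex "splits S W" compatible "quad_forms S W :: ('a set set \<Rightarrow> 'k) set"
  by unfold_locales (rule dual_forms_exist)

end

section \<open>Rooted trees\<close>

locale rooted_graph =
  fixes T :: "'b graph_scheme" and r :: nat
  assumes tree: "tree T" and root: "r \<in> verts T"
begin

abbreviation "iv \<equiv> invol T"
abbreviation "bd \<equiv> bnd T"

lemma graph: "graph T"
  using tree by (simp add: tree_def)

lemma finite_verts: "finite (verts T)" and finite_flags: "finite (flags T)"
  using graph by (simp_all add: graph_def)

lemma bd_verts: "f \<in> flags T \<Longrightarrow> bd f \<in> verts T"
  and iv_flags: "f \<in> flags T \<Longrightarrow> iv f \<in> flags T"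
  and iv_iv [simp]: "f \<in> flags T \<Longrightarrow> iv (iv f) = f"
  using graph by (simp_all add: graph_def)

definition half :: "nat \<Rightarrow> bool" where
  "half f \<longleftrightarrow> f \<in> flags T \<and> iv f \<noteq> f"

lemma half_iv: "half f \<Longrightarrow> half (iv f)"
  unfolding half_def using iv_flags iv_iv by metis

text \<open>The second condition forbids immediate backtracking.\<close>

definition follows :: "nat \<Rightarrow> nat \<Rightarrow> bool" where
  "follows f g \<longleftrightarrow> bd (iv f) = bd g \<and> g \<noteq> iv f"

text \<open>A closed walk without backtracking contains a circuit, namely a shortest closed subwalk.\<close>

lemma no_closed_walk:
  assumes "successively follows fs" "fs \<noteq> []" "\<forall>f\<in>set fs. half f" "bd (iv (last fs)) = bd (hd fs)"
  shows False
  using assms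
proof (induction "length fs" arbitrary: fs rule: less_induct)
  case less
  let ?n = "length fs"
  have succ: "bd (iv (fs ! i)) = bd (fs ! Suc i)" "fs ! Suc i \<noteq> iv (fs ! i)" if "Suc i < ?n" for i
    using less.prems(1) that by (auto simp: successively_conv_nth follows_def)
  have half: "half (fs ! i)" if "i < ?n" for i
    using less.prems(3) that by simp
  show False
  proof (cases "distinct (map bd fs)")
    case True
    then have inj: "i = j" if "bd (fs ! i) = bd (fs ! j)" "i < ?n" "j < ?n" for i j
      using that nth_eq_iff_index_eq[OF True, of i j] by simp
    have closed: "bd (iv (fs ! (?n - 1))) = bd (fs ! 0)"
      using less.prems(2,4) by (simp add: last_conv_nth hd_conv_nth)
    have cyc: "bd (iv (fs ! i)) = bd (fs ! (Suc i mod ?n))" if "i < ?n" for i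
    proof (cases "Suc i < ?n")
      case True
      then show ?thesis using succ by simp
    next
      case False
      then have "Suc i = ?n" using that by simp
      then show ?thesis using closed by (metis diff_Suc_1 mod_self)
    qed
    have "iv f \<notin> set fs" if f: "f \<in> set fs" for f
    proof
      assume "iv f \<in> set fs"
      then obtain a b where a: "a < ?n" "fs ! a = f" and b: "b < ?n" "fs ! b = iv f"
        using f by (metis in_set_conv_nth)
      have n0: "?n > 0" using a(1) by (rule le_less_trans[OF le0])
      \<comment> \<open>The reverse of a flag starts where its successor starts, hence is its
        successor. Since \<open>follows\<close> excludes this except at the base point, the flag is
        last and its reverse first; then the second flag starts where the last one does, so the
        length is at most 2, which is impossible as well.\<close>
      have "b = Suc a mod ?n"
        by (rule inj[OF _ b(1) mod_less_divisor[OF n0]]) (use cyc[OF a(1)] a b in simp)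
      moreover have "\<not> Suc a < ?n"
        using succ(2)[of a] a b calculation by auto
      ultimately have ab: "Suc a = ?n" "b = 0"
        using a(1) by (auto simp: not_less le_Suc_eq)
      show False
      proof (cases "?n = 1")
        case True
        then have "f = iv f" using a b ab by simp
        then show False using half[OF a(1)] a by (simp add: half_def)
      next
        case False
        then have 1: "Suc 0 < ?n" using n0 by linarith
        have "iv (fs ! 0) = f"
          using b ab a half[OF a(1)] by (simp add: half_def)
        then have "bd (fs ! a) = bd (fs ! 1)"
          using succ(1)[OF 1] a by simp
        then have "a = 1"
          using inj a 1 by simp
        then show False
          using succ(2)[OF 1] \<open>iv (fs ! 0) = f\<close> a by simp
      qed
    qed
    moreover have "set fs \<subseteq> flags T - tails T"
      using less.prems(3) by (auto simp: half_def tails_def)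
    ultimately have "circuit T fs"
      unfolding circuit_def using less.prems(2) cyc True by blast
    then show False
      using tree unfolding tree_def by blast
  next
    case False
    then obtain i j where ij: "i < j" "j < ?n" "bd (fs ! i) = bd (fs ! j)"
      unfolding distinct_conv_nth using linorder_neqE_nat by auto metis
    define gs where "gs = take (j - i) (drop i fs)"
    have len: "length gs = j - i"
      using ij by (simp add: gs_def)
    have nth: "gs ! m = fs ! (i + m)" if "m < j - i" for m
      using that ij by (simp add: gs_def)
    have "successively follows gs"
      unfolding successively_conv_nth len using less.prems(1) nth ij
      by (auto simp: successively_conv_nth)
    moreover have ne: "gs \<noteq> []" using len ij by auto
    moreover have "\<forall>f\<in>set gs. half f"
      using less.prems(3) by (auto simp: gs_def dest: in_set_takeD in_set_dropD)
    moreover have "bd (iv (last gs)) = bd (hd gs)"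
    proof -
      have "last gs = fs ! (j - 1)"
        using ne len nth[of "j - i - 1"] ij by (simp add: last_conv_nth)
      moreover have "hd gs = fs ! i"
        using ne nth[of 0] ij by (simp add: hd_conv_nth)
      moreover have "bd (iv (fs ! (j - 1))) = bd (fs ! j)"
        using succ(1)[of "j - 1"] ij by simp
      ultimately show ?thesis using ij by simp
    qed
    moreover have "length gs < length fs"
      using len ij by linarith
    ultimately show False
      using less.hyps by blast
  qed
qed

section \<open>Parents with respect to the root\<close>

definition adj :: "(nat \<times> nat) set" where
  "adj = {(bd f, bd (iv f)) | f. f \<in> flags T}"

definition depth :: "nat \<Rightarrow> nat" where
  "depth v = (LEAST n. (v, r) \<in> adj ^^ n)"

text \<open>Some flag whose edge leads closer to the root; that there is only one follows from
  \<open>half_edge_cases\<close>.\<close>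

definition up :: "nat \<Rightarrow> nat" where
  "up v = (SOME f. f \<in> flags T \<and> bd f = v \<and> depth (bd (iv f)) < depth v)"

definition par :: "nat \<Rightarrow> nat" where
  "par v = bd (iv (up v))"

definition nonroot :: "nat set" where
  "nonroot = verts T - {r}"

lemma up:
  assumes "v \<in> nonroot"
  shows up_flags: "up v \<in> flags T" and bd_up: "bd (up v) = v" and depth_par: "depth (par v) < depth v"
proof -
  have v: "v \<in> verts T" "v \<noteq> r" using assms by (auto simp: nonroot_def)
  have "(v, r) \<in> adj\<^sup>*"
    using tree v root unfolding tree_def graph_connected_def adj_def by blast
  then have "\<exists>n. (v, r) \<in> adj ^^ n"
    by (simp add: rtrancl_power)
  then have n: "(v, r) \<in> adj ^^ depth v"
    unfolding depth_def by (rule LeastI_ex)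
  moreover have "depth v \<noteq> 0"
    using n v(2) by (intro notI) simp
  ultimately obtain m where m: "depth v = Suc m" "(v, r) \<in> adj ^^ Suc m"
    by (metis not0_implies_Suc)
  then obtain u where u: "(v, u) \<in> adj" "(u, r) \<in> adj ^^ m"
    by (meson relpow_Suc_D2)
  then have "depth u \<le> m"
    unfolding depth_def by (intro Least_le)
  then have "depth u < depth v"
    using m by simp
  with u(1) have "\<exists>f. f \<in> flags T \<and> bd f = v \<and> depth (bd (iv f)) < depth v"
    unfolding adj_def by blast
  from someI_ex[OF this] show "up v \<in> flags T" "bd (up v) = v" "depth (par v) < depth v"
    unfolding par_def up_def by blast+
qed

lemma par_verts: "v \<in> nonroot \<Longrightarrow> par v \<in> verts T"
  unfolding par_def using bd_verts iv_flags up_flags by blast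

lemma half_up:
  assumes "v \<in> nonroot"
  shows "half (up v)"
proof -
  have "iv (up v) \<noteq> up v"
    using depth_par[OF assms] bd_up[OF assms] by (metis less_irrefl par_def)
  then show ?thesis using up_flags[OF assms] by (simp add: half_def)
qed

lemma up_neq_iv_up:
  assumes "u \<in> nonroot" "v \<in> nonroot"
  shows "up u \<noteq> iv (up v)"
proof
  assume eq: "up u = iv (up v)"
  then have "u = par v" "par u = v"
    using bd_up[OF assms(1)] bd_up[OF assms(2)] up_flags[OF assms(2)] by (auto simp: par_def)
  then show False
    using depth_par[OF assms(1)] depth_par[OF assms(2)] by simp
qed

lemma up_inj: "u \<in> nonroot \<Longrightarrow> v \<in> nonroot \<Longrightarrow> up u = up v \<Longrightarrow> u = v"
  using bd_up by metis

text \<open>Strict decrease of the depth along the upward flags gives termination and rules out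
  backtracking.\<close>

lemma up_path:
  assumes "v \<in> verts T"
  shows "\<exists>us. successively follows us \<and> (\<forall>f\<in>set us. half f) \<and> (v = r \<longrightarrow> us = []) \<and>
    (v \<noteq> r \<longrightarrow> us \<noteq> [] \<and> hd us = up v \<and> bd (iv (last us)) = r)"
  using assms
proof (induction "depth v" arbitrary: v rule: less_induct)
  case less
  show ?case
  proof (cases "v = r")
    case True
    then show ?thesis by (intro exI[of _ "[]"]) simp
  next
    case False
    then have v: "v \<in> nonroot" using less.prems by (simp add: nonroot_def)
    obtain us where us: "successively follows us" "\<forall>f\<in>set us. half f" "par v = r \<longrightarrow> us = []"
      "par v \<noteq> r \<longrightarrow> us \<noteq> [] \<and> hd us = up (par v) \<and> bd (iv (last us)) = r"
      using less.hyps[OF depth_par[OF v] par_verts[OF v]] by blast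
    have "successively follows (up v # us)"
    proof (cases "par v = r")
      case True
      then show ?thesis using us by simp
    next
      case False
      then have "par v \<in> nonroot" using par_verts[OF v] by (simp add: nonroot_def)
      then have "follows (up v) (up (par v))"
        using bd_up up_neq_iv_up v by (simp add: follows_def par_def[symmetric])
      then show ?thesis
        using us False by (cases us) auto
    qed
    then show ?thesis
      using us half_up[OF v] False by (intro exI[of _ "up v # us"]) (auto simp: par_def[symmetric])
  qed
qed

text \<open>Otherwise the reversed upward walk from the start of \<open>f\<close>, then
  \<open>f\<close>, then the upward walk from its end would be a closed walk at the root without
  backtracking.\<close>

lemma half_edge_cases:
  assumes "half f"
  shows "bd f \<in> nonroot \<and> f = up (bd f) \<or> bd (iv f) \<in> nonroot \<and> iv f = up (bd (iv f))"
proof (rule ccontr)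
  assume neg: "\<not> ?thesis"
  let ?v = "bd f" and ?u = "bd (iv f)"
  have f: "f \<in> flags T" using assms by (simp add: half_def)
  have vu: "?v \<in> verts T" "?u \<in> verts T" using f bd_verts iv_flags by auto
  obtain vs where vs: "successively follows vs" "\<forall>f\<in>set vs. half f" "?v = r \<longrightarrow> vs = []"
      "?v \<noteq> r \<longrightarrow> vs \<noteq> [] \<and> hd vs = up ?v \<and> bd (iv (last vs)) = r"
    using up_path[OF vu(1)] by blast
  obtain us where us: "successively follows us" "\<forall>f\<in>set us. half f" "?u = r \<longrightarrow> us = []"
      "?u \<noteq> r \<longrightarrow> us \<noteq> [] \<and> hd us = up ?u \<and> bd (iv (last us)) = r"
    using up_path[OF vu(2)] by blast
  define ws where "ws = rev (map iv vs)"
  have "successively follows ws"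
  proof -
    have "successively (\<lambda>x y. follows (iv y) (iv x)) vs"
      by (rule successively_mono[OF vs(1)])
        (use vs(2) in \<open>auto simp: follows_def half_def\<close>)
    then show ?thesis
      by (simp add: ws_def successively_rev successively_map)
  qed
  moreover have "\<forall>f\<in>set ws. half f"
    using vs(2) half_iv by (auto simp: ws_def)
  moreover have "follows (last ws) f" if "ws \<noteq> []"
  proof -
    have v: "?v \<noteq> r" "vs \<noteq> []" using that vs(3) by (auto simp: ws_def)
    then have vn: "?v \<in> nonroot" using vu by (simp add: nonroot_def)
    have "last ws = iv (up ?v)"
      using v vs(4) by (simp add: ws_def last_rev hd_map)
    then show ?thesis
      using neg vn up_flags[OF vn] bd_up[OF vn] by (auto simp: follows_def)
  qed
  moreover have "follows f (hd us)" if "us \<noteq> []"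
  proof -
    have u: "?u \<noteq> r" using that us(3) by auto
    then have un: "?u \<in> nonroot" using vu by (simp add: nonroot_def)
    show ?thesis
      using u us(4) neg un bd_up[OF un] by (auto simp: follows_def)
  qed
  ultimately have "successively follows (ws @ [f] @ us)" "\<forall>f\<in>set (ws @ [f] @ us). half f"
    using us(1,2) assms by (auto simp: successively_append_iff successively_Cons)
  moreover have "bd (hd (ws @ [f] @ us)) = r"
  proof (cases "vs = []")
    case True
    then show ?thesis using vs(4) by (auto simp: ws_def)
  next
    case False
    then have "?v \<noteq> r" using vs(3) by auto
    then show ?thesis
      using vs(4) False by (simp add: ws_def hd_append hd_rev last_map)
  qed
  moreover have "bd (iv (last (ws @ [f] @ us))) = r"
    using us(3,4) by (cases "us = []") auto
  ultimately show False
    using no_closed_walk[of "ws @ [f] @ us"] by simp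
qed

text \<open>In its reflexive transitive closure, \<open>(u, v)\<close> says that \<open>u\<close>
  lies in the subtree below \<open>v\<close>.\<close>

definition par_rel :: "(nat \<times> nat) set" where
  "par_rel = {(v, par v) | v. v \<in> nonroot}"

lemma par_relI: "v \<in> nonroot \<Longrightarrow> (v, par v) \<in> par_rel"
  by (auto simp: par_rel_def)

lemma par_relD: "(u, v) \<in> par_rel \<Longrightarrow> u \<in> nonroot \<and> v = par u"
  by (auto simp: par_rel_def)

lemma single_valued_par_rel: "single_valued par_rel"
  by (auto simp: single_valued_def par_rel_def)

lemma depth_par_rel: "(u, v) \<in> par_rel\<^sup>+ \<Longrightarrow> depth v < depth u"
  by (induction rule: trancl_induct) (auto dest!: par_relD dest: depth_par)

lemma par_rel_antisym: "(u, v) \<in> par_rel\<^sup>* \<Longrightarrow> (v, u) \<in> par_rel\<^sup>+ \<Longrightarrow> False"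
  using depth_par_rel by (metis less_irrefl rtrancl_trancl_trancl)

lemma par_rel_linear: "(x, u) \<in> par_rel\<^sup>* \<Longrightarrow> (x, v) \<in> par_rel\<^sup>* \<Longrightarrow> (u, v) \<in> par_rel\<^sup>* \<or> (v, u) \<in> par_rel\<^sup>*"
  by (rule single_valued_confluent[OF single_valued_par_rel])

lemma par_rel_step:
  assumes "(u, v) \<in> par_rel\<^sup>*" "u \<noteq> v"
  shows "u \<in> nonroot" "(par u, v) \<in> par_rel\<^sup>*"
  using assms by (auto elim!: converse_rtranclE dest!: par_relD)

lemma par_rel_trancl_iff: "u \<in> nonroot \<Longrightarrow> (u, v) \<in> par_rel\<^sup>+ \<longleftrightarrow> (par u, v) \<in> par_rel\<^sup>*"
  using par_relI by (auto dest!: tranclD par_relD intro: rtrancl_into_trancl2)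

lemma par_rel_root: "v \<in> verts T \<Longrightarrow> (v, r) \<in> par_rel\<^sup>*"
proof (induction "depth v" arbitrary: v rule: less_induct)
  case less
  show ?case
  proof (cases "v = r")
    case False
    then have "v \<in> nonroot" using less.prems by (simp add: nonroot_def)
    then show ?thesis
      using less.hyps[OF depth_par par_verts] par_relI by (meson converse_rtrancl_into_rtrancl)
  qed simp
qed

lemma root_par_rel: "(r, v) \<in> par_rel\<^sup>* \<longleftrightarrow> v = r"
  using par_rel_step(1)[of r v] by (auto simp: nonroot_def)

text \<open>Every edge joins a vertex to its parent, and both lie on the same side of the subtree
  below \<open>v\<close> unless the lower end is \<open>v\<close> itself.\<close>

lemma below_cross:
  assumes v: "v \<in> nonroot" and g: "g \<in> flags T" "g \<noteq> up v" "g \<noteq> iv (up v)"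
  shows "(bd g, v) \<in> par_rel\<^sup>* \<longleftrightarrow> (bd (iv g), v) \<in> par_rel\<^sup>*"
proof (cases "half g")
  case False
  then show ?thesis using g by (simp add: half_def)
next
  case True
  have *: "(x, v) \<in> par_rel\<^sup>* \<longleftrightarrow> (par x, v) \<in> par_rel\<^sup>*" if "x \<in> nonroot" "x \<noteq> v" for x
    using that par_rel_step(2)[of x v] par_relI by (meson converse_rtrancl_into_rtrancl)
  from half_edge_cases[OF True] show ?thesis
  proof
    assume a: "bd g \<in> nonroot \<and> g = up (bd g)"
    then have "bd g \<noteq> v" using g by auto
    then show ?thesis using *[of "bd g"] a by (auto simp: par_def)
  next
    assume a: "bd (iv g) \<in> nonroot \<and> iv g = up (bd (iv g))"
    then have "par (bd (iv g)) = bd g"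
      using g(1) by (metis iv_iv par_def)
    moreover have "bd (iv g) \<noteq> v" using a g by (metis iv_iv)
    ultimately show ?thesis using *[of "bd (iv g)"] a by auto
  qed
qed

section \<open>Linked flags after deletion of vertices or edges\<close>

definition link_rel :: "nat set \<Rightarrow> nat set \<Rightarrow> (nat \<times> nat) set" where
  "link_rel X Y = {(f, g). f \<in> flags T \<and> g \<in> flags T \<and>
     (bd f = bd g \<and> bd f \<notin> X \<or> g = iv f \<and> f \<notin> Y)}"

lemma linked_eq: "linked T X Y = (link_rel X Y)\<^sup>*"
  by (simp add: linked_def link_rel_def)

lemma linked_vertex: "f \<in> flags T \<Longrightarrow> g \<in> flags T \<Longrightarrow> bd f = bd g \<Longrightarrow> bd f \<notin> X \<Longrightarrow> (f, g) \<in> linked T X Y"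
  unfolding linked_eq by (rule r_into_rtrancl) (simp add: link_rel_def)

lemma linked_edge: "f \<in> flags T \<Longrightarrow> f \<notin> Y \<Longrightarrow> (f, iv f) \<in> linked T X Y"
  unfolding linked_eq by (rule r_into_rtrancl) (simp add: link_rel_def iv_flags)

lemma linked_trans: "(f, g) \<in> linked T X Y \<Longrightarrow> (g, h) \<in> linked T X Y \<Longrightarrow> (f, h) \<in> linked T X Y"
  unfolding linked_eq by (rule rtrancl_trans)

lemma linked_sym:
  assumes "\<And>f. f \<in> flags T \<Longrightarrow> f \<in> Y \<longleftrightarrow> iv f \<in> Y" "(f, g) \<in> linked T X Y"
  shows "(g, f) \<in> linked T X Y"
proof -
  have "sym (link_rel X Y)"
  proof (rule symI)
    fix f g assume "(f, g) \<in> link_rel X Y"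
    then show "(g, f) \<in> link_rel X Y"
      using assms(1)[of f] by (auto simp: link_rel_def)
  qed
  from sym_rtrancl[OF this] show ?thesis
    using assms(2) unfolding linked_eq by (rule symD)
qed

text \<open>Bounds a linked class from above; \<open>linked_up\<close> and
  \<open>linked_root\<close> give the bounds from below.\<close>

lemma linked_closed:
  assumes "(f, g) \<in> linked T X Y" "f \<in> A"
    "\<And>f g. f \<in> A \<Longrightarrow> f \<in> flags T \<Longrightarrow> g \<in> flags T \<Longrightarrow> bd f = bd g \<Longrightarrow> bd f \<notin> X \<Longrightarrow> g \<in> A"
    "\<And>f. f \<in> A \<Longrightarrow> f \<in> flags T \<Longrightarrow> f \<notin> Y \<Longrightarrow> iv f \<in> A"
  shows "g \<in> A"
  using assms(1) unfolding linked_eq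
proof (induction rule: rtrancl_induct)
  case base
  then show ?case by (rule assms(2))
next
  case (step g h)
  then show ?case
    using assms(3)[of g h] assms(4)[of g] by (auto simp: link_rel_def)
qed

text \<open>Nothing is deleted along the upward path from \<open>x\<close> to \<open>c\<close>, so
  linking follows it.\<close>

lemma linked_up:
  assumes c: "c \<in> nonroot" and X: "\<And>x. (x, c) \<in> par_rel\<^sup>* \<Longrightarrow> x \<notin> X"
    and Y: "\<And>x. (x, c) \<in> par_rel\<^sup>+ \<Longrightarrow> up x \<notin> Y"
  shows "(x, c) \<in> par_rel\<^sup>* \<Longrightarrow> g \<in> flags T \<Longrightarrow> bd g = x \<Longrightarrow> (g, up c) \<in> linked T X Y"
proof (induction arbitrary: g rule: converse_rtrancl_induct)
  case base
  then show ?case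
    using c X[of c] by (intro linked_vertex) (simp_all add: up_flags bd_up)
next
  case (step x y)
  from step.hyps(1) have x: "x \<in> nonroot" "y = par x" by (auto dest: par_relD)
  have "(x, c) \<in> par_rel\<^sup>+" using step.hyps by (rule rtrancl_into_trancl2)
  then have "(g, up x) \<in> linked T X Y"
    using X[OF trancl_into_rtrancl[OF \<open>(x, c) \<in> par_rel\<^sup>+\<close>]] step.prems x
    by (intro linked_vertex) (auto simp: up_flags bd_up)
  moreover have "(up x, iv (up x)) \<in> linked T X Y"
    using Y[OF \<open>(x, c) \<in> par_rel\<^sup>+\<close>] x by (intro linked_edge up_flags)
  moreover have "(iv (up x), up c) \<in> linked T X Y"
    using step.IH x by (simp add: iv_flags up_flags par_def)
  ultimately show ?case by (blast intro: linked_trans)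
qed

text \<open>Nothing is deleted outside the subtree below \<open>v\<close>, and the upward path from
  a vertex outside never enters that subtree.\<close>

lemma linked_root:
  assumes X: "\<And>x. x \<in> verts T \<Longrightarrow> (x, v) \<notin> par_rel\<^sup>* \<Longrightarrow> x \<notin> X"
    and Y: "\<And>x. x \<in> nonroot \<Longrightarrow> (x, v) \<notin> par_rel\<^sup>* \<Longrightarrow> up x \<notin> Y"
    and h: "h \<in> flags T" "bd h = r" and g: "g \<in> flags T" "(bd g, v) \<notin> par_rel\<^sup>*"
  shows "(g, h) \<in> linked T X Y"
proof -
  have "(x, r) \<in> par_rel\<^sup>* \<Longrightarrow> g \<in> flags T \<Longrightarrow> bd g = x \<Longrightarrow> (x, v) \<notin> par_rel\<^sup>* \<Longrightarrow> (g, h) \<in> linked T X Y" for x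
  proof (induction arbitrary: g rule: converse_rtrancl_induct)
    case base
    then show ?case using h X[OF root] by (intro linked_vertex) auto
  next
    case (step x y)
    from step.hyps(1) have x: "x \<in> nonroot" "y = par x" by (auto dest: par_relD)
    have y: "(y, v) \<notin> par_rel\<^sup>*"
      using step.hyps(1) step.prems(3) by (meson converse_rtrancl_into_rtrancl)
    have "(g, up x) \<in> linked T X Y"
      using X[of x] step.prems x by (intro linked_vertex) (auto simp: up_flags bd_up nonroot_def)
    moreover have "(up x, iv (up x)) \<in> linked T X Y"
      using Y[of x] x step.prems by (intro linked_edge up_flags)
    moreover have "(iv (up x), h) \<in> linked T X Y"
      using step.IH x y by (simp add: iv_flags up_flags par_def)
    ultimately show ?case by (blast intro: linked_trans)
  qed
  then show ?thesis using g par_rel_root bd_verts by blast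
qed

lemma edges_eq: "edges T = (\<lambda>v. {up v, iv (up v)}) ` nonroot"
proof (intro equalityI subsetI)
  fix e assume "e \<in> edges T"
  then obtain f where f: "e = {f, iv f}" "half f"
    by (auto simp: edges_def half_def)
  from half_edge_cases[OF f(2)] show "e \<in> (\<lambda>v. {up v, iv (up v)}) ` nonroot"
  proof
    assume "bd f \<in> nonroot \<and> f = up (bd f)"
    then show ?thesis using f(1) by (intro image_eqI[of _ _ "bd f"]) simp_all
  next
    assume "bd (iv f) \<in> nonroot \<and> iv f = up (bd (iv f))"
    moreover have "iv (iv f) = f" using f(2) by (simp add: half_def)
    ultimately show ?thesis
      using f(1) by (intro image_eqI[of _ _ "bd (iv f)"]) (auto simp: insert_commute)
  qed
next
  fix e assume "e \<in> (\<lambda>v. {up v, iv (up v)}) ` nonroot"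
  then show "e \<in> edges T"
    using half_up by (auto simp: edges_def half_def)
qed

end

section \<open>Branches and clusters of a painted stable tree\<close>

definition br :: "'a set \<Rightarrow> 'a lgraph \<Rightarrow> nat \<Rightarrow> 'a set" where
  "br S T f = branch_labels S T (bnd T f) f"

definition splits_of :: "'a set \<Rightarrow> 'a lgraph \<Rightarrow> 'a set set set" where
  "splits_of S T = edge_partition S T ` edges T"

locale stable_rooted_tree = painted_set S W w K
  for S W :: "'a set" and w :: 'a and K :: "'k::{comm_ring,monoid_mult} itself" +
  fixes T :: "'a lgraph"
  assumes stable: "stable_tree S W T"
begin

lemma labelled: "bij_betw (tail T) S (tails T)" and is_tree: "tree T"
  using stable by (simp_all add: stable_tree_def labelled_tree_def)

lemma tail_tails: "s \<in> S \<Longrightarrow> tail T s \<in> tails T"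
  using labelled by (auto simp: bij_betw_def)

lemma tail_flags: "s \<in> S \<Longrightarrow> tail T s \<in> flags T" and invol_tail: "s \<in> S \<Longrightarrow> invol T (tail T s) = tail T s"
  using tail_tails by (auto simp: tails_def)

lemma tail_inj: "s \<in> S \<Longrightarrow> t \<in> S \<Longrightarrow> tail T s = tail T t \<longleftrightarrow> s = t"
  using labelled by (auto simp: bij_betw_def inj_on_def)

lemma tailE:
  assumes "f \<in> flags T" "invol T f = f"
  obtains s where "s \<in> S" "f = tail T s"
proof -
  have "f \<in> tails T" using assms by (simp add: tails_def)
  then have "f \<in> tail T ` S" using labelled by (simp add: bij_betw_def)
  then show thesis using that by blast
qed

sublocale rooted_graph T "bnd T (tail T w)"
proof
  show "tree T" by (rule is_tree)
  show "bnd T (tail T w) \<in> verts T"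
    using is_tree tail_flags[OF w_in_S] by (simp add: tree_def graph_def)
qed

abbreviation "rt \<equiv> bd (tail T w)"

definition cluster :: "nat \<Rightarrow> 'a set" where
  "cluster v = {s \<in> S0. (bd (tail T s), v) \<in> par_rel\<^sup>*}"

text \<open>The flag towards \<open>w\<close>; at the root this is the tail of \<open>w\<close>
  itself, so that every vertex has one.\<close>

definition top :: "nat \<Rightarrow> nat" where
  "top v = (if v = rt then tail T w else up v)"

definition down :: "nat \<Rightarrow> nat set" where
  "down v = flags_at T v - {top v}"

lemma verts_cases: "v \<in> verts T \<Longrightarrow> v = rt \<or> v \<in> nonroot"
  by (simp add: nonroot_def)

lemma nonroot: "v \<in> nonroot \<Longrightarrow> v \<in> verts T \<and> v \<noteq> rt"
  by (simp add: nonroot_def)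

lemma S0_iff: "s \<in> S0 \<longleftrightarrow> s \<in> S \<and> s \<noteq> w"
  by (auto simp: S0_def)

lemma cluster_subset: "cluster v \<subseteq> S0"
  by (auto simp: cluster_def)

lemma cluster_root: "cluster rt = S0"
  using par_rel_root bd_verts tail_flags by (auto simp: cluster_def S0_iff)

lemma cluster_mono: "(u, v) \<in> par_rel\<^sup>* \<Longrightarrow> cluster u \<subseteq> cluster v"
  by (auto simp: cluster_def intro: rtrancl_trans)

lemma in_cluster_iff:
  assumes "v \<in> nonroot" "s \<in> S"
  shows "s \<in> cluster v \<longleftrightarrow> (bd (tail T s), v) \<in> par_rel\<^sup>*"
  using assms nonroot root_par_rel by (auto simp: cluster_def S0_iff)

lemma cluster_eq: "v \<in> nonroot \<Longrightarrow> cluster v = {s \<in> S. (bd (tail T s), v) \<in> par_rel\<^sup>*}"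
  using in_cluster_iff[of v] by (auto simp: cluster_def S0_iff)

lemma tail_neq_up: "s \<in> S \<Longrightarrow> v \<in> nonroot \<Longrightarrow> tail T s \<noteq> up v" "s \<in> S \<Longrightarrow> v \<in> nonroot \<Longrightarrow> tail T s \<noteq> iv (up v)"
  using half_up half_iv invol_tail unfolding half_def by metis+

lemma br_tail:
  assumes s: "s \<in> S"
  shows "br S T (tail T s) = {s}"
proof -
  have "g = tail T s" if "(tail T s, g) \<in> linked T {bd (tail T s)} {}" for g
  proof -
    have "g \<in> {tail T s}"
      using that by (rule linked_closed) (use s in \<open>auto simp: invol_tail\<close>)
    then show ?thesis by simp
  qed
  moreover have "(tail T s, tail T s) \<in> linked T {bd (tail T s)} {}"
    unfolding linked_eq by simp
  ultimately have "(tail T s, tail T t) \<in> linked T {bd (tail T s)} {} \<longleftrightarrow> t = s" if "t \<in> S" for t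
    using tail_inj[OF that s] by metis
  then show ?thesis
    using s unfolding br_def branch_labels_def by auto
qed

lemma par_not_below:
  assumes "v \<in> nonroot"
  shows "par v \<noteq> v" "(par v, v) \<notin> par_rel\<^sup>*"
proof -
  show "(par v, v) \<notin> par_rel\<^sup>*"
    using par_rel_antisym[of "par v" v] r_into_trancl[OF par_relI[OF assms]] by (intro notI)
  then show "par v \<noteq> v" by (intro notI) simp
qed

text \<open>With \<open>v\<close> deleted, \<open>up v\<close> together with the flags not below
  \<open>v\<close> is closed under linking, since only the edge of \<open>up v\<close> leaves the
  subtree below \<open>v\<close>. Conversely all these flags reach the tail of
  \<open>w\<close>.\<close>

lemma br_up:
  assumes v: "v \<in> nonroot"
  shows "br S T (up v) = S - cluster v"
proof -
  have p: "par v \<noteq> v" "(par v, v) \<notin> par_rel\<^sup>*"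
    using par_not_below[OF v] by simp_all
  have "(up v, tail T s) \<in> linked T {v} {} \<longleftrightarrow> (bd (tail T s), v) \<notin> par_rel\<^sup>*" if s: "s \<in> S" for s
  proof
    assume l: "(up v, tail T s) \<in> linked T {v} {}"
    let ?A = "insert (up v) {g \<in> flags T. (bd g, v) \<notin> par_rel\<^sup>*}"
    have "tail T s \<in> ?A"
      using l
    proof (rule linked_closed)
      fix f g assume "f \<in> ?A" "f \<in> flags T" "g \<in> flags T" "bd f = bd g" "bd f \<notin> {v}"
      then show "g \<in> ?A" using bd_up[OF v] by auto
    next
      fix f assume f: "f \<in> ?A" "f \<in> flags T"
      show "iv f \<in> ?A"
      proof (cases "f = up v \<or> f = iv (up v)")
        case True
        then show ?thesis
          using p(2) up_flags[OF v] iv_flags[OF up_flags[OF v]] by (elim disjE) (simp_all add: par_def)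
      next
        case False
        then show ?thesis
          using f below_cross[OF v f(2)] iv_flags by auto
      qed
    qed simp
    then show "(bd (tail T s), v) \<notin> par_rel\<^sup>*"
      using tail_neq_up[OF s v] by simp
  next
    assume s': "(bd (tail T s), v) \<notin> par_rel\<^sup>*"
    have root: "(g, tail T w) \<in> linked T {v} {}" if "g \<in> flags T" "(bd g, v) \<notin> par_rel\<^sup>*" for g
      by (rule linked_root[where v = v]) (use that tail_flags w_in_S in auto)
    have "(up v, iv (up v)) \<in> linked T {v} {}"
      using up_flags[OF v] by (intro linked_edge) auto
    moreover have "(iv (up v), tail T w) \<in> linked T {v} {}"
      using p up_flags[OF v] iv_flags by (intro root) (auto simp: par_def[symmetric])
    moreover have "(tail T w, tail T s) \<in> linked T {v} {}"
      using root[of "tail T s"] s' s tail_flags by (intro linked_sym[where g = "tail T w"]) auto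
    ultimately show "(up v, tail T s) \<in> linked T {v} {}"
      by (blast intro: linked_trans)
  qed
  then show ?thesis
    unfolding br_def branch_labels_def bd_up[OF v] using in_cluster_iff[OF v] by auto
qed

text \<open>The mirror image of \<open>br_up\<close>: with the parent deleted, the flags below
  \<open>v\<close> and the half at the parent form one class.\<close>

lemma br_iv_up:
  assumes v: "v \<in> nonroot"
  shows "br S T (iv (up v)) = cluster v"
proof -
  let ?p = "par v"
  have p: "?p \<noteq> v" "(?p, v) \<notin> par_rel\<^sup>*"
    using par_not_below[OF v] by simp_all
  have bp: "bd (iv (up v)) = ?p" by (simp add: par_def)
  have "(iv (up v), tail T s) \<in> linked T {?p} {} \<longleftrightarrow> (bd (tail T s), v) \<in> par_rel\<^sup>*" if s: "s \<in> S" for s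
  proof
    assume l: "(iv (up v), tail T s) \<in> linked T {?p} {}"
    let ?A = "insert (iv (up v)) {g \<in> flags T. (bd g, v) \<in> par_rel\<^sup>*}"
    have "tail T s \<in> ?A"
      using l
    proof (rule linked_closed)
      fix f g assume "f \<in> ?A" "f \<in> flags T" "g \<in> flags T" "bd f = bd g" "bd f \<notin> {?p}"
      then show "g \<in> ?A" using bp by auto
    next
      fix f assume f: "f \<in> ?A" "f \<in> flags T"
      show "iv f \<in> ?A"
      proof (cases "f = up v \<or> f = iv (up v)")
        case True
        then show ?thesis
          using up_flags[OF v] bd_up[OF v] by auto
      next
        case False
        then show ?thesis
          using f below_cross[OF v f(2)] iv_flags by auto
      qed
    qed simp
    then show "(bd (tail T s), v) \<in> par_rel\<^sup>*"
      using tail_neq_up[OF s v] by simp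
  next
    assume s': "(bd (tail T s), v) \<in> par_rel\<^sup>*"
    have "(iv (up v), iv (iv (up v))) \<in> linked T {?p} {}"
      using up_flags[OF v] iv_flags by (intro linked_edge) auto
    moreover have "(tail T s, up v) \<in> linked T {?p} {}"
      by (rule linked_up[OF v _ _ s']) (use p s tail_flags in auto)
    then have "(up v, tail T s) \<in> linked T {?p} {}"
      by (rule linked_sym[rotated]) auto
    ultimately show "(iv (up v), tail T s) \<in> linked T {?p} {}"
      using up_flags[OF v] by (auto intro: linked_trans)
  qed
  then show ?thesis
    unfolding br_def branch_labels_def bp cluster_eq[OF v] by auto
qed

text \<open>The orientation is opposite to that of branches: when its edge is cut,
  \<open>up v\<close> stays on the side of \<open>v\<close>, whereas its branch lies on the far
  side.\<close>

lemma edge_sides: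
  assumes v: "v \<in> nonroot"
  shows "{s \<in> S. (up v, tail T s) \<in> linked T {} {up v, iv (up v)}} = cluster v"
    and "{s \<in> S. (iv (up v), tail T s) \<in> linked T {} {up v, iv (up v)}} = S - cluster v"
proof -
  let ?Y = "{up v, iv (up v)}"
  have p: "(par v, v) \<notin> par_rel\<^sup>*"
    using par_not_below[OF v] by simp
  have Y: "f \<in> ?Y \<longleftrightarrow> iv f \<in> ?Y" if "f \<in> flags T" for f
    using that up_flags[OF v] iv_iv by (metis insert_iff singletonD)
  have up_Y: "up x \<in> ?Y \<longleftrightarrow> x = v" if "x \<in> nonroot" for x
    using that v up_inj up_neq_iv_up by auto
  have 1: "(up v, tail T s) \<in> linked T {} ?Y \<longleftrightarrow> (bd (tail T s), v) \<in> par_rel\<^sup>*" if s: "s \<in> S" for s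
  proof
    assume l: "(up v, tail T s) \<in> linked T {} ?Y"
    have "tail T s \<in> {g \<in> flags T. (bd g, v) \<in> par_rel\<^sup>*}"
      using l by (rule linked_closed) (use bd_up[OF v] up_flags[OF v] below_cross[OF v] iv_flags in auto)
    then show "(bd (tail T s), v) \<in> par_rel\<^sup>*" by simp
  next
    assume s': "(bd (tail T s), v) \<in> par_rel\<^sup>*"
    have "(tail T s, up v) \<in> linked T {} ?Y"
    proof (rule linked_up[OF v _ _ s'])
      fix x assume x: "(x, v) \<in> par_rel\<^sup>+"
      then have "x \<in> nonroot" "x \<noteq> v"
        using depth_par_rel[OF x] by (auto dest!: tranclD par_relD)
      then show "up x \<notin> ?Y" using up_Y by blast
    qed (use s tail_flags in auto)
    then show "(up v, tail T s) \<in> linked T {} ?Y"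
      by (rule linked_sym[OF Y, rotated])
  qed
  have 2: "(iv (up v), tail T s) \<in> linked T {} ?Y \<longleftrightarrow> (bd (tail T s), v) \<notin> par_rel\<^sup>*" if s: "s \<in> S" for s
  proof
    assume l: "(iv (up v), tail T s) \<in> linked T {} ?Y"
    have "tail T s \<in> {g \<in> flags T. (bd g, v) \<notin> par_rel\<^sup>*}"
      using l by (rule linked_closed)
        (use p up_flags[OF v] below_cross[OF v] iv_flags in \<open>auto simp: par_def[symmetric]\<close>)
    then show "(bd (tail T s), v) \<notin> par_rel\<^sup>*" by simp
  next
    assume s': "(bd (tail T s), v) \<notin> par_rel\<^sup>*"
    have root: "(g, tail T w) \<in> linked T {} ?Y" if "g \<in> flags T" "(bd g, v) \<notin> par_rel\<^sup>*" for g
    proof (rule linked_root[where v = v])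
      fix x assume "x \<in> nonroot" "(x, v) \<notin> par_rel\<^sup>*"
      then show "up x \<notin> ?Y" using up_Y by blast
    qed (use that tail_flags w_in_S in auto)
    have "(iv (up v), tail T w) \<in> linked T {} ?Y"
      using p up_flags[OF v] iv_flags by (intro root) (auto simp: par_def[symmetric])
    moreover have "(tail T w, tail T s) \<in> linked T {} ?Y"
      by (rule linked_sym[OF Y root]) (use s s' tail_flags in auto)
    ultimately show "(iv (up v), tail T s) \<in> linked T {} ?Y"
      by (blast intro: linked_trans)
  qed
  show "{s \<in> S. (up v, tail T s) \<in> linked T {} ?Y} = cluster v"
    using 1 unfolding cluster_eq[OF v] by auto
  show "{s \<in> S. (iv (up v), tail T s) \<in> linked T {} ?Y} = S - cluster v"
    using 2 in_cluster_iff[OF v] by auto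
qed

lemma edge_partition_up:
  "v \<in> nonroot \<Longrightarrow> edge_partition S T {up v, iv (up v)} = {cluster v, S - cluster v}"
  by (simp add: edge_partition_def edge_sides)

lemma top_flag: "v \<in> verts T \<Longrightarrow> top v \<in> flags_at T v"
  using verts_cases[of v] nonroot[of v] tail_flags[OF w_in_S] up_flags bd_up
  by (auto simp: top_def flags_at_def)

lemma br_top: "v \<in> verts T \<Longrightarrow> br S T (top v) = S - cluster v"
  using verts_cases[of v] nonroot[of v] br_tail[OF w_in_S] br_up[of v] cluster_root w_in_S
  by (auto simp: top_def S0_def)

lemma down_cases:
  assumes "v \<in> verts T" "f \<in> down v"
  obtains (edge) c where "c \<in> nonroot" "par c = v" "f = iv (up c)" "br S T f = cluster c"
  | (tail) s where "s \<in> S0" "f = tail T s" "bd (tail T s) = v" "br S T f = {s}"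
proof -
  have f: "f \<in> flags T" "bd f = v" "f \<noteq> top v"
    using assms(2) by (auto simp: down_def flags_at_def)
  show thesis
  proof (cases "iv f = f")
    case True
    then obtain s where s: "s \<in> S" "f = tail T s" using f by (auto elim: tailE)
    then have "s \<noteq> w" using f by (auto simp: top_def)
    then show thesis
      using tail[of s] s f br_tail by (simp add: S0_iff)
  next
    case False
    then have "half f" using f by (simp add: half_def)
    from half_edge_cases[OF this] show thesis
    proof
      assume "bd f \<in> nonroot \<and> f = up (bd f)"
      then show thesis using f nonroot by (auto simp: top_def)
    next
      assume a: "bd (iv f) \<in> nonroot \<and> iv f = up (bd (iv f))"
      then have "f = iv (up (bd (iv f)))" using f(1) iv_iv by metis
      moreover from this have "par (bd (iv f)) = v" using f(2) by (simp add: par_def)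
      ultimately show thesis
        using edge[of "bd (iv f)"] a br_iv_up by metis
    qed
  qed
qed

lemma iv_up_down: "c \<in> nonroot \<Longrightarrow> iv (up c) \<in> down (par c)"
proof -
  assume c: "c \<in> nonroot"
  have "iv (up c) \<noteq> top (par c)"
  proof (cases "par c = rt")
    case True
    then show ?thesis using tail_neq_up(2)[OF w_in_S c] by (auto simp: top_def)
  next
    case False
    then have "par c \<in> nonroot" using par_verts[OF c] by (simp add: nonroot_def)
    then show ?thesis using up_neq_iv_up[OF _ c] False by (metis top_def)
  qed
  then show ?thesis
    using up_flags[OF c] iv_flags by (auto simp: down_def flags_at_def par_def)
qed

lemma tail_down: "s \<in> S0 \<Longrightarrow> tail T s \<in> down (bd (tail T s))"
proof -
  assume s: "s \<in> S0"
  let ?v = "bd (tail T s)"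
  have sS: "s \<in> S" "s \<noteq> w" using s by (auto simp: S0_iff)
  have v: "?v \<in> verts T" using sS tail_flags bd_verts by simp
  have "tail T s \<noteq> top ?v"
    using sS tail_inj[OF sS(1) w_in_S] tail_neq_up(1)[OF sS(1)] verts_cases[OF v] by (auto simp: top_def)
  then show ?thesis
    using sS tail_flags by (auto simp: down_def flags_at_def)
qed

lemma br_down_subset: "v \<in> verts T \<Longrightarrow> f \<in> down v \<Longrightarrow> br S T f \<subseteq> cluster v"
proof (erule down_cases)
  fix c assume "c \<in> nonroot" "par c = v" "br S T f = cluster c"
  then show ?thesis using cluster_mono[of c v] par_relI[of c] by auto
next
  fix s assume "s \<in> S0" "bd (tail T s) = v" "br S T f = {s}"
  then show ?thesis by (simp add: cluster_def)
qed

lemma cluster_down: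
  assumes v: "v \<in> verts T" and s: "s \<in> cluster v"
  shows "\<exists>f\<in>down v. s \<in> br S T f"
proof -
  have s': "s \<in> S0" "(bd (tail T s), v) \<in> par_rel\<^sup>*" using s by (auto simp: cluster_def)
  from s'(2) show ?thesis
  proof (cases rule: rtranclE)
    case base
    then show ?thesis using tail_down[OF s'(1)] br_tail s' by (auto simp: S0_iff)
  next
    case (step c)
    then have "c \<in> nonroot" "v = par c" by (auto dest: par_relD)
    then show ?thesis
      using step iv_up_down[of c] br_iv_up[of c] s' by (auto simp: cluster_def)
  qed
qed

text \<open>The vertices above \<open>x\<close> form a chain, so the two children are comparable; if
  they differed, their common parent would lie below one of them.\<close>

lemma children_disjoint:
  assumes "c \<in> nonroot" "d \<in> nonroot" "par c = par d" "(x, c) \<in> par_rel\<^sup>*" "(x, d) \<in> par_rel\<^sup>*"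
  shows "c = d"
proof (rule ccontr)
  assume neq: "c \<noteq> d"
  have *: False if "(c, d) \<in> par_rel\<^sup>*" "c \<noteq> d" "c \<in> nonroot" "d \<in> nonroot" "par c = par d" for c d
    using par_rel_antisym[OF par_rel_step(2)[OF that(1,2)]] that(5) par_relI[OF that(4)] by auto
  from par_rel_linear[OF assms(4,5)] show False
    using *[of c d] *[of d c] neq assms by auto
qed

lemma br_down_disjoint:
  assumes v: "v \<in> verts T" and f: "f \<in> down v" and g: "g \<in> down v" and s: "s \<in> br S T f" "s \<in> br S T g"
  shows "f = g"
proof -
  have loop: False if "c \<in> nonroot" "(par c, c) \<in> par_rel\<^sup>*" for c
    using par_rel_antisym[OF that(2)] par_relI[OF that(1)] by auto
  from v f show ?thesis
  proof (cases rule: down_cases)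
    case c: (edge c)
    from v g show ?thesis
    proof (cases rule: down_cases)
      case d: (edge d)
      then show ?thesis
        using children_disjoint[of c d] c s by (auto simp: cluster_def)
    next
      case (tail t)
      then show ?thesis using c s loop[of c] by (auto simp: cluster_def)
    qed
  next
    case t: (tail t)
    from v g show ?thesis
    proof (cases rule: down_cases)
      case d: (edge d)
      then show ?thesis using t s loop[of d] by (auto simp: cluster_def)
    next
      case (tail t')
      then show ?thesis using t s by auto
    qed
  qed
qed

lemma flags_at_eq: "v \<in> verts T \<Longrightarrow> flags_at T v = insert (top v) (down v)"
  using top_flag by (auto simp: down_def)

lemma br_partition:
  assumes v: "v \<in> verts T"
  shows br_cover: "s \<in> S \<Longrightarrow> \<exists>f\<in>flags_at T v. s \<in> br S T f"
    and br_disjoint: "f \<in> flags_at T v \<Longrightarrow> g \<in> flags_at T v \<Longrightarrow> s \<in> br S T f \<Longrightarrow> s \<in> br S T g \<Longrightarrow> f = g"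
proof -
  show "\<exists>f\<in>flags_at T v. s \<in> br S T f" if "s \<in> S"
    using cluster_down[OF v] br_top[OF v] that unfolding flags_at_eq[OF v] by auto
  show "f = g" if "f \<in> flags_at T v" "g \<in> flags_at T v" "s \<in> br S T f" "s \<in> br S T g"
    using that br_top[OF v] br_down_subset[OF v] br_down_disjoint[OF v] unfolding flags_at_eq[OF v] by auto
qed

lemma card_down: "v \<in> verts T \<Longrightarrow> card (down v) \<ge> 2"
proof -
  assume v: "v \<in> verts T"
  have "card (flags_at T v) \<ge> 3" using stable v by (simp add: stable_tree_def)
  moreover have "finite (flags_at T v)" using finite_flags by (simp add: flags_at_def)
  ultimately show ?thesis
    using top_flag[OF v] by (simp add: down_def)
qed

text \<open>A deepest vertex below \<open>v\<close> meets no edge but its upward one, so stability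
  gives it a white tail; not being the root, it does not carry \<open>w\<close>. At the root a
  second white label is used.\<close>

lemma cluster_white:
  assumes v: "v \<in> verts T"
  shows "\<exists>s\<in>W. s \<in> cluster v"
proof (cases "v = rt")
  case True
  have "card (W - {w}) \<ge> 1"
    using card_W finite_subset[OF W_subset finite_S] w by simp
  then have "W - {w} \<noteq> {}"
    by (metis card.empty not_one_le_zero)
  then show ?thesis
    using True cluster_root W_subset by (auto simp: S0_def)
next
  case False
  let ?B = "{u \<in> verts T. (u, v) \<in> par_rel\<^sup>*}"
  have "finite ?B" "v \<in> ?B" using finite_verts v by auto
  then have "Max (depth ` ?B) \<in> depth ` ?B"
    by (intro Max_in) auto
  moreover have "\<forall>x\<in>?B. depth x \<le> Max (depth ` ?B)"
    using \<open>finite ?B\<close> by (intro ballI Max_ge) auto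
  moreover from \<open>Max (depth ` ?B) \<in> depth ` ?B\<close> obtain u where "Max (depth ` ?B) = depth u" "u \<in> ?B"
    by (rule imageE)
  ultimately have u: "u \<in> ?B" "\<forall>x\<in>?B. depth x \<le> depth u"
    by simp_all
  have un: "u \<in> nonroot"
    using u False root_par_rel by (auto simp: nonroot_def)
  have no_child: "par c \<noteq> u" if "c \<in> nonroot" for c
  proof
    assume "par c = u"
    then have "(c, v) \<in> par_rel\<^sup>*"
      using u(1) par_relI[OF that] by (auto intro: converse_rtrancl_into_rtrancl)
    then have "depth c \<le> depth u" using u(2) nonroot[OF that] by auto
    then show False using depth_par[OF that] \<open>par c = u\<close> by simp
  qed
  have "e = {up u, iv (up u)}" if e: "e \<in> edges T" "e \<inter> flags_at T u \<noteq> {}" for e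
  proof -
    obtain x where x: "x \<in> nonroot" "e = {up x, iv (up x)}"
      using e(1) unfolding edges_eq by blast
    then have "x = u"
      using e(2) no_child[OF x(1)] bd_up[OF x(1)] by (auto simp: flags_at_def par_def)
    then show ?thesis using x by simp
  qed
  then have "{e \<in> edges T. e \<inter> flags_at T u \<noteq> {}} \<subseteq> {{up u, iv (up u)}}"
    by blast
  then have "card {e \<in> edges T. e \<inter> flags_at T u \<noteq> {}} \<le> card {{up u, iv (up u)}}"
    by (intro card_mono) auto
  then have "\<exists>s\<in>W. bd (tail T s) = u"
    using stable nonroot[OF un] by (simp add: stable_tree_def)
  then obtain s where s: "s \<in> W" "bd (tail T s) = u" by blast
  moreover have "s \<noteq> w" using s nonroot[OF un] by auto
  ultimately have "s \<in> cluster v"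
    using u(1) W_subset by (auto simp: cluster_def S0_iff)
  then show ?thesis using s by blast
qed

lemma br_nonempty:
  assumes v: "v \<in> verts T" and f: "f \<in> flags_at T v"
  shows "br S T f \<noteq> {}"
proof (cases "f = top v")
  case True
  then show ?thesis
    using br_top[OF v] w_in_S cluster_subset[of v] by (auto simp: S0_iff)
next
  case False
  then have "f \<in> down v" using f by (simp add: down_def)
  with v show ?thesis
  proof (cases rule: down_cases)
    case (edge c)
    then show ?thesis using cluster_white[of c] nonroot[of c] by auto
  qed auto
qed

lemma other_down:
  assumes v: "v \<in> verts T"
  shows "\<exists>g\<in>down v. g \<noteq> f"
proof (rule ccontr)
  assume "\<not> ?thesis"
  then have "down v \<subseteq> {f}" by blast
  then have "card (down v) \<le> card {f}" by (intro card_mono) auto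
  then show False using card_down[OF v] by simp
qed

lemma br_down_psubset:
  assumes v: "v \<in> verts T" and f: "f \<in> down v"
  shows "br S T f \<subset> cluster v"
proof -
  obtain g where g: "g \<in> down v" "g \<noteq> f" using other_down[OF v] by blast
  then obtain s where s: "s \<in> br S T g" using br_nonempty[OF v, of g] by (auto simp: down_def)
  then have "s \<in> cluster v" "s \<notin> br S T f"
    using br_down_subset[OF v g(1)] br_down_disjoint[OF v f g(1)] g(2) by auto
  then show ?thesis using br_down_subset[OF v f] by blast
qed

lemma cluster_strict:
  assumes "(u, v) \<in> par_rel\<^sup>+"
  shows "cluster u \<subset> cluster v"
proof -
  from tranclD2[OF assms] obtain c where c: "(u, c) \<in> par_rel\<^sup>*" "(c, v) \<in> par_rel" by blast
  then have c': "c \<in> nonroot" "v = par c" by (auto dest: par_relD)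
  then have "cluster c \<subset> cluster v"
    using br_down_psubset[OF par_verts iv_up_down] br_iv_up by metis
  then show ?thesis using cluster_mono[OF c(1)] by blast
qed

lemma cluster_linear:
  assumes "s \<in> cluster u" "s \<in> cluster v"
  shows "(u, v) \<in> par_rel\<^sup>* \<or> (v, u) \<in> par_rel\<^sup>*"
  using assms par_rel_linear by (auto simp: cluster_def)

text \<open>Clusters are nonempty, so inclusion makes the vertices comparable, and the wrong order
  is excluded by \<open>cluster_strict\<close>. The tree order is thus inclusion of
  clusters.\<close>

lemma cluster_subset_iff:
  assumes "u \<in> verts T" "v \<in> verts T"
  shows "cluster u \<subseteq> cluster v \<longleftrightarrow> (u, v) \<in> par_rel\<^sup>*"
proof
  assume sub: "cluster u \<subseteq> cluster v"
  obtain s where s: "s \<in> cluster u" using cluster_white[OF assms(1)] by blast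
  then have "(u, v) \<in> par_rel\<^sup>* \<or> (v, u) \<in> par_rel\<^sup>*"
    using sub cluster_linear by blast
  then show "(u, v) \<in> par_rel\<^sup>*"
    using cluster_strict[of v u] sub by (auto simp: rtrancl_eq_or_trancl)
qed (rule cluster_mono)

lemma cluster_inj: "u \<in> verts T \<Longrightarrow> v \<in> verts T \<Longrightarrow> cluster u = cluster v \<Longrightarrow> u = v"
  using cluster_subset_iff[of u v] cluster_subset_iff[of v u] par_rel_antisym[of u v]
  by (auto simp: rtrancl_eq_or_trancl)

lemma cluster_psubset_iff:
  assumes "u \<in> verts T" "v \<in> verts T"
  shows "cluster u \<subset> cluster v \<longleftrightarrow> (u, v) \<in> par_rel\<^sup>+"
proof
  assume "cluster u \<subset> cluster v"
  then show "(u, v) \<in> par_rel\<^sup>+"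
    using cluster_subset_iff[OF assms] by (auto simp: rtrancl_eq_or_trancl)
qed (rule cluster_strict)

lemma finite_cluster: "finite (cluster v)"
  using finite_S by (simp add: cluster_def S0_def)

lemma card_cluster:
  assumes v: "v \<in> verts T"
  shows "card (cluster v) \<ge> 2"
proof -
  obtain f where f: "f \<in> down v" using other_down[OF v] by blast
  obtain s where "s \<in> br S T f" using br_nonempty[OF v, of f] f by (auto simp: down_def)
  moreover obtain t where "t \<in> cluster v" "t \<notin> br S T f" using br_down_psubset[OF v f] by blast
  ultimately have "{s, t} \<subseteq> cluster v" "s \<noteq> t" using br_down_subset[OF v f] by auto
  then have "card {s, t} \<le> card (cluster v)" by (intro card_mono finite_cluster)
  then show ?thesis using \<open>s \<noteq> t\<close> by simp
qed

lemma cluster_split: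
  assumes v: "v \<in> nonroot"
  shows "{cluster v, S - cluster v} \<in> splits S W" "cl {cluster v, S - cluster v} = cluster v"
proof -
  have vT: "v \<in> verts T" using nonroot[OF v] by simp
  show "cl {cluster v, S - cluster v} = cluster v"
    by (rule cl_pair[OF cluster_subset])
  have "(v, rt) \<in> par_rel\<^sup>+"
    using par_rel_root[OF vT] nonroot[OF v] by (auto simp: rtrancl_eq_or_trancl)
  then have "cluster v \<subset> S0"
    using cluster_strict cluster_root by metis
  then obtain t where t: "t \<in> S0" "t \<notin> cluster v" by blast
  then have "{t, w} \<subseteq> S - cluster v" "t \<noteq> w"
    using w_in_S cluster_subset[of v] by (auto simp: S0_iff)
  then have "card {t, w} \<le> card (S - cluster v)"
    using finite_S by (intro card_mono) auto
  then have "card (S - cluster v) \<ge> 2" using \<open>t \<noteq> w\<close> by simp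
  moreover have "cluster v \<inter> W \<noteq> {}" using cluster_white[OF vT] by blast
  ultimately show "{cluster v, S - cluster v} \<in> splits S W"
    unfolding splits_iff using card_cluster[OF vT] cluster_subset by blast
qed

section \<open>Flags and vertices read off from the 2-partitions\<close>

abbreviation "tree_splits \<equiv> splits_of S T"

lemmas tree_splits_def = splits_of_def

lemma tree_splits_eq: "tree_splits = (\<lambda>v. {cluster v, S - cluster v}) ` nonroot"
  unfolding tree_splits_def edges_eq image_image by (intro image_cong) (simp_all add: edge_partition_up)

lemma cl_tree_splits: "cl ` tree_splits = cluster ` nonroot"
  unfolding tree_splits_eq image_image using cluster_split(2) by (intro image_cong) simp_all

lemma edge_partition_inj: "inj_on (edge_partition S T) (edges T)"
proof (rule inj_onI)
  fix e e' assume e: "e \<in> edges T" "e' \<in> edges T" "edge_partition S T e = edge_partition S T e'"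
  then obtain u v where uv: "u \<in> nonroot" "v \<in> nonroot" "e = {up u, iv (up u)}" "e' = {up v, iv (up v)}"
    unfolding edges_eq by blast
  then have "{cluster u, S - cluster u} = {cluster v, S - cluster v}"
    using e(3) edge_partition_up by simp
  then have "cluster u = cluster v"
    using cluster_split(2) uv by metis
  then show "e = e'"
    using cluster_inj uv nonroot by metis
qed

lemma face_tree_splits: "face tree_splits"
  unfolding face_def
proof (intro conjI ballI impI subsetI)
  fix \<sigma> assume "\<sigma> \<in> tree_splits"
  then show "\<sigma> \<in> splits S W" using cluster_split(1) by (auto simp: tree_splits_eq)
next
  fix \<sigma> \<tau> assume "\<sigma> \<in> tree_splits" "\<tau> \<in> tree_splits"
  then obtain u v where uv: "u \<in> nonroot" "v \<in> nonroot"
    "\<sigma> = {cluster u, S - cluster u}" "\<tau> = {cluster v, S - cluster v}"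
    by (auto simp: tree_splits_eq)
  have "cluster u \<subseteq> cluster v \<or> cluster v \<subseteq> cluster u \<or> cluster u \<inter> cluster v = {}"
    using cluster_linear[of _ u v] cluster_mono by blast
  then show "compatible \<sigma> \<tau>"
    unfolding compatible_cl[OF cluster_split(1)[OF uv(1), folded uv(3)] cluster_split(1)[OF uv(2), folded uv(4)]]
    unfolding uv(3,4) cluster_split(2)[OF uv(1)] cluster_split(2)[OF uv(2)] .
qed

lemma cluster_subset_S: "cluster v \<subseteq> S"
  using cluster_subset S0_iff by blast

lemma down_or_top: "f \<in> flags T \<Longrightarrow> f = top (bd f) \<or> f \<in> down (bd f)"
  by (auto simp: down_def flags_at_def)

lemma w_notin_cluster: "w \<notin> cluster v"
  using cluster_subset S0_iff by blast

lemma w_in_br_iff: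
  assumes "f \<in> flags T"
  shows "w \<in> br S T f \<longleftrightarrow> f = top (bd f)"
  using down_or_top[OF assms] br_top[OF bd_verts[OF assms]] br_down_subset[OF bd_verts[OF assms]]
    w_notin_cluster w_in_S by (auto simp: down_def)

lemma cluster_bd_top:
  assumes "f \<in> flags T" "w \<in> br S T f"
  shows "cluster (bd f) = S - br S T f"
proof -
  have "br S T f = S - cluster (bd f)"
    using assms w_in_br_iff[OF assms(1)] br_top[OF bd_verts[OF assms(1)]] by simp
  then show ?thesis using cluster_subset_S by auto
qed

text \<open>Recovers the vertex of a flag from its branch: the cluster there is the least one
  properly containing the branch. For a tail this uses that clusters have at least two
  elements.\<close>

lemma cluster_bd_down:
  assumes f: "f \<in> flags T" "w \<notin> br S T f" and u: "u \<in> verts T"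
  shows "cluster (bd f) \<subseteq> cluster u \<longleftrightarrow> br S T f \<subset> cluster u"
proof -
  have v: "bd f \<in> verts T" using bd_verts f by simp
  have "f \<in> down (bd f)" using down_or_top[OF f(1)] w_in_br_iff[OF f(1)] f(2) by blast
  with v show ?thesis
  proof (cases rule: down_cases)
    case (edge c)
    have "cluster (bd f) \<subseteq> cluster u \<longleftrightarrow> (c, u) \<in> par_rel\<^sup>+"
      using edge(1,2) cluster_subset_iff[OF v u] par_rel_trancl_iff by simp
    then show ?thesis
      using edge(1,4) cluster_psubset_iff[of c u] nonroot u by simp
  next
    case (tail s)
    have "cluster (bd f) \<subseteq> cluster u \<longleftrightarrow> s \<in> cluster u"
      using tail(1,3) cluster_subset_iff[OF v u] by (simp add: cluster_def)
    also have "\<dots> \<longleftrightarrow> {s} \<subset> cluster u"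
    proof -
      have "cluster u \<noteq> {s}"
      proof
        assume "cluster u = {s}"
        then show False using card_cluster[OF u] by simp
      qed
      then show ?thesis by blast
    qed
    finally show ?thesis unfolding tail(4) .
  qed
qed

text \<open>A branch determines the cluster of its vertex, as its complement if it contains
  \<open>w\<close> and by \<open>cluster_bd_down\<close> otherwise; flags at one vertex have
  disjoint nonempty branches.\<close>

lemma br_inj: "inj_on (br S T) (flags T)"
proof (rule inj_onI)
  fix f g assume fg: "f \<in> flags T" "g \<in> flags T" "br S T f = br S T g"
  have v: "bd f \<in> verts T" "bd g \<in> verts T" using fg bd_verts by auto
  show "f = g"
  proof (cases "w \<in> br S T f")
    case True
    then have "bd f = bd g"
      using cluster_inj[OF v] cluster_bd_top fg by metis
    then show ?thesis using True w_in_br_iff fg by metis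
  next
    case False
    then have "cluster (bd f) \<subseteq> cluster u \<longleftrightarrow> cluster (bd g) \<subseteq> cluster u" if "u \<in> verts T" for u
      using cluster_bd_down that fg by metis
    then have "bd f = bd g"
      using cluster_inj[OF v] v by blast
    moreover obtain s where "s \<in> br S T f"
      using br_nonempty[OF v(1), of f] fg by (auto simp: flags_at_def)
    ultimately show ?thesis
      using br_disjoint[OF v(1), of f g s] fg by (auto simp: flags_at_def)
  qed
qed

lemma half_cases:
  assumes "half f"
  obtains v where "v \<in> nonroot" "f = up v" | v where "v \<in> nonroot" "f = iv (up v)"
proof -
  have "iv (iv f) = f" using assms by (simp add: half_def)
  then show thesis using half_edge_cases[OF assms] that by metis
qed

lemma br_half:
  assumes "half f"
  shows br_iv: "br S T (iv f) = S - br S T f"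
    and edge_partition_half: "edge_partition S T {f, iv f} = {br S T f, S - br S T f}"
    and br_half_subset: "br S T f \<subseteq> S"
    and card_br_half: "card (br S T f) \<ge> 2"
proof -
  have *: "S - (S - cluster v) = cluster v" for v
    using cluster_subset_S by blast
  have c: "card (S - cluster v) \<ge> 2" "card (cluster v) \<ge> 2" if "v \<in> nonroot" for v
    using cl_props[OF cluster_split(1)[OF that]] cluster_split(2)[OF that] by simp_all
  from assms show "br S T (iv f) = S - br S T f" "edge_partition S T {f, iv f} = {br S T f, S - br S T f}"
    "br S T f \<subseteq> S" "card (br S T f) \<ge> 2"
    by (cases rule: half_cases;
        simp add: br_up br_iv_up up_flags edge_partition_up insert_commute cluster_subset_S * c)+
qed

lemma half_iff_card: "f \<in> flags T \<Longrightarrow> half f \<longleftrightarrow> card (br S T f) \<ge> 2"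
  using card_br_half[of f] br_tail by (auto simp: half_def elim!: tailE)

lemma tree_splits_half: "tree_splits = {{br S T f, S - br S T f} | f. half f}"
proof (intro equalityI subsetI)
  fix \<sigma> assume "\<sigma> \<in> tree_splits"
  then obtain v where v: "v \<in> nonroot" "\<sigma> = {cluster v, S - cluster v}"
    unfolding tree_splits_eq by blast
  then have "\<sigma> = {br S T (up v), S - br S T (up v)}"
    using br_up cluster_subset_S[of v] by (simp add: double_diff insert_commute)
  then show "\<sigma> \<in> {{br S T f, S - br S T f} | f. half f}"
    using half_up[OF v(1)] by blast
next
  fix \<sigma> assume "\<sigma> \<in> {{br S T f, S - br S T f} | f. half f}"
  then obtain f where "half f" "\<sigma> = {br S T f, S - br S T f}" by blast
  then have "\<sigma> = edge_partition S T {f, iv f}" "{f, iv f} \<in> edges T"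
    using edge_partition_half by (auto simp: edges_def half_def)
  then show "\<sigma> \<in> tree_splits"
    unfolding tree_splits_def by blast
qed

text \<open>The set of branches depends on the 2-partitions alone, which allows the flags of two
  trees to be matched.\<close>

lemma br_flags: "br S T ` flags T = (\<lambda>s. {s}) ` S \<union> \<Union>tree_splits"
proof (intro equalityI subsetI)
  fix A assume "A \<in> br S T ` flags T"
  then obtain f where f: "f \<in> flags T" "A = br S T f" by blast
  show "A \<in> (\<lambda>s. {s}) ` S \<union> \<Union>tree_splits"
  proof (cases "half f")
    case True
    then show ?thesis using f unfolding tree_splits_half by blast
  next
    case False
    then obtain s where "s \<in> S" "f = tail T s" using f by (auto simp: half_def elim: tailE)
    then show ?thesis using f br_tail by simp
  qed
next
  fix A assume "A \<in> (\<lambda>s. {s}) ` S \<union> \<Union>tree_splits"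
  then consider s where "s \<in> S" "A = {s}" | f where "half f" "A = br S T f \<or> A = S - br S T f"
    unfolding tree_splits_half by blast
  then show "A \<in> br S T ` flags T"
  proof cases
    case 1
    then show ?thesis using tail_flags br_tail by (intro image_eqI[of _ _ "tail T s"]) auto
  next
    case 2
    then have "A = br S T f \<or> A = br S T (iv f)" "f \<in> flags T" "iv f \<in> flags T"
      using br_iv half_iv[of f] by (auto simp: half_def)
    then show ?thesis by blast
  qed
qed

lemma clusters_tree_splits: "clusters tree_splits = cluster ` verts T"
proof -
  have "verts T = insert rt nonroot"
    using root by (auto simp: nonroot_def)
  then show ?thesis
    using cl_tree_splits cluster_root clusters_def[OF face_tree_splits] by simp
qed

lemma side_half:
  assumes "half f"
  shows "{s \<in> S. (f, tail T s) \<in> linked T {} {f, iv f}} = S - br S T f"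
  using assms
proof (cases rule: half_cases)
  case (1 v)
  then show ?thesis
    using edge_sides(1)[OF 1(1)] br_up[OF 1(1)] cluster_subset_S[of v] by (simp add: double_diff)
next
  case (2 v)
  then show ?thesis
    using edge_sides(2)[OF 2(1)] br_iv_up[OF 2(1)] up_flags[OF 2(1)] by (simp add: insert_commute)
qed

end


section \<open>Recovering a tree from its 2-partitions\<close>

locale tree_pair = A: stable_rooted_tree S W w K T + B: stable_rooted_tree S W w K T'
  for S W :: "'a set" and w :: 'a and K :: "'k::{comm_ring,monoid_mult} itself"
    and T T' :: "'a lgraph"
begin

definition flag_map :: "nat \<Rightarrow> nat" where
  "flag_map f = inv_into (flags T') (br S T') (br S T f)"

text \<open>The vertex of \<open>T\<close> with the least cluster containing that of
  \<open>v'\<close>. If \<open>T'\<close> has all 2-partitions of \<open>T\<close>, this is the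
  contraction of the extra edges.\<close>

definition vertex_map :: "nat \<Rightarrow> nat" where
  "vertex_map v' = (SOME v. v \<in> verts T \<and> (\<forall>u\<in>verts T. B.cluster v' \<subseteq> A.cluster u \<longleftrightarrow> A.cluster v \<subseteq> A.cluster u))"

lemma vertex_map:
  assumes v': "v' \<in> verts T'"
  shows vertex_map_verts: "vertex_map v' \<in> verts T"
    and vertex_map_iff: "u \<in> verts T \<Longrightarrow> B.cluster v' \<subseteq> A.cluster u \<longleftrightarrow> A.cluster (vertex_map v') \<subseteq> A.cluster u"
proof -
  obtain x where x: "x \<in> B.cluster v'" using B.cluster_white[OF v'] by blast
  have "\<exists>C\<in>A.clusters A.tree_splits. B.cluster v' \<subseteq> C \<and>
      (\<forall>D\<in>A.clusters A.tree_splits. B.cluster v' \<subseteq> D \<longrightarrow> C \<subseteq> D)"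
    using x B.cluster_subset
    by (intro A.least_cluster[OF A.face_tree_splits, of "\<lambda>C. B.cluster v' \<subseteq> C" x]) auto
  then obtain v where v: "v \<in> verts T" "B.cluster v' \<subseteq> A.cluster v"
    "\<forall>u\<in>verts T. B.cluster v' \<subseteq> A.cluster u \<longrightarrow> A.cluster v \<subseteq> A.cluster u"
    unfolding A.clusters_tree_splits by auto
  then have "v \<in> verts T \<and> (\<forall>u\<in>verts T. B.cluster v' \<subseteq> A.cluster u \<longleftrightarrow> A.cluster v \<subseteq> A.cluster u)"
    by blast
  from someI[of "\<lambda>v. v \<in> verts T \<and> (\<forall>u\<in>verts T. B.cluster v' \<subseteq> A.cluster u \<longleftrightarrow> A.cluster v \<subseteq> A.cluster u)", OF this]
  show "vertex_map v' \<in> verts T"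
    "u \<in> verts T \<Longrightarrow> B.cluster v' \<subseteq> A.cluster u \<longleftrightarrow> A.cluster (vertex_map v') \<subseteq> A.cluster u"
    unfolding vertex_map_def by blast+
qed

lemma vertex_map_eqI:
  assumes "v' \<in> verts T'" "v \<in> verts T" "\<And>u. u \<in> verts T \<Longrightarrow> B.cluster v' \<subseteq> A.cluster u \<longleftrightarrow> A.cluster v \<subseteq> A.cluster u"
  shows "vertex_map v' = v"
proof (rule A.cluster_inj)
  show "A.cluster (vertex_map v') = A.cluster v"
    using vertex_map_iff[OF assms(1)] vertex_map_verts[OF assms(1)] assms(2,3) by blast
qed (use assms vertex_map_verts in auto)

lemma vertex_map_cluster:
  assumes "v' \<in> verts T'" "v \<in> verts T" "B.cluster v' = A.cluster v"
  shows "vertex_map v' = v"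
  by (rule vertex_map_eqI) (use assms in auto)

text \<open>A map of flags compatible with the incidences away from the image of each single edge preserves
  branches: it maps each side of an edge into a side, and sides are complementary.\<close>

lemma br_transport:
  fixes h :: "nat \<Rightarrow> nat"
  assumes h: "\<And>f. f \<in> flags T \<Longrightarrow> h f \<in> flags T'" "inj_on h (flags T)"
    "\<And>f. f \<in> flags T \<Longrightarrow> invol T' (h f) = h (invol T f)"
    "\<And>s. s \<in> S \<Longrightarrow> h (tail T s) = tail T' s"
    and adj: "\<And>f g e. f \<in> flags T \<Longrightarrow> g \<in> flags T \<Longrightarrow> bnd T f = bnd T g \<Longrightarrow> e \<subseteq> flags T \<Longrightarrow>
      (h f, h g) \<in> linked T' {} (h ` e)"
    and f: "A.half f"
  shows "B.half (h f)" "br S T' (h f) = br S T f"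
proof -
  have ff: "f \<in> flags T" "invol T f \<in> flags T" "invol T f \<noteq> f"
    using f A.iv_flags by (auto simp: A.half_def)
  then have "h (invol T f) \<noteq> h f" using h(2) by (meson inj_onD)
  then show half: "B.half (h f)"
    using h ff by (simp add: B.half_def)
  have lk: "(h x, h y) \<in> linked T' {} (h ` e)" if "(x, y) \<in> linked T {} e" "e \<subseteq> flags T" for x y e
    using that(1) unfolding A.linked_eq
  proof (induction rule: rtrancl_induct)
    case base
    then show ?case by (simp add: B.linked_eq)
  next
    case (step y z)
    have "(h y, h z) \<in> linked T' {} (h ` e)"
    proof (cases "bnd T y = bnd T z")
      case True
      then show ?thesis using step.hyps(2) adj that(2) by (simp add: A.link_rel_def)
    next
      case False
      then have yz: "y \<in> flags T" "z = invol T y" "y \<notin> e" using step.hyps(2) by (auto simp: A.link_rel_def)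
      then have "h y \<notin> h ` e" using h(2) that(2) by (auto dest: inj_onD)
      then show ?thesis
        using B.linked_edge[of "h y"] h(1,3) yz by simp
    qed
    then show ?case using step.IH B.linked_trans by blast
  qed
  have sub: "S - br S T g \<subseteq> S - br S T' (h g)" if g: "A.half g" for g
  proof -
    have gf: "g \<in> flags T" "invol T g \<in> flags T" using g A.iv_flags by (auto simp: A.half_def)
    then have "h (invol T g) \<noteq> h g" using h(2) g by (metis A.half_def inj_onD)
    then have hg: "B.half (h g)" using h gf by (simp add: B.half_def)
    have "h ` {g, invol T g} = {h g, invol T' (h g)}" using h gf by simp
    then have "{s \<in> S. (g, tail T s) \<in> linked T {} {g, invol T g}} \<subseteq>
        {s \<in> S. (h g, tail T' s) \<in> linked T' {} {h g, invol T' (h g)}}"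
      using lk[of g _ "{g, invol T g}"] gf h(4)[symmetric] by auto
    then show ?thesis using A.side_half[OF g] B.side_half[OF hg] by simp
  qed
  have "S - br S T f \<subseteq> S - br S T' (h f)" by (rule sub[OF f])
  moreover have "br S T f \<subseteq> br S T' (h f)"
  proof -
    have "S - br S T (invol T f) = br S T f"
      using A.br_iv[OF f] A.br_half_subset[OF f] by (simp add: double_diff)
    moreover have "S - br S T' (h (invol T f)) = br S T' (h f)"
      using B.br_iv[OF half] B.br_half_subset[OF half] h(3)[OF ff(1)] by (simp add: double_diff)
    ultimately show ?thesis using sub[OF A.half_iv[OF f]] by simp
  qed
  ultimately show "br S T' (h f) = br S T f"
    using A.br_half_subset[OF f] B.br_half_subset[OF half] by blast
qed

lemma tree_iso_imp_splits:
  assumes "tree_iso S T T'"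
  shows "A.tree_splits = B.tree_splits"
proof -
  obtain hV hF where h: "bij_betw hV (verts T) (verts T')" "bij_betw hF (flags T) (flags T')"
    "\<forall>f\<in>flags T. bnd T' (hF f) = hV (bnd T f) \<and> invol T' (hF f) = hF (invol T f)"
    "\<forall>s\<in>S. hF (tail T s) = tail T' s"
    using assms unfolding tree_iso_def by blast
  have hF: "hF f \<in> flags T'" if "f \<in> flags T" for f
    using h(2) that by (auto simp: bij_betw_def)
  have tr: "B.half (hF f)" "br S T' (hF f) = br S T f" if "A.half f" for f
  proof -
    have "B.half (hF f) \<and> br S T' (hF f) = br S T f"
      by (intro conjI br_transport[where h = hF])
        (use h hF that in \<open>auto simp: bij_betw_def intro!: B.linked_vertex\<close>)
    then show "B.half (hF f)" "br S T' (hF f) = br S T f" by auto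
  qed
  have ex: "\<exists>f. A.half f \<and> g = hF f" if "B.half g" for g
  proof -
    have "g \<in> flags T'" "invol T' g \<noteq> g" using that by (auto simp: B.half_def)
    then obtain f where "f \<in> flags T" "g = hF f" using h(2) by (auto simp: bij_betw_def)
    then show ?thesis using h(3) \<open>invol T' g \<noteq> g\<close> by (auto simp: A.half_def)
  qed
  show ?thesis
  proof (intro equalityI subsetI)
    fix \<sigma> assume "\<sigma> \<in> A.tree_splits"
    then obtain f where "A.half f" "\<sigma> = {br S T f, S - br S T f}"
      unfolding A.tree_splits_half by blast
    then show "\<sigma> \<in> B.tree_splits"
      unfolding B.tree_splits_half using tr[of f] by auto
  next
    fix \<sigma> assume "\<sigma> \<in> B.tree_splits"
    then obtain g where g: "B.half g" "\<sigma> = {br S T' g, S - br S T' g}"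
      unfolding B.tree_splits_half by blast
    then obtain f where "A.half f" "g = hF f" using ex by blast
    then show "\<sigma> \<in> A.tree_splits"
      unfolding A.tree_splits_half using tr[of f] g by auto
  qed
qed

text \<open>By \<open>br_transport\<close> the flag map of the contraction preserves branches of
  halves, so the 2-partitions of \<open>T\<close> persist and that of the contracted edge is the
  only new one.\<close>

lemma contracts_imp_splits:
  assumes c: "contracts S T' T e v" and \<sigma>: "\<sigma> = edge_partition S T' e"
  shows "\<sigma> \<notin> A.tree_splits" "B.tree_splits = insert \<sigma> A.tree_splits" "v \<in> verts T"
proof -
  obtain hV hF where e: "e \<in> edges T'" and h: "hV ` verts T' = verts T" "hV ` bnd T' ` e = {v}"
    "\<forall>u\<in>verts T'. \<forall>w\<in>verts T'. hV u = hV w \<longleftrightarrow> u = w \<or> {u, w} \<subseteq> bnd T' ` e"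
    "bij_betw hF (flags T) (flags T' - e)"
    "\<forall>f\<in>flags T. hV (bnd T' (hF f)) = bnd T f \<and> invol T' (hF f) = hF (invol T f)"
    "\<forall>s\<in>S. hF (tail T s) = tail T' s"
    using c unfolding contracts_def by (elim conjE exE) (rule that)
  obtain a where a: "B.half a" "e = {a, invol T' a}"
    using e unfolding edges_def B.half_def by blast
  have af: "a \<in> flags T'" "invol T' a \<in> flags T'" using a B.iv_flags by (auto simp: B.half_def)
  show "v \<in> verts T"
    using h(1,2) af B.bd_verts a(2) by blast
  have hF: "hF f \<in> flags T'" "hF f \<notin> e" if "f \<in> flags T" for f
    using h(4) that by (auto simp: bij_betw_def)
  \<comment> \<open>Flags meeting at the new vertex may come from different ends of
    \<open>e\<close>. They stay linked through \<open>e\<close>, whose halves are outside the image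
    of \<open>hF\<close> and so are never cut.\<close>
  have adj: "(hF f, hF g) \<in> linked T' {} (hF ` E)"
    if "f \<in> flags T" "g \<in> flags T" "bnd T f = bnd T g" "E \<subseteq> flags T" for f g E
  proof -
    have "hV (bnd T' (hF f)) = hV (bnd T' (hF g))" using h(5) that by simp
    then have "bnd T' (hF f) = bnd T' (hF g) \<or> {bnd T' (hF f), bnd T' (hF g)} \<subseteq> bnd T' ` e"
      using h(3) that hF B.bd_verts by metis
    then show ?thesis
    proof
      assume "bnd T' (hF f) = bnd T' (hF g)"
      then show ?thesis using hF that by (intro B.linked_vertex) auto
    next
      assume in_e: "{bnd T' (hF f), bnd T' (hF g)} \<subseteq> bnd T' ` e"
      have e_E: "e \<inter> hF ` E = {}" using hF(2) that(4) by blast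
      have aa: "(x, y) \<in> linked T' {} (hF ` E)" if "x \<in> e" "y \<in> e" for x y
      proof -
        have aE: "a \<notin> hF ` E" "invol T' a \<notin> hF ` E" using e_E a(2) by auto
        have "(a, invol T' a) \<in> linked T' {} (hF ` E)" "(invol T' a, a) \<in> linked T' {} (hF ` E)"
          using B.linked_edge[OF af(1) aE(1)] B.linked_edge[OF af(2) aE(2)] af(1) by simp_all
        moreover have "(z, z) \<in> linked T' {} (hF ` E)" for z by (simp add: B.linked_eq)
        ultimately show ?thesis using that unfolding a(2) by auto
      qed
      obtain x y where xy: "x \<in> e" "y \<in> e" "bnd T' (hF f) = bnd T' x" "bnd T' (hF g) = bnd T' y"
        using in_e by auto
      have "(hF f, x) \<in> linked T' {} (hF ` E)" "(y, hF g) \<in> linked T' {} (hF ` E)"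
        using xy hF that(1,2) af a(2) by (auto intro!: B.linked_vertex)
      then show ?thesis using aa[OF xy(1,2)] B.linked_trans by blast
    qed
  qed
  have tr: "B.half (hF f)" "br S T' (hF f) = br S T f" if "A.half f" for f
  proof -
    have "B.half (hF f) \<and> br S T' (hF f) = br S T f"
      by (intro conjI br_transport[where h = hF])
        (use h hF adj that in \<open>auto simp: bij_betw_def\<close>)
    then show "B.half (hF f)" "br S T' (hF f) = br S T f" by auto
  qed
  have \<sigma>a: "\<sigma> = {br S T' a, S - br S T' a}"
    using \<sigma> a B.edge_partition_half by simp
  show "\<sigma> \<notin> A.tree_splits"
  proof
    assume "\<sigma> \<in> A.tree_splits"
    then obtain f where f: "A.half f" "\<sigma> = {br S T f, S - br S T f}"
      unfolding A.tree_splits_half by blast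
    then have "edge_partition S T' {hF f, invol T' (hF f)} = edge_partition S T' e"
      using B.edge_partition_half[OF tr(1)[OF f(1)]] tr(2)[OF f(1)] \<sigma> by simp
    moreover have "{hF f, invol T' (hF f)} \<in> edges T'"
      using tr(1)[OF f(1)] unfolding edges_def B.half_def by blast
    ultimately have "{hF f, invol T' (hF f)} = e"
      using B.edge_partition_inj e by (meson inj_onD)
    then show False using hF(2)[of f] f(1) by (auto simp: A.half_def)
  qed
  show "B.tree_splits = insert \<sigma> A.tree_splits"
  proof (intro equalityI subsetI)
    fix \<tau> assume "\<tau> \<in> insert \<sigma> A.tree_splits"
    then consider "\<tau> = \<sigma>" | f where "A.half f" "\<tau> = {br S T f, S - br S T f}"
      unfolding A.tree_splits_half by blast
    then show "\<tau> \<in> B.tree_splits"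
    proof cases
      case 1
      then show ?thesis unfolding B.tree_splits_half \<sigma>a using a(1) by blast
    next
      case 2
      then show ?thesis unfolding B.tree_splits_half using tr[of f] by auto
    qed
  next
    fix \<tau> assume "\<tau> \<in> B.tree_splits"
    then obtain g where g: "B.half g" "\<tau> = {br S T' g, S - br S T' g}"
      unfolding B.tree_splits_half by blast
    show "\<tau> \<in> insert \<sigma> A.tree_splits"
    proof (cases "g \<in> e")
      case True
      then have "{g, invol T' g} = e" using a(2) af by auto
      then show ?thesis using g \<sigma> B.edge_partition_half[OF g(1)] by simp
    next
      case False
      then obtain f where f: "f \<in> flags T" "g = hF f"
        using g(1) h(4) by (auto simp: bij_betw_def B.half_def)
      then have "A.half f" using g(1) h(5) by (auto simp: A.half_def B.half_def)
      then show ?thesis using tr[of f] g f unfolding A.tree_splits_half by auto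
    qed
  qed
qed

section \<open>Maps induced by an inclusion of 2-partitions\<close>

context
  assumes sub: "A.tree_splits \<subseteq> B.tree_splits"
begin

lemma flag_map:
  assumes f: "f \<in> flags T"
  shows flag_map_flags: "flag_map f \<in> flags T'" and br_flag_map: "br S T' (flag_map f) = br S T f"
proof -
  have "br S T f \<in> br S T' ` flags T'"
    using imageI[OF f, of "br S T"] Union_mono[OF sub] unfolding A.br_flags B.br_flags by (elim UnE) auto
  then show "flag_map f \<in> flags T'" "br S T' (flag_map f) = br S T f"
    unfolding flag_map_def by (rule inv_into_into, rule f_inv_into_f)
qed

lemma flag_map_eqI: "f \<in> flags T \<Longrightarrow> g \<in> flags T' \<Longrightarrow> br S T' g = br S T f \<Longrightarrow> flag_map f = g"
  using inj_onD[OF B.br_inj, of "flag_map f" g] flag_map[of f] by simp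

lemma flag_map_inj: "inj_on flag_map (flags T)"
  using inj_onD[OF A.br_inj] br_flag_map by (metis inj_onI)

lemma flag_map_tail: "s \<in> S \<Longrightarrow> flag_map (tail T s) = tail T' s"
  by (rule flag_map_eqI) (simp_all add: A.tail_flags B.tail_flags A.br_tail B.br_tail)

text \<open>On branches the involution is complementation, and in both trees the size of a branch
  tells edges from tails.\<close>

lemma flag_map_invol:
  assumes f: "f \<in> flags T"
  shows "invol T' (flag_map f) = flag_map (invol T f)"
proof (cases "A.half f")
  case True
  then have "B.half (flag_map f)"
    using A.half_iff_card[OF f] B.half_iff_card[OF flag_map_flags[OF f]] br_flag_map[OF f] by simp
  then show ?thesis
    using A.br_iv[OF True] B.br_iv br_flag_map[OF f] flag_map_flags[OF f] f
    by (intro flag_map_eqI[symmetric]) (simp_all add: A.iv_flags B.iv_flags)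
next
  case False
  then obtain s where "s \<in> S" "f = tail T s" using f by (auto simp: A.half_def elim: A.tailE)
  then show ?thesis by (simp add: flag_map_tail A.invol_tail B.invol_tail)
qed

lemma cluster_in_B:
  assumes "v \<in> verts T"
  shows "\<exists>v'\<in>verts T'. B.cluster v' = A.cluster v"
proof -
  have "A.clusters A.tree_splits \<subseteq> A.clusters B.tree_splits"
    using sub by (auto simp: A.clusters_def[OF A.face_tree_splits] A.clusters_def[OF B.face_tree_splits])
  then have "A.cluster ` verts T \<subseteq> B.cluster ` verts T'"
    unfolding A.clusters_tree_splits B.clusters_tree_splits .
  then show ?thesis using assms by force
qed

lemma vertex_map_bnd:
  assumes f: "f \<in> flags T"
  shows "vertex_map (bnd T' (flag_map f)) = bnd T f"
proof (rule vertex_map_eqI)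
  fix u assume u: "u \<in> verts T"
  obtain u' where u': "u' \<in> verts T'" "B.cluster u' = A.cluster u" using cluster_in_B[OF u] by blast
  show "B.cluster (bnd T' (flag_map f)) \<subseteq> A.cluster u \<longleftrightarrow> A.cluster (bnd T f) \<subseteq> A.cluster u"
  proof (cases "w \<in> br S T f")
    case True
    then show ?thesis
      using A.cluster_bd_top[OF f] B.cluster_bd_top[OF flag_map_flags[OF f]] br_flag_map[OF f] by simp
  next
    case False
    then have "B.cluster (bnd T' (flag_map f)) \<subseteq> B.cluster u' \<longleftrightarrow> br S T f \<subset> B.cluster u'"
      using B.cluster_bd_down[OF flag_map_flags[OF f] _ u'(1)] br_flag_map[OF f] by simp
    then show ?thesis using A.cluster_bd_down[OF f False u] u'(2) by simp
  qed
qed (use f flag_map_flags A.bd_verts B.bd_verts in auto)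

lemma vertex_map_surj: "vertex_map ` verts T' = verts T"
proof (intro equalityI subsetI)
  fix v assume v: "v \<in> verts T"
  then obtain v' where "v' \<in> verts T'" "B.cluster v' = A.cluster v" using cluster_in_B by blast
  then show "v \<in> vertex_map ` verts T'" using vertex_map_cluster v by force
qed (auto simp: vertex_map_verts)

end

text \<open>Equal 2-partitions give equal sets of branches and of clusters, so both maps are
  bijective; \<open>vertex_map\<close> goes from \<open>T'\<close> to \<open>T\<close> and has to be
  inverted.\<close>

lemma splits_imp_tree_iso:
  assumes eq: "A.tree_splits = B.tree_splits"
  shows "tree_iso S T T'"
proof -
  have sub: "A.tree_splits \<subseteq> B.tree_splits" using eq by simp
  have cl: "A.cluster ` verts T = B.cluster ` verts T'"
    using A.clusters_tree_splits B.clusters_tree_splits eq by simp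
  have "A.cluster (vertex_map v') = B.cluster v'" if v': "v' \<in> verts T'" for v'
  proof -
    have "B.cluster v' \<in> A.cluster ` verts T" using cl v' by simp
    then obtain v where "B.cluster v' = A.cluster v" "v \<in> verts T" by (rule imageE)
    then show ?thesis using vertex_map_cluster[OF v'] by simp
  qed
  then have "inj_on vertex_map (verts T')"
    using B.cluster_inj by (metis inj_onI)
  then have bijV: "bij_betw vertex_map (verts T') (verts T)"
    using vertex_map_surj[OF sub] by (simp add: bij_betw_def)
  have "flag_map ` flags T = flags T'"
  proof (intro equalityI subsetI)
    fix g assume g: "g \<in> flags T'"
    then have "br S T' g \<in> br S T ` flags T"
      using imageI[OF g, of "br S T'"] unfolding A.br_flags B.br_flags eq by simp
    then obtain f where "br S T' g = br S T f" "f \<in> flags T" by (rule imageE)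
    then show "g \<in> flag_map ` flags T" using flag_map_eqI[OF sub _ g] by force
  qed (auto simp: flag_map_flags[OF sub])
  then have bijF: "bij_betw flag_map (flags T) (flags T')"
    using flag_map_inj[OF sub] by (simp add: bij_betw_def)
  have "bnd T' (flag_map f) = inv_into (verts T') vertex_map (bnd T f)" if "f \<in> flags T" for f
    using vertex_map_bnd[OF sub that] inv_into_f_f[OF \<open>inj_on vertex_map (verts T')\<close>]
      B.bd_verts flag_map_flags[OF sub that] by metis
  then show ?thesis
    unfolding tree_iso_def using bij_betw_inv_into[OF bijV] bijF flag_map_invol[OF sub] flag_map_tail[OF sub]
    by blast
qed

lemma tree_iso_iff: "tree_iso S T T' \<longleftrightarrow> A.tree_splits = B.tree_splits"
  using tree_iso_imp_splits splits_imp_tree_iso by blast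

text \<open>The new 2-partition belongs to the edge above the only vertex \<open>x\<close> of
  \<open>T'\<close> whose cluster does not occur in \<open>T\<close>. The ends of this edge have the
  same image, and elsewhere \<open>vertex_map\<close> is injective.\<close>

lemma splits_imp_contracts:
  assumes \<sigma>: "\<sigma> \<notin> A.tree_splits" "B.tree_splits = insert \<sigma> A.tree_splits"
  shows "\<exists>e v. contracts S T' T e v \<and> v \<in> verts T \<and> \<sigma> = edge_partition S T' e"
proof -
  have sub: "A.tree_splits \<subseteq> B.tree_splits" using \<sigma> by blast
  have "\<sigma> \<in> B.tree_splits" using \<sigma> by simp
  then obtain x where x: "x \<in> B.nonroot" "\<sigma> = {B.cluster x, S - B.cluster x}"
    unfolding B.tree_splits_eq by blast
  define e where "e = {B.up x, invol T' (B.up x)}"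
  have e: "e \<in> edges T'" using x(1) unfolding e_def B.edges_eq by blast
  have ep: "edge_partition S T' e = \<sigma>" using B.edge_partition_up[OF x(1)] x(2) by (simp add: e_def)
  have xv: "x \<in> verts T'" "B.par x \<in> verts T'" "B.par x \<noteq> x"
    using B.nonroot[OF x(1)] B.par_verts[OF x(1)] B.par_not_below[OF x(1)] by auto
  have be: "bnd T' ` e = {x, B.par x}"
    using B.bd_up[OF x(1)] by (simp add: e_def B.par_def)
  have x_notin: "A.cluster u \<noteq> B.cluster x" if u: "u \<in> verts T" for u
  proof
    assume eq: "A.cluster u = B.cluster x"
    from A.verts_cases[OF u] show False
    proof
      assume "u = A.rt"
      then have "B.cluster x = B.cluster B.rt" using eq A.cluster_root B.cluster_root by simp
      then show False using B.cluster_inj[OF xv(1) B.root] B.nonroot[OF x(1)] by simp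
    next
      assume "u \<in> A.nonroot"
      then have "\<sigma> \<in> A.tree_splits" unfolding A.tree_splits_eq x(2) using eq by force
      then show False using \<sigma> by simp
    qed
  qed
  have cl: "A.cluster (vertex_map y) = B.cluster y" if y: "y \<in> verts T'" "y \<noteq> x" for y
  proof -
    have "B.cluster y \<in> A.clusters B.tree_splits" using y unfolding B.clusters_tree_splits by simp
    then have "B.cluster y = A.cl \<sigma> \<or> B.cluster y \<in> A.clusters A.tree_splits"
      using A.clusters_def[OF A.face_tree_splits] A.clusters_def[OF B.face_tree_splits] \<sigma>(2) by simp blast
    moreover have "A.cl \<sigma> = B.cluster x" using B.cluster_split(2)[OF x(1)] x(2) by simp
    ultimately have "B.cluster y \<in> A.cluster ` verts T"
      using B.cluster_inj[OF y(1) xv(1)] y(2) unfolding A.clusters_tree_splits by auto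
    then show ?thesis using vertex_map_cluster[OF y(1)] by force
  qed
  \<comment> \<open>No cluster of \<open>T\<close> equals that of \<open>x\<close>, so containing
    the cluster of \<open>x\<close> means containing it properly, that is, containing the cluster of
    its parent.\<close>
  have par_eq: "vertex_map (B.par x) = vertex_map x"
  proof (rule vertex_map_eqI[OF xv(2) vertex_map_verts[OF xv(1)]])
    fix u assume u: "u \<in> verts T"
    obtain u' where u': "u' \<in> verts T'" "B.cluster u' = A.cluster u" using cluster_in_B[OF sub u] by blast
    have "B.cluster (B.par x) \<subseteq> B.cluster u' \<longleftrightarrow> B.cluster x \<subset> B.cluster u'"
      using B.cluster_subset_iff[OF xv(2) u'(1)] B.cluster_psubset_iff[OF xv(1) u'(1)]
        B.par_rel_trancl_iff[OF x(1)] by simp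
    also have "\<dots> \<longleftrightarrow> B.cluster x \<subseteq> A.cluster u"
      using x_notin[OF u] u'(2) by auto
    finally show "B.cluster (B.par x) \<subseteq> A.cluster u \<longleftrightarrow> A.cluster (vertex_map x) \<subseteq> A.cluster u"
      using u'(2) vertex_map_iff[OF xv(1) u] by simp
  qed
  have "flag_map ` flags T = flags T' - e"
  proof (intro equalityI subsetI)
    fix g assume "g \<in> flag_map ` flags T"
    then obtain f where f: "f \<in> flags T" "g = flag_map f" by blast
    have g: "g \<in> flags T'" "br S T' g = br S T f" using f flag_map[OF sub] by auto
    have "g \<notin> e"
    proof
      assume "g \<in> e"
      then have gh: "B.half g" and ge: "e = {g, invol T' g}"
        using B.half_up[OF x(1)] B.half_iv B.up_flags[OF x(1)] by (auto simp: e_def)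
      have "A.half f" using gh A.half_iff_card[OF f(1)] B.half_iff_card[OF g(1)] g(2) by simp
      moreover have "\<sigma> = {br S T f, S - br S T f}"
        using ep ge B.edge_partition_half[OF gh] g(2) by simp
      ultimately have "\<sigma> \<in> A.tree_splits" unfolding A.tree_splits_half by blast
      then show False using \<sigma> by simp
    qed
    then show "g \<in> flags T' - e" using g by simp
  next
    fix g assume g: "g \<in> flags T' - e"
    have "br S T' g \<in> br S T ` flags T"
    proof (cases "B.half g")
      case False
      then obtain s where "s \<in> S" "g = tail T' s" using g by (auto simp: B.half_def elim: B.tailE)
      then show ?thesis unfolding A.br_flags using B.br_tail by simp
    next
      case True
      have ge: "{g, invol T' g} \<in> edges T'" using True unfolding edges_def B.half_def by blast
      have "edge_partition S T' {g, invol T' g} \<in> B.tree_splits"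
        using ge by (simp add: B.tree_splits_def)
      moreover have "edge_partition S T' {g, invol T' g} \<noteq> \<sigma>"
        using inj_onD[OF B.edge_partition_inj _ ge e] ep g by blast
      ultimately have "{br S T' g, S - br S T' g} \<in> A.tree_splits"
        using \<sigma> B.edge_partition_half[OF True] by simp
      then show ?thesis unfolding A.br_flags by blast
    qed
    then obtain f where "f \<in> flags T" "br S T' g = br S T f" by blast
    then show "g \<in> flag_map ` flags T" using flag_map_eqI[OF sub, of f g] g by force
  qed
  then have bijF: "bij_betw flag_map (flags T) (flags T' - e)"
    using flag_map_inj[OF sub] by (simp add: bij_betw_def)
  have fib: "vertex_map u = vertex_map y \<longleftrightarrow> u = y \<or> {u, y} \<subseteq> bnd T' ` e"
    if u: "u \<in> verts T'" and y: "y \<in> verts T'" for u y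
  proof -
    have ne: "vertex_map u = vertex_map y \<longleftrightarrow> u = y" if "u \<in> verts T'" "y \<in> verts T'" "u \<noteq> x" "y \<noteq> x" for u y
      using cl[of u] cl[of y] B.cluster_inj[of u y] that by metis
    have nx: "vertex_map x = vertex_map z \<longleftrightarrow> z = B.par x" if "z \<in> verts T'" "z \<noteq> x" for z
      using ne[OF xv(2) that(1) xv(3) that(2)] par_eq by auto
    show ?thesis
      unfolding be using ne[OF u y] nx[OF u] nx[OF y] by (cases "u = x"; cases "y = x") auto
  qed
  have "contracts S T' T e (vertex_map x)"
    unfolding contracts_def
    using e vertex_map_surj[OF sub] be par_eq fib bijF vertex_map_bnd[OF sub] flag_map_invol[OF sub] flag_map_tail[OF sub]
    by (intro conjI exI[of _ vertex_map] exI[of _ flag_map]) auto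
  then show ?thesis using vertex_map_verts[OF xv(1)] ep by blast
qed

end

section \<open>The tree of a face\<close>

context painted_set
begin

text \<open>The smallest cluster properly containing \<open>Z\<close>, at which the edge or tail of
  \<open>Z\<close> will be attached from below. No cluster contains \<open>w\<close>, whose tail
  belongs to the root; hence the special case.\<close>

definition cover :: "'a set set set \<Rightarrow> 'a set \<Rightarrow> 'a set" where
  "cover F Z = (if Z = {w} then S0
     else (SOME C. C \<in> clusters F \<and> (\<forall>E\<in>clusters F. Z \<subset> E \<longleftrightarrow> C \<subseteq> E)))"

lemma cover:
  assumes F: "face F" and Z: "Z \<subset> S0" "Z \<noteq> {}"
  shows cover_cluster: "cover F Z \<in> clusters F"
    and cover_iff: "E \<in> clusters F \<Longrightarrow> cover F Z \<subseteq> E \<longleftrightarrow> Z \<subset> E"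
proof -
  obtain x where x: "x \<in> Z" using Z by blast
  have Zw: "Z \<noteq> {w}" using Z by (auto simp: S0_def)
  have "\<exists>C\<in>clusters F. Z \<subset> C \<and> (\<forall>E\<in>clusters F. Z \<subset> E \<longrightarrow> C \<subseteq> E)"
    using x Z(1) by (intro least_cluster[OF F, of "\<lambda>C. Z \<subset> C" x]) auto
  then obtain C where "C \<in> clusters F" "Z \<subset> C" "\<forall>E\<in>clusters F. Z \<subset> E \<longrightarrow> C \<subseteq> E"
    by (elim bexE conjE)
  then have "C \<in> clusters F \<and> (\<forall>E\<in>clusters F. Z \<subset> E \<longleftrightarrow> C \<subseteq> E)"
    by blast
  note P = someI[of "\<lambda>C. C \<in> clusters F \<and> (\<forall>E\<in>clusters F. Z \<subset> E \<longleftrightarrow> C \<subseteq> E)", OF this]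
  have eq: "cover F Z = (SOME C. C \<in> clusters F \<and> (\<forall>E\<in>clusters F. Z \<subset> E \<longleftrightarrow> C \<subseteq> E))"
    using Zw by (simp add: cover_def)
  show "cover F Z \<in> clusters F"
    unfolding eq using P by (rule conjunct1)
  show "cover F Z \<subseteq> E \<longleftrightarrow> Z \<subset> E" if "E \<in> clusters F"
    using bspec[OF conjunct2[OF P] that] unfolding eq by (rule sym)
qed

lemma cover_psubset: "face F \<Longrightarrow> Z \<subset> S0 \<Longrightarrow> Z \<noteq> {} \<Longrightarrow> Z \<subset> cover F Z"
  using cover_iff[of F Z "cover F Z"] cover_cluster[of F Z] by blast

lemma cover_w: "cover F {w} = S0"
  by (simp add: cover_def)

end

locale canonical_tree = painted_set S W w K
  for S W :: "'a set" and w :: 'a and K :: "'k::{comm_ring,monoid_mult} itself" +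
  fixes F :: "'a set set set" and enc :: "'a set \<Rightarrow> nat"
  assumes F: "face F" and enc: "inj_on enc (Pow S)"
begin

abbreviation "C0 \<equiv> cl ` F"

text \<open>The vertices are the clusters; \<open>uf A\<close> and \<open>df A\<close> are the halves of the edge above the cluster
  \<open>A\<close>, at \<open>A\<close> itself and at the cluster covering it.\<close>

definition tf :: "'a \<Rightarrow> nat" where "tf s = 3 * enc {s}"
definition uf :: "'a set \<Rightarrow> nat" where "uf A = 3 * enc A + 1"
definition df :: "'a set \<Rightarrow> nat" where "df A = 3 * enc A + 2"

definition dec :: "nat \<Rightarrow> 'a set" where "dec = inv_into (Pow S) enc"

text \<open>The residue modulo 3 tells tails, lower halves and upper halves apart, and division by 3
  recovers the subset, a singleton for a tail. All flags but the lower halves are attached at the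
  cover of their subset.\<close>

definition T :: "'a lgraph" where
  "T = \<lparr>verts = enc ` clusters F, flags = tf ` S \<union> uf ` C0 \<union> df ` C0,
     bnd = (\<lambda>n. let A = dec (n div 3) in enc (if n mod 3 = 1 then A else cover F A)),
     invol = (\<lambda>n. if n mod 3 = 0 then n else if n mod 3 = 1 then n + 1 else n - 1),
     tail = tf\<rparr>"

lemma S0_S: "S0 \<subseteq> S"
  by (auto simp: S0_def)

lemma cluster_S: "A \<in> clusters F \<Longrightarrow> A \<subseteq> S"
  using clusters_subset[OF F] S0_S by blast

lemma C0_cluster: "A \<in> C0 \<Longrightarrow> A \<in> clusters F"
  by (simp add: clusters_def[OF F])

lemma C0_props:
  assumes "A \<in> C0"
  shows "A \<subset> S0" "A \<noteq> {}" "A \<subseteq> S"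
proof -
  obtain \<sigma> where "\<sigma> \<in> F" "A = cl \<sigma>" using assms by blast
  then have "A \<subset> S0" "A \<inter> W \<noteq> {}"
    using cl_props(4,7)[OF F_splits[OF F \<open>\<sigma> \<in> F\<close>]] by simp_all
  then show "A \<subset> S0" "A \<noteq> {}" "A \<subseteq> S" using S0_S by auto
qed

lemma cluster_cases: "A \<in> clusters F \<Longrightarrow> A = S0 \<or> A \<in> C0"
  by (simp add: clusters_def[OF F])

lemma dec_enc: "A \<subseteq> S \<Longrightarrow> dec (enc A) = A"
  by (simp add: dec_def enc)

lemma enc_inj: "A \<subseteq> S \<Longrightarrow> B \<subseteq> S \<Longrightarrow> enc A = enc B \<longleftrightarrow> A = B"
  using inj_onD[OF enc, of A B] by auto

lemma flag_eq:
  "s \<in> S \<Longrightarrow> t \<in> S \<Longrightarrow> tf s = tf t \<longleftrightarrow> s = t"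
  "A \<subseteq> S \<Longrightarrow> B \<subseteq> S \<Longrightarrow> uf A = uf B \<longleftrightarrow> A = B"
  "A \<subseteq> S \<Longrightarrow> B \<subseteq> S \<Longrightarrow> df A = df B \<longleftrightarrow> A = B"
  using enc_inj[of "{s}" "{t}"] enc_inj[of A B] by (auto simp: tf_def uf_def df_def)

lemma flag_neq: "tf s \<noteq> uf A" "tf s \<noteq> df A" "uf A \<noteq> df B" "uf A \<noteq> tf s" "df A \<noteq> tf s" "df B \<noteq> uf A"
  unfolding tf_def uf_def df_def by presburger+

lemma T_simps [simp]:
  "verts T = enc ` clusters F" "flags T = tf ` S \<union> uf ` C0 \<union> df ` C0" "tail T = tf"
  by (simp_all add: T_def)

lemma T_bnd:
  "s \<in> S \<Longrightarrow> bnd T (tf s) = enc (cover F {s})"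
  "A \<in> C0 \<Longrightarrow> bnd T (uf A) = enc A"
  "A \<in> C0 \<Longrightarrow> bnd T (df A) = enc (cover F A)"
proof -
  show "bnd T (tf s) = enc (cover F {s})" if "s \<in> S"
    using that dec_enc[of "{s}"] by (simp add: T_def tf_def)
  assume A: "A \<in> C0"
  have "uf A div 3 = enc A" "uf A mod 3 = 1" "df A div 3 = enc A" "df A mod 3 = 2"
    unfolding uf_def df_def by presburger+
  then show "bnd T (uf A) = enc A" "bnd T (df A) = enc (cover F A)"
    using dec_enc[OF C0_props(3)[OF A]] by (simp_all add: T_def)
qed

lemma T_invol: "invol T (tf s) = tf s" "invol T (uf A) = df A" "invol T (df A) = uf A"
proof -
  have "tf s mod 3 = 0" "uf A mod 3 = 1" "df A mod 3 = 2"
    unfolding tf_def uf_def df_def by presburger+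
  then show "invol T (tf s) = tf s" "invol T (uf A) = df A" "invol T (df A) = uf A"
    by (simp_all add: T_def) (simp_all add: uf_def df_def)
qed

lemma single_props: "s \<in> S0 \<Longrightarrow> {s} \<subset> S0"
  using card_S0[OF F] by (cases "S0 = {s}") auto

lemma cover_single: "s \<in> S \<Longrightarrow> cover F {s} \<in> clusters F"
  using cover_cluster[OF F single_props] cover_w S0_cluster[OF F] by (cases "s = w") (auto simp: S0_def)

lemma cover_C0: "A \<in> C0 \<Longrightarrow> cover F A \<in> clusters F"
  using cover_cluster[OF F C0_props(1,2)] by blast

lemma T_graph: "graph T"
  unfolding graph_def
proof (intro conjI ballI)
  show "finite (verts T)" "finite (flags T)"
    using finite_clusters[OF F] finite_face[OF F] finite_S by simp_all
  fix f assume "f \<in> flags T"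
  then consider s where "s \<in> S" "f = tf s" | A where "A \<in> C0" "f = uf A" | A where "A \<in> C0" "f = df A"
    by auto
  then show "bnd T f \<in> verts T" "invol T f \<in> flags T" "invol T (invol T f) = f"
    by (cases; force simp: T_bnd T_invol cover_single cover_C0 C0_cluster)+
qed

lemma T_connected: "graph_connected T"
proof -
  let ?A = "{(bnd T f, bnd T (invol T f)) | f. f \<in> flags T}"
  have "(enc C, enc S0) \<in> ?A\<^sup>* \<and> (enc S0, enc C) \<in> ?A\<^sup>*" if "C \<in> clusters F" for C
    using that
  proof (induction "card (S0 - C)" arbitrary: C rule: less_induct)
    case less
    show ?case
    proof (cases "C = S0")
      case False
      then have C: "C \<in> C0" using cluster_cases less.prems by blast
      have sub: "C \<subset> cover F C" "cover F C \<in> clusters F"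
        using cover_psubset[OF F C0_props(1,2)[OF C]] cover_C0[OF C] by auto
      have "cover F C \<subseteq> S0" using clusters_subset[OF F sub(2)] .
      then have "S0 - cover F C \<subset> S0 - C" using sub(1) by blast
      then have "card (S0 - cover F C) < card (S0 - C)"
        using finite_S by (intro psubset_card_mono) (auto simp: S0_def)
      then have IH: "(enc (cover F C), enc S0) \<in> ?A\<^sup>*" "(enc S0, enc (cover F C)) \<in> ?A\<^sup>*"
        using less.hyps sub(2) by auto
      have f: "uf C \<in> flags T" "df C \<in> flags T" using C by auto
      have "(bnd T (uf C), bnd T (invol T (uf C))) \<in> ?A" "(bnd T (df C), bnd T (invol T (df C))) \<in> ?A"
        using f by blast+
      then have "(enc C, enc (cover F C)) \<in> ?A" "(enc (cover F C), enc C) \<in> ?A"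
        using C by (simp_all add: T_bnd T_invol)
      then show ?thesis
        using IH by (meson converse_rtrancl_into_rtrancl rtrancl_into_rtrancl)
    qed simp
  qed
  note root = this
  have *: "(enc C, enc E) \<in> ?A\<^sup>*" if "C \<in> clusters F" "E \<in> clusters F" for C E
    by (rule rtrancl_trans[OF conjunct1[OF root[OF that(1)]] conjunct2[OF root[OF that(2)]]])
  show ?thesis
    unfolding graph_connected_def
  proof (intro conjI ballI)
    show "verts T \<noteq> {}" using S0_cluster[OF F] by auto
    fix u v assume "u \<in> verts T" "v \<in> verts T"
    then obtain C E where "C \<in> clusters F" "E \<in> clusters F" "u = enc C" "v = enc E" by auto
    then show "(u, v) \<in> ?A\<^sup>*" using * by simp
  qed
qed

text \<open>At a vertex of a circuit with the smallest cluster, both adjacent edges of the circuit would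
  have to be the edge towards the root.\<close>

lemma T_no_circuit: "\<not> circuit T fs"
proof
  assume c: "circuit T fs"
  let ?n = "length fs"
  have ne: "fs \<noteq> []" and cyc: "\<And>i. i < ?n \<Longrightarrow> bnd T (invol T (fs ! i)) = bnd T (fs ! (Suc i mod ?n))"
    and inv: "\<And>f. f \<in> set fs \<Longrightarrow> invol T f \<notin> set fs"
    using c by (auto simp: circuit_def)
  have fl: "\<exists>A\<in>C0. f = uf A \<or> f = df A" if "f \<in> set fs" for f
  proof -
    have "f \<in> flags T" "f \<notin> tails T" using c that by (auto simp: circuit_def)
    then have "f \<notin> tf ` S" by (auto simp: tails_def T_invol flag_neq)
    then show ?thesis using \<open>f \<in> flags T\<close> by auto
  qed
  define k where "k f = card (dec (bnd T f))" for f
  have "\<exists>f. f \<in> set fs" using ne by (cases fs) auto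
  then obtain f where f: "f \<in> set fs" "\<And>g. g \<in> set fs \<Longrightarrow> k f \<le> k g"
    using ex_has_least_nat[of "\<lambda>f. f \<in> set fs" _ k] by blast
  have k_uf: "k (uf A) = card A" and k_df: "k (df A) = card (cover F A)" and lt: "card A < card (cover F A)"
    if "A \<in> C0" for A
  proof -
    show "k (uf A) = card A" "k (df A) = card (cover F A)"
      using that C0_props(3) cover_C0 cluster_S by (simp_all add: k_def T_bnd dec_enc)
    have "A \<subset> cover F A"
      by (rule cover_psubset[OF F C0_props(1,2)[OF that]])
    moreover have "finite (cover F A)"
      by (rule finite_subset[OF cluster_S[OF cover_C0[OF that]] finite_S])
    ultimately show "card A < card (cover F A)" by (intro psubset_card_mono)
  qed
  obtain i where i: "i < ?n" "fs ! i = f" using f(1) by (metis in_set_conv_nth)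
  have n0: "0 < ?n" using i by linarith
  have next_in: "fs ! (Suc i mod ?n) \<in> set fs"
    using n0 by (intro nth_mem mod_less_divisor)
  define j where "j = (if i = 0 then ?n - 1 else i - 1)"
  have j: "j < ?n" "Suc j mod ?n = i"
    using i n0 by (auto simp: j_def)
  have prev: "fs ! j \<in> set fs" "bnd T (invol T (fs ! j)) = bnd T f"
    using j cyc[OF j(1)] i by auto
  obtain A where A: "A \<in> C0" "f = uf A \<or> f = df A" using fl[OF f(1)] by blast
  \<comment> \<open>Leaving along \<open>df A\<close> would lead down to the smaller cluster
    \<open>A\<close>. Likewise the circuit cannot arrive from below, so it arrives along the reverse
    of \<open>f\<close>.\<close>
  have fA: "f = uf A"
  proof (rule ccontr)
    assume "f \<noteq> uf A"
    then have fd: "f = df A" using A by simp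
    have "bnd T (fs ! (Suc i mod ?n)) = enc A"
      using cyc[OF i(1)] i(2) fd A(1) by (simp add: T_bnd T_invol)
    then have "k (fs ! (Suc i mod ?n)) = card A"
      using C0_props(3)[OF A(1)] by (simp add: k_def dec_enc)
    then show False using f(2)[OF next_in] fd k_df[OF A(1)] lt[OF A(1)] by simp
  qed
  obtain B where B: "B \<in> C0" "fs ! j = uf B \<or> fs ! j = df B" using fl[OF prev(1)] by blast
  show False
  proof (cases "fs ! j = uf B")
    case True
    then have "enc (cover F B) = enc A"
      using prev(2) fA A(1) B(1) by (simp add: T_bnd T_invol)
    then have "cover F B = A"
      using enc_inj cover_C0[OF B(1)] cluster_S C0_props(3)[OF A(1)] by blast
    then show False
      using f(2)[OF prev(1)] True fA k_uf A(1) B(1) lt[OF B(1)] by simp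
  next
    case False
    then have d: "fs ! j = df B" using B by simp
    then have "enc B = enc A"
      using prev(2) fA A(1) B(1) by (simp add: T_bnd T_invol)
    then have "B = A" using enc_inj C0_props(3) A(1) B(1) by blast
    then have "invol T f \<in> set fs" using d fA prev(1) by (simp add: T_invol)
    then show False using inv f(1) by blast
  qed
qed

lemma T_tree: "tree T"
  using T_graph T_connected T_no_circuit by (simp add: tree_def)

lemma T_labelled: "labelled_tree S T"
proof -
  have "tails T = tf ` S"
    by (auto simp: tails_def T_invol flag_neq)
  moreover have "inj_on tf S"
    by (intro inj_onI) (simp add: flag_eq)
  ultimately show ?thesis
    using T_tree by (simp add: labelled_tree_def bij_betw_def)
qed

text \<open>The flag carrying \<open>s\<close> is the upper half over the largest cluster properly
  inside \<open>C\<close> that contains \<open>s\<close>, or the tail of \<open>s\<close> if there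
  is none.\<close>

lemma T_branch:
  assumes C: "C \<in> clusters F" and s: "s \<in> C"
  shows "\<exists>f Z. f \<in> flags T \<and> bnd T f = enc C \<and> s \<in> Z \<and> Z \<subset> C \<and> (f = tf s \<and> Z = {s} \<or> f = df Z \<and> Z \<in> C0)"
proof -
  let ?E = "{A \<in> C0. s \<in> A \<and> A \<subset> C}"
  have CS0: "C \<subseteq> S0" using clusters_subset[OF F C] .
  then have sS: "s \<in> S0" "s \<in> S" using s S0_S by auto
  have cov: "cover F Z = C" if Z: "Z \<subset> S0" "Z \<noteq> {}" "Z \<subset> C" and max: "\<not> (\<exists>A\<in>C0. Z \<subset> A \<and> A \<subset> C)" for Z
  proof -
    have "cover F Z \<subseteq> C" using cover_iff[OF F Z(1,2) C] Z(3) by simp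
    moreover have "\<not> cover F Z \<subset> C"
    proof
      assume lt: "cover F Z \<subset> C"
      then have "cover F Z \<noteq> S0" using CS0 by blast
      then have "cover F Z \<in> C0" using cluster_cases[OF cover_cluster[OF F Z(1,2)]] by blast
      then show False using max lt cover_psubset[OF F Z(1,2)] by blast
    qed
    ultimately show ?thesis by blast
  qed
  show ?thesis
  proof (cases "?E = {}")
    case True
    have ss: "{s} \<subset> S0" using single_props[OF sS(1)] .
    have "C \<noteq> {s}"
    proof
      assume "C = {s}"
      then show False using cluster_props[OF F C] by simp
    qed
    then have sC: "{s} \<subset> C" using s by blast
    have "cover F {s} = C"
      by (rule cov[OF ss _ sC]) (use True in auto)
    then show ?thesis
      using sS sC by (intro exI[of _ "tf s"] exI[of _ "{s}"]) (simp add: T_bnd)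
  next
    case False
    have "finite ?E" using finite_face[OF F] by simp
    from finite_has_maximal[OF this False] obtain A where A: "A \<in> ?E" "\<forall>B\<in>?E. A \<subseteq> B \<longrightarrow> A = B"
      by (rule bexE)
    have A': "A \<in> C0" "s \<in> A" "A \<subset> C" using A(1) by auto
    have "cover F A = C"
    proof (rule cov)
      show "\<not> (\<exists>B\<in>C0. A \<subset> B \<and> B \<subset> C)"
        using A(2) A' by auto
    qed (use A' C0_props in auto)
    then show ?thesis
      using A' by (intro exI[of _ "df A"] exI[of _ A]) (simp add: T_bnd)
  qed
qed

text \<open>A white \<open>s\<close> and a label outside its branch give two downward flags, and the
  flag towards \<open>w\<close> is the third. If a vertex other than the root meets only one edge,
  this is the upward one, so the flag of \<open>s\<close> is a white tail.\<close>

lemma T_stable: "stable_tree S W T"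
  unfolding stable_tree_def
proof (intro conjI ballI impI T_labelled)
  fix v assume "v \<in> verts T"
  then obtain C where C: "C \<in> clusters F" "v = enc C" by auto
  obtain s where s: "s \<in> C" "s \<in> W" using cluster_props[OF F C(1)] by blast
  from T_branch[OF C(1) s(1)] obtain f Z
    where f: "f \<in> flags T" "bnd T f = enc C" "s \<in> Z" "Z \<subset> C" "f = tf s \<and> Z = {s} \<or> f = df Z \<and> Z \<in> C0"
    by blast
  obtain t where t: "t \<in> C" "t \<notin> Z" using f(4) by blast
  from T_branch[OF C(1) t(1)] obtain g Y
    where g: "g \<in> flags T" "bnd T g = enc C" "t \<in> Y" "Y \<subset> C" "g = tf t \<and> Y = {t} \<or> g = df Y \<and> Y \<in> C0"
    by blast
  have st: "s \<in> S" "t \<in> S" "s \<noteq> w" "t \<noteq> w"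
    using s t clusters_subset[OF F C(1)] by (auto simp: S0_def)
  have fg: "f \<noteq> g"
    using f(3,5) g(3,5) t(2) st flag_eq flag_neq C0_props(3) by metis
  define h where "h = (if C = S0 then tf w else uf C)"
  have h: "h \<in> flags T" "bnd T h = enc C"
    using cluster_cases[OF C(1)] w_in_S cover_w by (auto simp: h_def T_bnd)
  have "h \<noteq> f" "h \<noteq> g"
    using f(5) g(5) st w_in_S flag_eq(1) flag_neq by (auto simp: h_def)
  have fin: "finite (flags_at T v)"
    using T_graph by (simp add: graph_def flags_at_def)
  have "{f, g, h} \<subseteq> flags_at T v"
    using f g h C by (auto simp: flags_at_def)
  then have "card {f, g, h} \<le> card (flags_at T v)"
    by (intro card_mono fin)
  then show "3 \<le> card (flags_at T v)"
    using fg \<open>h \<noteq> f\<close> \<open>h \<noteq> g\<close> by simp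
  assume le1: "card {e \<in> edges T. e \<inter> flags_at T v \<noteq> {}} \<le> 1"
  show "\<exists>s\<in>W. bnd T (tail T s) = v"
  proof (cases "C = S0")
    case True
    then show ?thesis using w w_in_S C cover_w by (intro bexI[of _ w]) (simp_all add: T_bnd)
  next
    case False
    then have CC: "C \<in> C0" using cluster_cases C by blast
    show ?thesis
    proof (cases "f = tf s")
      case True
      then show ?thesis using f(2) s C by (intro bexI[of _ s]) simp_all
    next
      case neq: False
      then have fX: "f = df Z" "Z \<in> C0" using f(5) by auto
      let ?E = "{e \<in> edges T. e \<inter> flags_at T v \<noteq> {}}"
      have "finite (edges T)"
        using T_graph by (simp add: graph_def edges_def)
      have e: "{uf A, df A} \<in> edges T" if "A \<in> C0" for A
      proof -
        have "uf A \<in> flags T" "invol T (uf A) = df A" "df A \<noteq> uf A"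
          using that flag_neq by (auto simp: T_invol)
        then show ?thesis unfolding edges_def by (metis (mono_tags, lifting) mem_Collect_eq)
      qed
      have "{uf C, df C} \<inter> flags_at T v \<noteq> {}"
        using CC C by (auto simp: flags_at_def T_bnd)
      moreover have "{uf Z, df Z} \<inter> flags_at T v \<noteq> {}"
        using f(1,2) fX C by (auto simp: flags_at_def)
      ultimately have "{{uf C, df C}, {uf Z, df Z}} \<subseteq> ?E"
        using e CC fX by auto
      then have "card {{uf C, df C}, {uf Z, df Z}} \<le> card ?E"
        using \<open>finite (edges T)\<close> by (intro card_mono) auto
      moreover have "{uf C, df C} \<noteq> {uf Z, df Z}"
        using flag_eq(2)[OF C0_props(3)[OF CC] C0_props(3)[OF fX(2)]] flag_neq f(4) by (auto simp: doubleton_eq_iff)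
      ultimately have "card ?E \<ge> 2" by simp
      then show ?thesis using le1 by simp
    qed
  qed
qed

lemma cover_single_iff:
  assumes s: "s \<in> S" and A: "A \<in> C0"
  shows "cover F {s} \<subseteq> A \<longleftrightarrow> s \<in> A"
proof (cases "s = w")
  case True
  then show ?thesis using C0_props(1)[OF A] cover_w by (auto simp: S0_def)
next
  case False
  then have "s \<in> S0" using s by (simp add: S0_def)
  then have "cover F {s} \<subseteq> A \<longleftrightarrow> {s} \<subset> A"
    using cover_iff[OF F single_props _ C0_cluster[OF A]] by simp
  moreover have "A \<noteq> {s}"
  proof
    assume "A = {s}"
    then show False using cluster_props[OF F C0_cluster[OF A]] by simp
  qed
  ultimately show ?thesis by blast
qed

text \<open>Cutting the edge of \<open>A\<close> separates the flags at clusters inside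
  \<open>A\<close> from all others, since any other edge joins two clusters that are both inside
  \<open>A\<close> or both not.\<close>

lemma T_splits: "splits_of S T = F"
proof -
  interpret R: stable_rooted_tree S W w K T
    by unfold_locales (rule T_stable)
  have cov: "cover F B \<subseteq> A \<longleftrightarrow> B \<subset> A" if "A \<in> C0" "B \<in> C0" for A B
    using cover_iff[OF F C0_props(1,2)[OF that(2)] C0_cluster[OF that(1)]] .
  have half: "R.half f \<longleftrightarrow> f \<in> uf ` C0 \<union> df ` C0" for f
    unfolding R.half_def by (auto simp: T_invol flag_neq)
  have br: "br S T (uf A) = S - A" if A: "A \<in> C0" for A
  proof -
    have h: "R.half (uf A)" "R.half (df A)" using half A by auto
    have iv: "invol T (uf A) = df A" "invol T (df A) = uf A" by (simp_all add: T_invol)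
    let ?Y = "{uf A, df A}"
    have fl: "f \<in> flags T \<Longrightarrow> (\<exists>s\<in>S. f = tf s) \<or> (\<exists>B\<in>C0. f = uf B) \<or> (\<exists>B\<in>C0. f = df B)" for f by auto
    let ?in = "\<lambda>f. dec (bnd T f) \<subseteq> A"
    have dec: "dec (bnd T (tf s)) = cover F {s}" if "s \<in> S" for s
      using that by (simp add: T_bnd dec_enc cluster_S cover_single)
    have dec': "dec (bnd T (uf B)) = B" "dec (bnd T (df B)) = cover F B" if "B \<in> C0" for B
      using that by (simp_all add: T_bnd dec_enc cluster_S cover_C0 C0_props)
    have cross: "?in f \<longleftrightarrow> ?in (invol T f)" if f: "f \<in> flags T" "f \<notin> ?Y" for f
    proof -
      consider s where "s \<in> S" "f = tf s" | B where "B \<in> C0" "f = uf B \<or> f = df B"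
        using fl[OF f(1)] by blast
      then show ?thesis
      proof cases
        case 1
        then show ?thesis by (simp add: T_invol)
      next
        case 2
        then have "B \<noteq> A" using f(2) by auto
        then have "cover F B \<subseteq> A \<longleftrightarrow> B \<subseteq> A" using cov[OF A 2(1)] by auto
        then show ?thesis using 2 by (auto simp: T_invol dec')
      qed
    qed
    have 1: "S - br S T (uf A) \<subseteq> A"
    proof
      fix s assume "s \<in> S - br S T (uf A)"
      then have s: "s \<in> S" "(uf A, tf s) \<in> linked T {} ?Y"
        using R.side_half[OF h(1)] iv by auto
      have "tf s \<in> {f. ?in f}"
        using s(2) by (rule R.linked_closed) (use A dec' cross in auto)
      then show "s \<in> A" using dec[OF s(1)] cover_single_iff[OF s(1) A] by simp
    qed
    have 2: "S - br S T (df A) \<subseteq> S - A"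
    proof
      fix s assume "s \<in> S - br S T (df A)"
      then have s: "s \<in> S" "(df A, tf s) \<in> linked T {} ?Y"
        using R.side_half[OF h(2)] iv by (auto simp: insert_commute)
      have "tf s \<in> {f. \<not> ?in f}"
        using s(2) by (rule R.linked_closed) (use A dec' cross cov[OF A A] in auto)
      then show "s \<in> S - A" using dec[OF s(1)] cover_single_iff[OF s(1) A] s(1) by simp
    qed
    have "br S T (df A) = S - br S T (uf A)" using R.br_iv[OF h(1)] iv by simp
    then show ?thesis using 1 2 R.br_half_subset[OF h(1)] C0_props(3)[OF A] by auto
  qed
  have to_C0: "R.half f \<Longrightarrow> \<exists>A\<in>C0. {br S T f, S - br S T f} = {A, S - A}" for f
  proof -
    assume f: "R.half f"
    then obtain A where A: "A \<in> C0" "f = uf A \<or> f = df A" using half by auto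
    have h: "R.half (uf A)" using half A by auto
    have "br S T (df A) = A" "br S T (uf A) = S - A" "S - (S - A) = A"
      using R.br_iv[OF h] br[OF A(1)] C0_props(3)[OF A(1)] by (simp_all add: T_invol double_diff)
    then have "{br S T f, S - br S T f} = {A, S - A}" using A(2) by auto
    then show ?thesis using A(1) by blast
  qed
  have from_C0: "\<exists>f. R.half f \<and> {A, S - A} = {br S T f, S - br S T f}" if A: "A \<in> C0" for A
  proof (intro exI conjI)
    show "R.half (uf A)" using half A by auto
    show "{A, S - A} = {br S T (uf A), S - br S T (uf A)}"
      using br[OF A] C0_props(3)[OF A] by (auto simp: double_diff)
  qed
  have "splits_of S T = (\<lambda>A. {A, S - A}) ` C0"
  proof (intro equalityI subsetI)
    fix \<sigma> assume "\<sigma> \<in> splits_of S T"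
    then obtain f where f: "\<sigma> = {br S T f, S - br S T f}" "R.half f"
      unfolding R.tree_splits_half mem_Collect_eq by (elim exE conjE)
    from to_C0[OF f(2)] obtain A where "A \<in> C0" "{br S T f, S - br S T f} = {A, S - A}"
      by (rule bexE)
    then show "\<sigma> \<in> (\<lambda>A. {A, S - A}) ` C0"
      unfolding f(1) by (intro image_eqI[of _ _ A])
  next
    fix \<sigma> assume "\<sigma> \<in> (\<lambda>A. {A, S - A}) ` C0"
    then obtain A where A: "\<sigma> = {A, S - A}" "A \<in> C0" by (rule imageE)
    from from_C0[OF A(2)] obtain f where "R.half f" "{A, S - A} = {br S T f, S - br S T f}"
      by (elim exE conjE)
    then show "\<sigma> \<in> splits_of S T"
      unfolding R.tree_splits_half mem_Collect_eq A(1) by (intro exI[of _ f] conjI)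
  qed
  also have "\<dots> = (\<lambda>\<sigma>. \<sigma>) ` F"
    unfolding image_image by (intro image_cong refl split_eq[symmetric] F_splits[OF F])
  finally show ?thesis by simp
qed

end

lemma (in painted_set) tree_of_face:
  assumes "face F"
  shows "\<exists>T. stable_tree S W T \<and> splits_of S T = F"
proof -
  obtain enc :: "'a set \<Rightarrow> nat" where "inj_on enc (Pow S)"
    using finite_imp_inj_to_nat_seg[of "Pow S"] finite_S by auto
  then interpret canonical_tree S W w K F enc
    by unfold_locales (use assms in auto)
  show ?thesis using T_stable T_splits by blast
qed

section \<open>Splitting a vertex\<close>

lemma separates_sym: "separates A \<sigma> B \<longleftrightarrow> separates B \<sigma> A"
  unfolding separates_def by (metis (no_types, lifting))

lemma split_sum_sym: "split_sum S W g T v A B = split_sum S W g T v B A"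
  unfolding split_sum_def by (simp add: separates_sym)

context painted_set
begin

lemma split_partE:
  assumes "\<sigma> \<in> splits S W" "P \<in> \<sigma>" "Q \<in> \<sigma>" "P \<noteq> Q"
  shows "\<sigma> = {P, Q}" "Q = S - P" "P = S - Q" "P \<subseteq> S" "Q \<subseteq> S" "card P \<ge> 2" "card Q \<ge> 2" "P \<noteq> {}" "Q \<noteq> {}"
proof -
  obtain A where A: "\<sigma> = {A, S - A}" "A \<subseteq> S" "2 \<le> card A" "2 \<le> card (S - A)"
    using assms(1) by (rule splitsE)
  have PQ: "P = A \<and> Q = S - A \<or> P = S - A \<and> Q = A"
    using assms(2-4) unfolding A(1) by auto
  have AA: "S - (S - A) = A" using A(2) by auto
  show "\<sigma> = {P, Q}" using PQ A(1) by (auto simp: insert_commute)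
  show "Q = S - P" "P = S - Q" using PQ AA by auto
  show "P \<subseteq> S" "Q \<subseteq> S" using PQ A(2) by auto
  show "card P \<ge> 2" "card Q \<ge> 2" using PQ A by auto
  then show "P \<noteq> {}" "Q \<noteq> {}" by auto
qed

lemma separatesE:
  assumes "separates A \<sigma> B"
  obtains P Q where "P \<in> \<sigma>" "Q \<in> \<sigma>" "P \<noteq> Q" "A \<subseteq> P" "B \<subseteq> Q"
  using assms unfolding separates_def by (elim bexE conjE) (rule that)

lemma separatesI: "P \<in> \<sigma> \<Longrightarrow> Q \<in> \<sigma> \<Longrightarrow> P \<noteq> Q \<Longrightarrow> A \<subseteq> P \<Longrightarrow> B \<subseteq> Q \<Longrightarrow> separates A \<sigma> B"
  unfolding separates_def by (intro bexI conjI)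

lemma link_splits: "\<sigma> \<in> link F \<Longrightarrow> \<sigma> \<in> splits S W"
  and link_notin: "\<sigma> \<in> link F \<Longrightarrow> \<sigma> \<notin> F"
  and link_face: "\<sigma> \<in> link F \<Longrightarrow> face (insert \<sigma> F)"
  by (simp_all add: link_def)

lemma link_compatible:
  assumes "\<sigma> \<in> link F" "\<tau> \<in> F"
  shows "compatible \<sigma> \<tau>"
  using assms by (auto simp: link_def face_def)

end

context stable_rooted_tree
begin

text \<open>Seen from \<open>v\<close>, the edge of \<tau> lies in one branch, which contains the
  whole side of the edge away from \<open>v\<close>.\<close>

lemma side_in_branch:
  assumes v: "v \<in> verts T" and \<tau>: "\<tau> \<in> tree_splits"
  shows "\<exists>f\<in>flags_at T v. \<exists>P\<in>\<tau>. P \<subseteq> br S T f"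
proof -
  obtain u where u: "u \<in> nonroot" "\<tau> = {cluster u, S - cluster u}"
    using \<tau> unfolding tree_splits_eq by (auto elim: imageE)
  have uT: "u \<in> verts T" using nonroot[OF u(1)] by simp
  consider "(u, v) \<in> par_rel\<^sup>+" | "(v, u) \<in> par_rel\<^sup>*" | "cluster u \<inter> cluster v = {}"
    using cluster_linear[of _ u v] by (auto simp: rtrancl_eq_or_trancl)
  then show ?thesis
  proof cases
    case 1
    then obtain c where c: "(u, c) \<in> par_rel\<^sup>*" "(c, v) \<in> par_rel" by (meson tranclD2)
    then have cv: "c \<in> nonroot" "par c = v" by (auto dest: par_relD)
    have "iv (up c) \<in> flags_at T v" using iv_up_down[OF cv(1)] cv(2) by (auto simp: down_def)
    moreover have "cluster u \<subseteq> br S T (iv (up c))" using br_iv_up[OF cv(1)] cluster_mono[OF c(1)] by simp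
    ultimately show ?thesis using u(2) by blast
  next
    case 2
    have "S - cluster u \<subseteq> br S T (top v)" using br_top[OF v] cluster_mono[OF 2] by auto
    then show ?thesis using u(2) top_flag[OF v] by blast
  next
    case 3
    then have "cluster u \<subseteq> br S T (top v)" using br_top[OF v] cluster_subset_S by auto
    then show ?thesis using u(2) top_flag[OF v] by blast
  qed
qed

lemma flags_atD: "f \<in> flags_at T v \<Longrightarrow> f \<in> flags T \<and> bd f = v"
  by (simp add: flags_at_def)

lemma half_split:
  assumes "half f"
  shows "{br S T f, S - br S T f} \<in> tree_splits"
  unfolding tree_splits_half using assms by blast

lemma br_subset:
  assumes "f \<in> flags T"
  shows "br S T f \<subseteq> S"
  by (auto simp: br_def branch_labels_def)

text \<open>For half of an edge, compatibility makes some part of \<sigma> disjoint from the branch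
  or from its complement; the latter would put the part inside the branch. The branch of a tail has
  one element.\<close>

lemma branch_in_part:
  assumes v: "v \<in> verts T" and f: "f \<in> flags_at T v" and \<sigma>: "\<sigma> \<in> link tree_splits"
    and no: "\<And>P. P \<in> \<sigma> \<Longrightarrow> \<not> P \<subseteq> br S T f"
  shows "\<exists>P\<in>\<sigma>. br S T f \<subseteq> P"
proof -
  obtain A where A: "\<sigma> = {A, S - A}" "A \<subseteq> S"
    using link_splits[OF \<sigma>] by (rule splitsE)
  have ff: "f \<in> flags T" using f by (simp add: flags_at_def)
  show ?thesis
  proof (cases "half f")
    case True
    from link_compatible[OF \<sigma> half_split[OF True]] obtain P where P: "P \<in> \<sigma>"
      "P \<inter> br S T f = {} \<or> P \<inter> (S - br S T f) = {}"
      unfolding compatible_def by auto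
    have "P \<subseteq> S" using P(1) A by auto
    then have "P \<inter> (S - br S T f) \<noteq> {}" using no[OF P(1)] by auto
    then have "P \<inter> br S T f = {}" using P(2) by simp
    then show ?thesis using P(1) A br_subset[OF ff] by auto
  next
    case False
    then obtain s where "s \<in> S" "f = tail T s" using ff by (auto simp: half_def elim: tailE)
    then show ?thesis using br_tail A by auto
  qed
qed

section \<open>Partitions of the flags at a vertex\<close>

definition labels :: "nat set \<Rightarrow> 'a set" where
  "labels A = (\<Union>f\<in>A. br S T f)"

lemma induced_partition_eq:
  assumes "\<alpha> \<subseteq> Pow (flags_at T v)"
  shows "induced_partition S T v \<alpha> = labels ` \<alpha>"
  unfolding induced_partition_def
proof (rule image_cong[OF refl])
  fix A assume "A \<in> \<alpha>"
  then have "A \<subseteq> flags_at T v" using assms by blast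
  then show "(\<Union>f\<in>A. branch_labels S T v f) = labels A"
    unfolding labels_def by (intro SUP_cong) (auto simp: br_def flags_at_def)
qed

lemma labels_subset_iff:
  assumes v: "v \<in> verts T" and "A \<subseteq> flags_at T v" "B \<subseteq> flags_at T v"
  shows "labels A \<subseteq> labels B \<longleftrightarrow> A \<subseteq> B"
proof
  assume sub: "labels A \<subseteq> labels B"
  show "A \<subseteq> B"
  proof
    fix f assume f: "f \<in> A"
    then obtain s where s: "s \<in> br S T f" using br_nonempty[OF v, of f] assms by blast
    then have "s \<in> labels B" using sub f by (auto simp: labels_def)
    then obtain g where "g \<in> B" "s \<in> br S T g" by (auto simp: labels_def)
    moreover have "f = g" by (rule br_disjoint[OF v _ _ s]) (use f calculation assms in auto)
    ultimately show "f \<in> B" by simp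
  qed
qed (auto simp: labels_def)

lemma labels_disjoint:
  assumes v: "v \<in> verts T" and "A \<subseteq> flags_at T v" "B \<subseteq> flags_at T v" "A \<inter> B = {}"
  shows "labels A \<inter> labels B = {}"
proof (rule ccontr)
  assume "\<not> ?thesis"
  then obtain s f g where "f \<in> A" "g \<in> B" "s \<in> br S T f" "s \<in> br S T g" by (auto simp: labels_def)
  then have "f = g" using br_disjoint[OF v] assms by blast
  then show False using \<open>f \<in> A\<close> \<open>g \<in> B\<close> assms by blast
qed

lemma stable_flag_partitionD:
  assumes "stable_flag_partition S W T v \<alpha>"
  obtains A where "\<alpha> = {A, flags_at T v - A}" "A \<subseteq> flags_at T v"
    "card A \<ge> 2" "card (flags_at T v - A) \<ge> 2" "labels ` \<alpha> \<in> splits S W"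
proof -
  have "two_partition (flags_at T v) \<alpha>" "\<forall>A\<in>\<alpha>. card A \<ge> 2"
    "stable_two_partition S W (induced_partition S T v \<alpha>)"
    using assms by (auto simp: stable_flag_partition_def)
  then obtain A where A: "\<alpha> = {A, flags_at T v - A}" "A \<subseteq> flags_at T v"
    unfolding two_partition_iff by (elim exE conjE) (rule that)
  have "induced_partition S T v \<alpha> = labels ` \<alpha>"
    by (rule induced_partition_eq) (use A in auto)
  then have "labels ` \<alpha> \<in> splits S W"
    using \<open>stable_two_partition S W (induced_partition S T v \<alpha>)\<close> by (simp add: splits_def)
  then show thesis
    using that[OF A] \<open>\<forall>A\<in>\<alpha>. card A \<ge> 2\<close> A(1) by simp
qed

text \<open>Each 2-partition of the tree has a side within one branch, hence within one of the
  induced parts, so it is compatible. The induced one is new since each of its parts consists of at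
  least two branches.\<close>

lemma induced_in_link:
  assumes v: "v \<in> verts T" and \<alpha>: "stable_flag_partition S W T v \<alpha>"
  shows "labels ` \<alpha> \<in> link tree_splits"
proof -
  obtain A where A: "\<alpha> = {A, flags_at T v - A}" "A \<subseteq> flags_at T v"
    "card A \<ge> 2" "card (flags_at T v - A) \<ge> 2" and spl: "labels ` \<alpha> \<in> splits S W"
    using \<alpha> by (rule stable_flag_partitionD)
  let ?B = "flags_at T v - A"
  have lab: "labels ` \<alpha> = {labels A, labels ?B}" using A(1) by simp
  have disj: "labels A \<inter> labels ?B = {}" by (rule labels_disjoint[OF v]) (use A in auto)
  have comp: "compatible (labels ` \<alpha>) \<tau>" if \<tau>: "\<tau> \<in> tree_splits" for \<tau>
  proof -
    obtain f P where fP: "f \<in> flags_at T v" "P \<in> \<tau>" "P \<subseteq> br S T f"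
      using side_in_branch[OF v \<tau>] by blast
    have "P \<subseteq> labels A \<or> P \<subseteq> labels ?B"
      using fP by (auto simp: labels_def)
    then have "labels ?B \<inter> P = {} \<or> labels A \<inter> P = {}" using disj by blast
    then show ?thesis unfolding compatible_def lab using fP(2) by blast
  qed
  have "labels ` \<alpha> \<notin> tree_splits"
  proof
    assume "labels ` \<alpha> \<in> tree_splits"
    from side_in_branch[OF v this] obtain f P where fP: "P \<subseteq> br S T f" "f \<in> flags_at T v" "P \<in> labels ` \<alpha>"
      by (elim bexE)
    from fP(3) obtain E where E: "P = labels E" "E \<in> \<alpha>" by (rule imageE)
    have "E \<subseteq> flags_at T v" "card E \<ge> 2" using E(2) A by auto
    moreover have "labels E \<subseteq> labels {f}" using E fP by (simp add: labels_def)
    ultimately have "E \<subseteq> {f}" using labels_subset_iff[OF v, of E "{f}"] fP(2) by simp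
    then have "card E \<le> card {f}" by (intro card_mono) auto
    then show False using \<open>card E \<ge> 2\<close> by simp
  qed
  moreover have "face (insert (labels ` \<alpha>) tree_splits)"
    using face_tree_splits spl comp compatible_sym unfolding face_def by blast
  ultimately show ?thesis using spl by (simp add: link_def)
qed

text \<open>No part of \<sigma> fits into a branch: one contains the branches of two flags, and the
  other, if inside that of \<open>y\<close>, would equal it, making \<sigma> the 2-partition of an
  edge. So each branch lies in one part, and \<sigma> sorts the flags.\<close>

lemma induced_surj:
  assumes v: "v \<in> verts T" and Xs: "Xs \<subseteq> flags_at T v" "x1 \<in> Xs" "x2 \<in> Xs" "x1 \<noteq> x2"
    and Ys: "Ys \<subseteq> flags_at T v" "y \<in> Ys"
    and \<sigma>: "\<sigma> \<in> link tree_splits" "separates (labels Xs) \<sigma> (labels Ys)"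
  shows "\<exists>\<alpha>. stable_flag_partition S W T v \<alpha> \<and> separates Xs \<alpha> Ys \<and> \<sigma> = labels ` \<alpha>"
proof -
  obtain P Q where PQ: "P \<in> \<sigma>" "Q \<in> \<sigma>" "P \<noteq> Q" "labels Xs \<subseteq> P" "labels Ys \<subseteq> Q"
    using \<sigma>(2) by (rule separatesE)
  note sp = split_partE[OF link_splits[OF \<sigma>(1)] PQ(1-3)]
  let ?F = "flags_at T v"
  have fin: "finite ?F" using finite_flags by (simp add: flags_at_def)
  have noP: "\<not> P \<subseteq> br S T f" if f: "f \<in> ?F" for f
  proof
    assume "P \<subseteq> br S T f"
    then have "labels Xs \<subseteq> labels {f}" using PQ(4) by (simp add: labels_def)
    then have "Xs \<subseteq> {f}" using labels_subset_iff[OF v Xs(1), of "{f}"] f by simp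
    then show False using Xs by auto
  qed
  have noQ: "\<not> Q \<subseteq> br S T f" if f: "f \<in> ?F" for f
  proof
    assume Qf: "Q \<subseteq> br S T f"
    then have "labels Ys \<subseteq> labels {f}" using PQ(5) by (simp add: labels_def)
    then have "Ys \<subseteq> {f}" using labels_subset_iff[OF v Ys(1), of "{f}"] f by simp
    then have "y = f" using Ys by auto
    then have Qe: "Q = br S T f" using Qf PQ(5) Ys(2) by (auto simp: labels_def)
    have "half f" using half_iff_card[of f] flags_atD[OF f] sp(7) Qe by simp
    then have "\<sigma> \<in> tree_splits" using half_split[of f] sp(1,3) Qe by (simp add: insert_commute)
    then show False using link_notin[OF \<sigma>(1)] by simp
  qed
  have part: "br S T f \<subseteq> P \<or> br S T f \<subseteq> Q" if f: "f \<in> ?F" for f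
    using branch_in_part[OF v f \<sigma>(1)] noP[OF f] noQ[OF f] sp(1) by auto
  define A where "A = {f \<in> ?F. br S T f \<subseteq> P}"
  have AF: "A \<subseteq> ?F" by (auto simp: A_def)
  have disj: "P \<inter> Q = {}" using sp(2) by auto
  have lA: "labels A = P"
  proof
    show "labels A \<subseteq> P" by (auto simp: labels_def A_def)
    show "P \<subseteq> labels A"
    proof
      fix s assume s: "s \<in> P"
      then have "s \<in> S" using sp(4) by blast
      then obtain f where f: "f \<in> ?F" "s \<in> br S T f" using br_cover[OF v] by blast
      then have "br S T f \<subseteq> P" using part[OF f(1)] s disj by auto
      then show "s \<in> labels A" using f by (auto simp: labels_def A_def)
    qed
  qed
  have lB: "labels (?F - A) = Q"
  proof
    show "labels (?F - A) \<subseteq> Q" using part by (auto simp: labels_def A_def)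
    show "Q \<subseteq> labels (?F - A)"
    proof
      fix s assume s: "s \<in> Q"
      then have "s \<in> S" using sp(5) by blast
      then obtain f where f: "f \<in> ?F" "s \<in> br S T f" using br_cover[OF v] by blast
      then have "\<not> br S T f \<subseteq> P" using s disj by auto
      then show "s \<in> labels (?F - A)" using f by (auto simp: labels_def A_def)
    qed
  qed
  have XA: "Xs \<subseteq> A" using PQ(4) Xs(1) by (auto simp: labels_def A_def)
  have YB: "Ys \<subseteq> ?F - A"
  proof
    fix f assume f: "f \<in> Ys"
    have fF: "f \<in> ?F" using f Ys(1) by blast
    have "br S T f \<subseteq> Q" using PQ(5) f by (auto simp: labels_def)
    then have "\<not> br S T f \<subseteq> P" using br_nonempty[OF v fF] disj by auto
    then show "f \<in> ?F - A" using fF by (simp add: A_def)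
  qed
  have cA: "card A \<ge> 2"
  proof -
    have "card {x1, x2} \<le> card A"
      using XA Xs fin AF by (intro card_mono) (auto intro: finite_subset)
    then show ?thesis using Xs(4) by simp
  qed
  have cB: "card (?F - A) \<ge> 2"
  proof -
    have "\<not> ?F - A \<subseteq> {y}"
    proof
      assume "?F - A \<subseteq> {y}"
      then have "Q \<subseteq> br S T y" using lB by (auto simp: labels_def)
      then show False using noQ[of y] Ys by auto
    qed
    then obtain z where "z \<in> ?F - A" "z \<noteq> y" by blast
    then have "{y, z} \<subseteq> ?F - A" using YB Ys(2) by auto
    then have "card {y, z} \<le> card (?F - A)" using fin by (intro card_mono) auto
    then show ?thesis using \<open>z \<noteq> y\<close> by simp
  qed
  define \<alpha> where "\<alpha> = {A, ?F - A}"
  have lab: "labels ` \<alpha> = \<sigma>" using lA lB sp(1) by (simp add: \<alpha>_def)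
  have "two_partition ?F \<alpha>"
    unfolding two_partition_iff \<alpha>_def using AF cA cB by (intro exI[of _ A]) auto
  moreover have "induced_partition S T v \<alpha> = labels ` \<alpha>"
    by (rule induced_partition_eq) (use AF in \<open>auto simp: \<alpha>_def\<close>)
  ultimately have "stable_flag_partition S W T v \<alpha>"
    using cA cB lab link_splits[OF \<sigma>(1)] by (simp add: stable_flag_partition_def splits_def \<alpha>_def)
  moreover have "separates Xs \<alpha> Ys"
    by (rule separatesI[of A _ "?F - A"]) (use XA YB Xs(2) in \<open>auto simp: \<alpha>_def\<close>)
  ultimately show ?thesis using lab by auto
qed

text \<open>Replaces partitions of flags by elements of the link. One side has two flags, as
  \<open>induced_surj\<close> requires; a single flag on the other side covers the edge formula of
  the action.\<close>

lemma split_sum_eq: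
  assumes v: "v \<in> verts T" and Xs: "Xs \<subseteq> flags_at T v" "x1 \<in> Xs" "x2 \<in> Xs" "x1 \<noteq> x2"
    and Ys: "Ys \<subseteq> flags_at T v" "y \<in> Ys"
  shows "split_sum S W g T v Xs Ys =
    (\<Sum>\<sigma> | \<sigma> \<in> link tree_splits \<and> separates (labels Xs) \<sigma> (labels Ys). g (star S W \<sigma> T))"
proof -
  let ?A = "{\<alpha>. stable_flag_partition S W T v \<alpha> \<and> separates Xs \<alpha> Ys}"
  let ?B = "{\<sigma>. \<sigma> \<in> link tree_splits \<and> separates (labels Xs) \<sigma> (labels Ys)}"
  have pow: "\<alpha> \<subseteq> Pow (flags_at T v)" if "stable_flag_partition S W T v \<alpha>" for \<alpha>
    using that by (rule stable_flag_partitionD) auto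
  have ind: "induced_partition S T v \<alpha> = labels ` \<alpha>" if "stable_flag_partition S W T v \<alpha>" for \<alpha>
    by (rule induced_partition_eq[OF pow[OF that]])
  have lab_inj: "inj_on labels (Pow (flags_at T v))"
    using labels_subset_iff[OF v] by (intro inj_onI) (metis PowD equalityD1 equalityD2 subset_antisym)
  have "inj_on (induced_partition S T v) ?A"
  proof (rule inj_onI)
    fix \<alpha> \<beta> assume "\<alpha> \<in> ?A" "\<beta> \<in> ?A" "induced_partition S T v \<alpha> = induced_partition S T v \<beta>"
    then show "\<alpha> = \<beta>"
      using ind inj_on_image_eq_iff[OF lab_inj] pow by simp
  qed
  moreover have "induced_partition S T v ` ?A = ?B"
  proof (intro equalityI subsetI)
    fix \<sigma> assume "\<sigma> \<in> induced_partition S T v ` ?A"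
    then obtain \<alpha> where \<alpha>: "stable_flag_partition S W T v \<alpha>" "separates Xs \<alpha> Ys" "\<sigma> = labels ` \<alpha>"
      using ind by auto
    from \<alpha>(2) obtain P Q where PQ: "P \<in> \<alpha>" "Q \<in> \<alpha>" "P \<noteq> Q" "Xs \<subseteq> P" "Ys \<subseteq> Q" by (rule separatesE)
    have "separates (labels Xs) \<sigma> (labels Ys)"
      unfolding \<alpha>(3)
    proof (rule separatesI)
      show "labels P \<noteq> labels Q" using inj_onD[OF lab_inj, of P Q] pow[OF \<alpha>(1)] PQ by blast
    qed (use PQ in \<open>auto simp: labels_def\<close>)
    then show "\<sigma> \<in> ?B" using induced_in_link[OF v \<alpha>(1)] \<alpha>(3) by simp
  next
    fix \<sigma> assume "\<sigma> \<in> ?B"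
    then have "\<sigma> \<in> link tree_splits" "separates (labels Xs) \<sigma> (labels Ys)" by auto
    from induced_surj[OF v Xs Ys this] obtain \<alpha>
      where "stable_flag_partition S W T v \<alpha>" "separates Xs \<alpha> Ys" "\<sigma> = labels ` \<alpha>"
      by (elim exE conjE)
    then show "\<sigma> \<in> induced_partition S T v ` ?A" using ind by auto
  qed
  ultimately have "bij_betw (induced_partition S T v) ?A ?B" by (simp add: bij_betw_def)
  from sum.reindex_bij_betw[OF this, of "\<lambda>\<sigma>. g (star S W \<sigma> T)"]
  show ?thesis by (simp add: split_sum_def split_tree_def)
qed

text \<open>In the following two situations the splits separating branches are determined by one label
  on each branch.\<close>

lemma separates_branches:
  assumes v: "v \<in> verts T" and fl: "{f1, f2, f3, f4} \<subseteq> flags_at T v" "distinct [f1, f2, f3, f4]"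
    and lb: "i \<in> br S T f1" "j \<in> br S T f2" "k \<in> br S T f3" "l \<in> br S T f4"
    and \<sigma>: "\<sigma> \<in> link tree_splits"
  shows "separates {i, j} \<sigma> {k, l} \<longleftrightarrow> separates (labels {f1, f2}) \<sigma> (labels {f3, f4})"
proof
  assume "separates (labels {f1, f2}) \<sigma> (labels {f3, f4})"
  then obtain P Q where PQ: "P \<in> \<sigma>" "Q \<in> \<sigma>" "P \<noteq> Q" "labels {f1, f2} \<subseteq> P" "labels {f3, f4} \<subseteq> Q"
    by (rule separatesE)
  then show "separates {i, j} \<sigma> {k, l}"
    by (intro separatesI[OF PQ(1-3)]) (use lb in \<open>auto simp: labels_def\<close>)
next
  assume "separates {i, j} \<sigma> {k, l}"
  then obtain P Q where PQ: "P \<in> \<sigma>" "Q \<in> \<sigma>" "P \<noteq> Q" "{i, j} \<subseteq> P" "{k, l} \<subseteq> Q" by (rule separatesE)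
  note sp = split_partE[OF link_splits[OF \<sigma>] PQ(1-3)]
  have disj: "P \<inter> Q = {}" using sp(2) by auto
  have no: "\<not> R \<subseteq> br S T f" if "R \<in> \<sigma>" "f \<in> flags_at T v" for R f
  proof
    assume R: "R \<subseteq> br S T f"
    have "R = P \<or> R = Q" using that(1) sp(1) by auto
    then show False
    proof
      assume "R = P"
      then have "i \<in> br S T f" "j \<in> br S T f" using R PQ(4) by auto
      then have "f1 = f" "f2 = f"
        using br_disjoint[OF v _ that(2) lb(1)] br_disjoint[OF v _ that(2) lb(2)] fl(1) by auto
      then show False using fl(2) by simp
    next
      assume "R = Q"
      then have "k \<in> br S T f" "l \<in> br S T f" using R PQ(5) by auto
      then have "f3 = f" "f4 = f"
        using br_disjoint[OF v _ that(2) lb(3)] br_disjoint[OF v _ that(2) lb(4)] fl(1) by auto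
      then show False using fl(2) by simp
    qed
  qed
  have in_part: "br S T f \<subseteq> R" if f: "f \<in> flags_at T v" "x \<in> br S T f" "x \<in> R" "R = P \<or> R = Q" for f x R
  proof -
    have "\<exists>R'\<in>\<sigma>. br S T f \<subseteq> R'"
      by (rule branch_in_part[OF v f(1) \<sigma>]) (use no f(1) in auto)
    then show ?thesis using f(2-4) disj sp(1) by auto
  qed
  show "separates (labels {f1, f2}) \<sigma> (labels {f3, f4})"
    by (rule separatesI[OF PQ(1-3)])
      (use in_part[of f1 i P] in_part[of f2 j P] in_part[of f3 k Q] in_part[of f4 l Q] fl(1) lb PQ(4,5)
        in \<open>auto simp: labels_def\<close>)
qed

text \<open>Some side of \<tau> lies in one branch at \<open>v\<close>, whereas each side of a
  separating 2-partition would contain labels of two branches.\<close>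

lemma no_separation_at_vertex:
  assumes v: "v \<in> verts T" and fl: "{f1, f2, f3, f4} \<subseteq> flags_at T v" "distinct [f1, f2, f3, f4]"
    and lb: "i \<in> br S T f1" "j \<in> br S T f2" "k \<in> br S T f3" "l \<in> br S T f4"
    and \<tau>: "\<tau> \<in> tree_splits"
  shows "\<not> separates {i, j} \<tau> {k, l}"
proof
  assume "separates {i, j} \<tau> {k, l}"
  then obtain P Q where PQ: "P \<in> \<tau>" "Q \<in> \<tau>" "P \<noteq> Q" "{i, j} \<subseteq> P" "{k, l} \<subseteq> Q" by (rule separatesE)
  have "\<tau> \<in> splits S W" using face_tree_splits \<tau> by (auto simp: face_def)
  note sp = split_partE[OF this PQ(1-3)]
  obtain f R where fR: "f \<in> flags_at T v" "R \<in> \<tau>" "R \<subseteq> br S T f" using side_in_branch[OF v \<tau>] by blast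
  have "R = P \<or> R = Q" using fR(2) sp(1) by auto
  then have "{i, j} \<subseteq> br S T f \<or> {k, l} \<subseteq> br S T f" using fR(3) PQ by auto
  then have "f1 = f \<and> f2 = f \<or> f3 = f \<and> f4 = f"
    using br_disjoint[OF v _ fR(1) lb(1)] br_disjoint[OF v _ fR(1) lb(2)]
      br_disjoint[OF v _ fR(1) lb(3)] br_disjoint[OF v _ fR(1) lb(4)] fl(1) by auto
  then show False using fl(2) by auto
qed

text \<open>The lowest vertex whose cluster contains two of the labels has the property. Downward
  branches contain at most one of them by minimality, and so does the upward one, as otherwise the
  edge above would separate the labels two by two.\<close>

lemma exists_vertex:
  assumes ijkl: "{i, j, k, l} \<subseteq> S" "distinct [i, j, k, l]"
    and no: "\<And>\<tau>. \<tau> \<in> tree_splits \<Longrightarrow>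
      \<not> separates {i, j} \<tau> {k, l} \<and> \<not> separates {k, j} \<tau> {i, l} \<and> \<not> separates {i, k} \<tau> {j, l}"
  shows "\<exists>v f1 f2 f3 f4. v \<in> verts T \<and> {f1, f2, f3, f4} \<subseteq> flags_at T v \<and> distinct [f1, f2, f3, f4] \<and>
    i \<in> br S T f1 \<and> j \<in> br S T f2 \<and> k \<in> br S T f3 \<and> l \<in> br S T f4"
proof -
  let ?Q = "{i, j, k, l}"
  define two where "two A \<longleftrightarrow> (\<exists>x y. x \<in> ?Q \<and> y \<in> ?Q \<and> x \<noteq> y \<and> x \<in> A \<and> y \<in> A)" for A
  have "two S0"
  proof (cases "w \<in> {i, j}")
    case True
    then show ?thesis unfolding two_def using ijkl by (intro exI[of _ k] exI[of _ l]) (auto simp: S0_def)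
  next
    case False
    then show ?thesis unfolding two_def using ijkl by (intro exI[of _ i] exI[of _ j]) (auto simp: S0_def)
  qed
  then have "rt \<in> verts T \<and> two (cluster rt)"
    using cluster_root root by simp
  from ex_has_least_nat[of "\<lambda>v. v \<in> verts T \<and> two (cluster v)", OF this, of "\<lambda>v. card (cluster v)"]
  obtain v where v: "v \<in> verts T \<and> two (cluster v)"
    "\<forall>u. u \<in> verts T \<and> two (cluster u) \<longrightarrow> card (cluster v) \<le> card (cluster u)"
    by (rule exE) (erule conjE, rule that)
  have vT: "v \<in> verts T" using v(1) by simp
  have one: "\<not> two (br S T f)" if f: "f \<in> flags_at T v" for f
  proof (cases "f = top v")
    case False
    then have fd: "f \<in> down v" using f by (simp add: down_def)
    with vT show ?thesis
    proof (cases rule: down_cases)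
      case (edge c)
      have "cluster c \<subset> cluster v" using br_down_psubset[OF vT fd] edge(4) by simp
      then have "card (cluster c) < card (cluster v)" by (intro psubset_card_mono finite_cluster)
      then have "\<not> two (cluster c)" using spec[OF v(2), of c] nonroot[OF edge(1)] by auto
      then show ?thesis unfolding edge(4) .
    next
      case (tail s)
      then show ?thesis by (auto simp: two_def)
    qed
  next
    case True
    show ?thesis
    proof (cases "v = rt")
      case True
      then have "br S T f = {w}" using \<open>f = top v\<close> br_tail[OF w_in_S] by (simp add: top_def)
      then show ?thesis by (auto simp: two_def)
    next
      case False
      then have vn: "v \<in> nonroot" using vT by (simp add: nonroot_def)
      then have \<tau>: "{cluster v, S - cluster v} \<in> tree_splits" unfolding tree_splits_eq by blast
      have sep: "separates A {cluster v, S - cluster v} B \<longleftrightarrow>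
          A \<subseteq> cluster v \<and> B \<subseteq> S - cluster v \<or> A \<subseteq> S - cluster v \<and> B \<subseteq> cluster v" if "A \<noteq> {}" "B \<noteq> {}" for A B
        using cluster_subset_S card_cluster[OF vT] that by (intro separates_pair) auto
      have n: "\<not> separates {i, j} {cluster v, S - cluster v} {k, l}"
          "\<not> separates {k, j} {cluster v, S - cluster v} {i, l}"
          "\<not> separates {i, k} {cluster v, S - cluster v} {j, l}"
        using no[OF \<tau>] by auto
      have two: "two (cluster v)" using v(1) by simp
      have "\<not> two (S - cluster v)"
        using n two ijkl unfolding sep[OF insert_not_empty insert_not_empty] two_def by auto
      then show ?thesis using br_top[OF vT] \<open>f = top v\<close> by simp
    qed
  qed
  have ex: "\<exists>f\<in>flags_at T v. x \<in> br S T f" if "x \<in> ?Q" for x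
    using br_cover[OF vT] that ijkl(1) by blast
  obtain f1 where f1: "f1 \<in> flags_at T v" "i \<in> br S T f1" using ex[of i] by auto
  obtain f2 where f2: "f2 \<in> flags_at T v" "j \<in> br S T f2" using ex[of j] by auto
  obtain f3 where f3: "f3 \<in> flags_at T v" "k \<in> br S T f3" using ex[of k] by auto
  obtain f4 where f4: "f4 \<in> flags_at T v" "l \<in> br S T f4" using ex[of l] by auto
  have ne: "f \<noteq> g" if "x \<in> ?Q" "y \<in> ?Q" "x \<noteq> y" "x \<in> br S T f" "y \<in> br S T g" "f \<in> flags_at T v" for f g x y
    using one[OF that(6)] that unfolding two_def by metis
  have "distinct [f1, f2, f3, f4]"
    using ne[of i j f1 f2] ne[of i k f1 f3] ne[of i l f1 f4] ne[of j k f2 f3] ne[of j l f2 f4] ne[of k l f3 f4]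
      f1 f2 f3 f4 ijkl(2) by auto
  then show ?thesis using vT f1 f2 f3 f4 by (intro exI[of _ v] exI[of _ f1] exI[of _ f2] exI[of _ f3] exI[of _ f4]) simp
qed

text \<open>\<open>tree_of_face\<close> provides a tree for the enlarged face, and it contracts to
  \<open>T\<close>, so the choice in \<open>star\<close> is not void. Any tree that may be chosen
  has the stated 2-partitions by \<open>contracts_imp_splits\<close>.\<close>

lemma star:
  assumes \<sigma>: "\<sigma> \<in> link tree_splits"
  shows star_stable: "stable_tree S W (star S W \<sigma> T)"
    and splits_of_star: "splits_of S (star S W \<sigma> T) = insert \<sigma> tree_splits"
    and star_breaks: "\<exists>v. breaks_at_vertex S W \<sigma> T v"
proof -
  obtain T' where T': "stable_tree S W T'" "splits_of S T' = insert \<sigma> tree_splits"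
    using tree_of_face[OF link_face[OF \<sigma>]] by blast
  interpret P: tree_pair S W w K T T'
    by unfold_locales (rule T'(1))
  obtain e v where ev: "contracts S T' T e v" "v \<in> verts T" "\<sigma> = edge_partition S T' e"
    using P.splits_imp_contracts[of \<sigma>] T'(2) link_notin[OF \<sigma>] by blast
  then have sv: "splits_vertex S W \<sigma> T v T'" using T'(1) by (auto simp: splits_vertex_def)
  then show "\<exists>v. breaks_at_vertex S W \<sigma> T v" using ev(2) by (auto simp: breaks_at_vertex_def)
  have "\<exists>T'. \<exists>v\<in>verts T. splits_vertex S W \<sigma> T v T'" using sv ev(2) by blast
  from someI_ex[OF this] obtain v where "v \<in> verts T" "splits_vertex S W \<sigma> T v (star S W \<sigma> T)"
    unfolding star_def by blast
  then obtain e where st: "stable_tree S W (star S W \<sigma> T)" "contracts S (star S W \<sigma> T) T e v"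
    "\<sigma> = edge_partition S (star S W \<sigma> T) e"
    by (auto simp: splits_vertex_def)
  show "stable_tree S W (star S W \<sigma> T)" by (rule st(1))
  interpret Q: tree_pair S W w K T "star S W \<sigma> T"
    by unfold_locales (rule st(1))
  show "splits_of S (star S W \<sigma> T) = insert \<sigma> tree_splits"
    by (rule Q.contracts_imp_splits(2)[OF st(2,3)])
qed

lemma breaks_at_vertex_link:
  assumes "breaks_at_vertex S W \<sigma> T v"
  shows "\<sigma> \<in> link tree_splits"
proof -
  obtain T' e where T': "stable_tree S W T'" "contracts S T' T e v" "\<sigma> = edge_partition S T' e"
    using assms by (auto simp: breaks_at_vertex_def splits_vertex_def)
  interpret P: tree_pair S W w K T T'
    by unfold_locales (rule T'(1))
  have "\<sigma> \<notin> tree_splits" "splits_of S T' = insert \<sigma> tree_splits"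
    using P.contracts_imp_splits(1,2)[OF T'(2,3)] by auto
  then show ?thesis
    using P.B.face_tree_splits by (auto simp: link_def face_def)
qed

text \<open>The claims make \<open>quad_form i j k l\<close> a dual form of the 2-partition of the
  edge, whose terms in the link are the splittings of the two end vertices. This is the origin of
  the two sums in the edge formula.\<close>

lemma edge_quadruple:
  assumes e1: "half e1" and e2: "e2 = iv e1"
    and IJ: "f1 \<in> flags_at T (bd e1)" "f2 \<in> flags_at T (bd e1)" "f1 \<noteq> e1" "f2 \<noteq> e1" "f1 \<noteq> f2"
    and KL: "f3 \<in> flags_at T (bd e2)" "f4 \<in> flags_at T (bd e2)" "f3 \<noteq> e2" "f4 \<noteq> e2" "f3 \<noteq> f4"
    and lb: "i \<in> br S T f1" "j \<in> br S T f2" "k \<in> br S T f3" "l \<in> br S T f4"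
  shows edge_no_cross: "\<tau> \<in> splits S W \<Longrightarrow> compatible \<tau> (edge_partition S T {e1, e2}) \<Longrightarrow> \<not> separates {k, j} \<tau> {i, l}"
    and edge_separates: "\<tau> \<in> tree_splits \<Longrightarrow> separates {i, j} \<tau> {k, l} \<longleftrightarrow> \<tau> = edge_partition S T {e1, e2}"
    and edge_link_separates: "\<sigma> \<in> link tree_splits \<Longrightarrow> separates {i, j} \<sigma> {k, l} \<longleftrightarrow>
      separates (labels {f1, f2}) \<sigma> (labels {e1}) \<or> separates (labels {f3, f4}) \<sigma> (labels {e2})"
    and edge_link_exclusive: "\<sigma> \<in> link tree_splits \<Longrightarrow>
      \<not> (separates (labels {f1, f2}) \<sigma> (labels {e1}) \<and> separates (labels {f3, f4}) \<sigma> (labels {e2}))"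
proof -
  have ef: "e1 \<in> flags T" "e2 \<in> flags T" and e2h: "half e2"
    using e1 e2 iv_flags half_iv by (auto simp: half_def)
  let ?A = "br S T e2" and ?B = "br S T e1"
  have AB: "?A = S - ?B" "?B \<subseteq> S" "?A \<subseteq> S" "?B = S - ?A"
    using br_iv[OF e1] br_half_subset[OF e1] e2 by (auto simp: double_diff)
  have ep: "edge_partition S T {e1, e2} = {?A, ?B}"
    using edge_partition_half[OF e1] e2 AB(1) by (simp add: insert_commute)
  have ep_in: "{?A, ?B} \<in> tree_splits"
    using half_split[OF e1] AB(1) by (simp add: insert_commute)
  have v1: "bd e1 \<in> verts T" and v2: "bd e2 \<in> verts T" using ef bd_verts by auto
  have at: "e1 \<in> flags_at T (bd e1)" "e2 \<in> flags_at T (bd e2)" using ef by (auto simp: flags_at_def)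
  have sub1: "br S T f \<subseteq> ?A" if "f \<in> flags_at T (bd e1)" "f \<noteq> e1" for f
  proof
    fix s assume s: "s \<in> br S T f"
    then have "s \<notin> ?B" using br_disjoint[OF v1 that(1) at(1) s] that(2) by auto
    then show "s \<in> ?A" using AB(1) s br_subset[of f] that(1) by (auto simp: flags_at_def)
  qed
  have sub2: "br S T f \<subseteq> ?B" if "f \<in> flags_at T (bd e2)" "f \<noteq> e2" for f
  proof
    fix s assume s: "s \<in> br S T f"
    then have "s \<notin> ?A" using br_disjoint[OF v2 that(1) at(2) s] that(2) by auto
    then show "s \<in> ?B" using AB(4) s br_subset[of f] that(1) by (auto simp: flags_at_def)
  qed
  have ij: "i \<in> ?A" "j \<in> ?A" and kl: "k \<in> ?B" "l \<in> ?B"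
    using sub1[OF IJ(1,3)] sub1[OF IJ(2,4)] sub2[OF KL(1,3)] sub2[OF KL(2,4)] lb by auto
  have disjAB: "?A \<inter> ?B = {}" using AB(1) by auto
  have comp: "\<exists>P\<in>\<tau>. P \<inter> ?A = {} \<or> P \<inter> ?B = {}" if "compatible \<tau> {?A, ?B}" for \<tau>
    using that unfolding compatible_def by auto
  show "\<not> separates {k, j} \<tau> {i, l}" if \<tau>: "\<tau> \<in> splits S W" "compatible \<tau> (edge_partition S T {e1, e2})" for \<tau>
  proof
    assume "separates {k, j} \<tau> {i, l}"
    then obtain P Q where PQ: "P \<in> \<tau>" "Q \<in> \<tau>" "P \<noteq> Q" "{k, j} \<subseteq> P" "{i, l} \<subseteq> Q" by (rule separatesE)
    note sp = split_partE[OF \<tau>(1) PQ(1-3)]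
    show False using comp[OF \<tau>(2)[unfolded ep]] sp(1) PQ(4,5) ij kl by auto
  qed
  \<comment> \<open>\<open>P\<close> meets the side \<open>?A\<close> in i and \<open>Q\<close>
    meets \<open>?B\<close> in k, so compatibility can only make \<open>P\<close> disjoint from
    \<open>?B\<close> or \<open>Q\<close> disjoint from \<open>?A\<close>.\<close>
  have nested: "?B \<subseteq> Q \<or> ?A \<subseteq> P"
    if \<tau>: "\<tau> \<in> splits S W" "compatible \<tau> {?A, ?B}" and PQ: "P \<in> \<tau>" "Q \<in> \<tau>" "P \<noteq> Q" "{i, j} \<subseteq> P" "{k, l} \<subseteq> Q" for \<tau> P Q
  proof -
    note sp = split_partE[OF \<tau>(1) PQ(1-3)]
    have "P \<inter> ?B = {} \<or> Q \<inter> ?A = {}"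
      using comp[OF \<tau>(2)] sp(1) PQ(4,5) ij kl by auto
    then show ?thesis
    proof
      assume "P \<inter> ?B = {}"
      then have "?B \<subseteq> S - P" using AB(2) by blast
      then show ?thesis unfolding sp(2)[symmetric] ..
    next
      assume "Q \<inter> ?A = {}"
      then have "?A \<subseteq> S - Q" using AB(3) by blast
      then show ?thesis unfolding sp(3)[symmetric] ..
    qed
  qed
  have tree_comp: "compatible \<tau> {?A, ?B}" if "\<tau> \<in> tree_splits" for \<tau>
    using face_tree_splits that ep_in compatible_refl[of \<tau>] by (cases "\<tau> = {?A, ?B}") (auto simp: face_def)
  show "separates {i, j} \<tau> {k, l} \<longleftrightarrow> \<tau> = edge_partition S T {e1, e2}" if \<tau>: "\<tau> \<in> tree_splits" for \<tau>
  proof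
    assume "\<tau> = edge_partition S T {e1, e2}"
    then show "separates {i, j} \<tau> {k, l}"
      unfolding ep by (intro separatesI[of ?A _ ?B]) (use ij kl disjAB in auto)
  next
    assume "separates {i, j} \<tau> {k, l}"
    then obtain P Q where PQ: "P \<in> \<tau>" "Q \<in> \<tau>" "P \<noteq> Q" "{i, j} \<subseteq> P" "{k, l} \<subseteq> Q" by (rule separatesE)
    have \<tau>s: "\<tau> \<in> splits S W" using face_tree_splits \<tau> by (auto simp: face_def)
    note sp = split_partE[OF \<tau>s PQ(1-3)]
    from nested[OF \<tau>s tree_comp[OF \<tau>] PQ] show "\<tau> = edge_partition S T {e1, e2}"
    proof
      assume BQ: "?B \<subseteq> Q"
      obtain f R where fR: "f \<in> flags_at T (bd e1)" "R \<in> \<tau>" "R \<subseteq> br S T f"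
        using side_in_branch[OF v1 \<tau>] by blast
      have "R \<noteq> P"
      proof
        assume "R = P"
        then have "i \<in> br S T f" "j \<in> br S T f" using fR PQ by auto
        then have "f1 = f" "f2 = f"
          using br_disjoint[OF v1 IJ(1) fR(1) lb(1)] br_disjoint[OF v1 IJ(2) fR(1) lb(2)] by auto
        then show False using IJ(5) by simp
      qed
      then have RQ: "R = Q" using fR(2) sp(1) by auto
      then have "k \<in> br S T f" using BQ kl fR by auto
      then have "f = e1" using br_disjoint[OF v1 fR(1) at(1) _ kl(1)] by simp
      then have "Q = ?B" using RQ fR(3) BQ by auto
      then show ?thesis unfolding ep using sp(1,3) AB(1) by simp
    next
      assume AP: "?A \<subseteq> P"
      obtain f R where fR: "f \<in> flags_at T (bd e2)" "R \<in> \<tau>" "R \<subseteq> br S T f"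
        using side_in_branch[OF v2 \<tau>] by blast
      have "R \<noteq> Q"
      proof
        assume "R = Q"
        then have "k \<in> br S T f" "l \<in> br S T f" using fR PQ by auto
        then have "f3 = f" "f4 = f"
          using br_disjoint[OF v2 KL(1) fR(1) lb(3)] br_disjoint[OF v2 KL(2) fR(1) lb(4)] by auto
        then show False using KL(5) by simp
      qed
      then have RP: "R = P" using fR(2) sp(1) by auto
      then have "i \<in> br S T f" using AP ij fR by auto
      then have "f = e2" using br_disjoint[OF v2 fR(1) at(2) _ ij(1)] by simp
      then have "P = ?A" using RP fR(3) AP by auto
      then show ?thesis unfolding ep using sp(1,2) AB(4) by simp
    qed
  qed
  have in_part: "br S T f \<subseteq> P"
    if \<sigma>: "\<sigma> \<in> link tree_splits" and v: "v \<in> verts T" "f \<in> flags_at T v" "g \<in> flags_at T v" "f \<noteq> g"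
      and P: "P \<in> \<sigma>" "Q \<in> \<sigma>" "P \<noteq> Q" "\<not> P \<subseteq> br S T f" "br S T g \<subseteq> Q" "x \<in> br S T f" "x \<in> P" for \<sigma> v f g P Q x
  proof -
    note sp = split_partE[OF link_splits[OF \<sigma>] P(1-3)]
    have "\<not> Q \<subseteq> br S T f"
    proof
      assume "Q \<subseteq> br S T f"
      then have "br S T g \<subseteq> br S T f" using P(5) by auto
      then show False using br_nonempty[OF v(1,3)] br_disjoint[OF v(1-3)] v(4) by blast
    qed
    then have "\<exists>R\<in>\<sigma>. br S T f \<subseteq> R"
      by (intro branch_in_part[OF v(1,2) \<sigma>]) (use P(4) sp(1) in auto)
    then show ?thesis using sp(1,2) P(6,7) by auto
  qed
  show "separates {i, j} \<sigma> {k, l} \<longleftrightarrow>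
      separates (labels {f1, f2}) \<sigma> (labels {e1}) \<or> separates (labels {f3, f4}) \<sigma> (labels {e2})"
    if \<sigma>: "\<sigma> \<in> link tree_splits" for \<sigma>
  proof
    assume "separates (labels {f1, f2}) \<sigma> (labels {e1}) \<or> separates (labels {f3, f4}) \<sigma> (labels {e2})"
    then show "separates {i, j} \<sigma> {k, l}"
    proof
      assume "separates (labels {f1, f2}) \<sigma> (labels {e1})"
      then obtain P Q where "P \<in> \<sigma>" "Q \<in> \<sigma>" "P \<noteq> Q" "labels {f1, f2} \<subseteq> P" "labels {e1} \<subseteq> Q" by (rule separatesE)
      then show ?thesis
        by (intro separatesI[of P _ Q]) (use lb kl in \<open>auto simp: labels_def\<close>)
    next
      assume "separates (labels {f3, f4}) \<sigma> (labels {e2})"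
      then obtain P Q where "P \<in> \<sigma>" "Q \<in> \<sigma>" "P \<noteq> Q" "labels {f3, f4} \<subseteq> P" "labels {e2} \<subseteq> Q" by (rule separatesE)
      then show ?thesis
        by (intro separatesI[of Q _ P]) (use lb ij in \<open>auto simp: labels_def\<close>)
    qed
  next
    assume "separates {i, j} \<sigma> {k, l}"
    then obtain P Q where PQ: "P \<in> \<sigma>" "Q \<in> \<sigma>" "P \<noteq> Q" "{i, j} \<subseteq> P" "{k, l} \<subseteq> Q" by (rule separatesE)
    have "compatible \<sigma> {?A, ?B}" by (rule link_compatible[OF \<sigma> ep_in])
    from nested[OF link_splits[OF \<sigma>] this PQ]
    show "separates (labels {f1, f2}) \<sigma> (labels {e1}) \<or> separates (labels {f3, f4}) \<sigma> (labels {e2})"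
    proof
      assume BQ: "?B \<subseteq> Q"
      have "i \<notin> br S T f2" "j \<notin> br S T f1"
        using br_disjoint[OF v1 IJ(1,2) lb(1)] br_disjoint[OF v1 IJ(1,2) _ lb(2)] IJ(5) by auto
      then have "br S T f1 \<subseteq> P" "br S T f2 \<subseteq> P"
        using in_part[OF \<sigma> v1 IJ(1) at(1) IJ(3) PQ(1-3) _ BQ lb(1)]
          in_part[OF \<sigma> v1 IJ(2) at(1) IJ(4) PQ(1-3) _ BQ lb(2)] PQ(4) by auto
      then have "separates (labels {f1, f2}) \<sigma> (labels {e1})"
        by (intro separatesI[OF PQ(1-3)]) (use BQ in \<open>auto simp: labels_def\<close>)
      then show ?thesis ..
    next
      assume AP: "?A \<subseteq> P"
      have "k \<notin> br S T f4" "l \<notin> br S T f3"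
        using br_disjoint[OF v2 KL(1,2) lb(3)] br_disjoint[OF v2 KL(1,2) _ lb(4)] KL(5) by auto
      then have "br S T f3 \<subseteq> Q" "br S T f4 \<subseteq> Q"
        using in_part[OF \<sigma> v2 KL(1) at(2) KL(3) PQ(2,1) _ _ AP lb(3)]
          in_part[OF \<sigma> v2 KL(2) at(2) KL(4) PQ(2,1) _ _ AP lb(4)] PQ(3,5) by auto
      then have "separates (labels {f3, f4}) \<sigma> (labels {e2})"
        by (intro separatesI[OF PQ(2,1) PQ(3)[symmetric]]) (use AP in \<open>auto simp: labels_def\<close>)
      then show ?thesis ..
    qed
  qed
  show "\<not> (separates (labels {f1, f2}) \<sigma> (labels {e1}) \<and> separates (labels {f3, f4}) \<sigma> (labels {e2}))"
    if \<sigma>: "\<sigma> \<in> link tree_splits" for \<sigma>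
  proof
    assume "separates (labels {f1, f2}) \<sigma> (labels {e1}) \<and> separates (labels {f3, f4}) \<sigma> (labels {e2})"
    then have s: "separates (labels {f1, f2}) \<sigma> (labels {e1})" "separates (labels {f3, f4}) \<sigma> (labels {e2})" by auto
    from s(1) obtain P Q where PQ: "P \<in> \<sigma>" "Q \<in> \<sigma>" "P \<noteq> Q" "labels {f1, f2} \<subseteq> P" "labels {e1} \<subseteq> Q" by (rule separatesE)
    from s(2) obtain P' where P': "P' \<in> \<sigma>" "labels {e2} \<subseteq> P'" by (rule separatesE)
    note sp = split_partE[OF link_splits[OF \<sigma>] PQ(1-3)]
    have "i \<in> P" "i \<in> P'" "?B \<subseteq> Q" "?A \<subseteq> P'"
      using PQ P' lb ij by (auto simp: labels_def)
    then have "?A \<subseteq> P" using P'(1) sp(1,2) by auto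
    have "P \<subseteq> ?A" using sp(3) AB(1) \<open>?B \<subseteq> Q\<close> by blast
    moreover have "Q \<subseteq> ?B" using sp(2) AB(4) \<open>?A \<subseteq> P\<close> by blast
    ultimately have "P = ?A" "Q = ?B" using \<open>?A \<subseteq> P\<close> \<open>?B \<subseteq> Q\<close> by auto
    then have "\<sigma> \<in> tree_splits" using sp(1) ep_in by simp
    then show False using link_notin[OF \<sigma>] by simp
  qed
qed

end

section \<open>Cohomology and homology\<close>

lemma a_r_coset_plus:
  fixes G (structure) and H :: "('b \<Rightarrow>\<^sub>0 'k::{comm_ring,monoid_mult}) set"
  assumes "add G = (+)"
  shows "H +> a = (\<lambda>h. h + a) ` H"
  unfolding a_r_coset_def' assms by auto

lemma coset_eq_iff:
  fixes N :: "('b \<Rightarrow>\<^sub>0 'k::{comm_ring,monoid_mult}) set"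
  assumes "ksub N"
  shows "(\<lambda>h. h + a) ` N = (\<lambda>h. h + b) ` N \<longleftrightarrow> a - b \<in> N"
proof
  assume eq: "(\<lambda>h. h + a) ` N = (\<lambda>h. h + b) ` N"
  have "0 + a \<in> (\<lambda>h. h + a) ` N" using ksub_zero[OF assms] by (rule imageI)
  then obtain h where "0 + a = h + b" "h \<in> N" unfolding eq by (rule imageE)
  then show "a - b \<in> N" by simp
next
  have sub: "(\<lambda>h. h + a) ` N \<subseteq> (\<lambda>h. h + b) ` N" if "a - b \<in> N" for a b
  proof
    fix x assume "x \<in> (\<lambda>h. h + a) ` N"
    then obtain h where "x = h + a" "h \<in> N" by (rule imageE)
    then show "x \<in> (\<lambda>h. h + b) ` N"
      using ksub_add[OF assms _ that] by (intro image_eqI[of _ _ "h + (a - b)"]) simp_all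
  qed
  assume "a - b \<in> N"
  then show "(\<lambda>h. h + a) ` N = (\<lambda>h. h + b) ` N"
    using sub[of a b] sub[of b a] ksub_sym[OF assms] by blast
qed

lemma coset_add:
  fixes N :: "('b \<Rightarrow>\<^sub>0 'k::{comm_ring,monoid_mult}) set" and G (structure)
  assumes "add G = (+)" "ksub N"
  shows "set_add G ((\<lambda>h. h + a) ` N) ((\<lambda>h. h + b) ` N) = (\<lambda>h. h + (a + b)) ` N"
proof (intro equalityI subsetI)
  fix x assume "x \<in> set_add G ((\<lambda>h. h + a) ` N) ((\<lambda>h. h + b) ` N)"
  then obtain h h' where "h \<in> N" "h' \<in> N" "x = (h + a) + (h' + b)"
    unfolding set_add_def' assms(1) by auto
  then show "x \<in> (\<lambda>h. h + (a + b)) ` N"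
    using ksub_add[OF assms(2)] by (intro image_eqI[of _ _ "h + h'"]) (simp_all add: ac_simps)
next
  fix x assume "x \<in> (\<lambda>h. h + (a + b)) ` N"
  then obtain h where "x = h + (a + b)" "h \<in> N" by (rule imageE)
  then have "x = (h + a) + (0 + b)" by (simp add: ac_simps)
  then show "x \<in> set_add G ((\<lambda>h. h + a) ` N) ((\<lambda>h. h + b) ` N)"
    unfolding set_add_def' assms(1) using \<open>h \<in> N\<close> ksub_zero[OF assms(2)] by blast
qed

context painted_set
begin

abbreviation R :: "('a, 'k) lpoly ring" where "R \<equiv> partition_poly_ring S W"
abbreviation M :: "('k, ('a, 'k) tree_chain) module" where "M \<equiv> tree_module S W"

lemma poly_var_eq: "poly_var = var"
  by (simp add: fun_eq_iff poly_var_def var_def)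

lemma poly_const_one: "poly_const 1 = mono {}"
  by (simp add: poly_const_def mono_def)

lemma R_simps [simp]:
  "carrier R = polys" "mult R = (*)" "one R = mono {}" "zero R = 0" "add R = (+)"
proof -
  have "{p :: ('a, 'k) lpoly. \<forall>m\<in>Poly_Mapping.keys p. \<forall>\<sigma>\<in>Poly_Mapping.keys m. stable_two_partition S W \<sigma>} = polys"
    unfolding polys_def by (auto simp: splits_def)
  then show "carrier R = polys" "mult R = (*)" "one R = mono {}" "zero R = 0" "add R = (+)"
    by (simp_all add: partition_poly_ring_def poly_const_one)
qed

lemma poly_const_in_polys: "poly_const a \<in> polys"
  unfolding poly_const_def by (rule single_in_polys) simp

lemma cring_R: "cring R"
proof (rule cringI)
  show "abelian_group R"
  proof (rule abelian_groupI)
    fix x assume "x \<in> carrier R"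
    then show "\<exists>y\<in>carrier R. y \<oplus>\<^bsub>R\<^esub> x = \<zero>\<^bsub>R\<^esub>"
      using ksub_uminus[OF ksub_polys, of x] by (intro bexI[of _ "- x"]) simp_all
  qed (simp_all add: ksub_add[OF ksub_polys] ksub_zero[OF ksub_polys] add.assoc add.commute)
  show "Group.comm_monoid R"
  proof (rule comm_monoidI)
    show "x \<otimes>\<^bsub>R\<^esub> y \<otimes>\<^bsub>R\<^esub> z = x \<otimes>\<^bsub>R\<^esub> (y \<otimes>\<^bsub>R\<^esub> z)" for x y z
      by (simp add: mult.assoc)
    show "x \<otimes>\<^bsub>R\<^esub> y = y \<otimes>\<^bsub>R\<^esub> x" for x y
      by (simp add: mult.commute)
  qed (simp_all add: mult_in_polys mono_in_polys mono_empty_mult)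
qed (simp add: distrib_right)

lemma ring_R: "ring R"
  using cring_R by (rule cring.axioms)

lemma a_inv_R: "p \<in> polys \<Longrightarrow> \<ominus>\<^bsub>R\<^esub> p = - p"
  using abelian_group.minus_equality[OF ring.is_abelian_group[OF ring_R], of "- p" p]
    ksub_uminus[OF ksub_polys, of p] by simp

lemma ideal_R_iff: "ideal N R \<longleftrightarrow> is_ideal N"
proof
  assume "ideal N R"
  then interpret ideal N R .
  have scale: "scale a p \<in> N" if "p \<in> N" for a p
    using I_l_closed[OF that, of "poly_const a"] poly_const_in_polys by (simp add: poly_const_mult)
  show "is_ideal N"
    unfolding is_ideal_def ksub_def
    using a_subset additive_subgroup.zero_closed[OF is_additive_subgroup]
      additive_subgroup.a_closed[OF is_additive_subgroup] I_l_closed scale by simp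
next
  assume N: "is_ideal N"
  then have sub: "N \<subseteq> polys" and k: "ksub N" and m: "\<And>p q. p \<in> N \<Longrightarrow> q \<in> polys \<Longrightarrow> q * p \<in> N"
    by (auto simp: is_ideal_def)
  show "ideal N R"
  proof (rule idealI[OF ring_R])
    show "subgroup N (add_monoid R)"
    proof (rule subgroup.intro)
      fix x assume "x \<in> N"
      then have "\<ominus>\<^bsub>R\<^esub> x \<in> N" using a_inv_R sub ksub_uminus[OF k] by auto
      then show "inv\<^bsub>add_monoid R\<^esub> x \<in> N" by (simp add: a_inv_def)
    qed (use sub ksub_add[OF k] ksub_zero[OF k] in auto)
  qed (use m in \<open>auto simp: mult.commute\<close>)
qed

lemma form_quad_form: "form (quad_form i j k l) = (linear_relator S W i j k l :: ('a, 'k) lpoly)"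
proof -
  have *: "(\<Sum>\<sigma>\<in>splits S W. scale (if separates A \<sigma> B then 1 else 0) (var \<sigma>)) =
      (\<Sum>\<sigma> | stable_two_partition S W \<sigma> \<and> separates A \<sigma> B. poly_var \<sigma>)" for A B
  proof -
    have "(\<Sum>\<sigma>\<in>splits S W. scale (if separates A \<sigma> B then 1 else 0) (var \<sigma>)) =
        (\<Sum>\<sigma>\<in>splits S W. if separates A \<sigma> B then var \<sigma> else 0)"
      by (intro sum.cong) auto
    also have "\<dots> = (\<Sum>\<sigma>\<in>{\<sigma> \<in> splits S W. separates A \<sigma> B}. var \<sigma>)"
      by (rule sum.inter_filter[symmetric]) (rule finite_V)
    finally show ?thesis by (simp add: splits_def poly_var_eq)
  qed
  show ?thesis
    unfolding form_def quad_form_def scale_diff_left sum_subtractf * linear_relator_def ..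
qed

text \<open>\<open>incompatible_iff_allowed\<close> translates the products; the factors are
  distinct because a 2-partition is compatible with itself.\<close>

lemma relators_eq: "relators =
    {linear_relator S W i j k l | i j k l. allowed S W i j k l} \<union>
      {poly_var \<sigma> * poly_var \<sigma>' | \<sigma> \<sigma>'.
         stable_two_partition S W \<sigma> \<and> stable_two_partition S W \<sigma>' \<and>
         (\<exists>i j k l. allowed S W i j k l \<and> separates {i, j} \<sigma> {k, l} \<and> separates {k, j} \<sigma>' {i, l})}"
  (is "_ = ?A \<union> ?B")
proof -
  have "form ` quad_forms S W = ?A"
    unfolding quad_forms_def using form_quad_form by (force simp: image_def)
  moreover have "{var \<sigma> * var \<tau> | \<sigma> \<tau>. \<sigma> \<in> splits S W \<and> \<tau> \<in> splits S W \<and> \<sigma> \<noteq> \<tau> \<and> \<not> compatible \<sigma> \<tau>} = ?B"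
  proof -
    have "\<sigma> \<in> splits S W \<and> \<tau> \<in> splits S W \<and> \<sigma> \<noteq> \<tau> \<and> \<not> compatible \<sigma> \<tau> \<longleftrightarrow>
        stable_two_partition S W \<sigma> \<and> stable_two_partition S W \<tau> \<and>
         (\<exists>i j k l. allowed S W i j k l \<and> separates {i, j} \<sigma> {k, l} \<and> separates {k, j} \<tau> {i, l})" for \<sigma> \<tau>
      using incompatible_iff_allowed[of \<sigma> S W \<tau>] compatible_refl[of \<sigma> S W] by (auto simp: splits_def)
    then show ?thesis unfolding poly_var_eq by simp
  qed
  ultimately show ?thesis unfolding relators_def by simp
qed

lemma relators_in_polys: "relators \<subseteq> polys"
  unfolding relators_def using form_in_polys var_in_polys mult_in_polys by auto

lemma cohomology_ideal_eq: "cohomology_ideal S W = genideal R relators"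
  unfolding cohomology_ideal_def relators_eq ..

end

sublocale painted_set \<subseteq> complex_ideal "splits S W" compatible "quad_forms S W :: ('a set set \<Rightarrow> 'k) set"
  "cohomology_ideal S W"
proof
  note ring = ring_R
  show "is_ideal (cohomology_ideal S W)"
    unfolding cohomology_ideal_eq ideal_R_iff[symmetric]
    by (rule ring.genideal_ideal[OF ring]) (simp add: relators_in_polys)
  show "relators \<subseteq> cohomology_ideal S W"
    unfolding cohomology_ideal_eq by (rule ring.genideal_self[OF ring]) (simp add: relators_in_polys)
  show "cohomology_ideal S W \<subseteq> N" if "is_ideal N" "relators \<subseteq> N" for N
    unfolding cohomology_ideal_eq using that
    by (intro ring.genideal_minimal[OF ring]) (simp_all add: ideal_R_iff)
qed

context painted_set
begin

abbreviation I :: "('a, 'k) lpoly set" where "I \<equiv> cohomology_ideal S W"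
abbreviation A :: "('a, 'k) lpoly set ring" where "A \<equiv> cohomology S W"
abbreviation coh :: "('a, 'k) lpoly \<Rightarrow> ('a, 'k) lpoly set" where "coh \<equiv> coh_class S W"

lemma ideal_I_R: "ideal I R"
  using ideal_I by (simp add: ideal_R_iff)

lemma coh_eq: "coh p = (\<lambda>h. h + p) ` I"
  unfolding coh_class_def by (rule a_r_coset_plus) simp

lemma coh_eq_iff: "coh p = coh q \<longleftrightarrow> p - q \<in> I"
  unfolding coh_eq by (rule coset_eq_iff[OF ksub_I])

lemma carrier_A: "carrier A = coh ` polys"
  unfolding cohomology_def FactRing_def A_RCOSETS_def' coh_class_def[abs_def] by auto

lemma coh_in_A: "p \<in> polys \<Longrightarrow> coh p \<in> carrier A"
  by (simp add: carrier_A)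

lemma zero_A: "\<zero>\<^bsub>A\<^esub> = I"
  by (simp add: cohomology_def FactRing_def)

lemma coh_zero_iff: "coh p = \<zero>\<^bsub>A\<^esub> \<longleftrightarrow> p \<in> I"
proof -
  have "coh 0 = I" by (simp add: coh_eq)
  then show ?thesis using coh_eq_iff[of p 0] by (simp add: zero_A)
qed

lemma one_A: "\<one>\<^bsub>A\<^esub> = coh (mono {})"
  by (simp add: cohomology_def FactRing_def coh_class_def)

lemma add_A: "coh p \<oplus>\<^bsub>A\<^esub> coh q = coh (p + q)"
proof -
  have "coh p \<oplus>\<^bsub>A\<^esub> coh q = set_add R (coh p) (coh q)"
    by (simp add: cohomology_def FactRing_def)
  also have "\<dots> = coh (p + q)"
    unfolding coh_eq by (rule coset_add) (simp_all add: ksub_I)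
  finally show ?thesis .
qed

lemma mult_A: "p \<in> polys \<Longrightarrow> q \<in> polys \<Longrightarrow> coh p \<otimes>\<^bsub>A\<^esub> coh q = coh (p * q)"
  using ideal.rcoset_mult_add[OF ideal_I_R, of p q]
  by (simp add: cohomology_def FactRing_def coh_class_def)

lemma cring_A: "cring A"
  unfolding cohomology_def by (rule ideal.quotient_is_cring[OF ideal_I_R cring_R])

section \<open>The module of trees and the chains of the complex\<close>

definition tchains :: "('a, 'k) tree_chain set" where
  "tchains = {c. Poly_Mapping.keys c \<subseteq> tree_classes S W}"

lemma M_simps [simp]:
  "carrier M = tchains" "zero M = 0" "add M = (+)" "smult M = scale"
  by (simp_all add: tree_module_def tchains_def scale_def[abs_def])

lemma ksub_tchains: "ksub tchains"
  unfolding ksub_def tchains_def mem_Collect_eq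
  by (auto dest!: subsetD[OF keys_add] subsetD[OF keys_scale])

lemma abelian_group_M: "abelian_group M"
proof (rule abelian_groupI)
  fix x assume "x \<in> carrier M"
  then show "\<exists>y\<in>carrier M. y \<oplus>\<^bsub>M\<^esub> x = \<zero>\<^bsub>M\<^esub>"
    using ksub_uminus[OF ksub_tchains, of x] by (intro bexI[of _ "- x"]) simp_all
qed (simp_all add: ksub_add[OF ksub_tchains] ksub_zero[OF ksub_tchains] add.assoc add.commute)

lemma a_inv_M: "c \<in> tchains \<Longrightarrow> \<ominus>\<^bsub>M\<^esub> c = - c"
  using abelian_group.minus_equality[OF abelian_group_M, of "- c" c]
    ksub_uminus[OF ksub_tchains, of c] by simp

lemma submodule_M_iff: "submodule N coeff_ring M \<longleftrightarrow> ksub N \<and> N \<subseteq> tchains"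
proof
  assume "submodule N coeff_ring M"
  then interpret submodule N coeff_ring M .
  show "ksub N \<and> N \<subseteq> tchains"
    using subset one_closed m_closed smult_closed by (simp add: ksub_def coeff_ring_def)
next
  assume N: "ksub N \<and> N \<subseteq> tchains"
  show "submodule N coeff_ring M"
  proof (intro submodule.intro subgroup.intro submodule_axioms.intro)
    fix x assume "x \<in> N"
    then have "x \<in> tchains" "- x \<in> N" using N ksub_uminus[of N x] by auto
    then have "\<ominus>\<^bsub>M\<^esub> x \<in> N" using a_inv_M[of x] by simp
    then show "inv\<^bsub>add_monoid M\<^esub> x \<in> N" by (simp add: a_inv_def)
  qed (use N ksub_add ksub_zero ksub_scale in auto)
qed

lemma gen_submodule_eq:
  assumes "Z \<subseteq> tchains"
  shows "gen_submodule coeff_ring M Z = kspan Z"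
proof (intro equalityI)
  have "kspan Z \<subseteq> tchains"
    using klinear_kspan[OF ksub_tchains klinear_id] assms by blast
  then show "gen_submodule coeff_ring M Z \<subseteq> kspan Z"
    unfolding gen_submodule_def submodule_M_iff using ksub_kspan kspan_base by blast
  show "kspan Z \<subseteq> gen_submodule coeff_ring M Z"
    unfolding gen_submodule_def submodule_M_iff
    using klinear_kspan[OF _ klinear_id] by blast
qed

lemma tree_pair_intro: "stable_tree S W T \<Longrightarrow> stable_tree S W T' \<Longrightarrow> tree_pair S W w T T'"
  by unfold_locales

lemma stable_rooted_tree_intro: "stable_tree S W T \<Longrightarrow> stable_rooted_tree S W w T"
  by unfold_locales

lemma face_splits_of: "stable_tree S W T \<Longrightarrow> face (splits_of S T)"
  by (rule stable_rooted_tree.face_tree_splits[OF stable_rooted_tree_intro])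

lemma tree_iso_splits: "stable_tree S W T \<Longrightarrow> stable_tree S W T' \<Longrightarrow> tree_iso S T T' \<longleftrightarrow> splits_of S T = splits_of S T'"
  by (rule tree_pair.tree_iso_iff[OF tree_pair_intro])

lemma tree_class_eq:
  "stable_tree S W T \<Longrightarrow> tree_class S W T = {T'. stable_tree S W T' \<and> splits_of S T' = splits_of S T}"
  using tree_iso_splits by (auto simp: tree_class_def)

definition class_splits :: "'a lgraph set \<Rightarrow> 'a set set set" where
  "class_splits C = splits_of S (SOME T. T \<in> C)"

lemma some_tree_class:
  assumes "stable_tree S W T"
  shows "stable_tree S W (SOME T'. T' \<in> tree_class S W T)"
    and class_splits_tree_class: "class_splits (tree_class S W T) = splits_of S T"
proof -
  have "T \<in> tree_class S W T" using assms by (simp add: tree_class_eq)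
  then have "(SOME T'. T' \<in> tree_class S W T) \<in> tree_class S W T" by (rule someI)
  then show "stable_tree S W (SOME T'. T' \<in> tree_class S W T)" "class_splits (tree_class S W T) = splits_of S T"
    using assms by (simp_all add: tree_class_eq class_splits_def)
qed

text \<open>With \<open>trees_of\<close>, the isomorphism between combinations of tree classes and
  chains: a class is replaced by the 2-partitions common to its members.\<close>

definition faces_of :: "('a, 'k) tree_chain \<Rightarrow> ('a set set set \<Rightarrow>\<^sub>0 'k)" where
  "faces_of = lin (\<lambda>C. Poly_Mapping.single (class_splits C) 1)"

definition rep :: "'a set set set \<Rightarrow> 'a lgraph" where
  "rep F = (SOME T. stable_tree S W T \<and> splits_of S T = F)"

definition trees_of :: "('a set set set \<Rightarrow>\<^sub>0 'k) \<Rightarrow> ('a, 'k) tree_chain" where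
  "trees_of = lin (\<lambda>F. if face F then basis_elt S W (rep F) else 0)"

lemma rep:
  assumes "face F"
  shows rep_stable: "stable_tree S W (rep F)" and splits_of_rep: "splits_of S (rep F) = F"
  using someI_ex[OF tree_of_face[OF assms]] unfolding rep_def by blast+

lemma klinear_faces_of: "klinear faces_of" and klinear_trees_of: "klinear trees_of"
  by (simp_all add: faces_of_def trees_of_def klinear_lin)

lemma faces_of_basis: "stable_tree S W T \<Longrightarrow> faces_of (basis_elt S W T) = Poly_Mapping.single (splits_of S T) 1"
  by (simp add: faces_of_def basis_elt_def class_splits_tree_class)

lemma basis_in_tchains: "stable_tree S W T \<Longrightarrow> basis_elt S W T \<in> tchains"
  by (simp add: tchains_def basis_elt_def tree_classes_def)

lemma basis_eq: "stable_tree S W T \<Longrightarrow> stable_tree S W T' \<Longrightarrow> splits_of S T = splits_of S T' \<Longrightarrow>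
    basis_elt S W T = basis_elt S W T'"
  by (simp add: basis_elt_def tree_class_eq)

lemma trees_of_single: "stable_tree S W T \<Longrightarrow> trees_of (Poly_Mapping.single (splits_of S T) 1) = basis_elt S W T"
  using basis_eq[OF rep_stable[OF face_splits_of], of T T] splits_of_rep[OF face_splits_of]
  by (simp add: trees_of_def face_splits_of)

lemma trees_of_in_tchains: "trees_of c \<in> tchains"
  by (rule klinear_mem[OF ksub_tchains klinear_trees_of])
    (auto simp: trees_of_def ksub_zero[OF ksub_tchains] basis_in_tchains rep_stable)

lemma faces_of_in_chains:
  assumes "c \<in> tchains"
  shows "faces_of c \<in> chains"
proof (rule klinear_mem[OF ksub_chains klinear_faces_of])
  fix C assume "C \<in> Poly_Mapping.keys c"
  then obtain T where "C = tree_class S W T" "stable_tree S W T"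
    using assms by (auto simp: tchains_def tree_classes_def)
  then show "faces_of (Poly_Mapping.single C 1) \<in> chains"
    by (simp add: faces_of_def class_splits_tree_class single_in_chains face_splits_of)
qed

lemma trees_of_faces_of:
  assumes "c \<in> tchains"
  shows "trees_of (faces_of c) = c"
proof -
  have "trees_of (faces_of c) - c \<in> {0}"
  proof (rule klinear_cong[OF _ klinear_comp[OF klinear_trees_of klinear_faces_of] klinear_id])
    show "ksub {0 :: ('a, 'k) tree_chain}" by (simp add: ksub_def)
    fix C assume "C \<in> Poly_Mapping.keys c"
    then obtain T where T: "C = tree_class S W T" "stable_tree S W T"
      using assms by (auto simp: tchains_def tree_classes_def)
    then have "(Poly_Mapping.single C 1 :: ('a, 'k) tree_chain) = basis_elt S W T" by (simp add: basis_elt_def)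
    then show "trees_of (faces_of (Poly_Mapping.single C 1)) - Poly_Mapping.single C 1 \<in> {0}"
      using T(2) by (simp add: faces_of_basis trees_of_single)
  qed
  then show ?thesis by simp
qed

lemma faces_of_trees_of:
  assumes "c \<in> chains"
  shows "faces_of (trees_of c) = c"
proof -
  have "faces_of (trees_of c) - c \<in> {0}"
  proof (rule klinear_cong[OF _ klinear_comp[OF klinear_faces_of klinear_trees_of] klinear_id])
    show "ksub {0 :: ('a set set set \<Rightarrow>\<^sub>0 'k)}" by (simp add: ksub_def)
    fix F assume "F \<in> Poly_Mapping.keys c"
    then have "face F" using assms by (auto simp: chains_def)
    then show "faces_of (trees_of (Poly_Mapping.single F 1)) - Poly_Mapping.single F 1 \<in> {0}"
      by (simp add: trees_of_def faces_of_basis rep_stable splits_of_rep)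
  qed
  then show ?thesis by simp
qed

text \<open>Different edges have different 2-partitions, so the product over edges is squarefree and
  indexed by the face.\<close>

lemma good_monomial_eq:
  assumes "stable_tree S W T"
  shows "good_monomial S W T = mono (splits_of S T)"
proof -
  interpret stable_rooted_tree S W w K T by (rule stable_rooted_tree_intro[OF assms])
  interpret Rc: cring R by (rule cring_R)
  have "finite (edges T)" using finite_flags by (simp add: edges_def)
  have fp: "(\<Otimes>\<^bsub>R\<^esub>e\<in>E. poly_var (edge_partition S T e)) =
      Poly_Mapping.single (\<Sum>e\<in>E. Poly_Mapping.single (edge_partition S T e) 1) 1"
    if "finite E" "E \<subseteq> edges T" for E
    using that
  proof (induction E rule: finite_induct)
    case empty
    then show ?case by (simp add: mono_def)
  next
    case (insert e E)
    have sp: "edge_partition S T e \<in> splits S W" if "e \<in> edges T" for e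
      using face_tree_splits that by (auto simp: face_def splits_of_def)
    have "(\<Otimes>\<^bsub>R\<^esub>e\<in>insert e E. poly_var (edge_partition S T e)) =
        poly_var (edge_partition S T e) \<otimes>\<^bsub>R\<^esub> (\<Otimes>\<^bsub>R\<^esub>e\<in>E. poly_var (edge_partition S T e))"
      using insert.hyps insert.prems sp var_in_polys
      by (intro Rc.finprod_insert) (auto simp: poly_var_eq)
    then show ?case
      using insert by (simp add: poly_var_eq var_mult_single)
  qed
  show ?thesis
    unfolding good_monomial_def fp[OF \<open>finite (edges T)\<close> order_refl] mono_def splits_of_def
    by (simp add: sum.reindex[OF edge_partition_inj])
qed

lemma monomial_combination_eq:
  assumes "c \<in> tchains"
  shows "monomial_combination S W c = Phi (faces_of c)"
proof -
  have "good_monomial S W (SOME T. T \<in> C) = Phi (Poly_Mapping.single (class_splits C) 1)"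
    if C: "C \<in> Poly_Mapping.keys c" for C
  proof -
    obtain T where "C = tree_class S W T" "stable_tree S W T"
      using assms C by (auto simp: tchains_def tree_classes_def)
    then show ?thesis
      using good_monomial_eq[OF some_tree_class(1)] by (simp add: class_splits_def face_splits_of some_tree_class(1))
  qed
  then have "monomial_combination S W c =
      (\<Sum>C\<in>Poly_Mapping.keys c. scale (Poly_Mapping.lookup c C) (Phi (Poly_Mapping.single (class_splits C) 1)))"
    unfolding monomial_combination_def poly_const_mult by (intro sum.cong) simp_all
  also have "\<dots> = Phi (faces_of c)"
    unfolding faces_of_def lin_def by (simp only: klinear_sum[OF klinear_Phi] klinear_scale[OF klinear_Phi])
  finally show ?thesis .
qed

section \<open>Standard relations as sums over links\<close>

lemma rho_quad_form:
  "rho F (quad_form i j k l) =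
    (\<Sum>\<sigma> | \<sigma> \<in> link F \<and> separates {i, j} \<sigma> {k, l}. Poly_Mapping.single (insert \<sigma> F) 1) -
    (\<Sum>\<sigma> | \<sigma> \<in> link F \<and> separates {k, j} \<sigma> {i, l}. Poly_Mapping.single (insert \<sigma> F) 1)"
proof -
  have *: "(\<Sum>\<sigma>\<in>link F. Poly_Mapping.single (insert \<sigma> F) (if P \<sigma> then 1 else (0::'k))) =
      (\<Sum>\<sigma> | \<sigma> \<in> link F \<and> P \<sigma>. Poly_Mapping.single (insert \<sigma> F) 1)" for P
    unfolding sum.inter_filter[OF finite_link] by (intro sum.cong) auto
  show ?thesis
    unfolding rho_def quad_form_def single_diff sum_subtractf * ..
qed

lemma standard_relation_labels:
  fixes g :: "'a lgraph \<Rightarrow> 'm::ab_group_add"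
  assumes T: "stable_tree S W T" "v \<in> verts T"
    and fl: "{f1, f2, f3, f4} \<subseteq> flags_at T v" "distinct [f1, f2, f3, f4]"
    and lb: "i \<in> br S T f1" "j \<in> br S T f2" "k \<in> br S T f3" "l \<in> br S T f4"
  shows "standard_relation S W g T v f1 f2 f3 f4 =
      (\<Sum>\<sigma> | \<sigma> \<in> link (splits_of S T) \<and> separates {i, j} \<sigma> {k, l}. g (star S W \<sigma> T)) -
      (\<Sum>\<sigma> | \<sigma> \<in> link (splits_of S T) \<and> separates {k, j} \<sigma> {i, l}. g (star S W \<sigma> T))"
proof -
  interpret stable_rooted_tree S W w K T by (rule stable_rooted_tree_intro[OF T(1)])
  have fl': "{f3, f2, f1, f4} \<subseteq> flags_at T v" "distinct [f3, f2, f1, f4]" using fl by auto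
  have eq: "split_sum S W g T v {a, b} {c, d} =
      (\<Sum>\<sigma> | \<sigma> \<in> link tree_splits \<and> separates {x, y} \<sigma> {z, u}. g (star S W \<sigma> T))"
    if "{a, b, c, d} \<subseteq> flags_at T v" "distinct [a, b, c, d]"
      "x \<in> br S T a" "y \<in> br S T b" "z \<in> br S T c" "u \<in> br S T d"
    for a b c d x y z u
  proof -
    have "split_sum S W g T v {a, b} {c, d} =
        (\<Sum>\<sigma> | \<sigma> \<in> link tree_splits \<and> separates (labels {a, b}) \<sigma> (labels {c, d}). g (star S W \<sigma> T))"
      using that by (intro split_sum_eq[where ?x1.0 = a and ?x2.0 = b and y = c] T(2)) auto
    also have "{\<sigma>. \<sigma> \<in> link tree_splits \<and> separates (labels {a, b}) \<sigma> (labels {c, d})} =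
        {\<sigma>. \<sigma> \<in> link tree_splits \<and> separates {x, y} \<sigma> {z, u}}"
      using separates_branches[OF T(2) that] by blast
    finally show ?thesis .
  qed
  show ?thesis
    by (simp add: standard_relation_def eq[OF fl lb] eq[OF fl' lb(3,2,1,4)])
qed

lemma branch_labels_br: "f \<in> flags_at T v \<Longrightarrow> branch_labels S T v f = br S T f"
  by (simp add: br_def flags_at_def)

lemma allowed_flagsE:
  assumes T: "stable_tree S W T" "v \<in> verts T" "allowed_flags S W T v f1 f2 f3 f4"
  obtains i j k l where "allowed S W i j k l" "{f1, f2, f3, f4} \<subseteq> flags_at T v" "distinct [f1, f2, f3, f4]"
    "i \<in> br S T f1" "j \<in> br S T f2" "k \<in> br S T f3" "l \<in> br S T f4"
    "\<And>\<tau>. \<tau> \<in> splits_of S T \<Longrightarrow> \<not> separates {i, j} \<tau> {k, l} \<and> \<not> separates {k, j} \<tau> {i, l}"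
proof -
  interpret stable_rooted_tree S W w K T by (rule stable_rooted_tree_intro[OF T(1)])
  have fl: "{f1, f2, f3, f4} \<subseteq> flags_at T v" "distinct [f1, f2, f3, f4]"
    and ab: "allowed_branches S W (branch_labels S T v f1) (branch_labels S T v f2)
       (branch_labels S T v f3) (branch_labels S T v f4)"
    using T(3) by (simp_all add: allowed_flags_def)
  then obtain i j k l where al: "allowed S W i j k l"
    and lb: "i \<in> br S T f1" "j \<in> br S T f2" "k \<in> br S T f3" "l \<in> br S T f4"
    unfolding allowed_branches_def by (auto simp: branch_labels_br)
  have fl': "{f3, f2, f1, f4} \<subseteq> flags_at T v" "distinct [f3, f2, f1, f4]" using fl by auto
  show thesis
    by (rule that[OF al fl lb])
      (use no_separation_at_vertex[OF T(2) fl lb] no_separation_at_vertex[OF T(2) fl' lb(3,2,1,4)] in simp)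
qed

definition std :: "('a, 'k) tree_chain set" where
  "std = {standard_relation S W (basis_elt S W) T v f1 f2 f3 f4 | T v f1 f2 f3 f4.
         stable_tree S W T \<and> v \<in> verts T \<and> allowed_flags S W T v f1 f2 f3 f4}"

lemma star_props:
  assumes "stable_tree S W T" "\<sigma> \<in> link (splits_of S T)"
  shows "stable_tree S W (star S W \<sigma> T)" "splits_of S (star S W \<sigma> T) = insert \<sigma> (splits_of S T)"
  using stable_rooted_tree.star(1,2)[OF stable_rooted_tree_intro[OF assms(1)] assms(2)] by auto

lemma faces_of_sum_star:
  assumes "stable_tree S W T"
  shows "faces_of (\<Sum>\<sigma> | \<sigma> \<in> link (splits_of S T) \<and> P \<sigma>. basis_elt S W (star S W \<sigma> T)) =
    (\<Sum>\<sigma> | \<sigma> \<in> link (splits_of S T) \<and> P \<sigma>. Poly_Mapping.single (insert \<sigma> (splits_of S T)) 1)"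
  unfolding klinear_sum[OF klinear_faces_of]
  by (intro sum.cong refl) (simp add: faces_of_basis star_props[OF assms])

lemma sum_star_in_tchains:
  assumes "stable_tree S W T"
  shows "(\<Sum>\<sigma> | \<sigma> \<in> link (splits_of S T) \<and> P \<sigma>. basis_elt S W (star S W \<sigma> T)) \<in> tchains"
  by (intro ksub_sum ksub_tchains basis_in_tchains) (simp add: star_props[OF assms])

lemma std_in_tchains: "std \<subseteq> tchains"
proof
  fix c assume "c \<in> std"
  then obtain T v f1 f2 f3 f4 where T: "stable_tree S W T" "v \<in> verts T" "allowed_flags S W T v f1 f2 f3 f4"
    and c: "c = standard_relation S W (basis_elt S W) T v f1 f2 f3 f4"
    unfolding std_def by (elim CollectE exE conjE)
  show "c \<in> tchains"
    using T
  proof (rule allowed_flagsE)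
    fix i j k l
    assume "{f1, f2, f3, f4} \<subseteq> flags_at T v" "distinct [f1, f2, f3, f4]"
      "i \<in> br S T f1" "j \<in> br S T f2" "k \<in> br S T f3" "l \<in> br S T f4"
    note eq = standard_relation_labels[OF T(1,2) this]
    show "c \<in> tchains"
      unfolding c eq by (intro ksub_diff ksub_tchains sum_star_in_tchains T(1))
  qed
qed

lemma tree_relations_eq: "tree_relations S W = kspan std"
  unfolding tree_relations_def std_def[symmetric] by (rule gen_submodule_eq[OF std_in_tchains])

lemma faces_of_standard_relation:
  assumes T: "stable_tree S W T" "v \<in> verts T"
    and fl: "{f1, f2, f3, f4} \<subseteq> flags_at T v" "distinct [f1, f2, f3, f4]"
    and lb: "i \<in> br S T f1" "j \<in> br S T f2" "k \<in> br S T f3" "l \<in> br S T f4"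
  shows "faces_of (standard_relation S W (basis_elt S W) T v f1 f2 f3 f4) = rho (splits_of S T) (quad_form i j k l)"
    and "standard_relation S W (good_monomial S W) T v f1 f2 f3 f4 = Phi (rho (splits_of S T) (quad_form i j k l))"
proof -
  let ?F = "splits_of S T"
  note eq = standard_relation_labels[OF T fl lb]
  show "faces_of (standard_relation S W (basis_elt S W) T v f1 f2 f3 f4) = rho ?F (quad_form i j k l)"
    unfolding eq klinear_diff[OF klinear_faces_of] faces_of_sum_star[OF T(1)] rho_quad_form ..
  have "(\<Sum>\<sigma> | \<sigma> \<in> link ?F \<and> P \<sigma>. good_monomial S W (star S W \<sigma> T)) =
      Phi (\<Sum>\<sigma> | \<sigma> \<in> link ?F \<and> P \<sigma>. Poly_Mapping.single (insert \<sigma> ?F) 1)" for P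
    unfolding klinear_sum[OF klinear_Phi]
    by (intro sum.cong refl) (simp add: good_monomial_eq star_props[OF T(1)] link_face)
  then show "standard_relation S W (good_monomial S W) T v f1 f2 f3 f4 = Phi (rho ?F (quad_form i j k l))"
    unfolding eq rho_quad_form by (simp add: klinear_diff[OF klinear_Phi])
qed

lemma standard_relation_forms:
  assumes T: "stable_tree S W T" "v \<in> verts T" "allowed_flags S W T v f1 f2 f3 f4"
  shows "faces_of (standard_relation S W (basis_elt S W) T v f1 f2 f3 f4) \<in> J"
    and "(standard_relation S W (good_monomial S W) T v f1 f2 f3 f4 :: ('a, 'k) lpoly) \<in> I"
proof -
  obtain i j k l where al: "allowed S W i j k l"
    and fl: "{f1, f2, f3, f4} \<subseteq> flags_at T v" "distinct [f1, f2, f3, f4]"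
    and lb: "i \<in> br S T f1" "j \<in> br S T f2" "k \<in> br S T f3" "l \<in> br S T f4"
    and ns: "\<And>\<tau>. \<tau> \<in> splits_of S T \<Longrightarrow> \<not> separates {i, j} \<tau> {k, l} \<and> \<not> separates {k, j} \<tau> {i, l}"
    using T by (rule allowed_flagsE) (rule that)
  have "rho (splits_of S T) (quad_form i j k l) \<in> J"
    by (rule rho_in_J[OF face_splits_of[OF T(1)] quad_form_in_G[OF al]]) (simp add: quad_form_def ns)
  then show "faces_of (standard_relation S W (basis_elt S W) T v f1 f2 f3 f4) \<in> J"
    and "(standard_relation S W (good_monomial S W) T v f1 f2 f3 f4 :: ('a, 'k) lpoly) \<in> I"
    unfolding faces_of_standard_relation[OF T(1,2) fl lb] by (simp_all add: Phi_J)
qed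

text \<open>The four intersections of parts contain a, b, c and d respectively.\<close>

lemma crossing_incompatible:
  assumes "\<sigma> \<in> splits S W" "\<tau> \<in> splits S W" "separates {a, b} \<sigma> {c, d}" "separates {a, c} \<tau> {b, d}"
  shows "\<not> compatible \<sigma> \<tau>"
proof -
  obtain P Q where PQ: "P \<in> \<sigma>" "Q \<in> \<sigma>" "P \<noteq> Q" "{a, b} \<subseteq> P" "{c, d} \<subseteq> Q"
    using assms(3) by (rule separatesE)
  obtain P' Q' where PQ': "P' \<in> \<tau>" "Q' \<in> \<tau>" "P' \<noteq> Q'" "{a, c} \<subseteq> P'" "{b, d} \<subseteq> Q'"
    using assms(4) by (rule separatesE)
  show ?thesis
    unfolding compatible_def split_partE(1)[OF assms(1) PQ(1-3)] split_partE(1)[OF assms(2) PQ'(1-3)]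
    using PQ(4,5) PQ'(4,5) by auto
qed

text \<open>Vanishing on \<open>F\<close> means that no member separates the quadruple in a way
  counted by the form, as none can do both. If a member separates it in the third way, compatibility
  with that member makes all terms zero; otherwise some vertex has the labels on four branches and
  the relation is standard.\<close>

lemma trees_of_rho_in_std:
  assumes F: "face F" and g: "g \<in> quad_forms S W" "\<And>\<tau>. \<tau> \<in> F \<Longrightarrow> g \<tau> = 0"
  shows "trees_of (rho F g) \<in> kspan std"
proof (cases "(1 :: 'k) = 0")
  \<comment> \<open>Over the zero ring the vanishing of a form says nothing about separation, so
    this case is treated apart.\<close>
  case True
  have "scale (1 :: 'k) (trees_of (rho F g)) = 0" unfolding True by simp
  then show ?thesis by (simp add: kspan_zero)
next
  case one: False
  obtain i j k l where gq: "g = quad_form i j k l" and al: "allowed S W i j k l"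
    using g(1) by (auto simp: quad_forms_def)
  then have ijkl: "{i, j, k, l} \<subseteq> S" "distinct [i, j, k, l]" by (auto simp: allowed_iff)
  have Fs: "\<tau> \<in> splits S W" if "\<tau> \<in> F" for \<tau> using F that by (auto simp: face_def)
  have ns: "\<not> separates {i, j} \<tau> {k, l} \<and> \<not> separates {k, j} \<tau> {i, l}" if \<tau>: "\<tau> \<in> F" for \<tau>
  proof -
    have "\<not> (separates {i, j} \<tau> {k, l} \<and> separates {k, j} \<tau> {i, l})"
      using crossing_incompatible[OF Fs[OF \<tau>] Fs[OF \<tau>], of j i k l] compatible_refl[OF Fs[OF \<tau>]]
      by (auto simp: insert_commute)
    then show ?thesis using g(2)[OF \<tau>] one unfolding gq quad_form_def by (auto split: if_splits)
  qed
  show ?thesis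
  proof (cases "\<exists>\<tau>\<in>F. separates {i, k} \<tau> {j, l}")
    case True
    then obtain \<tau> where \<tau>: "\<tau> \<in> F" "separates {i, k} \<tau> {j, l}" by blast
    then have \<tau>': "separates {k, i} \<tau> {j, l}" by (simp add: insert_commute)
    have "rho F g = rho F (\<lambda>_. 0)"
    proof (rule rho_cong)
      fix \<sigma> assume \<sigma>: "\<sigma> \<in> link F"
      then show "g \<sigma> = 0"
        using crossing_incompatible[OF link_splits[OF \<sigma>] Fs[OF \<tau>(1)] _ \<tau>(2)]
          crossing_incompatible[OF link_splits[OF \<sigma>] Fs[OF \<tau>(1)] _ \<tau>'] link_compatible[OF \<sigma> \<tau>(1)]
        by (auto simp: gq quad_form_def)
    qed
    then show ?thesis by (simp add: rho_zero klinear_zero[OF klinear_trees_of] kspan_zero)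
  next
    case False
    let ?T = "rep F"
    have T: "stable_tree S W ?T" "splits_of S ?T = F" using rep[OF F] by auto
    interpret Tr: stable_rooted_tree S W w K ?T by (rule stable_rooted_tree_intro[OF T(1)])
    obtain v f1 f2 f3 f4 where v: "v \<in> verts ?T"
      and fl: "{f1, f2, f3, f4} \<subseteq> flags_at ?T v" "distinct [f1, f2, f3, f4]"
      and lb: "i \<in> br S ?T f1" "j \<in> br S ?T f2" "k \<in> br S ?T f3" "l \<in> br S ?T f4"
      using Tr.exists_vertex[OF ijkl] ns False unfolding T(2) by blast
    have "allowed_flags S W ?T v f1 f2 f3 f4"
      unfolding allowed_flags_def allowed_branches_def using fl lb al by (auto simp: branch_labels_br)
    then have in_std: "standard_relation S W (basis_elt S W) ?T v f1 f2 f3 f4 \<in> std"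
      unfolding std_def using T(1) v by blast
    have "trees_of (rho F g) = trees_of (faces_of (standard_relation S W (basis_elt S W) ?T v f1 f2 f3 f4))"
      using faces_of_standard_relation(1)[OF T(1) v fl lb] unfolding gq T(2) by simp
    also have "\<dots> = standard_relation S W (basis_elt S W) ?T v f1 f2 f3 f4"
      by (rule trees_of_faces_of) (use in_std std_in_tchains in blast)
    finally show ?thesis using kspan_base[OF in_std] by simp
  qed
qed

lemma tree_relations_iff:
  assumes "c \<in> tchains"
  shows "c \<in> tree_relations S W \<longleftrightarrow> faces_of c \<in> J"
proof
  assume "c \<in> tree_relations S W"
  then have "c \<in> kspan std" unfolding tree_relations_eq .
  then show "faces_of c \<in> J"
  proof (rule klinear_kspan[OF ksub_J klinear_faces_of])
    fix d assume "d \<in> std"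
    then show "faces_of d \<in> J" unfolding std_def using standard_relation_forms(1) by blast
  qed
next
  assume "faces_of c \<in> J"
  then have "trees_of (faces_of c) \<in> kspan std"
    unfolding J_def
  proof (rule klinear_kspan[OF ksub_kspan klinear_trees_of])
    fix x assume "x \<in> {rho F g | F g. face F \<and> g \<in> quad_forms S W \<and> (\<forall>\<sigma>\<in>F. g \<sigma> = 0)}"
    then show "trees_of x \<in> kspan std" using trees_of_rho_in_std by blast
  qed
  then show "c \<in> tree_relations S W" using trees_of_faces_of[OF assms] by (simp add: tree_relations_eq)
qed

section \<open>The isomorphism from homology to cohomology\<close>

abbreviation hom :: "('a, 'k) tree_chain \<Rightarrow> ('a, 'k) tree_chain set" where "hom \<equiv> hom_class S W"

definition monomials :: "('a, 'k) tree_chain \<Rightarrow> ('a, 'k) lpoly" where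
  "monomials c = Phi (faces_of c)"

lemma klinear_monomials: "klinear monomials"
  unfolding monomials_def[abs_def] by (rule klinear_comp[OF klinear_Phi klinear_faces_of])

lemma monomials_in_polys: "monomials c \<in> polys"
  by (simp add: monomials_def Phi_in_polys)

lemma monomials_in_I_iff: "c \<in> tchains \<Longrightarrow> monomials c \<in> I \<longleftrightarrow> c \<in> tree_relations S W"
  unfolding monomials_def tree_relations_iff using faces_of_in_chains by (intro Phi_in_I_iff) (auto simp: chains_def)

lemma monomials_basis: "stable_tree S W T \<Longrightarrow> monomials (basis_elt S W T) = mono (splits_of S T)"
  by (simp add: monomials_def faces_of_basis face_splits_of)

lemma monomials_trees_of: "c \<in> chains \<Longrightarrow> monomials (trees_of c) = Phi c"
  by (simp add: monomials_def faces_of_trees_of)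

lemma Psi_in_chains: "Psi p \<in> chains"
  using keys_Psi by (auto simp: chains_def)

lemma ex_monomials: "p \<in> polys \<Longrightarrow> \<exists>d\<in>tchains. p - monomials d \<in> I"
  using Phi_Psi[of p] monomials_trees_of[OF Psi_in_chains, of p] trees_of_in_tchains[of "Psi p"] by force

lemma ksub_tree_relations: "ksub (tree_relations S W :: ('a, 'k) tree_chain set)"
  by (simp add: tree_relations_eq ksub_kspan)

lemma hom_eq: "hom c = (\<lambda>h. h + c) ` tree_relations S W"
  unfolding hom_class_def by (rule a_r_coset_plus) simp

lemma hom_eq_iff: "hom c = hom d \<longleftrightarrow> c - d \<in> tree_relations S W"
  unfolding hom_eq by (rule coset_eq_iff[OF ksub_tree_relations])

lemma hom_eq_iff_monomials:
  assumes "c \<in> tchains" "d \<in> tchains"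
  shows "hom c = hom d \<longleftrightarrow> monomials c - monomials d \<in> I"
  unfolding hom_eq_iff using monomials_in_I_iff[OF ksub_diff[OF ksub_tchains assms]]
  by (simp add: klinear_diff[OF klinear_monomials])

lemma hom_zero: "tree_relations S W = hom 0"
  by (simp add: hom_eq)

lemma carrier_homology: "carrier (homology S W act) = hom ` tchains"
  unfolding homology_def A_RCOSETS_def' hom_class_def[abs_def] by auto

lemma zero_homology: "\<zero>\<^bsub>homology S W act\<^esub> = hom 0"
  by (simp add: homology_def hom_zero)

lemma add_homology: "hom c \<oplus>\<^bsub>homology S W act\<^esub> hom d = hom (c + d)"
proof -
  have "hom c \<oplus>\<^bsub>homology S W act\<^esub> hom d = set_add M (hom c) (hom d)"
    by (simp add: homology_def)
  also have "\<dots> = hom (c + d)"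
    unfolding hom_eq by (rule coset_add) (simp_all add: ksub_tree_relations)
  finally show ?thesis .
qed

lemma smult_homology: "smult (homology S W act) = act"
  by (simp add: homology_def)

lemma tchains_closed:
  "0 \<in> tchains" "c \<in> tchains \<Longrightarrow> d \<in> tchains \<Longrightarrow> c + d \<in> tchains" "c \<in> tchains \<Longrightarrow> - c \<in> tchains"
  "c \<in> tchains \<Longrightarrow> d \<in> tchains \<Longrightarrow> c - d \<in> tchains" "c \<in> tchains \<Longrightarrow> scale a c \<in> tchains"
  using ksub_tchains by (auto intro: ksub_zero ksub_add ksub_uminus ksub_diff ksub_scale)

lemma abelian_group_homology:
  fixes act :: "('a, 'k) lpoly set \<Rightarrow> ('a, 'k) tree_chain set \<Rightarrow> ('a, 'k) tree_chain set"
  shows "abelian_group (homology S W act)"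
proof (rule abelian_groupI)
  show "x \<oplus>\<^bsub>homology S W act\<^esub> y \<in> carrier (homology S W act)"
    if "x \<in> carrier (homology S W act)" "y \<in> carrier (homology S W act)" for x y
    using that unfolding carrier_homology by (auto simp: add_homology tchains_closed)
  show "\<zero>\<^bsub>homology S W act\<^esub> \<in> carrier (homology S W act)"
    unfolding carrier_homology zero_homology by (intro imageI tchains_closed)
  show "x \<oplus>\<^bsub>homology S W act\<^esub> y \<oplus>\<^bsub>homology S W act\<^esub> z = x \<oplus>\<^bsub>homology S W act\<^esub> (y \<oplus>\<^bsub>homology S W act\<^esub> z)"
    if "x \<in> carrier (homology S W act)" "y \<in> carrier (homology S W act)" "z \<in> carrier (homology S W act)" for x y z
    using that unfolding carrier_homology by (auto simp: add_homology add.assoc)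
  show "x \<oplus>\<^bsub>homology S W act\<^esub> y = y \<oplus>\<^bsub>homology S W act\<^esub> x"
    if "x \<in> carrier (homology S W act)" "y \<in> carrier (homology S W act)" for x y
    using that unfolding carrier_homology by (auto simp: add_homology add.commute)
  show "\<zero>\<^bsub>homology S W act\<^esub> \<oplus>\<^bsub>homology S W act\<^esub> x = x"
    if "x \<in> carrier (homology S W act)" for x
    using that unfolding carrier_homology zero_homology by (auto simp: add_homology)
  show "\<exists>y\<in>carrier (homology S W act). y \<oplus>\<^bsub>homology S W act\<^esub> x = \<zero>\<^bsub>homology S W act\<^esub>"
    if x: "x \<in> carrier (homology S W act)" for x
  proof -
    obtain c where c: "x = hom c" "c \<in> tchains" using x unfolding carrier_homology by (rule imageE)
    have "hom (- c) \<oplus>\<^bsub>homology S W act\<^esub> x = \<zero>\<^bsub>homology S W act\<^esub>"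
      unfolding c(1) add_homology zero_homology by simp
    moreover have "hom (- c) \<in> carrier (homology S W act)"
      unfolding carrier_homology by (intro imageI tchains_closed c(2))
    ultimately show ?thesis by (rule bexI)
  qed
qed

section \<open>The action\<close>

text \<open>The action is transported from the multiplication along the isomorphism from homology to
  cohomology induced by \<open>monomials\<close>.\<close>

definition act0 :: "('a, 'k) lpoly set \<Rightarrow> ('a, 'k) tree_chain set \<Rightarrow> ('a, 'k) tree_chain set" where
  "act0 x y = (SOME z. \<exists>p c d. p \<in> polys \<and> c \<in> tchains \<and> d \<in> tchains \<and>
     x = coh p \<and> y = hom c \<and> z = hom d \<and> p * monomials c - monomials d \<in> I)"

text \<open>Other representatives change the product only by a member of \<open>I\<close>, and
  \<open>monomials\<close> is injective from homology to the ring modulo \<open>I\<close>, so the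
  description in \<open>act0\<close> determines its value.\<close>

lemma act0_eq:
  assumes p: "p \<in> polys" and c: "c \<in> tchains" and d: "d \<in> tchains" and eq: "p * monomials c - monomials d \<in> I"
  shows "act0 (coh p) (hom c) = hom d"
proof -
  have "\<exists>z p' c' d'. p' \<in> polys \<and> c' \<in> tchains \<and> d' \<in> tchains \<and>
     coh p = coh p' \<and> hom c = hom c' \<and> z = hom d' \<and> p' * monomials c' - monomials d' \<in> I"
    using assms by blast
  from someI_ex[OF this] obtain p' c' d' where *: "p' \<in> polys" "c' \<in> tchains" "d' \<in> tchains"
    "coh p = coh p'" "hom c = hom c'" "act0 (coh p) (hom c) = hom d'" "p' * monomials c' - monomials d' \<in> I"
    unfolding act0_def by (elim exE conjE)
  have "monomials c * (p - p') \<in> I"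
    using *(4) by (intro I_mult monomials_in_polys) (simp add: coh_eq_iff)
  moreover have "p' * (monomials c - monomials c') \<in> I"
    using *(5) by (intro I_mult *(1)) (simp add: hom_eq_iff_monomials[OF c *(2)])
  ultimately have "monomials c * (p - p') + p' * (monomials c - monomials c') \<in> I"
    by (rule ksub_add[OF ksub_I])
  then have "p * monomials c - p' * monomials c' \<in> I"
    by (simp add: algebra_simps)
  from ksub_trans[OF ksub_I ksub_trans[OF ksub_I ksub_sym[OF ksub_I eq] this] *(7)]
  have "monomials d - monomials d' \<in> I" .
  then show ?thesis using *(6) hom_eq_iff_monomials[OF d *(3)] by simp
qed

lemma act0E:
  assumes "p \<in> polys" "c \<in> tchains"
  obtains d where "d \<in> tchains" "p * monomials c - monomials d \<in> I" "act0 (coh p) (hom c) = hom d"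
proof -
  obtain d where d: "d \<in> tchains" "p * monomials c - monomials d \<in> I"
    using ex_monomials[OF mult_in_polys[OF assms(1) monomials_in_polys]] by (rule bexE)
  then show thesis using that act0_eq[OF assms d] by blast
qed

lemma module_act0: "module A (homology S W act0)"
proof (rule moduleI)
  show "cring A" by (rule cring_A)
  show "abelian_group (homology S W act0)" by (rule abelian_group_homology)
  let ?H = "homology S W act0"
  have A: "\<exists>p\<in>polys. x = coh p" if "x \<in> carrier A" for x using that unfolding carrier_A by blast
  have H: "\<exists>c\<in>tchains. y = hom c" if "y \<in> carrier ?H" for y using that unfolding carrier_homology by blast
  show "x \<odot>\<^bsub>?H\<^esub> y \<in> carrier ?H" if xy: "x \<in> carrier A" "y \<in> carrier ?H" for x y
  proof -
    obtain p c where pc: "p \<in> polys" "x = coh p" "c \<in> tchains" "y = hom c" using A[OF xy(1)] H[OF xy(2)] by blast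
    obtain d where "d \<in> tchains" "act0 (coh p) (hom c) = hom d" using act0E[OF pc(1,3)] by blast
    then show ?thesis unfolding smult_homology pc(2,4) carrier_homology by simp
  qed
  show "(x \<oplus>\<^bsub>A\<^esub> x') \<odot>\<^bsub>?H\<^esub> y = x \<odot>\<^bsub>?H\<^esub> y \<oplus>\<^bsub>?H\<^esub> x' \<odot>\<^bsub>?H\<^esub> y"
    if xy: "x \<in> carrier A" "x' \<in> carrier A" "y \<in> carrier ?H" for x x' y
  proof -
    obtain p p' c where pc: "p \<in> polys" "x = coh p" "p' \<in> polys" "x' = coh p'" "c \<in> tchains" "y = hom c"
      using A[OF xy(1)] A[OF xy(2)] H[OF xy(3)] by blast
    obtain d where d: "d \<in> tchains" "p * monomials c - monomials d \<in> I" "act0 (coh p) (hom c) = hom d"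
      by (rule act0E[OF pc(1,5)])
    obtain d' where d': "d' \<in> tchains" "p' * monomials c - monomials d' \<in> I" "act0 (coh p') (hom c) = hom d'"
      by (rule act0E[OF pc(3,5)])
    have "(p + p') * monomials c - monomials (d + d') \<in> I"
      using ksub_add[OF ksub_I d(2) d'(2)] by (simp add: klinear_add[OF klinear_monomials] distrib_right algebra_simps)
    then have "act0 (coh (p + p')) (hom c) = hom (d + d')"
      by (intro act0_eq ksub_add[OF ksub_polys] tchains_closed pc d d')
    then show ?thesis unfolding smult_homology pc(2,4,6) add_A d(3) d'(3) add_homology .
  qed
  show "x \<odot>\<^bsub>?H\<^esub> (y \<oplus>\<^bsub>?H\<^esub> y') = x \<odot>\<^bsub>?H\<^esub> y \<oplus>\<^bsub>?H\<^esub> x \<odot>\<^bsub>?H\<^esub> y'"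
    if xy: "x \<in> carrier A" "y \<in> carrier ?H" "y' \<in> carrier ?H" for x y y'
  proof -
    obtain p c c' where pc: "p \<in> polys" "x = coh p" "c \<in> tchains" "y = hom c" "c' \<in> tchains" "y' = hom c'"
      using A[OF xy(1)] H[OF xy(2)] H[OF xy(3)] by blast
    obtain d where d: "d \<in> tchains" "p * monomials c - monomials d \<in> I" "act0 (coh p) (hom c) = hom d"
      by (rule act0E[OF pc(1,3)])
    obtain d' where d': "d' \<in> tchains" "p * monomials c' - monomials d' \<in> I" "act0 (coh p) (hom c') = hom d'"
      by (rule act0E[OF pc(1,5)])
    have "p * monomials (c + c') - monomials (d + d') \<in> I"
      using ksub_add[OF ksub_I d(2) d'(2)] by (simp add: klinear_add[OF klinear_monomials] distrib_left algebra_simps)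
    then have "act0 (coh p) (hom (c + c')) = hom (d + d')"
      by (intro act0_eq tchains_closed pc d d')
    then show ?thesis unfolding smult_homology pc(2,4,6) add_homology d(3) d'(3) .
  qed
  show "(x \<otimes>\<^bsub>A\<^esub> x') \<odot>\<^bsub>?H\<^esub> y = x \<odot>\<^bsub>?H\<^esub> (x' \<odot>\<^bsub>?H\<^esub> y)"
    if xy: "x \<in> carrier A" "x' \<in> carrier A" "y \<in> carrier ?H" for x x' y
  proof -
    obtain p p' c where pc: "p \<in> polys" "x = coh p" "p' \<in> polys" "x' = coh p'" "c \<in> tchains" "y = hom c"
      using A[OF xy(1)] A[OF xy(2)] H[OF xy(3)] by blast
    obtain d where d: "d \<in> tchains" "p' * monomials c - monomials d \<in> I" "act0 (coh p') (hom c) = hom d"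
      by (rule act0E[OF pc(3,5)])
    obtain e where e: "e \<in> tchains" "p * monomials d - monomials e \<in> I" "act0 (coh p) (hom d) = hom e"
      by (rule act0E[OF pc(1) d(1)])
    have "p * (p' * monomials c - monomials d) + (p * monomials d - monomials e) \<in> I"
      by (intro ksub_add[OF ksub_I] I_mult d e pc)
    then have "(p * p') * monomials c - monomials e \<in> I"
      by (simp add: right_diff_distrib mult.assoc)
    then have "act0 (coh (p * p')) (hom c) = hom e"
      by (intro act0_eq mult_in_polys pc e)
    then show ?thesis unfolding smult_homology pc(2,4,6) mult_A[OF pc(1,3)] d(3) e(3) .
  qed
  show "\<one>\<^bsub>A\<^esub> \<odot>\<^bsub>?H\<^esub> y = y" if y: "y \<in> carrier ?H" for y
  proof -
    obtain c where c: "c \<in> tchains" "y = hom c" using H[OF y] by blast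
    show ?thesis
      unfolding smult_homology c(2) one_A
      by (rule act0_eq) (use c mono_in_polys in \<open>auto simp: mono_empty_mult ksub_zero[OF ksub_I]\<close>)
  qed
qed

lemma act0_const: "c \<in> tchains \<Longrightarrow> act0 (coh (poly_const a)) (hom c) = hom (scale a c)"
  by (rule act0_eq)
    (simp_all add: poly_const_in_polys tchains_closed poly_const_mult klinear_scale[OF klinear_monomials] ksub_zero[OF ksub_I])

lemma act0_var:
  assumes "\<sigma> \<in> splits S W" "stable_tree S W T" "d \<in> tchains" "var \<sigma> * mono (splits_of S T) - monomials d \<in> I"
  shows "act0 (coh (var \<sigma>)) (hom (basis_elt S W T)) = hom d"
  by (rule act0_eq) (use assms in \<open>simp_all add: var_in_polys basis_in_tchains monomials_basis\<close>)

text \<open>The quadruple form is dual to \<sigma>, so \<open>var_mult_mono_in\<close> turns the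
  product into minus \<open>rho\<close>. Its positive terms form two disjoint families, the
  splittings of either end of the edge, and there are no negative ones.\<close>

lemma edge_relation:
  assumes T: "stable_tree S W T" and e1: "e1 \<in> flags T" and e2: "e2 = invol T e1"
    and \<sigma>: "breaks_at_edge S \<sigma> T {e1, e2}"
    and IJ: "{f1, f2} \<subseteq> flags_at T (bnd T e1) - {e1}" "f1 \<noteq> f2"
    and KL: "{f3, f4} \<subseteq> flags_at T (bnd T e2) - {e2}" "f3 \<noteq> f4"
    and ab: "allowed_branches S W (branch_labels S T (bnd T e1) f1) (branch_labels S T (bnd T e1) f2)
       (branch_labels S T (bnd T e2) f3) (branch_labels S T (bnd T e2) f4)"
  defines "d \<equiv> - split_sum S W (basis_elt S W) T (bnd T e1) {f1, f2} {e1}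
      - split_sum S W (basis_elt S W) T (bnd T e2) {e2} {f3, f4}"
  shows "d \<in> tchains" "var \<sigma> * mono (splits_of S T) - monomials d \<in> I"
proof -
  interpret stable_rooted_tree S W w K T by (rule stable_rooted_tree_intro[OF T])
  let ?F = "splits_of S T"
  have half: "half e1"
  proof -
    obtain f where "{e1, e2} = {f, invol T f}" "invol T f \<noteq> f"
      using \<sigma> by (auto simp: breaks_at_edge_def edges_def)
    then have "e1 \<noteq> e2" by (auto simp: doubleton_eq_iff)
    then show ?thesis using e1 e2 by (simp add: half_def)
  qed
  have \<sigma>e: "\<sigma> = edge_partition S T {e1, e2}" "{e1, e2} \<in> edges T"
    using \<sigma> by (auto simp: breaks_at_edge_def)
  have \<sigma>F: "\<sigma> \<in> ?F" unfolding \<sigma>e(1) splits_of_def using \<sigma>e(2) by (rule imageI)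
  have fl: "f1 \<in> flags_at T (bnd T e1)" "f2 \<in> flags_at T (bnd T e1)" "f1 \<noteq> e1" "f2 \<noteq> e1"
    "f3 \<in> flags_at T (bnd T e2)" "f4 \<in> flags_at T (bnd T e2)" "f3 \<noteq> e2" "f4 \<noteq> e2"
    using IJ(1) KL(1) by auto
  obtain i j k l where al: "allowed S W i j k l"
    and lb: "i \<in> br S T f1" "j \<in> br S T f2" "k \<in> br S T f3" "l \<in> br S T f4"
    using ab unfolding allowed_branches_def branch_labels_br[OF fl(1)] branch_labels_br[OF fl(2)]
      branch_labels_br[OF fl(5)] branch_labels_br[OF fl(6)] by (elim bexE) (rule that)
  note eq = edge_quadruple[OF half e2 fl(1-4) IJ(2) fl(5-8) KL(2) lb]
  have Fs: "\<tau> \<in> splits S W" if "\<tau> \<in> ?F" for \<tau> using face_tree_splits that by (auto simp: face_def)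
  have Fcomp: "compatible \<tau> \<sigma>" if "\<tau> \<in> ?F" for \<tau>
    using face_tree_splits that \<sigma>F compatible_refl[OF Fs[OF \<sigma>F]] by (cases "\<tau> = \<sigma>") (auto simp: face_def)
  have quad: "quad_form i j k l \<tau> = (if \<tau> = \<sigma> then 1 else (0 :: 'k))" if \<tau>: "\<tau> \<in> ?F" for \<tau>
    using eq(1)[OF Fs[OF \<tau>]] eq(2)[OF \<tau>] Fcomp[OF \<tau>] unfolding \<sigma>e(1) by (simp add: quad_form_def)
  have main: "var \<sigma> * mono ?F + Phi (rho ?F (quad_form i j k l)) \<in> I"
    by (rule var_mult_mono_in[OF face_tree_splits \<sigma>F L_base[OF quad_form_in_G[OF al]] quad])
  have vs: "bnd T e1 \<in> verts T" "bnd T e2 \<in> verts T" using e1 e2 bd_verts iv_flags by auto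
  have at: "e1 \<in> flags_at T (bnd T e1)" "e2 \<in> flags_at T (bnd T e2)"
    using e1 e2 iv_flags by (auto simp: flags_at_def)
  let ?s = "\<lambda>P. \<Sum>\<sigma>' | \<sigma>' \<in> link ?F \<and> P \<sigma>'. basis_elt S W (star S W \<sigma>' T)"
  have s1: "split_sum S W (basis_elt S W) T (bnd T e1) {f1, f2} {e1} =
      ?s (\<lambda>\<sigma>'. separates (labels {f1, f2}) \<sigma>' (labels {e1}))"
    using fl at IJ(2) vs by (intro split_sum_eq[where ?x1.0 = f1 and ?x2.0 = f2 and y = e1]) auto
  have s2: "split_sum S W (basis_elt S W) T (bnd T e2) {e2} {f3, f4} =
      ?s (\<lambda>\<sigma>'. separates (labels {f3, f4}) \<sigma>' (labels {e2}))"
    unfolding split_sum_sym[of S W _ T "bnd T e2" "{e2}"]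
    using fl at KL(2) vs by (intro split_sum_eq[where ?x1.0 = f3 and ?x2.0 = f4 and y = e2]) auto
  show "d \<in> tchains"
    unfolding d_def s1 s2 by (intro tchains_closed sum_star_in_tchains T)
  let ?P1 = "\<lambda>\<sigma>'. separates (labels {f1, f2}) \<sigma>' (labels {e1})"
  let ?P2 = "\<lambda>\<sigma>'. separates (labels {f3, f4}) \<sigma>' (labels {e2})"
  let ?t = "\<lambda>\<sigma>'. Poly_Mapping.single (insert \<sigma>' ?F) (1 :: 'k)"
  have "{\<sigma>'. \<sigma>' \<in> link ?F \<and> separates {i, j} \<sigma>' {k, l}} =
      {\<sigma>'. \<sigma>' \<in> link ?F \<and> ?P1 \<sigma>'} \<union> {\<sigma>'. \<sigma>' \<in> link ?F \<and> ?P2 \<sigma>'}"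
    using eq(3) by blast
  moreover have "{\<sigma>'. \<sigma>' \<in> link ?F \<and> ?P1 \<sigma>'} \<inter> {\<sigma>'. \<sigma>' \<in> link ?F \<and> ?P2 \<sigma>'} = {}"
    using eq(4) by blast
  ultimately have "(\<Sum>\<sigma>' | \<sigma>' \<in> link ?F \<and> separates {i, j} \<sigma>' {k, l}. ?t \<sigma>') =
      (\<Sum>\<sigma>' | \<sigma>' \<in> link ?F \<and> ?P1 \<sigma>'. ?t \<sigma>') + (\<Sum>\<sigma>' | \<sigma>' \<in> link ?F \<and> ?P2 \<sigma>'. ?t \<sigma>')"
    by (simp add: sum.union_disjoint)
  moreover have none: "{\<sigma>'. \<sigma>' \<in> link ?F \<and> separates {k, j} \<sigma>' {i, l}} = {}"
    using eq(1)[OF link_splits] link_compatible[OF _ \<sigma>F] unfolding \<sigma>e(1) by blast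
  ultimately have "rho ?F (quad_form i j k l) =
      (\<Sum>\<sigma>' | \<sigma>' \<in> link ?F \<and> ?P1 \<sigma>'. ?t \<sigma>') + (\<Sum>\<sigma>' | \<sigma>' \<in> link ?F \<and> ?P2 \<sigma>'. ?t \<sigma>')"
    unfolding rho_quad_form by (simp only: none sum.empty diff_zero)
  then have "faces_of d = - rho ?F (quad_form i j k l)"
    unfolding d_def s1 s2 klinear_diff[OF klinear_faces_of] klinear_uminus[OF klinear_faces_of] faces_of_sum_star[OF T] by simp
  then show "var \<sigma> * mono ?F - monomials d \<in> I"
    using main by (simp add: monomials_def klinear_uminus[OF klinear_Phi])
qed

lemma act0_is_action: "is_homology_action S W act0"
  unfolding is_homology_action_def
proof (intro conjI allI ballI impI)
  show "module A (homology S W act0)" by (rule module_act0)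
  show "act0 (coh (poly_const a)) (hom c) = hom (a \<odot>\<^bsub>M\<^esub> c)" if "c \<in> carrier M" for a c
    using act0_const that by simp
next
  fix \<sigma> T assume "stable_two_partition S W \<sigma> \<and> stable_tree S W T"
  then have \<sigma>: "\<sigma> \<in> splits S W" and T: "stable_tree S W T" by (auto simp: splits_def)
  interpret stable_rooted_tree S W w K T by (rule stable_rooted_tree_intro[OF T])
  assume no: "(\<nexists>e. breaks_at_edge S \<sigma> T e) \<and> (\<nexists>v. breaks_at_vertex S W \<sigma> T v)"
  have "\<sigma> \<notin> splits_of S T" using no by (auto simp: splits_of_def breaks_at_edge_def)
  moreover have "\<sigma> \<notin> link (splits_of S T)" using no star_breaks by blast
  ultimately have "\<not> face (insert \<sigma> (splits_of S T))" using \<sigma> by (simp add: link_def)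
  then have "var \<sigma> * mono (splits_of S T) \<in> I"
    using var_mult_mono_incompatible[OF \<sigma> face_tree_splits] by simp
  then show "act0 (coh (poly_var \<sigma>)) (hom (basis_elt S W T)) = hom 0"
    unfolding poly_var_eq
    by (intro act0_var[OF \<sigma> T]) (simp_all add: tchains_closed klinear_zero[OF klinear_monomials])
next
  fix \<sigma> T v assume "stable_two_partition S W \<sigma> \<and> stable_tree S W T"
  then have \<sigma>: "\<sigma> \<in> splits S W" and T: "stable_tree S W T" by (auto simp: splits_def)
  interpret stable_rooted_tree S W w K T by (rule stable_rooted_tree_intro[OF T])
  assume "breaks_at_vertex S W \<sigma> T v"
  then have l: "\<sigma> \<in> link (splits_of S T)" by (rule breaks_at_vertex_link)
  have "var \<sigma> * mono (splits_of S T) = monomials (basis_elt S W (star S W \<sigma> T))"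
    using star_props[OF T l] link_notin[OF l] finite_face[OF face_tree_splits]
    by (simp add: monomials_basis var_mult_mono)
  then show "act0 (coh (poly_var \<sigma>)) (hom (basis_elt S W T)) = hom (basis_elt S W (star S W \<sigma> T))"
    unfolding poly_var_eq
    by (intro act0_var[OF \<sigma> T]) (simp_all add: basis_in_tchains star_props[OF T l] ksub_zero[OF ksub_I])
next
  fix \<sigma> T e1 e2 v1 v2 f1 f2 f3 f4
  assume "stable_two_partition S W \<sigma> \<and> stable_tree S W T" and e1: "e1 \<in> flags T"
  then have \<sigma>: "\<sigma> \<in> splits S W" and T: "stable_tree S W T" by (auto simp: splits_def)
  assume *: "e2 = invol T e1 \<and> breaks_at_edge S \<sigma> T {e1, e2} \<and> v1 = bnd T e1 \<and> v2 = bnd T e2 \<and>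
           {f1, f2} \<subseteq> flags_at T v1 - {e1} \<and> f1 \<noteq> f2 \<and> {f3, f4} \<subseteq> flags_at T v2 - {e2} \<and> f3 \<noteq> f4 \<and>
           allowed_branches S W (branch_labels S T v1 f1) (branch_labels S T v1 f2)
             (branch_labels S T v2 f3) (branch_labels S T v2 f4)"
  then have e2: "e2 = invol T e1" and br: "breaks_at_edge S \<sigma> T {e1, e2}"
    and v: "v1 = bnd T e1" "v2 = bnd T e2"
    and fl: "{f1, f2} \<subseteq> flags_at T (bnd T e1) - {e1}" "f1 \<noteq> f2" "{f3, f4} \<subseteq> flags_at T (bnd T e2) - {e2}" "f3 \<noteq> f4"
    and ab: "allowed_branches S W (branch_labels S T (bnd T e1) f1) (branch_labels S T (bnd T e1) f2)
       (branch_labels S T (bnd T e2) f3) (branch_labels S T (bnd T e2) f4)"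
    by auto
  show "act0 (coh (poly_var \<sigma>)) (hom (basis_elt S W T)) =
    hom (- split_sum S W (basis_elt S W) T v1 {f1, f2} {e1} - split_sum S W (basis_elt S W) T v2 {e2} {f3, f4})"
    unfolding v poly_var_eq
    by (rule act0_var[OF \<sigma> T edge_relation[OF T e1 e2 br fl ab]])
qed

text \<open>The one-vertex class is a basis: by induction on faces and the vertex formula, the
  monomial of a face sends it to the class of the corresponding tree. Acting on it therefore inverts
  the isomorphism from homology to cohomology.\<close>

lemma action_free:
  assumes act: "is_homology_action S W (act :: ('a, 'k) lpoly set \<Rightarrow> ('a, 'k) tree_chain set \<Rightarrow> ('a, 'k) tree_chain set)"
  shows "free_of_rank_one A (homology S W act)"
proof -
  let ?H = "homology S W act"
  note act' = act[unfolded is_homology_action_def]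
  have mod: "module A ?H" by (rule act'[THEN conjunct1])
  have const: "act (coh (poly_const a)) (hom c) = hom (scale a c)" if "c \<in> tchains" for a c
    using act'[THEN conjunct2, THEN conjunct1] that by simp
  have vertex: "act (coh (var \<sigma>)) (hom (basis_elt S W T)) = hom (basis_elt S W (star S W \<sigma> T))"
    if "\<sigma> \<in> splits S W" "stable_tree S W T" "breaks_at_vertex S W \<sigma> T v" for \<sigma> T v
    using act'[THEN conjunct2, THEN conjunct2, THEN spec, THEN spec, THEN mp, THEN conjunct2,
      THEN conjunct1, THEN spec, THEN mp, of \<sigma> T v] that
    by (simp add: splits_def poly_var_eq)
  interpret m: module A ?H by (rule mod)
  define x where "x = hom (trees_of (Poly_Mapping.single {} 1))"
  have x: "x \<in> carrier ?H" unfolding x_def carrier_homology by (intro imageI trees_of_in_tchains)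
  have assoc: "act (coh (p * q)) x = act (coh p) (act (coh q) x)" if "p \<in> polys" "q \<in> polys" for p q
    using m.smult_assoc1[OF coh_in_A[OF that(1)] coh_in_A[OF that(2)] x] mult_A[OF that]
    by (simp add: smult_homology)
  have add: "act (coh (p + q)) x = act (coh p) x \<oplus>\<^bsub>?H\<^esub> act (coh q) x" if "p \<in> polys" "q \<in> polys" for p q
    using m.smult_l_distr[OF coh_in_A[OF that(1)] coh_in_A[OF that(2)] x] add_A[of p q]
    by (simp add: smult_homology)
  have mono: "act (coh (mono F)) x = hom (trees_of (Poly_Mapping.single F 1))" if "face F" for F
    using finite_face[OF that] that
  proof (induction F rule: finite_induct)
    case empty
    show ?case
      using m.smult_one[OF x] unfolding one_A smult_homology by (simp add: x_def)
  next
    case (insert \<sigma> F)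
    have F: "face F" by (rule face_subset[OF insert.prems]) blast
    have \<sigma>: "\<sigma> \<in> splits S W" using insert.prems by (simp add: face_def)
    have T: "stable_tree S W (rep F)" "splits_of S (rep F) = F" using rep[OF F] by auto
    interpret Tr: stable_rooted_tree S W w K "rep F" by (rule stable_rooted_tree_intro[OF T(1)])
    have l: "\<sigma> \<in> link (splits_of S (rep F))"
      using insert.hyps(2) insert.prems \<sigma> T(2) by (simp add: link_def)
    obtain v where v: "breaks_at_vertex S W \<sigma> (rep F) v" using Tr.star_breaks[OF l] by blast
    have "mono (insert \<sigma> F) = var \<sigma> * mono F" using insert.hyps by (simp add: var_mult_mono)
    then have "act (coh (mono (insert \<sigma> F))) x = act (coh (var \<sigma>)) (act (coh (mono F)) x)"
      using assoc[OF var_in_polys[OF \<sigma>] mono_in_polys] F by (simp add: face_def)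
    also have "act (coh (mono F)) x = hom (basis_elt S W (rep F))"
      using insert.IH[OF F] trees_of_single[OF T(1)] T(2) by simp
    also have "act (coh (var \<sigma>)) (hom (basis_elt S W (rep F))) = hom (basis_elt S W (star S W \<sigma> (rep F)))"
      by (rule vertex[OF \<sigma> T(1) v])
    also have "basis_elt S W (star S W \<sigma> (rep F)) = trees_of (Poly_Mapping.single (insert \<sigma> F) 1)"
      using trees_of_single[OF star_props(1)[OF T(1) l]] star_props(2)[OF T(1) l] T(2) by simp
    finally show ?case .
  qed
  \<comment> \<open>The chains obeying the formula form a submodule, so it is enough to know it for
    single faces.\<close>
  let ?Z = "{d. act (coh (Phi d)) x = hom (trees_of d)}"
  have Z: "ksub ?Z"
    unfolding ksub_def mem_Collect_eq
  proof (intro conjI ballI allI)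
    have "coh 0 = \<zero>\<^bsub>A\<^esub>" using coh_zero_iff[of 0] ksub_zero[OF ksub_I] by simp
    then have "act (coh 0) x = hom 0"
      using m.smult_l_null[OF x] by (simp add: smult_homology zero_homology)
    then show "act (coh (Phi 0)) x = hom (trees_of 0)"
      by (simp add: klinear_zero[OF klinear_Phi] klinear_zero[OF klinear_trees_of])
    fix d e assume "d \<in> ?Z" "e \<in> ?Z"
    then have de: "act (coh (Phi d)) x = hom (trees_of d)" "act (coh (Phi e)) x = hom (trees_of e)" by auto
    have "act (coh (Phi d + Phi e)) x = hom (trees_of d + trees_of e)"
      unfolding add[OF Phi_in_polys Phi_in_polys] de add_homology ..
    then show "act (coh (Phi (d + e))) x = hom (trees_of (d + e))"
      by (simp add: klinear_add[OF klinear_Phi] klinear_add[OF klinear_trees_of])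
  next
    fix a d assume "d \<in> ?Z"
    then have d: "act (coh (Phi d)) x = hom (trees_of d)" by simp
    have "act (coh (poly_const a * Phi d)) x = hom (scale a (trees_of d))"
      unfolding assoc[OF poly_const_in_polys Phi_in_polys] d by (rule const[OF trees_of_in_tchains])
    then show "act (coh (Phi (scale a d))) x = hom (trees_of (scale a d))"
      by (simp add: poly_const_mult klinear_scale[OF klinear_Phi] klinear_scale[OF klinear_trees_of])
  qed
  have chains: "act (coh (Phi d)) x = hom (trees_of d)" if d: "d \<in> chains" for d
  proof -
    have "Poly_Mapping.single F 1 \<in> ?Z" if "F \<in> Poly_Mapping.keys d" for F
      using mono[of F] d that by (auto simp: chains_def)
    from klinear_mem[OF Z klinear_id this] show ?thesis by simp
  qed
  have ex: "\<exists>d\<in>chains. y = coh (Phi d)" if y: "y \<in> carrier A" for y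
  proof -
    obtain p where p: "y = coh p" "p \<in> polys" using y unfolding carrier_A by (rule imageE)
    have "y = coh (Phi (Psi p))" unfolding p(1) coh_eq_iff by (rule Phi_Psi[OF p(2)])
    then show ?thesis using Psi_in_chains by blast
  qed
  have "inj_on (\<lambda>r. r \<odot>\<^bsub>?H\<^esub> x) (carrier A)"
  proof (rule inj_onI)
    fix y z assume yz: "y \<in> carrier A" "z \<in> carrier A" "y \<odot>\<^bsub>?H\<^esub> x = z \<odot>\<^bsub>?H\<^esub> x"
    obtain d e where de: "d \<in> chains" "y = coh (Phi d)" "e \<in> chains" "z = coh (Phi e)"
      using ex[OF yz(1)] ex[OF yz(2)] by blast
    have "hom (trees_of d) = hom (trees_of e)"
      using yz(3) unfolding smult_homology de(2,4) chains[OF de(1)] chains[OF de(3)] .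
    then have "monomials (trees_of d) - monomials (trees_of e) \<in> I"
      using hom_eq_iff_monomials[OF trees_of_in_tchains trees_of_in_tchains] by simp
    then show "y = z" unfolding de(2,4) coh_eq_iff monomials_trees_of[OF de(1)] monomials_trees_of[OF de(3)] .
  qed
  moreover have "(\<lambda>r. r \<odot>\<^bsub>?H\<^esub> x) ` carrier A = carrier ?H"
  proof (intro equalityI subsetI)
    fix z assume "z \<in> (\<lambda>r. r \<odot>\<^bsub>?H\<^esub> x) ` carrier A"
    then show "z \<in> carrier ?H" using m.smult_closed x by auto
  next
    fix z assume "z \<in> carrier ?H"
    then obtain c where c: "z = hom c" "c \<in> tchains" unfolding carrier_homology by (rule imageE)
    have "z = coh (Phi (faces_of c)) \<odot>\<^bsub>?H\<^esub> x"
      unfolding smult_homology chains[OF faces_of_in_chains[OF c(2)]] trees_of_faces_of[OF c(2)] by (rule c(1))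
    then show "z \<in> (\<lambda>r. r \<odot>\<^bsub>?H\<^esub> x) ` carrier A"
      by (rule image_eqI) (rule coh_in_A[OF Phi_in_polys])
  qed
  ultimately show ?thesis
    unfolding free_of_rank_one_def bij_betw_def using mod x by blast
qed

lemma monomial_relations_eq: "(monomial_relations S W :: ('a, 'k) tree_chain set) = tree_relations S W"
proof -
  have "(monomial_relations S W :: ('a, 'k) tree_chain set) = {c \<in> tchains. c \<in> tree_relations S W}"
    unfolding monomial_relations_def
    using monomials_in_I_iff by (auto simp: coh_zero_iff monomial_combination_eq monomials_def)
  also have "\<dots> = tree_relations S W"
    unfolding tree_relations_eq using klinear_kspan[OF ksub_tchains klinear_id] std_in_tchains by blast
  finally show ?thesis .
qed

end

theorem corollary2p3p1:
  fixes S W :: "'a set"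
  assumes "finite S" and "W \<subseteq> S" and "card S \<ge> 3" and "card W \<ge> 2"
  shows
    "((\<exists>act :: ('a, 'k::{comm_ring,monoid_mult}) lpoly set \<Rightarrow>
            ('a, 'k) tree_chain set \<Rightarrow> ('a, 'k) tree_chain set.
          is_homology_action S W act) \<and>
      (\<forall>act :: ('a, 'k) lpoly set \<Rightarrow> ('a, 'k) tree_chain set \<Rightarrow> ('a, 'k) tree_chain set.
          is_homology_action S W act \<longrightarrow>
          free_of_rank_one (cohomology S W) (homology S W act))) \<and>
     ((\<forall>T v I J K L. stable_tree S W T \<and> v \<in> verts T \<and> allowed_flags S W T v I J K L \<longrightarrow>
          coh_class S W (standard_relation S W (good_monomial S W) T v I J K L :: ('a, 'k) lpoly) =
            \<zero>\<^bsub>cohomology S W\<^esub>) \<and>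
      (monomial_relations S W :: ('a, 'k) tree_chain set) =
        gen_submodule coeff_ring (tree_module S W)
          {standard_relation S W (basis_elt S W) T v I J K L | T v I J K L.
             stable_tree S W T \<and> v \<in> verts T \<and> allowed_flags S W T v I J K L})"
proof -
  have "W \<noteq> {}" using assms(4) by auto
  then obtain w where "w \<in> W" by blast
  then interpret P: painted_set S W w "TYPE('k)"
    using assms by unfold_locales
  show ?thesis
    using P.act0_is_action P.action_free P.standard_relation_forms(2) P.coh_zero_iff
      P.monomial_relations_eq[unfolded tree_relations_def] by blast
qed

end
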